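(* Let $s\ge1$, let $\mathcal{T}$ be a homogeneous differential equation on $\mathrm{Imm}\,T^s_nX$ and let $T_\sigma$ be the components of the associated non-homogeneous equation in a chart, i.e. $\mathcal{T}_\sigma=\det(\mathbf{x})T_\sigma\circ\rho^s_n$, $\mathcal{T}_i=-\det(\mathbf{x})(y^\sigma_iT_\sigma)\circ\rho^s_n$ on $W^s$. Then on $W^t$, $t\ge2s$, the following relations hold, for $k=1,\dots,s$ wherever $k$ occurs (multi-indices $I$ have $|I|\le s$; functions on $P^t_nX$ are composed with $\rho^t_n$; $\sigma,\nu\in\{1,\dots,m\}$, $p,q\in\{1,\dots,n\}$). Write $Z^{j_1\dots j_k}_I=\sum_{(I_1,\dots,I_k)}\mathcal{S}^+_{j_1,\dots,j_k}z^{j_1}_{I_1}\cdots z^{j_k}_{I_k}$. $$\mathcal{H}_{\sigma\nu}(\mathcal{T})=\det(\mathbf{x})\,H_{\sigma\nu}(T),\qquad \mathcal{H}^{j_1,\dots,j_k}_{\sigma\nu}(\mathcal{T})=\det(\mathbf{x})\sum_{|I|\ge k}Z^{j_1\dots j_k}_I\,H^I_{\sigma\nu}(T),$$ $$\mathcal{H}_{\sigma p}(\mathcal{T})=-\det(\mathbf{x})\sum_{|I_0|\le s}y^\nu_{pI_0}H^{I_0}_{\sigma\nu}(T),$$ $$\mathcal{H}^{j_1,\dots,j_k}_{\sigma p}(\mathcal{T})=-\det(\mathbf{x})\sum_{|I_0|\le s}\ \sum_{|I|=k}^{s-|I_0|}\binom{|I|+|I_0|}{|I|}Z^{j_1\dots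 j_k}_I\,y^\nu_{pI_0}H^{II_0}_{\sigma\nu}(T),$$ $$\mathcal{H}_{p\nu}(\mathcal{T})=-\det(\mathbf{x})\,y^\sigma_pH_{\sigma\nu}(T),\qquad \mathcal{H}^{j_1,\dots,j_k}_{p\nu}(\mathcal{T})=-\det(\mathbf{x})\,y^\sigma_p\sum_{|I|\ge k}Z^{j_1\dots j_k}_I\,H^I_{\sigma\nu}(T),$$ $$\mathcal{H}_{pq}(\mathcal{T})=\det(\mathbf{x})\,y^\sigma_p\sum_{|I_0|\le s}y^\nu_{qI_0}H^{I_0}_{\sigma\nu}(T),$$ $$\mathcal{H}^{j_1,\dots,j_k}_{pq}(\mathcal{T})=\det(\mathbf{x})\,y^\sigma_p\sum_{|I_0|\le s}\ \sum_{|I|=k}^{s-|I_0|}\binom{|I|+|I_0|}{|I|}Z^{j_1\dots j_k}_I\,y^\nu_{qI_0}H^{II_0}_{\sigma\nu}(T).$$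
   Context: Velocities. $X$ is a smooth manifold of dimension $N=n+m$, $n\ge 1$. $T^s_nX$ is the manifold of $(s,n)$-velocities, i.e. $s$-jets $j^s_0\gamma$ at $0$ of smooth maps $\gamma$ from a neighbourhood of $0\in\mathbb{R}^n$ to $X$; $\mathrm{Imm}\,T^s_nX$ is the open subset of regular velocities (jets of immersions). A chart $(V,(x^A))$ of $X$ induces coordinates $x^A_{j_1,\dots,j_k}(j^s_0\gamma)=\partial^k(x^A\circ\gamma)/\partial t^{j_1}\cdots\partial t^{j_k}|_0$, $0\le k\le s$, symmetric in the lower indices. For an immersion $\gamma$, $j^s\gamma$ is the map $t\mapsto j^s_0(u\mapsto\gamma(t+u))$. Functions of lower order are pulled back to higher order without notation. Group and quotient. $L^s_n$ is the group of $s$-jets at $0$ of local diffeomorphisms of $\mathbb{R}^n$ fixing $0$, acting on the right by $\phi_a(j^s_0\gamma)=j^s_0(\gamma\circ\alpha)$, $a=j^s_0\alpha$; $\det(a)$ is the Jacobian determinant of $\alpha$ at $0$. $P^s_nX=\mathrm{Imm}\,T^s_nX/L^s_n$, with projection $\rho^s_n$ (a smooth principal bundle). Differential equation: a $1$-form $\mathcal{T}$ which in the induced charts has the form $\mathcal{T}=\mathcal{T}_Adx^A$, $\mathcal{T}_A$ smooth functions of the $x^B_J$, $|J|\le s$. It is homogeneous if $(\phi_a)^*\mathcal{T}=\det(a)\mathcal{T}$ for all $a\in L^s_n$ and $(j^s\gamma)^*\mathcal{T}=0$ for every immersion $\gamma$. Multi-indices. A multi-index $I$ with $|I|=k$ is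 a sequence $(i_1,\dots,i_k)$ in $\{1,\dots,n\}$; sums over multi-indices run over all sequences; $IJ$ is juxtaposition. $\sum_{(I_1,\dots,I_k)}$ runs over all partitions of (the positions of) $I$ into $k$ nonempty subsets, partitions differing by a permutation of the subsets being identified. $\mathcal{S}^+_{j_1,\dots,j_k}$ is the average over all permutations of $j_1,\dots,j_k$. Derivatives. $\partial^{j_1,\dots,j_k}_A=\frac{r_1!\cdots r_n!}{k!}\frac{\partial}{\partial x^A_{j_1,\dots,j_k}}$, $r_l$ being the number of occurrences of $l$ in $(j_1,\dots,j_k)$; on $T^t_nX$, $d_i=\sum_{|J|\le t-1}x^A_{iJ}\partial^J_A$, $d_J=\prod_{j\in J}d_j$. Charts. Split the coordinates of a chart of $X$ into $x^i$ ($i=1,\dots,n$) and $x^\sigma$ ($\sigma=1,\dots,m$). $W^s$ is the set of regular velocities over $V$ with $\det(\mathbf{x}):=\det(x^i_j)\ne0$; there $(z^i_j)$ is the inverse matrix of $(x^i_j)$, $z^i_{j_1,\dots,j_k}=z^p_{j_1}d_pz^i_{j_2,\dots,j_k}$ ($k\ge2$), and $y^\sigma=x^\sigma$, $y^\sigma_{i_1,\dots,i_k}=z^j_{i_1}d_jy^\sigma_{i_2,\dots,i_k}$. The $z^i_I$, $y^\sigma_I$ are symmetric in $I$, the $y^\sigma_I$ are $L^s_n$-invariant and $(x^i,y^\sigma_I)_{|I|\le s}$ are coordinates on $\rho^s_n(W^s)$. $\Delta^{j_1,\dots,j_k}_\sigma=\frac{r_1!\cdots r_n!}{k!}\frac{\partial}{\partial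 y^\sigma_{j_1,\dots,j_k}}$, and on $P^t_nX$, $D_i=\frac{\partial}{\partial x^i}+\sum_{|J|\le t-1}y^\sigma_{iJ}\Delta^J_\sigma$, $D_J=\prod_{j\in J}D_j$. Lie–Euler operators on functions of order $s$: $\mathcal{E}^I_A(f)=\sum_{|J|\le s-|I|}(-1)^{|J|}\binom{|I|+|J|}{|I|}d_J\partial^{IJ}_Af$, $E^I_\sigma(f)=\sum_{|J|\le s-|I|}(-1)^{|J|}\binom{|I|+|J|}{|I|}D_J\Delta^{IJ}_\sigma f$. Helmholtz–Sonin expressions, for $|J|\le s$: $\mathcal{H}^J_{AB}(\mathcal{T})=\partial^J_B\mathcal{T}_A-(-1)^{|J|}\mathcal{E}^J_A(\mathcal{T}_B)$ and $H^J_{\sigma\nu}(T)=\Delta^J_\nu T_\sigma-(-1)^{|J|}E^J_\sigma(T_\nu)$; no upper index means $J=\emptyset$. *)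

theory Defs
  imports "HOL-Analysis.Analysis" "HOL-Library.Multiset" "HOL-Library.Disjoint_Sets"
begin

section \<open>Smooth maps and smooth manifolds\<close>

text \<open>The set \<open>S\<close> is open wherever these notions are used.\<close>

fun Ck_on :: "nat \<Rightarrow> 'e::real_normed_vector set \<Rightarrow> ('e \<Rightarrow> 'f::real_normed_vector) \<Rightarrow> bool" where
  "Ck_on 0 S f \<longleftrightarrow> continuous_on S f"
| "Ck_on (Suc k) S f \<longleftrightarrow>
     (\<forall>x\<in>S. f differentiable (at x)) \<and> (\<forall>v. Ck_on k S (\<lambda>x. frechet_derivative f (at x) v))"

definition smooth_on :: "'e::real_normed_vector set \<Rightarrow> ('e \<Rightarrow> 'f::real_normed_vector) \<Rightarrow> bool" where
  "smooth_on S f \<longleftrightarrow> (\<forall>k. Ck_on k S f)"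

type_synonym ('x, 'a) chart = "'x set \<times> ('x \<Rightarrow> real ^ 'a)"

definition is_chart :: "('x::topological_space, 'a::finite) chart \<Rightarrow> bool" where
  "is_chart = (\<lambda>(V, x). open V \<and> open (x ` V) \<and> homeomorphism V (x ` V) x (inv_into V x))"

definition compatible :: "('x::topological_space, 'a::finite) chart \<Rightarrow> ('x, 'a) chart \<Rightarrow> bool" where
  "compatible = (\<lambda>(V, x) (V', x').
     smooth_on (x ` (V \<inter> V')) (x' \<circ> inv_into V x) \<and>
     smooth_on (x' ` (V \<inter> V')) (x \<circ> inv_into V' x'))"

text \<open>A maximal smooth atlas on the whole type \<open>'x\<close>, the model space having dimension
  \<open>CARD('a)\<close>.\<close>

definition smooth_structure ::
  "('x::{t2_space, second_countable_topology}, 'a::finite) chart set \<Rightarrow> bool" where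
  "smooth_structure \<A> \<longleftrightarrow>
     (\<forall>C\<in>\<A>. is_chart C) \<and> (\<Union>(V, x)\<in>\<A>. V) = UNIV \<and>
     (\<forall>C\<in>\<A>. \<forall>C'\<in>\<A>. compatible C C') \<and>
     (\<forall>C. is_chart C \<and> (\<forall>C'\<in>\<A>. compatible C C') \<longrightarrow> C \<in> \<A>)"

definition smooth_map ::
  "('x::topological_space, 'a::finite) chart set \<Rightarrow> (real ^ 'n::finite) set \<Rightarrow> (real ^ 'n \<Rightarrow> 'x) \<Rightarrow> bool" where
  "smooth_map \<A> U \<gamma> \<longleftrightarrow> open U \<and> continuous_on U \<gamma> \<and>
     (\<forall>(V, x)\<in>\<A>. smooth_on (U \<inter> \<gamma> -` V) (x \<circ> \<gamma>))"

definition immersion_on ::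
  "('x::topological_space, 'a::finite) chart set \<Rightarrow> (real ^ 'n::finite) set \<Rightarrow> (real ^ 'n \<Rightarrow> 'x) \<Rightarrow> bool" where
  "immersion_on \<A> U \<gamma> \<longleftrightarrow> smooth_map \<A> U \<gamma> \<and>
     (\<forall>t\<in>U. \<forall>(V, x)\<in>\<A>. \<gamma> t \<in> V \<longrightarrow> inj (frechet_derivative (x \<circ> \<gamma>) (at t)))"


section \<open>Velocities\<close>

definition partial :: "'n::finite \<Rightarrow> (real ^ 'n \<Rightarrow> real) \<Rightarrow> real ^ 'n \<Rightarrow> real" where
  "partial j f t = deriv (\<lambda>h. f (t + h *\<^sub>R axis j 1)) 0"

definition partials :: "'n::finite list \<Rightarrow> (real ^ 'n \<Rightarrow> real) \<Rightarrow> real ^ 'n \<Rightarrow> real" where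
  "partials J f = foldr partial J f"

text \<open>An \<open>s\<close>-jet at \<open>0\<close> is the set of all smooth germs (represented by total functions that are
  smooth near \<open>0\<close>) having the same value and the same partial derivatives up to order \<open>s\<close>
  in charts.\<close>

type_synonym ('n, 'x) velocity = "(real ^ 'n \<Rightarrow> 'x) set"

definition jet0 ::
  "('x::topological_space, 'a::finite) chart set \<Rightarrow> nat \<Rightarrow> (real ^ 'n::finite \<Rightarrow> 'x) \<Rightarrow> ('n, 'x) velocity" where
  "jet0 \<A> s \<gamma> = {\<gamma>'. (\<exists>U. 0 \<in> U \<and> smooth_map \<A> U \<gamma>') \<and> \<gamma>' 0 = \<gamma> 0 \<and>
     (\<forall>(V, x)\<in>\<A>. \<gamma> 0 \<in> V \<longrightarrow> (\<forall>A J. length J \<le> s \<longrightarrow>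
        partials J (\<lambda>u. x (\<gamma>' u) $ A) 0 = partials J (\<lambda>u. x (\<gamma> u) $ A) 0))}"

definition Imm ::
  "('x::topological_space, 'a::finite) chart set \<Rightarrow> nat \<Rightarrow> ('n::finite, 'x) velocity set" where
  "Imm \<A> s = {jet0 \<A> s \<gamma> | \<gamma>. \<exists>U. 0 \<in> U \<and> immersion_on \<A> U \<gamma>}"

definition prolongation ::
  "('x::topological_space, 'a::finite) chart set \<Rightarrow> nat \<Rightarrow> (real ^ 'n::finite \<Rightarrow> 'x) \<Rightarrow> real ^ 'n \<Rightarrow> ('n, 'x) velocity" where
  "prolongation \<A> s \<gamma> t = jet0 \<A> s (\<lambda>u. \<gamma> (t + u))"

definition rep :: "'b set \<Rightarrow> 'b" where
  "rep v = (SOME \<gamma>. \<gamma> \<in> v)"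

definition base :: "('n::finite, 'x) velocity \<Rightarrow> 'x" where
  "base v = rep v 0"

text \<open>Symmetric families \<open>x\<^sup>A\<^sub>J\<close> are families indexed by the multiset underlying \<open>J\<close>, so that
  \<open>(A, mset J)\<close> runs over independent coordinates.  One index set serves all orders: a function of
  order \<open>s\<close> is a function that only depends on the coordinates with \<open>size M \<le> s\<close>, and
  pulling it back to a higher order is the identity.  For a velocity \<open>v\<close> of order \<open>s\<close> only the
  values \<open>coords x v (A, M)\<close> with \<open>size M \<le> s\<close> are meaningful.\<close>

type_synonym ('a, 'n) vcoords = "'a \<times> 'n multiset \<Rightarrow> real"

definition mlist :: "'n::finite multiset \<Rightarrow> 'n list" where
  "mlist M = (SOME J. mset J = M)"

definition coords :: "('x \<Rightarrow> real ^ 'a) \<Rightarrow> ('n::finite, 'x) velocity \<Rightarrow> ('a::finite, 'n) vcoords" where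
  "coords x v = (\<lambda>(A, M). partials (mlist M) (\<lambda>u. x (rep v u) $ A) 0)"


section \<open>The jet group and the quotient\<close>

definition local_diffeo :: "(real ^ 'n::finite \<Rightarrow> real ^ 'n) \<Rightarrow> bool" where
  "local_diffeo \<alpha> \<longleftrightarrow> \<alpha> 0 = 0 \<and> (\<exists>U \<beta>. open U \<and> 0 \<in> U \<and> open (\<alpha> ` U) \<and>
     smooth_on U \<alpha> \<and> smooth_on (\<alpha> ` U) \<beta> \<and> (\<forall>t\<in>U. \<beta> (\<alpha> t) = t))"

definition diffeo_jet :: "nat \<Rightarrow> (real ^ 'n::finite \<Rightarrow> real ^ 'n) \<Rightarrow> (real ^ 'n \<Rightarrow> real ^ 'n) set" where
  "diffeo_jet s \<alpha> = {\<alpha>'. local_diffeo \<alpha>' \<and> (\<forall>i J. length J \<le> s \<longrightarrow>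
     partials J (\<lambda>u. \<alpha>' u $ i) 0 = partials J (\<lambda>u. \<alpha> u $ i) 0)}"

definition jet_group :: "nat \<Rightarrow> (real ^ 'n::finite \<Rightarrow> real ^ 'n) set set" where
  "jet_group s = {diffeo_jet s \<alpha> | \<alpha>. local_diffeo \<alpha>}"

definition jet_det :: "(real ^ 'n::finite \<Rightarrow> real ^ 'n) set \<Rightarrow> real" where
  "jet_det a = det (\<chi> i j. partial j (\<lambda>u. rep a u $ i) 0)"

definition act ::
  "('x::topological_space, 'a::finite) chart set \<Rightarrow> nat \<Rightarrow> (real ^ 'n::finite \<Rightarrow> real ^ 'n) set \<Rightarrow>
     ('n, 'x) velocity \<Rightarrow> ('n, 'x) velocity" where
  "act \<A> s a v = jet0 \<A> s (rep v \<circ> rep a)"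

text \<open>A point of the quotient is an orbit; the projection sends a velocity to its orbit.\<close>

definition orbit ::
  "('x::topological_space, 'a::finite) chart set \<Rightarrow> nat \<Rightarrow> ('n::finite, 'x) velocity \<Rightarrow> ('n, 'x) velocity set" where
  "orbit \<A> s v = (\<lambda>a. act \<A> s a v) ` jet_group s"


section \<open>Functions of coordinates\<close>

text \<open>Smoothness of a function of a family of real coordinates that depends on finitely many of
  them only: all iterated partial derivatives exist and are continuous.  The topology of
  \<open>'k \<Rightarrow> real\<close> is the product topology.\<close>

definition pd :: "'k \<Rightarrow> (('k \<Rightarrow> real) \<Rightarrow> real) \<Rightarrow> ('k \<Rightarrow> real) \<Rightarrow> real" where
  "pd k f c = deriv (\<lambda>u. f (c(k := u))) (c k)"

fun Ck_coords :: "nat \<Rightarrow> ('k \<Rightarrow> real) set \<Rightarrow> (('k \<Rightarrow> real) \<Rightarrow> real) \<Rightarrow> bool" where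
  "Ck_coords 0 S f \<longleftrightarrow> continuous_on S f"
| "Ck_coords (Suc r) S f \<longleftrightarrow>
     (\<forall>c\<in>S. \<forall>k. (\<lambda>u. f (c(k := u))) differentiable (at (c k))) \<and> (\<forall>k. Ck_coords r S (pd k f))"

definition agree :: "nat \<Rightarrow> ('a, 'n::finite) vcoords \<Rightarrow> ('a, 'n) vcoords \<Rightarrow> bool" where
  "agree s c c' \<longleftrightarrow> (\<forall>A M. size M \<le> s \<longrightarrow> c (A, M) = c' (A, M))"

definition chart_image ::
  "('x::topological_space, 'a::finite) chart set \<Rightarrow> nat \<Rightarrow> 'x set \<Rightarrow> ('x \<Rightarrow> real ^ 'a) \<Rightarrow>
     ('a, 'n::finite) vcoords set" where
  "chart_image \<A> s V x =
     {c. \<exists>v::('n, 'x) velocity. v \<in> Imm \<A> s \<and> base v \<in> V \<and> agree s c (coords x v)}"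

definition smooth_of_order :: "nat \<Rightarrow> ('a, 'n::finite) vcoords set \<Rightarrow> (('a, 'n) vcoords \<Rightarrow> real) \<Rightarrow> bool" where
  "smooth_of_order s S f \<longleftrightarrow>
     (\<forall>c\<in>S. \<forall>c'\<in>S. agree s c c' \<longrightarrow> f c = f c') \<and> (\<forall>r. Ck_coords r S f)"


section \<open>Differential equations\<close>

definition smooth_curve ::
  "('x::topological_space, 'a::finite) chart set \<Rightarrow> nat \<Rightarrow> (real \<Rightarrow> ('n::finite, 'x) velocity) \<Rightarrow> bool" where
  "smooth_curve \<A> s c \<longleftrightarrow> (\<exists>e>0. (\<forall>r\<in>{-e<..<e}. c r \<in> Imm \<A> s) \<and>
     continuous_on {-e<..<e} (base \<circ> c) \<and>
     (\<forall>(V, x)\<in>\<A>. \<forall>A M. size M \<le> s \<longrightarrow>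
        smooth_on ({-e<..<e} \<inter> (base \<circ> c) -` V) (\<lambda>r. coords x (c r) (A, M))))"

text \<open>Tangent vectors are represented by smooth curves \<open>c\<close>, standing for the velocity vector
  of \<open>c\<close> at parameter \<open>0\<close>.  A 1-form is then a real-valued function of smooth curves, and
  \<open>dx\<^sup>A\<close> is the derivative of \<open>x\<^sup>A \<circ> c\<close> at \<open>0\<close>.  The value of a form of the shape \<open>\<tau>\<^sub>A dx\<^sup>A\<close>
  depends on the tangent vector only, and linearly.\<close>

type_synonym 'b one_form = "(real \<Rightarrow> 'b) \<Rightarrow> real"

definition pullback :: "('b \<Rightarrow> 'c) \<Rightarrow> 'c one_form \<Rightarrow> 'b one_form" where
  "pullback f \<omega> c = \<omega> (f \<circ> c)"

definition chart_form ::
  "('x::topological_space, 'a::finite) chart set \<Rightarrow> nat \<Rightarrow> 'x set \<Rightarrow> ('x \<Rightarrow> real ^ 'a) \<Rightarrow>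
     ('n::finite, 'x) velocity one_form \<Rightarrow> ('a \<Rightarrow> ('a, 'n) vcoords \<Rightarrow> real) \<Rightarrow> bool" where
  "chart_form \<A> s V x \<omega> \<tau> \<longleftrightarrow>
     (\<forall>A. smooth_of_order s (chart_image \<A> s V x) (\<tau> A)) \<and>
     (\<forall>c. smooth_curve \<A> s c \<and> base (c 0) \<in> V \<longrightarrow>
        \<omega> c = (\<Sum>A\<in>UNIV. \<tau> A (coords x (c 0)) * deriv (\<lambda>r. coords x (c r) (A, {#})) 0))"

definition differential_equation ::
  "('x::topological_space, 'a::finite) chart set \<Rightarrow> nat \<Rightarrow> ('n::finite, 'x) velocity one_form \<Rightarrow> bool" where
  "differential_equation \<A> s \<omega> \<longleftrightarrow> (\<forall>(V, x)\<in>\<A>. \<exists>\<tau>. chart_form \<A> s V x \<omega> \<tau>)"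

definition homogeneous ::
  "('x::topological_space, 'a::finite) chart set \<Rightarrow> nat \<Rightarrow> ('n::finite, 'x) velocity one_form \<Rightarrow> bool" where
  "homogeneous \<A> s \<omega> \<longleftrightarrow>
     (\<forall>a\<in>jet_group s. \<forall>c. smooth_curve \<A> s c \<longrightarrow> pullback (act \<A> s a) \<omega> c = jet_det a * \<omega> c) \<and>
     (\<forall>U \<gamma>. immersion_on \<A> U \<gamma> \<longrightarrow>
        (\<forall>b. (\<exists>e>0. smooth_on {-e<..<e} b \<and> b ` {-e<..<e} \<subseteq> U) \<longrightarrow>
           pullback (prolongation \<A> s \<gamma>) \<omega> b = 0))"


section \<open>Operators on velocities\<close>

text \<open>The quotient of factorials in front of the symmetrised partial derivatives.\<close>

definition sym_weight :: "'n::finite list \<Rightarrow> real" where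
  "sym_weight J = (\<Prod>l\<in>UNIV. fact (count_list J l)) / fact (length J)"

definition dpart :: "'a \<Rightarrow> 'n::finite list \<Rightarrow> (('a, 'n) vcoords \<Rightarrow> real) \<Rightarrow> ('a, 'n) vcoords \<Rightarrow> real" where
  "dpart A J f c = sym_weight J * pd (A, mset J) f c"

text \<open>The argument \<open>t\<close> of the total derivatives is the order of the velocity manifold they
  act on.\<close>

definition dtot ::
  "nat \<Rightarrow> 'n::finite \<Rightarrow> (('a::finite, 'n) vcoords \<Rightarrow> real) \<Rightarrow> ('a, 'n) vcoords \<Rightarrow> real" where
  "dtot t i f c = (\<Sum>A\<in>UNIV. \<Sum>J\<in>{J. length J \<le> t - 1}. c (A, mset (i # J)) * dpart A J f c)"

definition dtots ::
  "nat \<Rightarrow> 'n::finite list \<Rightarrow> (('a::finite, 'n) vcoords \<Rightarrow> real) \<Rightarrow> ('a, 'n) vcoords \<Rightarrow> real" where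
  "dtots t J f = foldr (dtot t) J f"

definition lie_euler ::
  "nat \<Rightarrow> nat \<Rightarrow> 'n::finite list \<Rightarrow> 'a::finite \<Rightarrow> (('a, 'n) vcoords \<Rightarrow> real) \<Rightarrow> ('a, 'n) vcoords \<Rightarrow> real" where
  "lie_euler t s I A f c = (\<Sum>J\<in>{J. length J \<le> s - length I}.
     (-1) ^ length J * real ((length I + length J) choose length I) * dtots t J (dpart A (I @ J) f) c)"

definition helmholtz ::
  "nat \<Rightarrow> nat \<Rightarrow> ('a::finite \<Rightarrow> ('a, 'n::finite) vcoords \<Rightarrow> real) \<Rightarrow> 'n list \<Rightarrow> 'a \<Rightarrow> 'a \<Rightarrow>
     ('a, 'n) vcoords \<Rightarrow> real" where
  "helmholtz t s \<tau> J A B c = dpart B J (\<tau> A) c - (-1) ^ length J * lie_euler t s J A (\<tau> B) c"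


section \<open>Split charts and coordinates on the quotient\<close>

text \<open>A splitting of the chart coordinates is an injection \<open>\<iota>\<close>: the coordinate \<open>x\<^sup>i\<close> is the one with
  index \<open>\<iota> i\<close>, and the indices \<open>\<sigma>\<close> are those outside \<open>range \<iota>\<close> (possibly none).\<close>

definition xmat :: "('n::finite \<Rightarrow> 'a) \<Rightarrow> ('a, 'n) vcoords \<Rightarrow> real ^ 'n ^ 'n" where
  "xmat \<iota> c = (\<chi> i j. c (\<iota> i, {#j#}))"

definition Wset ::
  "('x::topological_space, 'a::finite) chart set \<Rightarrow> nat \<Rightarrow> 'x set \<Rightarrow> ('x \<Rightarrow> real ^ 'a) \<Rightarrow>
     ('n::finite \<Rightarrow> 'a) \<Rightarrow> ('n, 'x) velocity set" where
  "Wset \<A> s V x \<iota> = {v \<in> Imm \<A> s. base v \<in> V \<and> det (xmat \<iota> (coords x v)) \<noteq> 0}"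

text \<open>\<open>zjet\<close> has no meaning for the empty multi-index.\<close>

fun zjet :: "('n::finite \<Rightarrow> 'a::finite) \<Rightarrow> nat \<Rightarrow> 'n \<Rightarrow> 'n list \<Rightarrow> ('a, 'n) vcoords \<Rightarrow> real" where
  "zjet \<iota> t i [] = (\<lambda>c. 0)"
| "zjet \<iota> t i [j] = (\<lambda>c. matrix_inv (xmat \<iota> c) $ i $ j)"
| "zjet \<iota> t i (j # k # J) = (\<lambda>c. \<Sum>p\<in>UNIV. zjet \<iota> t p [j] c * dtot t p (zjet \<iota> t i (k # J)) c)"

fun yjet :: "('n::finite \<Rightarrow> 'a::finite) \<Rightarrow> nat \<Rightarrow> 'a \<Rightarrow> 'n list \<Rightarrow> ('a, 'n) vcoords \<Rightarrow> real" where
  "yjet \<iota> t \<sigma> [] = (\<lambda>c. c (\<sigma>, {#}))"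
| "yjet \<iota> t \<sigma> (i # I) = (\<lambda>c. \<Sum>j\<in>UNIV. zjet \<iota> t j [i] c * dtot t j (yjet \<iota> t \<sigma> I) c)"

text \<open>Coordinates \<open>(x\<^sup>i, y\<^sup>\<sigma>\<^sub>I)\<close> on the quotient.  Only the coordinates \<open>PY \<sigma> M\<close> with \<open>\<sigma>\<close> outside
  \<open>range \<iota>\<close>, and \<open>size M\<close> at most the order, are used.  The choice made by \<open>mlist\<close> is immaterial,
  because \<open>y\<^sup>\<sigma>\<^sub>I\<close> is symmetric in \<open>I\<close>.\<close>

datatype ('a, 'n) pindex = PX 'n | PY 'a "'n multiset"

type_synonym ('a, 'n) pcoords = "('a, 'n) pindex \<Rightarrow> real"

definition quot_coords ::
  "('n::finite \<Rightarrow> 'a::finite) \<Rightarrow> nat \<Rightarrow> ('a, 'n) vcoords \<Rightarrow> ('a, 'n) pcoords" where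
  "quot_coords \<iota> t c = (\<lambda>k. case k of PX i \<Rightarrow> c (\<iota> i, {#}) | PY \<sigma> M \<Rightarrow> yjet \<iota> t \<sigma> (mlist M) c)"

text \<open>The function \<open>f\<close> on the quotient of order \<open>s\<close> has the expression \<open>g\<close> in the coordinates
  \<open>(x\<^sup>i, y\<^sup>\<sigma>\<^sub>I)\<close> with \<open>|I| \<le> s\<close>.\<close>

definition quot_expression ::
  "('x::topological_space, 'a::finite) chart set \<Rightarrow> nat \<Rightarrow> 'x set \<Rightarrow> ('x \<Rightarrow> real ^ 'a) \<Rightarrow> ('n::finite \<Rightarrow> 'a) \<Rightarrow>
     (('n, 'x) velocity set \<Rightarrow> real) \<Rightarrow> (('a, 'n) pcoords \<Rightarrow> real) \<Rightarrow> bool" where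
  "quot_expression \<A> s V x \<iota> f g \<longleftrightarrow> (\<forall>v\<in>Wset \<A> s V x \<iota>. \<forall>Y.
     (\<forall>i. Y (PX i) = quot_coords \<iota> s (coords x v) (PX i)) \<and>
     (\<forall>\<sigma> M. \<sigma> \<notin> range \<iota> \<and> size M \<le> s \<longrightarrow>
        Y (PY \<sigma> M) = quot_coords \<iota> s (coords x v) (PY \<sigma> M)) \<longrightarrow>
     f (orbit \<A> s v) = g Y)"


section \<open>Operators on the quotient\<close>

definition Delta :: "'a \<Rightarrow> 'n::finite list \<Rightarrow> (('a, 'n) pcoords \<Rightarrow> real) \<Rightarrow> ('a, 'n) pcoords \<Rightarrow> real" where
  "Delta \<sigma> J f Y = sym_weight J * pd (PY \<sigma> (mset J)) f Y"

definition Dtot ::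
  "('n::finite \<Rightarrow> 'a::finite) \<Rightarrow> nat \<Rightarrow> 'n \<Rightarrow> (('a, 'n) pcoords \<Rightarrow> real) \<Rightarrow> ('a, 'n) pcoords \<Rightarrow> real" where
  "Dtot \<iota> t i f Y = pd (PX i) f Y +
     (\<Sum>\<sigma>\<in>- range \<iota>. \<Sum>J\<in>{J. length J \<le> t - 1}. Y (PY \<sigma> (mset (i # J))) * Delta \<sigma> J f Y)"

definition Dtots ::
  "('n::finite \<Rightarrow> 'a::finite) \<Rightarrow> nat \<Rightarrow> 'n list \<Rightarrow> (('a, 'n) pcoords \<Rightarrow> real) \<Rightarrow> ('a, 'n) pcoords \<Rightarrow> real" where
  "Dtots \<iota> t J f = foldr (Dtot \<iota> t) J f"

definition quot_lie_euler ::
  "('n::finite \<Rightarrow> 'a::finite) \<Rightarrow> nat \<Rightarrow> nat \<Rightarrow> 'n list \<Rightarrow> 'a \<Rightarrow> (('a, 'n) pcoords \<Rightarrow> real) \<Rightarrow>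
     ('a, 'n) pcoords \<Rightarrow> real" where
  "quot_lie_euler \<iota> t s I \<sigma> f Y = (\<Sum>J\<in>{J. length J \<le> s - length I}.
     (-1) ^ length J * real ((length I + length J) choose length I) * Dtots \<iota> t J (Delta \<sigma> (I @ J) f) Y)"

definition quot_helmholtz ::
  "('n::finite \<Rightarrow> 'a::finite) \<Rightarrow> nat \<Rightarrow> nat \<Rightarrow> ('a \<Rightarrow> ('a, 'n) pcoords \<Rightarrow> real) \<Rightarrow> 'n list \<Rightarrow> 'a \<Rightarrow> 'a \<Rightarrow>
     ('a, 'n) pcoords \<Rightarrow> real" where
  "quot_helmholtz \<iota> t s T J \<sigma> \<nu> Y =
     Delta \<nu> J (T \<sigma>) Y - (-1) ^ length J * quot_lie_euler \<iota> t s J \<sigma> (T \<nu>) Y"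

text \<open>Sum over the partitions \<open>P\<close> of the positions of \<open>I\<close> into \<open>length J\<close> nonempty blocks of the
  average over all permutations of the entries of \<open>J\<close>.  As \<open>P\<close> is unordered, this average is taken
  over the assignments \<open>f\<close> of the positions of \<open>J\<close> to the blocks; \<open>nths I B\<close> is the sub-multi-index
  at the positions in \<open>B\<close>.\<close>

definition Zsum ::
  "('n::finite \<Rightarrow> 'a::finite) \<Rightarrow> nat \<Rightarrow> 'n list \<Rightarrow> 'n list \<Rightarrow> ('a, 'n) vcoords \<Rightarrow> real" where
  "Zsum \<iota> t J I c =
     (\<Sum>P\<in>{P. partition_on {..<length I} P \<and> card P = length J}.
        (\<Sum>f\<in>{f \<in> P \<rightarrow>\<^sub>E {..<length J}. bij_betw f P {..<length J}}.
           \<Prod>B\<in>P. zjet \<iota> t (J ! f B) (nths I B) c) / fact (length J))"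

end

theory Submission
  imports Defs "HOL-Combinatorics.Multiset_Permutations"
begin

text \<open>The coefficients of a linear differential operator are determined by the operator as a map, and
  so is its formal adjoint. The expressions \<open>\<H>\<^sub>A\<^sub>B\<close> are the coefficients, in the derivations \<open>d\<^sub>j\<close>, of
  the linearisation of \<open>\<T>\<close> minus its adjoint, evaluated along the Taylor polynomial of an immersion with
  prescribed jet; the \<open>H\<^sub>\<sigma>\<^sub>\<nu>\<close> are the coefficients of the same difference for \<open>T\<close> in the moving frame
  \<open>D\<^sub>i = z\<^sup>j\<^sub>i d\<^sub>j\<close>. A variation of the immersion, corrected by its tangential part, commutes with the
  frame. Hence the linearisation of \<open>\<T>\<^sub>\<sigma> = det(x) T\<^sub>\<sigma>\<close> is \<open>det(x)\<close> times a divergence-like term plus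
  the linearisation of \<open>T\<close> applied to the transversal part of the variation. Taking adjoints by Piola's
  identity \<open>d\<^sub>j (det(x) z\<^sup>j\<^sub>i a) = det(x) D\<^sub>i a\<close>, the terms that involve \<open>T\<close> itself cancel. The relations
  follow by expanding \<open>D\<^sub>I\<close> in the \<open>d\<^sub>J\<close>, which produces the sums over partitions, and comparing
  coefficients. Derivatives are taken in a ring of germs of smooth functions.\<close>

section \<open>Calculus in families of coordinates\<close>

text \<open>All identities are pointwise in the jet, whereas adjoints and total derivatives are not.
  Once the coordinates are replaced by the germs of an immersion, \<open>dtot\<close> becomes
  partial differentiation, the calculus runs in a commutative ring with commuting derivations, and
  \<open>ev\<close> returns to the point at the end. Nothing is lost, because Taylor polynomials
  prescribe finite jets freely, both of the immersion and of the test functions that isolate a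
  coefficient. Adjoints need no integrals: the commutator of an operator with multiplication by x^k
  differentiates its symbol in the k-th covector component, so iterated commutators applied to 1
  read off the coefficients. A variation is the derivative in one extra variable, whence germs over
  \<open>'n option\<close>. The order 2s is that of the adjoint, where up to s total derivatives act
  on coefficients of order s. Smoothness of T_\<sigma> in the coordinates of the quotient is deduced
  from that of \<tau>, by restriction to graphs, where det(x) = 1.\<close>

lemma continuous_on_line: "continuous_on UNIV (\<lambda>u::real. c(k := u))"
proof (rule continuous_on_coordinatewise_then_product)
  fix i show "continuous_on UNIV (\<lambda>u::real. (c(k := u)) i)" by (cases "i = k") auto
qed

lemma open_line:
  fixes S :: "('k \<Rightarrow> real) set"
  assumes "open S"
  shows "open {u. c(k := u) \<in> S}"
  using open_vimage[OF assms continuous_on_line[of c k]] by (simp add: vimage_def)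

lemma eventually_line:
  fixes S :: "('k \<Rightarrow> real) set"
  assumes "open S" "c \<in> S"
  shows "eventually (\<lambda>u. c(k := u) \<in> S) (nhds (c k))"
  using open_line[OF assms(1), of c k] assms(2) eventually_nhds_in_open[of "{u. c(k := u) \<in> S}"]
  by simp

text \<open>Only the coordinates in the finite set \<open>K\<close> move, so one radius serves them
  all even when \<open>'k\<close> is infinite; the other factors of a basic open set see the
  unchanged values of \<open>p\<close>.\<close>

lemma open_box:
  fixes U :: "('k \<Rightarrow> real) set"
  assumes "open U" "p \<in> U" "finite K"
  shows "\<exists>e>0. \<forall>q. (\<forall>i\<in>K. \<bar>q i - p i\<bar> < e) \<and> (\<forall>i. i \<notin> K \<longrightarrow> q i = p i) \<longrightarrow> q \<in> U"
proof -
  have "openin (product_topology (\<lambda>i::'k. euclidean :: real topology) UNIV) U"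
    using assms(1) by (simp add: open_fun_def)
  then obtain X where X: "p \<in> Pi\<^sub>E UNIV X" "\<And>i. open (X i)" "Pi\<^sub>E UNIV X \<subseteq> U"
    using product_topology_open_contains_basis[of "\<lambda>i::'k. euclidean :: real topology" UNIV U p] assms(2)
    by auto
  have "\<exists>e>0. ball (p i) e \<subseteq> X i" for i
    using X(1) X(2)[of i] unfolding open_contains_ball by auto
  then obtain E where E: "\<And>i. E i > 0" "\<And>i. ball (p i) (E i) \<subseteq> X i" by metis
  have "\<exists>e>0. \<forall>i\<in>K. e \<le> E i"
  proof (cases "K = {}")
    case False
    then show ?thesis using assms(3) E(1)
      by (intro exI[of _ "Min (E ` K)"]) auto
  qed (auto intro: exI[of _ 1])
  then obtain e where e: "e > 0" "\<And>i. i \<in> K \<Longrightarrow> e \<le> E i" by auto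
  show ?thesis
  proof (intro exI[of _ e] conjI allI impI e)
    fix q assume q: "(\<forall>i\<in>K. \<bar>q i - p i\<bar> < e) \<and> (\<forall>i. i \<notin> K \<longrightarrow> q i = p i)"
    have "q i \<in> X i" for i
    proof (cases "i \<in> K")
      case True
      then have "q i \<in> ball (p i) (E i)" using q e(2)[OF True] by (auto simp: dist_real_def abs_minus_commute)
      then show ?thesis using E(2) by blast
    next
      case False
      then show ?thesis using q X(1) by auto
    qed
    then show "q \<in> U" using X(3) by auto
  qed
qed

section \<open>Functions of finitely many coordinates and their differentiability classes\<close>

definition depends_on :: "'k set \<Rightarrow> ('k \<Rightarrow> real) set \<Rightarrow> (('k \<Rightarrow> real) \<Rightarrow> real) \<Rightarrow> bool" where
  "depends_on K S f \<longleftrightarrow> (\<forall>c\<in>S. \<forall>c'\<in>S. (\<forall>k\<in>K. c k = c' k) \<longrightarrow> f c = f c')"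

text \<open>These are the cylinder sets over the coordinates in \<open>K\<close>. Inside a cylinder
  the other coordinates can be altered at will, so the partial derivatives of a function that
  depends on \<open>K\<close> vanish in all other directions.\<close>

definition saturated :: "'k set \<Rightarrow> ('k \<Rightarrow> real) set \<Rightarrow> bool" where
  "saturated K S \<longleftrightarrow> (\<forall>c\<in>S. \<forall>c'. (\<forall>k\<in>K. c k = c' k) \<longrightarrow> c' \<in> S)"

text \<open>\<^const>\<open>Ck_coords\<close> does not control the derivatives of lower order, so that closure properties
  have to be proved for all orders up to \<open>r\<close> at once.\<close>

definition Cle :: "nat \<Rightarrow> ('k \<Rightarrow> real) set \<Rightarrow> (('k \<Rightarrow> real) \<Rightarrow> real) \<Rightarrow> bool" where
  "Cle r S f \<longleftrightarrow> (\<forall>q\<le>r. Ck_coords q S f)"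

definition smooth_coords :: "('k \<Rightarrow> real) set \<Rightarrow> (('k \<Rightarrow> real) \<Rightarrow> real) \<Rightarrow> bool" where
  "smooth_coords S f \<longleftrightarrow> (\<forall>r. Ck_coords r S f)"

lemma depends_on_mono: "depends_on K S f \<Longrightarrow> K \<subseteq> K' \<Longrightarrow> depends_on K' S f"
  unfolding depends_on_def by (meson subsetD)

lemma saturatedD: "saturated K S \<Longrightarrow> c \<in> S \<Longrightarrow> (\<And>k. k \<in> K \<Longrightarrow> c k = c' k) \<Longrightarrow> c' \<in> S"
  unfolding saturated_def by blast

lemma depends_onD:
  "depends_on K S f \<Longrightarrow> c \<in> S \<Longrightarrow> c' \<in> S \<Longrightarrow> (\<And>k. k \<in> K \<Longrightarrow> c k = c' k) \<Longrightarrow> f c = f c'"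
  unfolding depends_on_def by blast

lemma smooth_coords_Cle: "smooth_coords S f \<longleftrightarrow> (\<forall>r. Cle r S f)"
  unfolding smooth_coords_def Cle_def by blast

lemma Cle_0: "Cle 0 S f \<longleftrightarrow> continuous_on S f"
  by (simp add: Cle_def)

lemma Cle_Suc:
  "Cle (Suc r) S f \<longleftrightarrow> continuous_on S f \<and>
     (\<forall>c\<in>S. \<forall>k. (\<lambda>u. f (c(k := u))) differentiable (at (c k))) \<and> (\<forall>k. Cle r S (pd k f))"
proof -
  have "Cle (Suc r) S f \<longleftrightarrow> Ck_coords 0 S f \<and> (\<forall>q\<le>r. Ck_coords (Suc q) S f)"
    unfolding Cle_def by (metis Suc_le_D Suc_le_mono not0_implies_Suc zero_le)
  then show ?thesis by (auto simp: Cle_def)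
qed

lemma Cle_imp_continuous_on: "Cle r S f \<Longrightarrow> continuous_on S f"
  unfolding Cle_def by (metis Ck_coords.simps(1) le0)

lemma Cle_antimono: "Cle r S f \<Longrightarrow> q \<le> r \<Longrightarrow> Cle q S f"
  by (auto simp: Cle_def)

lemma Cle_subset: "Cle r S f \<Longrightarrow> S' \<subseteq> S \<Longrightarrow> Cle r S' f"
proof (induction r arbitrary: f)
  case (Suc r)
  then show ?case unfolding Cle_Suc using continuous_on_subset by blast
qed (simp add: Cle_0 continuous_on_subset)

lemma Cle_pd:
  assumes "Cle (Suc r) S f" "c \<in> S"
  shows "((\<lambda>u. f (c(k := u))) has_real_derivative pd k f c) (at (c k))"
  using assms by (simp add: Cle_Suc pd_def DERIV_deriv_iff_real_differentiable)

lemma pdI: "((\<lambda>u. f (c(k := u))) has_real_derivative D) (at (c k)) \<Longrightarrow> pd k f c = D"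
  by (simp add: pd_def DERIV_imp_deriv)

lemma has_pd_cong:
  fixes S :: "('k \<Rightarrow> real) set"
  assumes "open S" "c \<in> S" "\<And>c. c \<in> S \<Longrightarrow> f c = g c"
    and "((\<lambda>u. f (c(k := u))) has_real_derivative D) (at (c k))"
  shows "((\<lambda>u. g (c(k := u))) has_real_derivative D) (at (c k))"
proof -
  have "\<forall>\<^sub>F u in nhds (c k). f (c(k := u)) = g (c(k := u))"
    using eventually_line[OF assms(1,2), of k] by eventually_elim (simp add: assms(3))
  from DERIV_cong_ev[OF refl this refl] show ?thesis using assms(4) by simp
qed

lemma pd_cong:
  fixes S :: "('k \<Rightarrow> real) set"
  assumes "open S" "c \<in> S" "\<And>c. c \<in> S \<Longrightarrow> f c = g c"
  shows "pd k f c = pd k g c"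
proof -
  have "\<forall>\<^sub>F u in nhds (c k). f (c(k := u)) = g (c(k := u))"
    using eventually_line[OF assms(1,2), of k] by eventually_elim (simp add: assms(3))
  then show ?thesis unfolding pd_def by (rule deriv_cong_ev) simp
qed

lemma Cle_cong:
  fixes S :: "('k \<Rightarrow> real) set"
  assumes "open S" "Cle r S f" "\<And>c. c \<in> S \<Longrightarrow> f c = g c"
  shows "Cle r S g"
  using assms(2,3)
proof (induction r arbitrary: f g)
  case 0
  then show ?case by (simp add: Cle_0 cong: continuous_on_cong)
next
  case (Suc r)
  show ?case unfolding Cle_Suc
  proof (intro conjI ballI allI)
    show "continuous_on S g"
      using Cle_imp_continuous_on[OF Suc.prems(1)] Suc.prems(2) by (simp cong: continuous_on_cong)
    fix k show "Cle r S (pd k g)"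
      using Suc.IH[of "pd k f" "pd k g"] Suc.prems pd_cong[OF assms(1), of _ f g k]
      by (auto simp: Cle_Suc)
    fix c assume "c \<in> S"
    then show "(\<lambda>u. g (c(k := u))) differentiable (at (c k))"
      using has_pd_cong[OF assms(1) _ Suc.prems(2) Cle_pd[OF Suc.prems(1)]] real_differentiable_def
      by blast
  qed
qed

text \<open>Differentiability classes are built by recursion from explicit formulas
  \<open>g k\<close> for the partial derivatives. The formulas hold on \<open>S\<close> only, which
  suffices because \<open>S\<close> is open.\<close>

lemma Cle_Suc_intro:
  fixes S :: "('k \<Rightarrow> real) set"
  assumes "open S" "continuous_on S f"
    and "\<And>c k. c \<in> S \<Longrightarrow> ((\<lambda>u. f (c(k := u))) has_real_derivative g k c) (at (c k))"
    and "\<And>k. Cle r S (g k)"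
  shows "Cle (Suc r) S f"
  unfolding Cle_Suc
proof (intro conjI ballI allI assms(2))
  fix c k assume "c \<in> S"
  then show "(\<lambda>u. f (c(k := u))) differentiable (at (c k))"
    using assms(3) real_differentiable_def by blast
next
  fix k show "Cle r S (pd k f)"
    by (rule Cle_cong[OF assms(1) assms(4)[of k]]) (use assms(3) pdI in metis)
qed

lemma Cle_const:
  assumes "open S"
  shows "Cle r S (\<lambda>c. a)"
proof (induction r arbitrary: a)
  case (Suc r)
  show ?case by (rule Cle_Suc_intro[where g="\<lambda>_ _. 0", OF assms _ _ Suc]) auto
qed (simp add: Cle_0)

lemma has_pd_proj:
  "((\<lambda>u. (c(k := u)) l) has_real_derivative (if k = l then 1 else 0)) (at (c k))"
  by (cases "k = l") auto

lemma continuous_on_proj: "continuous_on S (\<lambda>c::'k \<Rightarrow> real. c l)"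
  by (rule continuous_on_subset[OF continuous_on_product_coordinates]) simp

lemma Cle_proj: "open S \<Longrightarrow> Cle r S (\<lambda>c. c l)"
proof (cases r)
  case (Suc q)
  assume "open S"
  then show ?thesis unfolding Suc
    by (intro Cle_Suc_intro[where g="\<lambda>k _. if k = l then 1 else 0"])
       (rule Cle_const has_pd_proj continuous_on_proj | assumption)+
qed (simp add: Cle_0 continuous_on_proj)

lemma Cle_add:
  assumes "open S" "Cle r S f" "Cle r S g"
  shows "Cle r S (\<lambda>c. f c + g c)"
  using assms(2,3)
proof (induction r arbitrary: f g)
  case 0
  then show ?case by (simp add: Cle_0 continuous_on_add)
next
  case (Suc r)
  show ?case
  proof (rule Cle_Suc_intro[where g="\<lambda>k c. pd k f c + pd k g c", OF assms(1)])
    show "continuous_on S (\<lambda>c. f c + g c)"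
      using Suc.prems by (intro continuous_on_add Cle_imp_continuous_on)
    fix k
    show "Cle r S (\<lambda>c. pd k f c + pd k g c)"
      using Suc.prems by (intro Suc.IH) (auto simp: Cle_Suc)
    fix c assume "c \<in> S"
    then show "((\<lambda>u. f (c(k := u)) + g (c(k := u))) has_real_derivative pd k f c + pd k g c) (at (c k))"
      using Suc.prems by (intro DERIV_add Cle_pd)
  qed
qed

lemma Cle_mult:
  assumes "open S" "Cle r S f" "Cle r S g"
  shows "Cle r S (\<lambda>c. f c * g c)"
  using assms(2,3)
proof (induction r arbitrary: f g)
  case 0
  then show ?case by (simp add: Cle_0 continuous_on_mult)
next
  case (Suc r)
  show ?case
  proof (rule Cle_Suc_intro[where g="\<lambda>k c. pd k f c * g c + pd k g c * f c", OF assms(1)])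
    show "continuous_on S (\<lambda>c. f c * g c)"
      using Suc.prems by (intro continuous_on_mult Cle_imp_continuous_on)
    fix k
    show "Cle r S (\<lambda>c. pd k f c * g c + pd k g c * f c)"
      using Suc.prems
      by (intro Cle_add Suc.IH assms(1)) (auto simp: Cle_Suc intro: Cle_antimono[of "Suc r"])
    fix c assume "c \<in> S"
    then show "((\<lambda>u. f (c(k := u)) * g (c(k := u))) has_real_derivative pd k f c * g c + pd k g c * f c) (at (c k))"
      using DERIV_mult[OF Cle_pd[OF Suc.prems(1), of c k] Cle_pd[OF Suc.prems(2), of c k]]
      by (simp del: fun_upd_apply)
  qed
qed

lemma Cle_sum:
  assumes "open S" "\<And>i. i \<in> I \<Longrightarrow> Cle r S (f i)"
  shows "Cle r S (\<lambda>c. \<Sum>i\<in>I. f i c)"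
  using assms(2)
proof (induction I rule: infinite_finite_induct)
  case (insert x F)
  then show ?case using Cle_add[OF assms(1), of r "f x" "\<lambda>c. \<Sum>i\<in>F. f i c"] by simp
qed (simp_all add: Cle_const[OF assms(1)])

lemma Cle_prod:
  assumes "open S" "\<And>i. i \<in> I \<Longrightarrow> Cle r S (f i)"
  shows "Cle r S (\<lambda>c. \<Prod>i\<in>I. f i c)"
  using assms(2)
proof (induction I rule: infinite_finite_induct)
  case (insert x F)
  then show ?case using Cle_mult[OF assms(1), of r "f x" "\<lambda>c. \<Prod>i\<in>F. f i c"] by simp
qed (simp_all add: Cle_const[OF assms(1)])

lemma Cle_inverse:
  assumes "open S" "Cle r S f" "\<And>c. c \<in> S \<Longrightarrow> f c \<noteq> 0"
  shows "Cle r S (\<lambda>c. inverse (f c))"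
  using assms(2)
proof (induction r)
  case 0
  then show ?case using assms(3) by (simp add: Cle_0 continuous_on_inverse)
next
  case (Suc r)
  show ?case
  proof (rule Cle_Suc_intro[where g="\<lambda>k c. (-1) * (inverse (f c) * pd k f c * inverse (f c))", OF assms(1)])
    show "continuous_on S (\<lambda>c. inverse (f c))"
      using Suc.prems assms(3) by (intro continuous_on_inverse Cle_imp_continuous_on) auto
    fix k
    show "Cle r S (\<lambda>c. (-1) * (inverse (f c) * pd k f c * inverse (f c)))"
      using Suc.prems Suc.IH[OF Cle_antimono[OF Suc.prems]]
      by (intro Cle_mult Cle_const assms(1)) (auto simp: Cle_Suc)
    fix c assume c: "c \<in> S"
    show "((\<lambda>u. inverse (f (c(k := u)))) has_real_derivative (-1) * (inverse (f c) * pd k f c * inverse (f c))) (at (c k))"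
      using DERIV_inverse'[OF Cle_pd[OF Suc.prems(1) c, of k]] assms(3)[OF c]
      by (simp del: fun_upd_apply)
  qed
qed

section \<open>The chain rule and smoothness of compositions\<close>

lemma continuous_on_nbhd:
  fixes f :: "('k \<Rightarrow> real) \<Rightarrow> real"
  assumes "continuous_on S f" "open S" "c \<in> S" "e > 0"
  shows "\<exists>U. open U \<and> c \<in> U \<and> (\<forall>x\<in>U. \<bar>f x - f c\<bar> < e)"
proof -
  obtain A where A: "open A" "c \<in> A" "\<forall>y\<in>S. y \<in> A \<longrightarrow> f y \<in> ball (f c) e"
    using assms(1,3,4) unfolding continuous_on_topological by (metis centre_in_ball open_ball)
  then show ?thesis using assms(2,3)
    by (intro exI[of _ "A \<inter> S"]) (auto simp: dist_real_def abs_minus_commute)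
qed

text \<open>The product space need not carry a norm, so the rule is derived from continuous partial
  derivatives by induction on the set of moving coordinates. Freezing coordinate \<open>k\<close>
  turns \<open>a\<close> into \<open>b\<close>, and \<open>f (a u) - f (b u)\<close> is governed by
  the mean value theorem in the direction \<open>k\<close> alone.\<close>

lemma chain_rule_line:
  fixes f :: "('k \<Rightarrow> real) \<Rightarrow> real" and a :: "real \<Rightarrow> 'k \<Rightarrow> real"
  assumes S: "open S" and f: "Cle 1 S f" and K: "finite K"
    and a: "\<And>k. k \<in> K \<Longrightarrow> ((\<lambda>u. a u k) has_real_derivative a' k) (at u0)"
    and const: "\<And>u k. k \<notin> K \<Longrightarrow> a u k = a u0 k" and p: "a u0 \<in> S"
  shows "((\<lambda>u. f (a u)) has_real_derivative (\<Sum>k\<in>K. pd k f (a u0) * a' k)) (at u0)"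
  using K a const p
proof (induction K arbitrary: a)
  case empty
  have "a u = a u0" for u by (rule ext) (use empty.prems(2)[of _ u] in blast)
  then have "(\<lambda>u. f (a u)) = (\<lambda>u. f (a u0))" by metis
  then show ?case by simp
next
  case (insert k K)
  define b where "b u = (a u)(k := a u0 k)" for u
  have b0: "b u0 = a u0" by (simp add: b_def)
  have "((\<lambda>u. f (b u)) has_real_derivative (\<Sum>i\<in>K. pd i f (b u0) * a' i)) (at u0)"
  proof (rule insert.IH)
    fix i assume i: "i \<in> K"
    then have "i \<noteq> k" using insert.hyps by auto
    then show "((\<lambda>u. b u i) has_real_derivative a' i) (at u0)"
      using insert.prems(1)[of i] i by (simp add: b_def)
  next
    fix u i assume "i \<notin> K"
    then show "b u i = b u0 i" using insert.prems(2)[of i u] by (auto simp: b_def)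
  qed (use b0 insert.prems(3) in simp)
  moreover have "((\<lambda>u. f (a u) - f (b u)) has_real_derivative pd k f (a u0) * a' k) (at u0)"
  proof -
    define q where "q = a u0"
    have ak: "((\<lambda>u. a u k) has_real_derivative a' k) (at u0)" using insert.prems(1) by simp
    have cont: "((\<lambda>u. a u i) \<longlongrightarrow> q i) (at u0)" if "i \<in> insert k K" for i
      using DERIV_isCont[OF insert.prems(1)[OF that]] unfolding isCont_def q_def .
    have pdc: "continuous_on S (pd k f)" using f Cle_Suc[of 0 S f] by (simp add: Cle_0)
    \<comment> \<open>\<open>W u\<close> is a value of \<open>pd k f\<close> at an intermediate
      point, hence close to its value at \<open>q\<close>; where coordinate \<open>k\<close> does
      not move, the value at \<open>q\<close> itself serves.\<close>
    have mvt: "\<exists>W. \<forall>\<^sub>F u in at u0. f (a u) - f (b u) = W u * (a u k - q k) \<and> \<bar>W u - pd k f q\<bar> < e"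
      if e: "e > 0" for e
    proof -
      obtain U where U: "open U" "q \<in> U" "\<And>x. x \<in> U \<Longrightarrow> \<bar>pd k f x - pd k f q\<bar> < e"
        using continuous_on_nbhd[OF pdc S _ e, of q] insert.prems(3) by (auto simp: q_def)
      obtain d where d: "d > 0" "\<And>x. (\<forall>i\<in>insert k K. \<bar>x i - q i\<bar> < d) \<Longrightarrow> (\<forall>i. i \<notin> insert k K \<longrightarrow> x i = q i) \<Longrightarrow> x \<in> U \<inter> S"
        using open_box[OF open_Int[OF U(1) S], of q "insert k K"] U(2) insert.prems(3) insert.hyps(1)
        unfolding q_def[symmetric] by auto
      have near: "\<forall>\<^sub>F u in at u0. \<forall>i\<in>insert k K. \<bar>a u i - q i\<bar> < d"
        using insert.hyps tendstoD[OF cont d(1)]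
        by (subst eventually_ball_finite_distrib) (auto simp: dist_real_def)
      have "\<forall>\<^sub>F u in at u0. \<exists>w. f (a u) - f (b u) = w * (a u k - q k) \<and> \<bar>w - pd k f q\<bar> < e"
        using near
      proof eventually_elim
        case (elim u)
        have mem: "(a u)(k := s) \<in> U \<inter> S" if "\<bar>s - q k\<bar> < d" for s
        proof (rule d(2))
          show "\<forall>i\<in>insert k K. \<bar>((a u)(k := s)) i - q i\<bar> < d" using that elim by auto
          show "\<forall>i. i \<notin> insert k K \<longrightarrow> ((a u)(k := s)) i = q i"
            unfolding q_def using insert.prems(2)[of _ u] by (metis fun_upd_other insertI1)
        qed
        have der: "((\<lambda>s. f ((a u)(k := s))) has_real_derivative pd k f ((a u)(k := s))) (at s)"
          if "\<bar>s - q k\<bar> < d" for s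
          using Cle_pd[of 0 S f "(a u)(k := s)" k] f mem[OF that] by simp
        have fa: "f (a u) = f ((a u)(k := a u k))" by simp
        have fb: "f (b u) = f ((a u)(k := q k))" by (simp add: b_def q_def)
        have da: "\<bar>a u k - q k\<bar> < d" using elim by auto
        consider "a u k = q k" | "a u k < q k" | "a u k > q k" by linarith
        then show ?case
        proof cases
          case 1
          then show ?thesis using e by (intro exI[of _ "pd k f q"]) (simp add: fa fb del: fun_upd_triv)
        next
          case 2
          obtain z where z: "a u k < z" "z < q k"
            "f ((a u)(k := q k)) - f ((a u)(k := a u k)) = (q k - a u k) * pd k f ((a u)(k := z))"
            using MVT2[OF 2, of "\<lambda>s. f ((a u)(k := s))" "\<lambda>s. pd k f ((a u)(k := s))"] der da by force
          have "\<bar>z - q k\<bar> < d" using z da by auto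
          then show ?thesis using U(3)[of "(a u)(k := z)"] mem[of z] z
            by (intro exI[of _ "pd k f ((a u)(k := z))"]) (auto simp: fa fb algebra_simps simp del: fun_upd_triv)
        next
          case 3
          obtain z where z: "q k < z" "z < a u k"
            "f ((a u)(k := a u k)) - f ((a u)(k := q k)) = (a u k - q k) * pd k f ((a u)(k := z))"
            using MVT2[OF 3, of "\<lambda>s. f ((a u)(k := s))" "\<lambda>s. pd k f ((a u)(k := s))"] der da by force
          have "\<bar>z - q k\<bar> < d" using z da by auto
          then show ?thesis using U(3)[of "(a u)(k := z)"] mem[of z] z
            by (intro exI[of _ "pd k f ((a u)(k := z))"]) (auto simp: fa fb algebra_simps simp del: fun_upd_triv)
        qed
      qed
      then show ?thesis
        by (intro exI[of _ "\<lambda>u. SOME w. f (a u) - f (b u) = w * (a u k - q k) \<and> \<bar>w - pd k f q\<bar> < e"])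
           (erule eventually_mono, rule someI_ex)
    qed
    have slope: "((\<lambda>u. (a u k - q k) / (u - u0)) \<longlongrightarrow> a' k) (at u0)"
      using ak by (simp add: has_field_derivative_iff q_def)
    have "((\<lambda>u. (f (a u) - f (b u)) / (u - u0) - pd k f q * ((a u k - q k) / (u - u0))) \<longlongrightarrow> 0) (at u0)"
    proof (rule tendstoI)
      fix e :: real assume e: "e > 0"
      \<comment> \<open>Adding 1 keeps the divisor positive when \<open>a' k = 0\<close> and gives
        an eventual strict bound for the difference quotient of coordinate \<open>k\<close>.\<close>
      define e' where "e' = e / (\<bar>a' k\<bar> + 1)"
      have e': "e' > 0" "e' * (\<bar>a' k\<bar> + 1) = e" using e by (auto simp: e'_def)
      obtain W where W: "\<forall>\<^sub>F u in at u0. f (a u) - f (b u) = W u * (a u k - q k) \<and> \<bar>W u - pd k f q\<bar> < e'"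
        using mvt[OF e'(1)] by blast
      have "\<forall>\<^sub>F u in at u0. \<bar>(a u k - q k) / (u - u0)\<bar> < \<bar>a' k\<bar> + 1"
        using order_tendstoD(2)[OF tendsto_rabs[OF slope], of "\<bar>a' k\<bar> + 1"] by simp
      with W show "\<forall>\<^sub>F u in at u0. dist ((f (a u) - f (b u)) / (u - u0) - pd k f q * ((a u k - q k) / (u - u0))) 0 < e"
      proof eventually_elim
        case (elim u)
        define s where "s = (a u k - q k) / (u - u0)"
        have "(f (a u) - f (b u)) / (u - u0) - pd k f q * s = (W u - pd k f q) * s"
        proof -
          have "(f (a u) - f (b u)) / (u - u0) = W u * s" using elim by (simp add: s_def)
          then show ?thesis by (simp add: left_diff_distrib)
        qed
        moreover have "\<bar>(W u - pd k f q) * s\<bar> < e' * (\<bar>a' k\<bar> + 1)"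
          unfolding abs_mult using elim by (intro mult_strict_mono') (auto simp: s_def)
        ultimately show ?case by (simp add: s_def[symmetric] e'(2))
      qed
    qed
    from tendsto_add[OF this tendsto_mult_left[OF slope, of "pd k f q"]]
    have "((\<lambda>u. (f (a u) - f (b u)) / (u - u0)) \<longlongrightarrow> pd k f q * a' k) (at u0)"
      by simp
    then show ?thesis unfolding has_field_derivative_iff using b0 by (simp add: q_def)
  qed
  ultimately have "((\<lambda>u. f (b u) + (f (a u) - f (b u))) has_real_derivative
      (\<Sum>i\<in>K. pd i f (b u0) * a' i) + pd k f (a u0) * a' k) (at u0)"
    by (rule DERIV_add)
  then show ?case using insert.hyps by (simp add: b0 add.commute)
qed

lemma depends_on_line:
  fixes S :: "('k \<Rightarrow> real) set"
  assumes "open S" "saturated K S" "depends_on K S f" "c \<in> S" "k \<notin> K"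
  shows "f (c(k := u)) = f c"
proof -
  have "c(k := u) \<in> S"
    by (rule saturatedD[OF assms(2,4)]) (use assms(5) in auto)
  then show ?thesis
    by (rule depends_onD[OF assms(3) _ assms(4)]) (use assms(5) in auto)
qed

lemma pd_eq_0:
  fixes S :: "('k \<Rightarrow> real) set"
  assumes "open S" "saturated K S" "depends_on K S f" "c \<in> S" "k \<notin> K"
  shows "pd k f c = 0"
  by (rule pdI) (simp only: depends_on_line[OF assms] DERIV_const)

lemma depends_on_pd:
  fixes S :: "('k \<Rightarrow> real) set"
  assumes "open S" "saturated K S" "depends_on K S f"
  shows "depends_on K S (pd k f)"
  unfolding depends_on_def
proof (intro ballI impI)
  fix c c' assume c: "c \<in> S" "c' \<in> S" "\<forall>k\<in>K. c k = c' k"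
  show "pd k f c = pd k f c'"
  proof (cases "k \<in> K")
    case True
    have "\<forall>\<^sub>F u in nhds (c k). f (c(k := u)) = f (c'(k := u))"
      using eventually_line[OF assms(1) c(1), of k]
    proof eventually_elim
      case (elim u)
      have agree: "\<forall>i\<in>K. (c(k := u)) i = (c'(k := u)) i" using c(3) by simp
      have "c'(k := u) \<in> S" by (rule saturatedD[OF assms(2) elim]) (use agree in blast)
      with elim show ?case by (rule depends_onD[OF assms(3)]) (use agree in blast)
    qed
    then show ?thesis unfolding pd_def using c(3) True by (intro deriv_cong_ev) auto
  next
    case False
    then show ?thesis using pd_eq_0[OF assms] c by simp
  qed
qed

lemma smooth_coords_pd: "smooth_coords S f \<Longrightarrow> smooth_coords S (pd k f)"
  unfolding smooth_coords_Cle
proof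
  fix r assume "\<forall>r. Cle r S f"
  then have "Cle (Suc r) S f" by blast
  then show "Cle r S (pd k f)" by (simp add: Cle_Suc)
qed

lemma smooth_coords_Cle_D: "smooth_coords S f \<Longrightarrow> Cle r S f"
  by (simp add: smooth_coords_Cle)

lemma has_pd_comp:
  fixes f :: "('k \<Rightarrow> real) \<Rightarrow> real" and F :: "'k \<Rightarrow> ('l \<Rightarrow> real) \<Rightarrow> real"
  assumes \<Omega>: "open \<Omega>" "saturated K \<Omega>" and f: "depends_on K \<Omega> f" "Cle 1 \<Omega> f" and K: "finite K"
    and S: "open S" and F: "\<And>k. k \<in> K \<Longrightarrow> Cle 1 S (F k)" and into: "\<And>c. c \<in> S \<Longrightarrow> (\<lambda>k. F k c) \<in> \<Omega>"
    and c: "c \<in> S"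
  shows "((\<lambda>u. f (\<lambda>k. F k (c(l := u)))) has_real_derivative
      (\<Sum>k\<in>K. pd k f (\<lambda>k. F k c) * pd l (F k) c)) (at (c l))"
proof -
  \<comment> \<open>Outside \<open>K\<close> the family \<open>F\<close> need not be differentiable.
    Freezing these components changes no value of \<open>f\<close>, which depends on
    \<open>K\<close> only.\<close>
  define a where "a u k = (if k \<in> K then F k (c(l := u)) else F k c)" for u k
  have a0: "a (c l) = (\<lambda>k. F k c)" by (auto simp: a_def)
  have "((\<lambda>u. f (a u)) has_real_derivative (\<Sum>k\<in>K. pd k f (a (c l)) * pd l (F k) c)) (at (c l))"
  proof (rule chain_rule_line[OF \<Omega>(1) f(2) K])
    show "((\<lambda>u. a u k) has_real_derivative pd l (F k) c) (at (c l))" if "k \<in> K" for k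
      using Cle_pd[of 0 S "F k" c l] F[OF that] c that by (simp add: a_def )
    show "a (c l) \<in> \<Omega>" using into[OF c] by (simp add: a0)
  qed (simp add: a_def)
  note der = this
  have "\<forall>\<^sub>F u in nhds (c l). f (a u) = f (\<lambda>k. F k (c(l := u)))"
    using eventually_line[OF S c, of l]
  proof eventually_elim
    case (elim u)
    have agree: "\<forall>k\<in>K. F k (c(l := u)) = a u k" by (simp add: a_def)
    have "(\<lambda>k. F k (c(l := u))) \<in> \<Omega>" using into elim by blast
    then have "a u \<in> \<Omega>" by (rule saturatedD[OF \<Omega>(2)]) (use agree in blast)
    then show ?case using \<open>(\<lambda>k. F k (c(l := u))) \<in> \<Omega>\<close>
      by (rule depends_onD[OF f(1)]) (use agree in force)
  qed
  from DERIV_cong_ev[OF refl this refl] show ?thesis using der a0 by simp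
qed

text \<open>The induction runs over all \<open>f\<close> at once, since the derivatives of the
  composition contain compositions with the functions \<open>pd k f\<close>.\<close>

lemma Cle_comp:
  fixes f :: "('k \<Rightarrow> real) \<Rightarrow> real" and F :: "'k \<Rightarrow> ('l \<Rightarrow> real) \<Rightarrow> real"
  assumes \<Omega>: "open \<Omega>" "saturated K \<Omega>" and f: "depends_on K \<Omega> f" "smooth_coords \<Omega> f" and K: "finite K"
    and S: "open S" and F: "\<And>k. k \<in> K \<Longrightarrow> Cle r S (F k)" and into: "\<And>c. c \<in> S \<Longrightarrow> (\<lambda>k. F k c) \<in> \<Omega>"
  shows "Cle r S (\<lambda>c. f (\<lambda>k. F k c))"
proof -
  have cont: "continuous_on S (\<lambda>c. f (\<lambda>k. F k c))"
    if f: "depends_on K \<Omega> f" "smooth_coords \<Omega> f" for f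
  proof (cases "S = {}")
    case False
    then obtain c0 where c0: "c0 \<in> S" by blast
    \<comment> \<open>Continuity into the product requires every component to be continuous; those
      outside \<open>K\<close> are frozen at their values at \<open>c0\<close>.\<close>
    define G where "G c = (\<lambda>k. if k \<in> K then F k c else F k c0)" for c
    have agree: "\<forall>k\<in>K. F k c = G c k" for c by (simp add: G_def)
    have GO: "G c \<in> \<Omega>" if "c \<in> S" for c
      by (rule saturatedD[OF \<Omega>(2) into[OF that]]) (use agree in blast)
    have eq: "f (\<lambda>k. F k c) = f (G c)" if "c \<in> S" for c
      by (rule depends_onD[OF f(1) into[OF that] GO[OF that]]) (use agree in blast)
    have "continuous_on S (\<lambda>c. f (G c))"
    proof (rule continuous_on_compose2[of \<Omega> f])
      show "continuous_on \<Omega> f" using f(2) smooth_coords_Cle_D Cle_0 by blast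
      show "continuous_on S G"
      proof (rule continuous_on_coordinatewise_then_product)
        fix k show "continuous_on S (\<lambda>c. G c k)"
          using F[of k] by (cases "k \<in> K") (auto simp: G_def dest: Cle_imp_continuous_on)
      qed
    qed (use GO in auto)
    then show ?thesis using eq by (simp cong: continuous_on_cong)
  qed simp
  show ?thesis using f F
  proof (induction r arbitrary: f)
    case 0
    then show ?case using cont[OF 0(1,2)] by (simp add: Cle_0)
  next
    case (Suc r)
    show ?case
    proof (rule Cle_Suc_intro[where g="\<lambda>l c. \<Sum>k\<in>K. pd k f (\<lambda>k. F k c) * pd l (F k) c", OF S])
      show "continuous_on S (\<lambda>c. f (\<lambda>k. F k c))" by (rule cont[OF Suc.prems(1,2)])
      have Fr: "Cle r S (F k)" if "k \<in> K" for k
        by (rule Cle_antimono[OF Suc.prems(3)[OF that]]) simp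
      fix l
      show "Cle r S (\<lambda>c. \<Sum>k\<in>K. pd k f (\<lambda>k. F k c) * pd l (F k) c)"
      proof (intro Cle_sum Cle_mult S)
        fix k assume k: "k \<in> K"
        show "Cle r S (\<lambda>c. pd k f (\<lambda>k. F k c))"
          by (rule Suc.IH[OF depends_on_pd[OF \<Omega> Suc.prems(1)] smooth_coords_pd[OF Suc.prems(2)] Fr])
        show "Cle r S (pd l (F k))" using Suc.prems(3)[OF k] by (simp add: Cle_Suc)
      qed
      have F1: "Cle 1 S (F k)" if "k \<in> K" for k
        by (rule Cle_antimono[OF Suc.prems(3)[OF that]]) simp
      fix c assume c: "c \<in> S"
      show "((\<lambda>u. f (\<lambda>k. F k (c(l := u)))) has_real_derivative
          (\<Sum>k\<in>K. pd k f (\<lambda>k. F k c) * pd l (F k) c)) (at (c l))"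
        by (rule has_pd_comp[where F=F, OF \<Omega> Suc.prems(1) smooth_coords_Cle_D[OF Suc.prems(2)] K S F1 into c])
    qed
  qed
qed

section \<open>Symmetry of second partial derivatives\<close>

lemma double_difference:
  fixes f :: "('k \<Rightarrow> real) \<Rightarrow> real"
  assumes f: "Cle 2 S f" and kl: "k \<noteq> l" and h: "h > 0"
    and box: "\<And>a b. a \<in> {c k..c k + h} \<Longrightarrow> b \<in> {c l..c l + h} \<Longrightarrow> c(k := a, l := b) \<in> S"
  shows "\<exists>a\<in>{c k..c k + h}. \<exists>b\<in>{c l..c l + h}.
     f (c(k := c k + h, l := c l + h)) - f (c(k := c k + h)) - f (c(l := c l + h)) + f c =
     h * h * pd l (pd k f) (c(k := a, l := b))"
proof -
  have f1: "Cle 1 S f" using f by (rule Cle_antimono) simp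
  have f2: "Cle 1 S (pd k f)" using f by (simp add: Cle_Suc numeral_2_eq_2)
  have dk: "((\<lambda>a. f (c(k := a, l := b))) has_real_derivative pd k f (c(k := a, l := b))) (at a)"
    if "a \<in> {c k..c k + h}" "b \<in> {c l..c l + h}" for a b
    using Cle_pd[of 0 S f "c(k := a, l := b)" k] f1 box[OF that] kl
    by (simp add: One_nat_def fun_upd_twist)
  have dl: "((\<lambda>b. pd k f (c(k := a, l := b))) has_real_derivative pd l (pd k f) (c(k := a, l := b))) (at b)"
    if "a \<in> {c k..c k + h}" "b \<in> {c l..c l + h}" for a b
    using Cle_pd[of 0 S "pd k f" "c(k := a, l := b)" l] f2 box[OF that] kl
    by simp
  obtain a where a: "c k < a" "a < c k + h"
    and eq: "(f (c(k := c k + h, l := c l + h)) - f (c(k := c k + h, l := c l))) -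
        (f (c(k := c k, l := c l + h)) - f (c(k := c k, l := c l))) =
        h * (pd k f (c(k := a, l := c l + h)) - pd k f (c(k := a, l := c l)))"
    using MVT2[of "c k" "c k + h" "\<lambda>a. f (c(k := a, l := c l + h)) - f (c(k := a, l := c l))"
        "\<lambda>a. pd k f (c(k := a, l := c l + h)) - pd k f (c(k := a, l := c l))"] h dk
    by (force intro: DERIV_diff)
  obtain b where b: "c l < b" "b < c l + h"
    and eq2: "pd k f (c(k := a, l := c l + h)) - pd k f (c(k := a, l := c l)) =
        h * pd l (pd k f) (c(k := a, l := b))"
    using MVT2[of "c l" "c l + h" "\<lambda>b. pd k f (c(k := a, l := b))"
        "\<lambda>b. pd l (pd k f) (c(k := a, l := b))"] h dl a by force
  have "f (c(k := c k + h, l := c l)) = f (c(k := c k + h))" "f (c(k := c k, l := c l + h)) = f (c(l := c l + h))"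
    using kl by (simp_all add: fun_upd_idem)
  then show ?thesis using eq eq2 a b by (intro bexI[of _ a] bexI[of _ b]) (auto simp: algebra_simps)
qed

text \<open>The second difference of \<open>f\<close> over a square in the directions
  \<open>k\<close> and \<open>l\<close> is symmetric in the two, and it is \<open>h * h\<close>
  times either mixed derivative at some point of the square. Continuity moves both points back to
  \<open>c\<close>.\<close>

lemma pd_commute:
  fixes f :: "('k \<Rightarrow> real) \<Rightarrow> real"
  assumes S: "open S" and f: "Cle 2 S f" and c: "c \<in> S"
  shows "pd k (pd l f) c = pd l (pd k f) c"
proof (cases "k = l")
  case False
  have "\<bar>pd k (pd l f) c - pd l (pd k f) c\<bar> < e" if e: "e > 0" for e
  proof -
    have near: "\<exists>U. open U \<and> c \<in> U \<and> (\<forall>x\<in>U. \<bar>pd i (pd j f) x - pd i (pd j f) c\<bar> < e / 2)" for i j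
      using continuous_on_nbhd[OF _ S c, of "pd i (pd j f)" "e / 2"] f e
      by (simp add: Cle_Suc numeral_2_eq_2 Cle_0)
    obtain U where U: "open U" "c \<in> U" "\<And>x. x \<in> U \<Longrightarrow> \<bar>pd l (pd k f) x - pd l (pd k f) c\<bar> < e / 2"
      using near[of l k] by blast
    obtain U' where U': "open U'" "c \<in> U'" "\<And>x. x \<in> U' \<Longrightarrow> \<bar>pd k (pd l f) x - pd k (pd l f) c\<bar> < e / 2"
      using near[of k l] by blast
    obtain d where d: "d > 0" "\<And>q. (\<forall>i\<in>{k, l}. \<bar>q i - c i\<bar> < d) \<Longrightarrow> (\<forall>i. i \<notin> {k, l} \<longrightarrow> q i = c i) \<Longrightarrow> q \<in> S \<inter> U \<inter> U'"
      using open_box[of "S \<inter> U \<inter> U'" c "{k, l}"] open_Int[OF open_Int[OF S U(1)] U'(1)] U(2) U'(2) c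
      by auto
    define h where "h = d / 2"
    have h: "h > 0" "h < d" using d(1) by (auto simp: h_def)
    have box: "c(k := a, l := b) \<in> S \<inter> U \<inter> U'" if "a \<in> {c k..c k + h}" "b \<in> {c l..c l + h}" for a b
      using that h by (intro d(2)) auto
    then have box': "c(l := b, k := a) \<in> S \<inter> U \<inter> U'" if "a \<in> {c k..c k + h}" "b \<in> {c l..c l + h}" for a b
      using that False by (simp add: fun_upd_twist)
    obtain a b where ab: "a\<in>{c k..c k + h}" "b\<in>{c l..c l + h}"
      "f (c(k := c k + h, l := c l + h)) - f (c(k := c k + h)) - f (c(l := c l + h)) + f c =
        h * h * pd l (pd k f) (c(k := a, l := b))"
      using double_difference[OF f False h(1), of c] box by blast
    obtain b' a' where ab': "b'\<in>{c l..c l + h}" "a'\<in>{c k..c k + h}"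
      "f (c(l := c l + h, k := c k + h)) - f (c(l := c l + h)) - f (c(k := c k + h)) + f c =
        h * h * pd k (pd l f) (c(l := b', k := a'))"
      using double_difference[OF f False[symmetric] h(1), of c] box' by blast
    have "h * h * pd l (pd k f) (c(k := a, l := b)) = h * h * pd k (pd l f) (c(l := b', k := a'))"
      using ab(3)[unfolded fun_upd_twist[OF False, of c "c k + h" "c l + h"]] ab'(3) by linarith
    then have "pd l (pd k f) (c(k := a, l := b)) = pd k (pd l f) (c(l := b', k := a'))"
      using h by (simp del: fun_upd_apply)
    moreover have "\<bar>pd l (pd k f) (c(k := a, l := b)) - pd l (pd k f) c\<bar> < e / 2"
      using U(3) box ab by blast
    moreover have "\<bar>pd k (pd l f) (c(l := b', k := a')) - pd k (pd l f) c\<bar> < e / 2"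
      using U'(3) box' ab' by blast
    ultimately show ?thesis by linarith
  qed
  then show ?thesis by (metis abs_le_zero_iff eq_iff_diff_eq_0 less_irrefl not_le)
qed simp

section \<open>Germs of smooth functions\<close>

text \<open>Substitutions that are coordinate changes in the strict sense: every new coordinate is
  either copied to one old coordinate or ignored.\<close>

lemma smooth_coords_subst:
  fixes m :: "('l \<Rightarrow> real) \<Rightarrow> ('k \<Rightarrow> real)" and q :: "'l \<Rightarrow> 'k option"
  assumes S: "open S" and S': "open S'" and m: "continuous_on S' m" "\<And>u. u \<in> S' \<Longrightarrow> m u \<in> S"
    and none: "\<And>l u h. q l = None \<Longrightarrow> m (u(l := h)) = m u"
    and some: "\<And>l k u h. q l = Some k \<Longrightarrow> m (u(l := h)) = (m u)(k := h) \<and> m u k = u l"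
    and f: "smooth_coords S f"
  shows "smooth_coords S' (\<lambda>u. f (m u))"
proof -
  have "Cle r S' (\<lambda>u. f (m u))" if "smooth_coords S f" for r f using that
  proof (induction r arbitrary: f)
    case 0
    then show ?case
      unfolding Cle_0
      using continuous_on_compose2[OF Cle_imp_continuous_on[OF smooth_coords_Cle_D[OF 0]] m(1)] m(2) by blast
  next
    case (Suc r)
    define g where "g l u = (case q l of None \<Rightarrow> 0 | Some k \<Rightarrow> pd k f (m u))" for l u
    show ?case
    proof (rule Cle_Suc_intro[where g=g, OF S'])
      show "continuous_on S' (\<lambda>u. f (m u))"
        by (rule continuous_on_compose2[OF Cle_imp_continuous_on[OF smooth_coords_Cle_D[OF Suc.prems]] m(1)])
           (use m in auto)
      fix l
      show "Cle r S' (g l)"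
        using Suc.IH[OF smooth_coords_pd[OF Suc.prems]] Cle_const[OF S', of r 0]
        by (cases "q l") (simp_all add: g_def[abs_def])
      fix u assume u: "u \<in> S'"
      show "((\<lambda>h. f (m (u(l := h)))) has_real_derivative g l u) (at (u l))"
      proof (cases "q l")
        case None
        then show ?thesis by (simp only: none[OF None] g_def option.case DERIV_const)
      next
        case (Some k)
        have "((\<lambda>h. f ((m u)(k := h))) has_real_derivative pd k f (m u)) (at (m u k))"
          by (rule Cle_pd[OF smooth_coords_Cle_D[OF Suc.prems] m(2)[OF u]])
        moreover have "m u k = u l" "\<And>h. m (u(l := h)) = (m u)(k := h)" using some[OF Some] by auto
        ultimately show ?thesis by (simp only: Some g_def option.case)
      qed
    qed
  qed
  then show ?thesis using f by (simp add: smooth_coords_Cle)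
qed

definition smooth_near0 :: "(('k \<Rightarrow> real) \<Rightarrow> real) \<Rightarrow> bool" where
  "smooth_near0 f \<longleftrightarrow> (\<exists>S. open S \<and> (\<lambda>_. 0) \<in> S \<and> smooth_coords S f)"

definition eq_near0 :: "(('k \<Rightarrow> real) \<Rightarrow> real) \<Rightarrow> (('k \<Rightarrow> real) \<Rightarrow> real) \<Rightarrow> bool" where
  "eq_near0 f g \<longleftrightarrow> (\<exists>S. open S \<and> (\<lambda>_. 0) \<in> S \<and> (\<forall>c\<in>S. f c = g c))"

definition germ_rel :: "(('k \<Rightarrow> real) \<Rightarrow> real) \<Rightarrow> (('k \<Rightarrow> real) \<Rightarrow> real) \<Rightarrow> bool" where
  "germ_rel f g \<longleftrightarrow> smooth_near0 f \<and> smooth_near0 g \<and> eq_near0 f g"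

lemma smooth_coords_subset: "smooth_coords S f \<Longrightarrow> S' \<subseteq> S \<Longrightarrow> smooth_coords S' f"
  by (metis Cle_subset smooth_coords_Cle)

lemma smooth_coords_const: "open S \<Longrightarrow> smooth_coords S (\<lambda>c. a)"
  by (simp add: smooth_coords_Cle Cle_const)

lemma smooth_coords_proj: "open S \<Longrightarrow> smooth_coords S (\<lambda>c. c l)"
  by (simp add: smooth_coords_Cle Cle_proj)

lemma smooth_coords_add: "open S \<Longrightarrow> smooth_coords S f \<Longrightarrow> smooth_coords S g \<Longrightarrow> smooth_coords S (\<lambda>c. f c + g c)"
  by (simp add: smooth_coords_Cle Cle_add)

lemma smooth_coords_mult: "open S \<Longrightarrow> smooth_coords S f \<Longrightarrow> smooth_coords S g \<Longrightarrow> smooth_coords S (\<lambda>c. f c * g c)"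
  by (simp add: smooth_coords_Cle Cle_mult)

lemma smooth_coords_sum: "open S \<Longrightarrow> (\<And>i. i \<in> I \<Longrightarrow> smooth_coords S (f i)) \<Longrightarrow> smooth_coords S (\<lambda>c. \<Sum>i\<in>I. f i c)"
  by (simp add: smooth_coords_Cle Cle_sum)

lemma smooth_coords_prod: "open S \<Longrightarrow> (\<And>i. i \<in> I \<Longrightarrow> smooth_coords S (f i)) \<Longrightarrow> smooth_coords S (\<lambda>c. \<Prod>i\<in>I. f i c)"
  by (simp add: smooth_coords_Cle Cle_prod)

lemma smooth_coords_inverse:
  "open S \<Longrightarrow> smooth_coords S f \<Longrightarrow> (\<And>c. c \<in> S \<Longrightarrow> f c \<noteq> 0) \<Longrightarrow> smooth_coords S (\<lambda>c. inverse (f c))"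
  by (simp add: smooth_coords_Cle Cle_inverse)

lemma smooth_coords_cong:
  "open S \<Longrightarrow> smooth_coords S f \<Longrightarrow> (\<And>c. c \<in> S \<Longrightarrow> f c = g c) \<Longrightarrow> smooth_coords S g"
  unfolding smooth_coords_Cle using Cle_cong by metis

lemma eq_near0I: "open S \<Longrightarrow> (\<lambda>_. 0) \<in> S \<Longrightarrow> (\<And>c. c \<in> S \<Longrightarrow> f c = g c) \<Longrightarrow> eq_near0 f g"
  by (simp only: eq_near0_def) (intro exI[of _ S] conjI ballI)

lemma eq_near0E:
  assumes "eq_near0 f g"
  obtains S where "open S" "(\<lambda>_. 0) \<in> S" "\<forall>c\<in>S. f c = g c"
  using assms unfolding eq_near0_def by (elim exE conjE)

lemma smooth_near0E:
  assumes "smooth_near0 f"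
  obtains S where "open S" "(\<lambda>_. 0) \<in> S" "smooth_coords S f"
  using assms unfolding smooth_near0_def by (elim exE conjE)

lemma eq_near0_refl: "eq_near0 f f"
  by (rule eq_near0I[of UNIV]) auto

lemma eq_near0_sym: "eq_near0 f g \<Longrightarrow> eq_near0 g f"
proof (elim eq_near0E)
  fix S assume "open S" "(\<lambda>_. 0) \<in> S" "\<forall>c\<in>S. f c = g c"
  then show "eq_near0 g f" by (intro eq_near0I[of S]) metis+
qed

lemma eq_near0_trans:
  assumes "eq_near0 f g" "eq_near0 g h"
  shows "eq_near0 f h"
proof -
  obtain S where S: "open S" "(\<lambda>_. 0) \<in> S" "\<forall>c\<in>S. f c = g c" using assms(1) by (rule eq_near0E)
  obtain S' where S': "open S'" "(\<lambda>_. 0) \<in> S'" "\<forall>c\<in>S'. g c = h c" using assms(2) by (rule eq_near0E)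
  show ?thesis
    by (rule eq_near0I[of "S \<inter> S'"]) (use S S' in auto)
qed

lemma germ_rel_refl: "germ_rel f f \<longleftrightarrow> smooth_near0 f"
  by (simp add: germ_rel_def eq_near0_refl)

lemma smooth_near0I: "open S \<Longrightarrow> (\<lambda>_. 0) \<in> S \<Longrightarrow> smooth_coords S f \<Longrightarrow> smooth_near0 f"
  unfolding smooth_near0_def by blast

lemma smooth_near0_common:
  assumes "smooth_near0 f" "smooth_near0 g"
  obtains S where "open S" "(\<lambda>_. 0) \<in> S" "smooth_coords S f" "smooth_coords S g"
proof -
  obtain S where S: "open S" "(\<lambda>_. 0) \<in> S" "smooth_coords S f" using assms(1) by (rule smooth_near0E)
  obtain S' where S': "open S'" "(\<lambda>_. 0) \<in> S'" "smooth_coords S' g" using assms(2) by (rule smooth_near0E)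
  show thesis
    by (rule that[of "S \<inter> S'"]) (use S S' in \<open>auto intro: smooth_coords_subset\<close>)
qed

lemma smooth_near0_const: "smooth_near0 (\<lambda>c. a)"
  by (rule smooth_near0I[of UNIV]) (auto intro: smooth_coords_const)

lemma smooth_near0_proj: "smooth_near0 (\<lambda>c. c l)"
  by (rule smooth_near0I[of UNIV]) (auto intro: smooth_coords_proj)

lemma smooth_near0_add:
  assumes "smooth_near0 f" "smooth_near0 g"
  shows "smooth_near0 (\<lambda>c. f c + g c)"
proof -
  obtain S where "open S" "(\<lambda>_. 0) \<in> S" "smooth_coords S f" "smooth_coords S g"
    by (rule smooth_near0_common[OF assms])
  then show ?thesis by (intro smooth_near0I smooth_coords_add)
qed

lemma smooth_near0_mult:
  assumes "smooth_near0 f" "smooth_near0 g"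
  shows "smooth_near0 (\<lambda>c. f c * g c)"
proof -
  obtain S where "open S" "(\<lambda>_. 0) \<in> S" "smooth_coords S f" "smooth_coords S g"
    by (rule smooth_near0_common[OF assms])
  then show ?thesis by (intro smooth_near0I smooth_coords_mult)
qed

lemma smooth_near0_sum: "(\<And>i. i \<in> I \<Longrightarrow> smooth_near0 (f i)) \<Longrightarrow> smooth_near0 (\<lambda>c. \<Sum>i\<in>I. f i c)"
proof (induction I rule: infinite_finite_induct)
  case (insert x F)
  then show ?case using smooth_near0_add[of "f x" "\<lambda>c. \<Sum>i\<in>F. f i c"] by simp
qed (simp_all add: smooth_near0_const)

lemma smooth_near0_pd: "smooth_near0 f \<Longrightarrow> smooth_near0 (pd k f)"
  by (elim smooth_near0E) (rule smooth_near0I, assumption+, rule smooth_coords_pd)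

lemma eq_near0_pd: "eq_near0 f g \<Longrightarrow> eq_near0 (pd k f) (pd k g)"
proof (elim eq_near0E)
  fix S assume S: "open S" "(\<lambda>_. 0) \<in> S" "\<forall>c\<in>S. f c = g c"
  have "pd k f c = pd k g c" if "c \<in> S" for c
    by (rule pd_cong[OF S(1) that]) (rule bspec[OF S(3)])
  then show "eq_near0 (pd k f) (pd k g)" by (intro eq_near0I[OF S(1,2)])
qed

lemma eq_near0_op2:
  assumes "eq_near0 f f'" "eq_near0 g g'"
  shows "eq_near0 (\<lambda>c. h (f c) (g c)) (\<lambda>c. h (f' c) (g' c))"
proof -
  obtain S where S: "open S" "(\<lambda>_. 0) \<in> S" "\<forall>c\<in>S. f c = f' c" using assms(1) by (rule eq_near0E)
  obtain S' where S': "open S'" "(\<lambda>_. 0) \<in> S'" "\<forall>c\<in>S'. g c = g' c" using assms(2) by (rule eq_near0E)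
  show ?thesis
    by (rule eq_near0I[of "S \<inter> S'"]) (use S S' in auto)
qed

lemma eq_near0_0: "eq_near0 f g \<Longrightarrow> f (\<lambda>_. 0) = g (\<lambda>_. 0)"
  by (elim eq_near0E) simp

\<comment> \<open>The ring of germs at the origin, its derivations and evaluation\<close>
quotient_type 'k germ = "('k \<Rightarrow> real) \<Rightarrow> real" / partial: germ_rel
proof (rule part_equivpI)
  show "\<exists>f::('k \<Rightarrow> real) \<Rightarrow> real. germ_rel f f"
    using smooth_near0_const by (intro exI[of _ "\<lambda>_. 0"]) (simp add: germ_rel_refl)
  show "symp (germ_rel :: (('k \<Rightarrow> real) \<Rightarrow> real) \<Rightarrow> _)"
    by (rule sympI) (simp add: germ_rel_def eq_near0_sym)
  show "transp (germ_rel :: (('k \<Rightarrow> real) \<Rightarrow> real) \<Rightarrow> _)"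
    by (rule transpI) (metis germ_rel_def eq_near0_trans)
qed

instantiation germ :: (type) "{comm_ring_1, real_algebra_1}"
begin

lift_definition zero_germ :: "'a germ" is "\<lambda>_. 0"
  by (simp add: germ_rel_refl smooth_near0_const)

lift_definition one_germ :: "'a germ" is "\<lambda>_. 1"
  by (simp add: germ_rel_refl smooth_near0_const)

lift_definition plus_germ :: "'a germ \<Rightarrow> 'a germ \<Rightarrow> 'a germ" is "\<lambda>f g c. f c + g c"
  unfolding germ_rel_def
  by (elim conjE) (intro conjI smooth_near0_add eq_near0_op2[of _ _ _ _ "(+)"], assumption+)

lift_definition times_germ :: "'a germ \<Rightarrow> 'a germ \<Rightarrow> 'a germ" is "\<lambda>f g c. f c * g c"
  unfolding germ_rel_def
  by (elim conjE) (intro conjI smooth_near0_mult eq_near0_op2[of _ _ _ _ "(*)"], assumption+)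

lift_definition scaleR_germ :: "real \<Rightarrow> 'a germ \<Rightarrow> 'a germ" is "\<lambda>a f c. a * f c"
  unfolding germ_rel_def
  by (elim conjE) (intro conjI smooth_near0_mult smooth_near0_const eq_near0_op2[of "\<lambda>_. _" "\<lambda>_. _" _ _ "(*)"] eq_near0_refl)

lift_definition uminus_germ :: "'a germ \<Rightarrow> 'a germ" is "\<lambda>f c. (-1) * f c"
  unfolding germ_rel_def
  by (elim conjE) (intro conjI smooth_near0_mult smooth_near0_const eq_near0_op2[of "\<lambda>_. _" "\<lambda>_. _" _ _ "(*)"] eq_near0_refl)

definition minus_germ :: "'a germ \<Rightarrow> 'a germ \<Rightarrow> 'a germ" where
  "minus_germ f g = f + - g"

instance
proof
  fix a b c :: "'a germ" and r s :: real
  show "a + b + c = a + (b + c)" by transfer (simp add: germ_rel_def smooth_near0_add eq_near0_refl ac_simps)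
  show "a + b = b + a" by transfer (simp add: germ_rel_def smooth_near0_add eq_near0_refl ac_simps)
  show "0 + a = a" by transfer (simp add: germ_rel_def)
  show "- a + a = 0" by transfer (simp add: germ_rel_def smooth_near0_const eq_near0_refl)
  show "a - b = a + - b" by (simp add: minus_germ_def)
  show "a * b * c = a * (b * c)" by transfer (simp add: germ_rel_def smooth_near0_mult eq_near0_refl ac_simps)
  show "a * b = b * a" by transfer (simp add: germ_rel_def smooth_near0_mult eq_near0_refl ac_simps)
  show "1 * a = a" by transfer (simp add: germ_rel_def)
  show "a * 1 = a" by transfer (simp add: germ_rel_def)
  show "a * (b + c) = a * b + a * c"
    by transfer (simp add: germ_rel_def smooth_near0_mult smooth_near0_add eq_near0_refl distrib_left)
  show "(a + b) * c = a * c + b * c"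
    by transfer (simp add: germ_rel_def smooth_near0_mult smooth_near0_add eq_near0_refl distrib_right)
  show "(0 :: 'a germ) \<noteq> 1"
    by transfer (use eq_near0_0[of "\<lambda>_. 0" "\<lambda>_. 1"] in \<open>auto simp: germ_rel_def\<close>)
  show "r *\<^sub>R (a + b) = r *\<^sub>R a + r *\<^sub>R b"
    by transfer (simp add: germ_rel_def smooth_near0_mult smooth_near0_const smooth_near0_add eq_near0_refl distrib_left)
  show "(r + s) *\<^sub>R a = r *\<^sub>R a + s *\<^sub>R a"
    by transfer (simp add: germ_rel_def smooth_near0_mult smooth_near0_const smooth_near0_add eq_near0_refl distrib_right)
  show "r *\<^sub>R s *\<^sub>R a = (r * s) *\<^sub>R a"
    by transfer (simp add: germ_rel_def smooth_near0_mult smooth_near0_const eq_near0_refl mult.assoc)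
  show "1 *\<^sub>R a = a" by transfer (simp add: germ_rel_def)
  show "r *\<^sub>R a * b = r *\<^sub>R (a * b)"
    by transfer (simp add: germ_rel_def smooth_near0_mult smooth_near0_const eq_near0_refl mult.assoc)
  show "a * r *\<^sub>R b = r *\<^sub>R (a * b)"
    by transfer (simp add: germ_rel_def smooth_near0_mult smooth_near0_const eq_near0_refl ac_simps)
qed

end

lift_definition pder :: "'k \<Rightarrow> 'k germ \<Rightarrow> 'k germ" is pd
  by (simp add: germ_rel_def smooth_near0_pd eq_near0_pd)

lift_definition ev :: "'k germ \<Rightarrow> real" is "\<lambda>f. f (\<lambda>_. 0)"
  by (simp add: germ_rel_def eq_near0_0)

lift_definition gvar :: "'k \<Rightarrow> 'k germ" is "\<lambda>k c. c k"
  by (simp add: germ_rel_refl smooth_near0_proj)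

lemma abs_germ_eqI:
  "smooth_near0 f \<Longrightarrow> smooth_near0 g \<Longrightarrow> eq_near0 f g \<Longrightarrow> abs_germ f = abs_germ g"
  by (rule Quotient_rel_abs[OF Quotient_germ]) (simp add: germ_rel_def)

lemma smooth_near0_rep: "smooth_near0 (rep_germ a)"
  using Quotient_rep_reflp[OF Quotient_germ, of a] by (simp add: germ_rel_refl)

lemma abs_rep_germ: "abs_germ (rep_germ a) = a"
  by (rule Quotient_abs_rep[OF Quotient_germ])

lemma abs_germ_cases: obtains f where "a = abs_germ f" "smooth_near0 f"
  using that[of "rep_germ a"] abs_rep_germ[of a] smooth_near0_rep[of a] by simp

lemma rep_abs_near0: "smooth_near0 f \<Longrightarrow> eq_near0 (rep_germ (abs_germ f)) f"
  using Quotient_rep_abs[OF Quotient_germ, of f, unfolded germ_rel_refl] by (simp add: germ_rel_def)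

lemmas abs_eqs = plus_germ.abs_eq times_germ.abs_eq scaleR_germ.abs_eq pder.abs_eq ev.abs_eq

lemma pder_add: "pder k (a + b) = pder k a + pder k b"
proof -
  obtain f where f: "a = abs_germ f" "smooth_near0 f" by (rule abs_germ_cases)
  obtain g where g: "b = abs_germ g" "smooth_near0 g" by (rule abs_germ_cases)
  obtain S where S: "open S" "(\<lambda>_. 0) \<in> S" "smooth_coords S f" "smooth_coords S g"
    by (rule smooth_near0_common[OF f(2) g(2)])
  have "pd k (\<lambda>c. f c + g c) c = pd k f c + pd k g c" if "c \<in> S" for c
    by (rule pdI, rule DERIV_add; rule Cle_pd[OF smooth_coords_Cle_D that]) (rule S)+
  then have "eq_near0 (pd k (\<lambda>c. f c + g c)) (\<lambda>c. pd k f c + pd k g c)"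
    by (intro eq_near0I[OF S(1,2)])
  then show ?thesis unfolding f g
    using f g by (simp add: abs_eqs germ_rel_refl smooth_near0_add smooth_near0_pd abs_germ_eqI)
qed

lemma pder_mult: "pder k (a * b) = pder k a * b + a * pder k b"
proof -
  obtain f where f: "a = abs_germ f" "smooth_near0 f" by (rule abs_germ_cases)
  obtain g where g: "b = abs_germ g" "smooth_near0 g" by (rule abs_germ_cases)
  obtain S where S: "open S" "(\<lambda>_. 0) \<in> S" "smooth_coords S f" "smooth_coords S g"
    by (rule smooth_near0_common[OF f(2) g(2)])
  have "pd k (\<lambda>c. f c * g c) c = pd k f c * g c + f c * pd k g c" if c: "c \<in> S" for c
  proof -
    have "pd k (\<lambda>c. f c * g c) c = pd k f c * g (c(k := c k)) + pd k g c * f (c(k := c k))"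
      by (rule pdI, rule DERIV_mult; rule Cle_pd[OF smooth_coords_Cle_D c]) (rule S)+
    then show ?thesis by simp
  qed
  then have "eq_near0 (pd k (\<lambda>c. f c * g c)) (\<lambda>c. pd k f c * g c + f c * pd k g c)"
    by (intro eq_near0I[OF S(1,2)])
  then show ?thesis unfolding f g
    using f g by (simp add: abs_eqs germ_rel_refl smooth_near0_add smooth_near0_mult smooth_near0_pd abs_germ_eqI)
qed

lemma pder_scaleR: "pder k (r *\<^sub>R a) = r *\<^sub>R pder k a"
proof -
  obtain f where f: "a = abs_germ f" "smooth_near0 f" by (rule abs_germ_cases)
  obtain S where S: "open S" "(\<lambda>_. 0) \<in> S" "smooth_coords S f" by (rule smooth_near0E[OF f(2)])
  have "pd k (\<lambda>c. r * f c) c = r * pd k f c" if "c \<in> S" for c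
    by (rule pdI, rule DERIV_cmult, rule Cle_pd[OF smooth_coords_Cle_D that]) (rule S)
  then have "eq_near0 (pd k (\<lambda>c. r * f c)) (\<lambda>c. r * pd k f c)"
    by (intro eq_near0I[OF S(1,2)])
  then show ?thesis unfolding f
    using f by (simp add: abs_eqs germ_rel_refl smooth_near0_mult smooth_near0_const smooth_near0_pd abs_germ_eqI)
qed

lemma pder_commute: "pder k (pder l a) = pder l (pder k a)"
proof -
  obtain f where f: "a = abs_germ f" "smooth_near0 f" by (rule abs_germ_cases)
  obtain S where S: "open S" "(\<lambda>_. 0) \<in> S" "smooth_coords S f" by (rule smooth_near0E[OF f(2)])
  have "eq_near0 (pd k (pd l f)) (pd l (pd k f))"
    by (intro eq_near0I[OF S(1,2)] pd_commute[OF S(1) smooth_coords_Cle_D[OF S(3)]])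
  then show ?thesis unfolding f
    using f by (simp add: abs_eqs germ_rel_refl smooth_near0_pd abs_germ_eqI)
qed

lemma pder_gvar: "pder k (gvar l) = (if k = l then 1 else 0)"
proof -
  have "pd k (\<lambda>c::'a \<Rightarrow> real. c l) = (\<lambda>c. if k = l then 1 else 0)"
    by (rule ext) (rule pdI[OF has_pd_proj])
  then show ?thesis
    using pder.abs_eq[of "\<lambda>c. c l" k]
    by (cases "k = l") (simp_all add: gvar_def one_germ_def zero_germ_def germ_rel_refl smooth_near0_proj)
qed

lemma ev_add [simp]: "ev (a + b) = ev a + ev b"
  by transfer simp

lemma ev_mult [simp]: "ev (a * b) = ev a * ev b"
  by transfer simp

lemma ev_scaleR [simp]: "ev (r *\<^sub>R a) = r * ev a"
  by transfer simp

lemma ev_uminus [simp]: "ev (- a) = - ev a"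
  by transfer simp

lemma ev_diff [simp]: "ev (a - b) = ev a - ev b"
  using ev_add[of a "- b"] by simp

lemma ev_0 [simp]: "ev 0 = 0" and ev_1 [simp]: "ev 1 = 1" and ev_gvar [simp]: "ev (gvar k) = 0"
  by (transfer, simp)+

lemma ev_sum [simp]: "ev (\<Sum>i\<in>I. f i) = (\<Sum>i\<in>I. ev (f i))"
  by (induction I rule: infinite_finite_induct) auto

lemma ev_prod [simp]: "ev (\<Prod>i\<in>I. f i) = (\<Prod>i\<in>I. ev (f i))"
  by (induction I rule: infinite_finite_induct) auto

lemma abs_germ_sum:
  assumes "\<And>i. i \<in> I \<Longrightarrow> smooth_near0 (f i)"
  shows "(\<Sum>i\<in>I. abs_germ (f i)) = abs_germ (\<lambda>c. \<Sum>i\<in>I. f i c)"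
  using assms
proof (induction I rule: infinite_finite_induct)
  case (insert x F)
  then show ?case by (simp add: plus_germ.abs_eq germ_rel_refl smooth_near0_sum)
qed (simp_all add: zero_germ_def)

subsection \<open>Composition with functions of finitely many coordinates\<close>

definition region :: "'k set \<Rightarrow> ('k \<Rightarrow> real) set \<Rightarrow> bool" where
  "region K S \<longleftrightarrow> finite K \<and> open S \<and> saturated K S"

definition smooth_fn :: "'k set \<Rightarrow> ('k \<Rightarrow> real) set \<Rightarrow> (('k \<Rightarrow> real) \<Rightarrow> real) \<Rightarrow> bool" where
  "smooth_fn K S f \<longleftrightarrow> depends_on K S f \<and> smooth_coords S f"

text \<open>Substitution of germs into a function. Representatives are picked for all
  \<open>k\<close>, possibly infinitely many and without a common neighbourhood of 0; for
  \<open>f\<close> smooth around the values of the germs, the result is determined by the finitely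
  many \<open>k\<close> on which \<open>f\<close> depends.\<close>

definition gcomp :: "(('k \<Rightarrow> real) \<Rightarrow> real) \<Rightarrow> ('k \<Rightarrow> 'l germ) \<Rightarrow> 'l germ" where
  "gcomp f j = abs_germ (\<lambda>u. f (\<lambda>k. rep_germ (j k) u))"

lemma smooth_fn_mono: "smooth_fn K S f \<Longrightarrow> K \<subseteq> K' \<Longrightarrow> smooth_fn K' S f"
  by (auto simp: smooth_fn_def intro: depends_on_mono)

lemma smooth_fn_pd: "region K S \<Longrightarrow> smooth_fn K S f \<Longrightarrow> smooth_fn K S (pd k f)"
  by (simp add: region_def smooth_fn_def depends_on_pd smooth_coords_pd)

lemma smooth_near0_inter:
  assumes "finite K" "\<And>k. k \<in> K \<Longrightarrow> smooth_near0 (F k)"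
  shows "\<exists>S. open S \<and> (\<lambda>_. 0) \<in> S \<and> (\<forall>k\<in>K. smooth_coords S (F k))"
proof -
  have "\<forall>k\<in>K. \<exists>S. open S \<and> (\<lambda>_. 0) \<in> S \<and> smooth_coords S (F k)"
    using assms(2) by (simp add: smooth_near0_def)
  then obtain S where S: "\<And>k. k \<in> K \<Longrightarrow> open (S k) \<and> (\<lambda>_. 0) \<in> S k \<and> smooth_coords (S k) (F k)"
    by metis
  show ?thesis
    by (rule exI[of _ "\<Inter>k\<in>K. S k"]) (use S assms(1) in \<open>auto intro: smooth_coords_subset\<close>)
qed

text \<open>Finitely many members of the family share a neighbourhood of 0. Freezing the others
  gives a continuous map \<open>G\<close>, so the preimage of \<Omega> under \<open>G\<close> is
  open; saturation then replaces \<open>G\<close> by \<open>F\<close>.\<close>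

lemma family_near0:
  assumes \<Omega>: "region K \<Omega>" and F: "\<And>k. k \<in> K \<Longrightarrow> smooth_near0 (F k)" and 0: "(\<lambda>k. F k (\<lambda>_. 0)) \<in> \<Omega>"
  obtains S where "open S" "(\<lambda>_. 0) \<in> S" "\<forall>u\<in>S. (\<lambda>k. F k u) \<in> \<Omega>"
    "\<forall>k\<in>K. smooth_coords S (F k)"
proof -
  obtain S where S: "open S" "(\<lambda>_. 0) \<in> S" "\<And>k. k \<in> K \<Longrightarrow> smooth_coords S (F k)"
    using smooth_near0_inter[of K F] F \<Omega> by (auto simp: region_def)
  define G where "G u k = (if k \<in> K then F k u else F k (\<lambda>_. 0))" for u k
  have "continuous_on S G"
  proof (rule continuous_on_coordinatewise_then_product)
    fix k show "continuous_on S (\<lambda>u. G u k)"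
      using S(3)[of k] by (cases "k \<in> K") (auto simp: G_def dest: smooth_coords_Cle_D[of _ _ 0] Cle_imp_continuous_on)
  qed
  then have "open (G -` \<Omega> \<inter> S)"
    using \<Omega> S(1) by (simp add: region_def continuous_on_open_vimage)
  moreover have "G (\<lambda>_. 0) = (\<lambda>k. F k (\<lambda>_. 0))" by (auto simp: G_def)
  moreover have "(\<lambda>k. F k u) \<in> \<Omega>" if "G u \<in> \<Omega>" for u
    by (rule saturatedD[of K \<Omega> "G u"]) (use \<Omega> that in \<open>auto simp: region_def G_def\<close>)
  ultimately show thesis
    using that[of "G -` \<Omega> \<inter> S"] S 0 smooth_coords_subset[OF S(3)] by auto
qed

lemma smooth_near0_comp:
  assumes \<Omega>: "region K \<Omega>" and F: "\<And>k. k \<in> K \<Longrightarrow> smooth_near0 (F k)" and 0: "(\<lambda>k. F k (\<lambda>_. 0)) \<in> \<Omega>"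
    and f: "smooth_fn K \<Omega> f"
  shows "smooth_near0 (\<lambda>u. f (\<lambda>k. F k u))"
proof -
  obtain S where S: "open S" "(\<lambda>_. 0) \<in> S" "\<forall>u\<in>S. (\<lambda>k. F k u) \<in> \<Omega>"
    "\<forall>k\<in>K. smooth_coords S (F k)"
    by (rule family_near0[OF \<Omega> F 0])
  have "Cle r S (\<lambda>u. f (\<lambda>k. F k u))" for r
    by (rule Cle_comp[of \<Omega> K f S r F])
       (use \<Omega> f S in \<open>auto simp: region_def smooth_fn_def smooth_coords_Cle\<close>)
  then show ?thesis using S by (intro smooth_near0I[of S]) (auto simp: smooth_coords_Cle)
qed

lemma rep_germ_0: "rep_germ a (\<lambda>_. 0) = ev a"
  using ev.abs_eq[of "rep_germ a"] by (simp add: abs_rep_germ germ_rel_refl smooth_near0_rep)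

context
  fixes K :: "'k set" and \<Omega> and j :: "'k \<Rightarrow> 'l germ"
  assumes \<Omega>: "region K \<Omega>" and j: "(\<lambda>k. ev (j k)) \<in> \<Omega>"
begin

lemma smooth_near0_gcomp: "smooth_fn K \<Omega> f \<Longrightarrow> smooth_near0 (\<lambda>u. f (\<lambda>k. rep_germ (j k) u))"
  by (rule smooth_near0_comp[OF \<Omega> smooth_near0_rep]) (simp_all add: rep_germ_0 j)

lemma gcomp_near0:
  obtains S where "open S" "(\<lambda>_. 0) \<in> S" "\<forall>u\<in>S. (\<lambda>k. rep_germ (j k) u) \<in> \<Omega>"
    "\<forall>k\<in>K. smooth_coords S (rep_germ (j k))"
  by (rule family_near0[OF \<Omega>, of "\<lambda>k. rep_germ (j k)"]) (simp_all add: smooth_near0_rep j rep_germ_0)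

lemma gcomp_add:
  "smooth_fn K \<Omega> f \<Longrightarrow> smooth_fn K \<Omega> g \<Longrightarrow> gcomp (\<lambda>c. f c + g c) j = gcomp f j + gcomp g j"
  using smooth_near0_gcomp[of f] smooth_near0_gcomp[of g]
  by (simp add: gcomp_def plus_germ.abs_eq germ_rel_refl)

lemma gcomp_mult:
  "smooth_fn K \<Omega> f \<Longrightarrow> smooth_fn K \<Omega> g \<Longrightarrow> gcomp (\<lambda>c. f c * g c) j = gcomp f j * gcomp g j"
  using smooth_near0_gcomp[of f] smooth_near0_gcomp[of g]
  by (simp add: gcomp_def times_germ.abs_eq germ_rel_refl)

lemma ev_gcomp: "smooth_fn K \<Omega> f \<Longrightarrow> ev (gcomp f j) = f (\<lambda>k. ev (j k))"
  using smooth_near0_gcomp[of f] by (simp add: gcomp_def ev.abs_eq germ_rel_refl rep_germ_0)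

lemma gcomp_cong:
  assumes "smooth_fn K \<Omega> f" "smooth_fn K \<Omega> g" "\<And>c. c \<in> \<Omega> \<Longrightarrow> f c = g c"
  shows "gcomp f j = gcomp g j"
proof -
  obtain S where S: "open S" "(\<lambda>_. 0) \<in> S" "\<forall>u\<in>S. (\<lambda>k. rep_germ (j k) u) \<in> \<Omega>"
    by (rule gcomp_near0)
  have "eq_near0 (\<lambda>u. f (\<lambda>k. rep_germ (j k) u)) (\<lambda>u. g (\<lambda>k. rep_germ (j k) u))"
    by (intro eq_near0I[OF S(1,2)] assms(3)) (use S(3) in blast)
  then show ?thesis unfolding gcomp_def
    using smooth_near0_gcomp[OF assms(1)] smooth_near0_gcomp[OF assms(2)] by (intro abs_germ_eqI)
qed

lemma pder_gcomp:
  assumes f: "smooth_fn K \<Omega> f"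
  shows "pder l (gcomp f j) = (\<Sum>k\<in>K. gcomp (pd k f) j * pder l (j k))"
proof -
  obtain S where S: "open S" "(\<lambda>_. 0) \<in> S" "\<forall>u\<in>S. (\<lambda>k. rep_germ (j k) u) \<in> \<Omega>"
    "\<forall>k\<in>K. smooth_coords S (rep_germ (j k))"
    by (rule gcomp_near0)
  let ?F = "\<lambda>u. f (\<lambda>k. rep_germ (j k) u)"
  let ?G = "\<lambda>u. \<Sum>k\<in>K. pd k f (\<lambda>k. rep_germ (j k) u) * pd l (rep_germ (j k)) u"
  have "pd l ?F u = ?G u" if "u \<in> S" for u
    by (rule pdI, rule has_pd_comp[where F="\<lambda>k. rep_germ (j k)" and \<Omega>=\<Omega> and S=S])
       (use \<Omega> f S that in \<open>auto simp: region_def smooth_fn_def smooth_coords_Cle\<close>)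
  then have eq: "eq_near0 (pd l ?F) ?G" by (intro eq_near0I[OF S(1,2)])
  have sm: "smooth_near0 (\<lambda>u. pd k f (\<lambda>k. rep_germ (j k) u))" for k
    by (rule smooth_near0_gcomp[OF smooth_fn_pd[OF \<Omega> f]])
  have "pder l (gcomp f j) = abs_germ (pd l ?F)"
    unfolding gcomp_def by (rule pder.abs_eq) (simp add: germ_rel_refl smooth_near0_gcomp f)
  also have "\<dots> = abs_germ ?G"
    by (intro abs_germ_eqI eq smooth_near0_pd smooth_near0_gcomp f smooth_near0_sum smooth_near0_mult sm smooth_near0_rep)
  also have "\<dots> = (\<Sum>k\<in>K. abs_germ (\<lambda>u. pd k f (\<lambda>k. rep_germ (j k) u) * pd l (rep_germ (j k)) u))"
    by (intro abs_germ_sum[symmetric] smooth_near0_mult sm smooth_near0_pd smooth_near0_rep)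
  also have "\<dots> = (\<Sum>k\<in>K. gcomp (pd k f) j * pder l (j k))"
  proof (rule sum.cong[OF refl])
    fix k
    have "pder l (j k) = abs_germ (pd l (rep_germ (j k)))"
      using pder.abs_eq[of "rep_germ (j k)" l] by (simp add: abs_rep_germ germ_rel_refl smooth_near0_rep)
    then show "abs_germ (\<lambda>u. pd k f (\<lambda>k. rep_germ (j k) u) * pd l (rep_germ (j k)) u) =
        gcomp (pd k f) j * pder l (j k)"
      using sm by (simp add: gcomp_def times_germ.abs_eq germ_rel_refl smooth_near0_pd smooth_near0_rep)
  qed
  finally show ?thesis .
qed

text \<open>Independence of representatives: on a common neighbourhood the members with index in
  \<open>K\<close> coincide, and the remaining ones may differ arbitrarily.\<close>

lemma gcomp_cong_family:
  assumes f: "smooth_fn K \<Omega> f" and eq: "\<And>k. k \<in> K \<Longrightarrow> eq_near0 (rep_germ (j k)) (F k)"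
    and F: "\<And>k. k \<in> K \<Longrightarrow> smooth_near0 (F k)" and 0: "(\<lambda>k. F k (\<lambda>_. 0)) \<in> \<Omega>"
  shows "gcomp f j = abs_germ (\<lambda>u. f (\<lambda>k. F k u))"
proof -
  obtain S where S: "open S" "(\<lambda>_. 0) \<in> S" "\<forall>u\<in>S. (\<lambda>k. rep_germ (j k) u) \<in> \<Omega>"
    by (rule gcomp_near0)
  obtain S' where S': "open S'" "(\<lambda>_. 0) \<in> S'" "\<forall>u\<in>S'. (\<lambda>k. F k u) \<in> \<Omega>"
    by (rule family_near0[OF \<Omega> F 0])
  have "\<forall>k\<in>K. \<exists>A. open A \<and> (\<lambda>_. 0) \<in> A \<and> (\<forall>u\<in>A. rep_germ (j k) u = F k u)"
    using eq by (simp add: eq_near0_def)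
  then obtain A where A: "\<And>k. k \<in> K \<Longrightarrow> open (A k) \<and> (\<lambda>_. 0) \<in> A k \<and> (\<forall>u\<in>A k. rep_germ (j k) u = F k u)"
    by metis
  have "eq_near0 (\<lambda>u. f (\<lambda>k. rep_germ (j k) u)) (\<lambda>u. f (\<lambda>k. F k u))"
  proof (rule eq_near0I[of "S \<inter> S' \<inter> (\<Inter>k\<in>K. A k)"])
    show "open (S \<inter> S' \<inter> (\<Inter>k\<in>K. A k))" using S(1) S'(1) A \<Omega> by (intro open_Int open_INT) (auto simp: region_def)
    show "(\<lambda>_. 0) \<in> S \<inter> S' \<inter> (\<Inter>k\<in>K. A k)" using S S' A by auto
    fix u assume u: "u \<in> S \<inter> S' \<inter> (\<Inter>k\<in>K. A k)"
    show "f (\<lambda>k. rep_germ (j k) u) = f (\<lambda>k. F k u)"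
      by (rule depends_onD[of K \<Omega> f]) (use f u S S' A in \<open>auto simp: smooth_fn_def\<close>)
  qed
  then show ?thesis unfolding gcomp_def
    using smooth_near0_gcomp[OF f] smooth_near0_comp[OF \<Omega> F 0 f] by (intro abs_germ_eqI)
qed

lemma gcomp_cong_germs:
  assumes f: "smooth_fn K \<Omega> f" and eq: "\<And>k. k \<in> K \<Longrightarrow> j k = j' k"
  shows "gcomp f j = gcomp f j'"
  unfolding gcomp_def[of f j']
proof (rule gcomp_cong_family[OF f])
  show "(\<lambda>k. rep_germ (j' k) (\<lambda>_. 0)) \<in> \<Omega>"
    by (rule saturatedD[of K \<Omega> "\<lambda>k. ev (j k)"]) (use \<Omega> j eq in \<open>auto simp: region_def rep_germ_0\<close>)
qed (simp_all add: eq eq_near0_refl smooth_near0_rep)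

lemma gcomp_abs:
  assumes f: "smooth_fn K \<Omega> f" and eq: "\<And>k. k \<in> K \<Longrightarrow> j k = abs_germ (F k)"
    and F: "\<And>k. k \<in> K \<Longrightarrow> smooth_near0 (F k)"
  shows "gcomp f j = abs_germ (\<lambda>u. f (\<lambda>k. F k u))"
proof (rule gcomp_cong_family[OF f _ F])
  show "(\<lambda>k. F k (\<lambda>_. 0)) \<in> \<Omega>"
    by (rule saturatedD[of K \<Omega> "\<lambda>k. ev (j k)"])
       (use \<Omega> j eq F in \<open>auto simp: region_def germ_rel_refl ev.abs_eq\<close>)
qed (simp_all add: eq rep_abs_near0 F)

end

lemma gcomp_const: "gcomp (\<lambda>c. a) j = a *\<^sub>R 1"
  by (simp add: gcomp_def one_germ_def scaleR_germ.abs_eq germ_rel_refl smooth_near0_const)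

lemma gcomp_proj: "gcomp (\<lambda>c. c k) j = j k"
  by (simp add: gcomp_def abs_rep_germ)

text \<open>Associativity of substitution. It is what allows a function on the quotient, written in
  jet coordinates, to be evaluated directly on frame derivatives.\<close>

lemma gcomp_gcomp:
  fixes F :: "'k \<Rightarrow> ('l \<Rightarrow> real) \<Rightarrow> real" and j :: "'l \<Rightarrow> 'm germ"
  assumes \<Omega>: "region K \<Omega>" and f: "smooth_fn K \<Omega> f"
    and O: "region K' O'" and j: "(\<lambda>l. ev (j l)) \<in> O'"
    and F: "\<And>k. k \<in> K \<Longrightarrow> smooth_fn K' O' (F k)" and into: "\<And>c. c \<in> O' \<Longrightarrow> (\<lambda>k. F k c) \<in> \<Omega>"
  shows "gcomp (\<lambda>c. f (\<lambda>k. F k c)) j = gcomp f (\<lambda>k. gcomp (F k) j)"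
proof -
  have evs: "ev (gcomp (F k) j) = F k (\<lambda>l. ev (j l))" if "k \<in> K" for k
    by (rule ev_gcomp[OF O j F[OF that]])
  have "(\<lambda>k. ev (gcomp (F k) j)) \<in> \<Omega>"
    by (rule saturatedD[of K \<Omega> "\<lambda>k. F k (\<lambda>l. ev (j l))"])
       (use \<Omega> into j evs in \<open>auto simp: region_def\<close>)
  then have "gcomp f (\<lambda>k. gcomp (F k) j) = abs_germ (\<lambda>u. f (\<lambda>k. F k (\<lambda>l. rep_germ (j l) u)))"
    by (rule gcomp_abs[OF \<Omega> _ f]) (auto simp: gcomp_def smooth_near0_gcomp[OF O j F])
  then show ?thesis by (simp add: gcomp_def)
qed

lemma smooth_fn_comp:
  fixes F :: "'k \<Rightarrow> ('l \<Rightarrow> real) \<Rightarrow> real"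
  assumes \<Omega>: "region K \<Omega>" and f: "smooth_fn K \<Omega> f" and O: "open O'"
    and F: "\<And>k. k \<in> K \<Longrightarrow> smooth_fn K' O' (F k)" and into: "\<And>c. c \<in> O' \<Longrightarrow> (\<lambda>k. F k c) \<in> \<Omega>"
  shows "smooth_fn K' O' (\<lambda>c. f (\<lambda>k. F k c))"
  unfolding smooth_fn_def smooth_coords_Cle
proof (intro conjI allI)
  show "depends_on K' O' (\<lambda>c. f (\<lambda>k. F k c))"
    unfolding depends_on_def
  proof (intro ballI impI)
    fix c c' assume c: "c \<in> O'" "c' \<in> O'" "\<forall>k\<in>K'. c k = c' k"
    show "f (\<lambda>k. F k c) = f (\<lambda>k. F k c')"
    proof (rule depends_onD[of K \<Omega> f])
      fix k assume "k \<in> K"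
      then show "F k c = F k c'"
        using depends_onD[of K' O' "F k" c c'] F c by (auto simp: smooth_fn_def)
    qed (use f into c in \<open>auto simp: smooth_fn_def\<close>)
  qed
  fix r show "Cle r O' (\<lambda>c. f (\<lambda>k. F k c))"
    by (rule Cle_comp[of \<Omega> K f O' r F])
       (use \<Omega> f O F into in \<open>auto simp: region_def smooth_fn_def smooth_coords_Cle\<close>)
qed

subsection \<open>Adding and removing a parameter\<close>

lemma continuous_on_Some: "continuous_on S (\<lambda>u k. u (Some k) :: real)"
  by (rule continuous_on_coordinatewise_then_product) (rule continuous_on_proj)

lemma continuous_on_case_option: "continuous_on S (\<lambda>u. case_option 0 u :: 'k option \<Rightarrow> real)"
proof (rule continuous_on_coordinatewise_then_product)
  fix k :: "'k option" show "continuous_on S (\<lambda>u. case_option (0::real) u k)"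
    by (cases k) (auto intro: continuous_on_proj)
qed

lemma case_option_0: "case_option 0 (\<lambda>_. 0) = (\<lambda>_. 0 :: real)"
  by (rule ext) (simp split: option.split)

lemma smooth_near0_gext:
  assumes "smooth_near0 f"
  shows "smooth_near0 (\<lambda>u. f (\<lambda>k. u (Some k)))"
proof -
  obtain S where S: "open S" "(\<lambda>_. 0) \<in> S" "smooth_coords S f" using assms by (rule smooth_near0E)
  have op: "open {u. (\<lambda>k. u (Some k)) \<in> S}"
    using open_vimage[OF S(1) continuous_on_Some] by (simp add: vimage_def)
  have "smooth_coords {u. (\<lambda>k. u (Some k)) \<in> S} (\<lambda>u. f (\<lambda>k. u (Some k)))"
    by (rule smooth_coords_subst[where m="\<lambda>u k. u (Some k)" and q="\<lambda>l. l" and S=S])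
       (use S op continuous_on_Some in \<open>auto simp: fun_eq_iff\<close>)
  then show ?thesis using S op by (intro smooth_near0I[of "{u. (\<lambda>k. u (Some k)) \<in> S}"]) auto
qed

lemma smooth_near0_gres:
  assumes "smooth_near0 f"
  shows "smooth_near0 (\<lambda>u. f (case_option 0 u))"
proof -
  obtain S where S: "open S" "(\<lambda>_. 0) \<in> S" "smooth_coords S f" using assms by (rule smooth_near0E)
  have op: "open {u. case_option 0 u \<in> S}"
    using open_vimage[OF S(1) continuous_on_case_option] by (simp add: vimage_def)
  have "smooth_coords {u. case_option 0 u \<in> S} (\<lambda>u. f (case_option 0 u))"
    by (rule smooth_coords_subst[where m="\<lambda>u. case_option 0 u" and q="\<lambda>l. Some (Some l)" and S=S])
       (use S op continuous_on_case_option in \<open>auto simp: fun_eq_iff split: option.split\<close>)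
  then show ?thesis using S op
    by (intro smooth_near0I[of "{u. case_option 0 u \<in> S}"]) (auto simp: case_option_0)
qed

text \<open>Extension that is constant in the new variable \<open>None\<close>, which serves as the
  deformation parameter.\<close>

lift_definition gext :: "'k germ \<Rightarrow> 'k option germ" is "\<lambda>f u. f (\<lambda>k. u (Some k))"
  unfolding germ_rel_def
proof (elim conjE, intro conjI smooth_near0_gext)
  fix f g :: "('k \<Rightarrow> real) \<Rightarrow> real" assume "eq_near0 f g"
  then obtain S where S: "open S" "(\<lambda>_. 0) \<in> S" "\<forall>c\<in>S. f c = g c" by (rule eq_near0E)
  show "eq_near0 (\<lambda>u. f (\<lambda>k. u (Some k))) (\<lambda>u. g (\<lambda>k. u (Some k)))"
    by (rule eq_near0I[OF open_vimage[OF S(1) continuous_on_Some]]) (use S in auto)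
qed

text \<open>Restriction to the parameter value 0, a ring homomorphism and a left inverse of
  \<open>gext\<close>. It commutes with \<open>pder (Some k)\<close>; applied after
  \<open>pder None\<close> it yields first variations.\<close>

lift_definition gres :: "'k option germ \<Rightarrow> 'k germ" is "\<lambda>f u. f (case_option 0 u)"
  unfolding germ_rel_def
proof (elim conjE, intro conjI smooth_near0_gres)
  fix f g :: "('k option \<Rightarrow> real) \<Rightarrow> real" assume "eq_near0 f g"
  then obtain S where S: "open S" "(\<lambda>_. 0) \<in> S" "\<forall>c\<in>S. f c = g c" by (rule eq_near0E)
  show "eq_near0 (\<lambda>u. f (case_option 0 u)) (\<lambda>u. g (case_option 0 u))"
    by (rule eq_near0I[OF open_vimage[OF S(1) continuous_on_case_option]])
       (use S in \<open>auto simp: case_option_0\<close>)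
qed

lemma gres_add: "gres (a + b) = gres a + gres b"
  by transfer (simp add: germ_rel_def smooth_near0_gres smooth_near0_add eq_near0_refl)

lemma gres_mult: "gres (a * b) = gres a * gres b"
  by transfer (simp add: germ_rel_def smooth_near0_gres smooth_near0_mult eq_near0_refl)

lemma gres_0 [simp]: "gres 0 = 0" and gres_1 [simp]: "gres 1 = 1"
  by (transfer, simp add: germ_rel_def smooth_near0_const eq_near0_refl)+

lemma gres_uminus: "gres (- a) = - gres a"
  using gres_add[of a "- a"] by (simp add: eq_neg_iff_add_eq_0 add.commute)

lemma gres_diff: "gres (a - b) = gres a - gres b"
  using gres_add[of a "- b"] by (simp add: gres_uminus)

lemma gres_sum: "gres (\<Sum>i\<in>I. f i) = (\<Sum>i\<in>I. gres (f i))"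
  by (induction I rule: infinite_finite_induct) (simp_all add: gres_add)

lemma gres_gext: "gres (gext d) = d"
  by transfer (simp add: germ_rel_def)

lemma ev_gres: "ev (gres a) = ev a"
  by transfer (simp add: case_option_0)

lemma gres_gvar_None: "gres (gvar None) = 0"
  by transfer (simp add: germ_rel_def smooth_near0_const eq_near0_refl)

lemma gres_pder: "gres (pder (Some k) a) = pder k (gres a)"
proof -
  obtain f where f: "a = abs_germ f" "smooth_near0 f" by (rule abs_germ_cases)
  have "case_option 0 (u(k := h)) = (case_option 0 u)(Some k := h)" for u and h :: real
    by (auto simp: fun_eq_iff split: option.split)
  then have "pd k (\<lambda>u. f (case_option 0 u)) = (\<lambda>u. pd (Some k) f (case_option 0 u))"
    by (intro ext) (simp add: pd_def del: fun_upd_apply)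
  then show ?thesis unfolding f
    using f(2) by (simp add: gres.abs_eq pder.abs_eq germ_rel_refl smooth_near0_pd smooth_near0_gres)
qed

lemma pder_None_gext: "pder None (gext b) = 0"
proof -
  obtain f where f: "b = abs_germ f" "smooth_near0 f" by (rule abs_germ_cases)
  have "pd None (\<lambda>u. f (\<lambda>k. u (Some k))) = (\<lambda>u. 0)" by (intro ext) (simp add: pd_def)
  then show ?thesis unfolding f zero_germ_def
    using f(2) by (simp add: gext.abs_eq pder.abs_eq germ_rel_refl smooth_near0_gext)
qed

lemma gres_gcomp:
  assumes "region K \<Omega>" "smooth_fn K \<Omega> f" "(\<lambda>k. ev (j k)) \<in> \<Omega>"
  shows "gres (gcomp f j) = gcomp f (\<lambda>k. gres (j k))"
proof -
  have "gres (gcomp f j) = abs_germ (\<lambda>u. f (\<lambda>k. rep_germ (j k) (case_option 0 u)))"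
    using smooth_near0_gcomp[OF assms(1,3,2)] by (simp add: gcomp_def gres.abs_eq germ_rel_refl)
  also have "\<dots> = gcomp f (\<lambda>k. gres (j k))"
  proof (rule gcomp_abs[OF assms(1) _ assms(2), symmetric])
    show "(\<lambda>k. ev (gres (j k))) \<in> \<Omega>" using assms(3) by (simp add: ev_gres)
    fix k
    show "gres (j k) = abs_germ (\<lambda>u. rep_germ (j k) (case_option 0 u))"
      using gres.abs_eq[of "rep_germ (j k)"] by (simp add: abs_rep_germ germ_rel_refl smooth_near0_rep)
  qed (rule smooth_near0_gres[OF smooth_near0_rep])
  finally show ?thesis .
qed

section \<open>Taylor polynomials\<close>

lemma finite_msets_le [simp]: "finite {M :: 'n::finite multiset. size M \<le> N}"
proof -
  have "{M :: 'n multiset. size M \<le> N} = mset ` {J. length J \<le> N}"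
    by (auto simp: image_iff) (metis ex_mset size_mset)
  then show ?thesis using finite_lists_length_le[of "UNIV :: 'n set" N] by simp
qed

text \<open>Divided powers: differentiation removes one letter from \<open>M\<close> and leaves no
  numerical factor, so the coefficients of a Taylor polynomial are its derivatives at 0.\<close>

definition monomial :: "'n::finite multiset \<Rightarrow> ('n \<Rightarrow> real) \<Rightarrow> real" where
  "monomial M u = (\<Prod>i\<in>UNIV. u i ^ count M i / fact (count M i))"

definition taylor :: "nat \<Rightarrow> ('n::finite multiset \<Rightarrow> real) \<Rightarrow> ('n \<Rightarrow> real) \<Rightarrow> real" where
  "taylor N c u = (\<Sum>M\<in>{M. size M \<le> N}. c M * monomial M u)"

definition pds :: "'k list \<Rightarrow> (('k \<Rightarrow> real) \<Rightarrow> real) \<Rightarrow> ('k \<Rightarrow> real) \<Rightarrow> real" where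
  "pds J f = foldr pd J f"

lemma has_pd_monomial:
  "((\<lambda>h. monomial M (u(i := h))) has_real_derivative (if i \<in># M then monomial (M - {#i#}) u else 0)) (at (u i))"
proof -
  define C where "C = (\<Prod>k\<in>UNIV - {i}. u k ^ count M k / fact (count M k))"
  have split: "(\<Prod>k\<in>UNIV. F k) = F i * (\<Prod>k\<in>UNIV - {i}. F k)" for F :: "'a \<Rightarrow> real"
    by (rule prod.remove) auto
  have "monomial M (u(i := h)) = h ^ count M i / fact (count M i) * C" for h
    unfolding monomial_def C_def by (subst split) auto
  moreover have "((\<lambda>h. h ^ count M i / fact (count M i) * C) has_real_derivative
      (if i \<in># M then monomial (M - {#i#}) u else 0)) (at (u i))"
  proof (cases "count M i")
    case 0
    then have "i \<notin># M" by (simp add: count_eq_zero_iff)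
    then show ?thesis unfolding 0 by simp
  next
    case (Suc m)
    then have "i \<in># M" using count_inI[of M i] by fastforce
    have "monomial (M - {#i#}) u = u i ^ m / fact m * C"
      unfolding monomial_def C_def by (subst split) (auto simp: Suc intro!: prod.cong)
    moreover have "((\<lambda>h. h ^ Suc m / fact (Suc m) * C) has_real_derivative u i ^ m / fact m * C) (at (u i))"
    proof -
      have "((\<lambda>h. h ^ Suc m) has_real_derivative real (Suc m) * u i ^ m) (at (u i))"
        using DERIV_pow[of "Suc m" "u i" UNIV] by simp
      then have "((\<lambda>h. h ^ Suc m / fact (Suc m) * C) has_real_derivative real (Suc m) * u i ^ m / fact (Suc m) * C) (at (u i))"
        by (intro DERIV_cmult_right DERIV_cdivide)
      moreover have "real (Suc m) * u i ^ m / fact (Suc m) = u i ^ m / fact m"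
        unfolding fact_Suc by (simp del: of_nat_Suc)
      ultimately show ?thesis by (simp only:)
    qed
    ultimately show ?thesis using \<open>i \<in># M\<close> Suc by simp
  qed
  ultimately show ?thesis by simp
qed

lemma smooth_coords_power: "open S \<Longrightarrow> smooth_coords S f \<Longrightarrow> smooth_coords S (\<lambda>c. f c ^ k)"
  by (induction k) (simp_all add: smooth_coords_const smooth_coords_mult)

lemma smooth_coords_monomial: "smooth_coords UNIV (monomial M)"
  unfolding monomial_def[abs_def] divide_inverse
  by (intro smooth_coords_prod smooth_coords_mult smooth_coords_power smooth_coords_proj smooth_coords_const) auto

lemma smooth_coords_taylor: "smooth_coords UNIV (taylor N c)"
  unfolding taylor_def[abs_def]
  by (intro smooth_coords_sum smooth_coords_mult smooth_coords_const smooth_coords_monomial) auto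

lemma has_pd_taylor:
  "((\<lambda>h. taylor (Suc N) c (u(i := h))) has_real_derivative taylor N (\<lambda>M. c (add_mset i M)) u) (at (u i))"
proof -
  have "((\<lambda>h. taylor (Suc N) c (u(i := h))) has_real_derivative
      (\<Sum>M\<in>{M. size M \<le> Suc N}. c M * (if i \<in># M then monomial (M - {#i#}) u else 0))) (at (u i))"
    unfolding taylor_def by (intro DERIV_sum DERIV_cmult has_pd_monomial)
  also have "(\<Sum>M\<in>{M. size M \<le> Suc N}. c M * (if i \<in># M then monomial (M - {#i#}) u else 0)) =
      (\<Sum>M\<in>{M. size M \<le> Suc N \<and> i \<in># M}. c M * monomial (M - {#i#}) u)"
    by (rule sum.mono_neutral_cong_right) auto
  also have "\<dots> = taylor N (\<lambda>M. c (add_mset i M)) u"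
    unfolding taylor_def
    by (rule sum.reindex_bij_witness[of _ "add_mset i" "\<lambda>M. M - {#i#}"])
       (auto simp: size_Diff_singleton)
  finally show ?thesis .
qed

lemma pd_taylor: "pd i (taylor (Suc N) c) = taylor N (\<lambda>M. c (add_mset i M))"
  by (rule ext) (rule pdI[OF has_pd_taylor])

lemma taylor_0: "taylor N c (\<lambda>_. 0) = c {#}"
proof -
  have "monomial M (\<lambda>_. 0) = (if M = {#} then 1 else 0)" for M :: "'a multiset"
  proof (cases "M = {#}")
    case False
    then obtain i where "i \<in># M" by auto
    then have "count M i \<noteq> 0" by simp
    then have "(0 :: real) ^ count M i / fact (count M i) = 0" by simp
    then have "monomial M (\<lambda>_. 0) = 0"
      unfolding monomial_def by (intro prod_zero) auto
    then show ?thesis using False by simp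
  qed (simp add: monomial_def)
  then show ?thesis by (simp add: taylor_def if_distrib[of "\<lambda>x. _ * x"] cong: if_cong)
qed

lemma pds_taylor: "length J \<le> N \<Longrightarrow> pds J (taylor N c) = taylor (N - length J) (\<lambda>M. c (mset J + M))"
proof (induction J)
  case Nil
  then show ?case by (simp add: pds_def)
next
  case (Cons i J)
  have "pds (i # J) (taylor N c) = pd i (pds J (taylor N c))" by (simp add: pds_def)
  also have "\<dots> = pd i (taylor (Suc (N - Suc (length J))) (\<lambda>M. c (mset J + M)))"
    using Cons by (simp add: Suc_diff_Suc Suc_le_lessD)
  also have "\<dots> = taylor (N - Suc (length J)) (\<lambda>M. c (mset J + add_mset i M))"
    by (rule pd_taylor)
  finally show ?case by simp
qed

lemma pds_taylor_0: "length J \<le> N \<Longrightarrow> pds J (taylor N c) (\<lambda>_. 0) = c (mset J)"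
  by (simp add: pds_taylor taylor_0)

section \<open>Realisation of coordinates by immersions\<close>

definition Dle :: "nat \<Rightarrow> 'e::euclidean_space set \<Rightarrow> ('e \<Rightarrow> 'f::real_normed_vector) \<Rightarrow> bool" where
  "Dle r S f \<longleftrightarrow> (\<forall>q\<le>r. Ck_on q S f)"

lemma smooth_on_Dle: "smooth_on S f \<longleftrightarrow> (\<forall>r. Dle r S f)"
  unfolding smooth_on_def Dle_def by blast

lemma Dle_0: "Dle 0 S f \<longleftrightarrow> continuous_on S f"
  by (simp add: Dle_def)

lemma Dle_Suc:
  "Dle (Suc r) S f \<longleftrightarrow> continuous_on S f \<and> (\<forall>x\<in>S. f differentiable (at x)) \<and>
     (\<forall>v. Dle r S (\<lambda>x. frechet_derivative f (at x) v))"
proof -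
  have "Dle (Suc r) S f \<longleftrightarrow> Ck_on 0 S f \<and> (\<forall>q\<le>r. Ck_on (Suc q) S f)"
    unfolding Dle_def by (metis Suc_le_D Suc_le_mono not0_implies_Suc zero_le)
  then show ?thesis by (auto simp: Dle_def)
qed

lemma Dle_continuous_on: "Dle r S f \<Longrightarrow> continuous_on S f"
  unfolding Dle_def by (metis Ck_on.simps(1) le0)

lemma Dle_antimono: "Dle r S f \<Longrightarrow> q \<le> r \<Longrightarrow> Dle q S f"
  by (auto simp: Dle_def)

lemma Dle_subset: "Dle r S f \<Longrightarrow> S' \<subseteq> S \<Longrightarrow> Dle r S' f"
proof (induction r arbitrary: f)
  case (Suc r)
  then show ?case unfolding Dle_Suc using continuous_on_subset by blast
qed (simp add: Dle_0 continuous_on_subset)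

lemma Dle_has_derivative:
  "Dle (Suc r) S f \<Longrightarrow> x \<in> S \<Longrightarrow> (f has_derivative frechet_derivative f (at x)) (at x)"
  by (simp add: Dle_Suc frechet_derivative_works)

lemma Dle_cong:
  assumes "open S" "Dle r S f" "\<And>x. x \<in> S \<Longrightarrow> f x = g x"
  shows "Dle r S g"
  using assms(2,3)
proof (induction r arbitrary: f g)
  case 0
  then show ?case by (simp add: Dle_0 cong: continuous_on_cong)
next
  case (Suc r)
  have der: "(g has_derivative frechet_derivative f (at x)) (at x)" if "x \<in> S" for x
    by (rule has_derivative_transform_within_open[OF Dle_has_derivative[OF Suc.prems(1) that] assms(1) that Suc.prems(2)])
  show ?case unfolding Dle_Suc
  proof (intro conjI ballI allI)
    show "continuous_on S g"
      using Dle_continuous_on[OF Suc.prems(1)] Suc.prems(2) by (simp cong: continuous_on_cong)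
    show "g differentiable (at x)" if "x \<in> S" for x using der[OF that] by (auto simp: differentiable_def)
    fix v
    have "frechet_derivative f (at x) v = frechet_derivative g (at x) v" if "x \<in> S" for x
      using frechet_derivative_at[OF der[OF that]] by simp
    then show "Dle r S (\<lambda>x. frechet_derivative g (at x) v)"
      using Suc.IH[of "\<lambda>x. frechet_derivative f (at x) v"] Suc.prems(1) by (simp add: Dle_Suc)
  qed
qed

lemma Dle_SucI:
  assumes "open S" "\<And>x. x \<in> S \<Longrightarrow> (f has_derivative f' x) (at x)" "\<And>v. Dle r S (\<lambda>x. f' x v)"
  shows "Dle (Suc r) S f"
  unfolding Dle_Suc
proof (intro conjI ballI allI)
  show "continuous_on S f"
    using assms(2) by (intro continuous_at_imp_continuous_on) (auto dest: has_derivative_continuous)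
  show "f differentiable (at x)" if "x \<in> S" for x using assms(2)[OF that] by (auto simp: differentiable_def)
  fix v show "Dle r S (\<lambda>x. frechet_derivative f (at x) v)"
    by (rule Dle_cong[OF assms(1) assms(3)[of v]]) (simp add: frechet_derivative_at[OF assms(2)])
qed

lemma Dle_const: "open S \<Longrightarrow> Dle r S (\<lambda>x. a)"
proof (induction r arbitrary: a)
  case (Suc r)
  show ?case by (rule Dle_SucI[where f'="\<lambda>_ _. 0", OF Suc.prems _ Suc.IH[OF Suc.prems]]) simp
qed (simp add: Dle_0)

lemma Dle_linear:
  assumes "open S" "bounded_linear L"
  shows "Dle r S L"
proof (cases r)
  case 0
  then show ?thesis using linear_continuous_on[OF assms(2)] by (simp add: Dle_0)
next
  case (Suc q)
  show ?thesis unfolding Suc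
    by (rule Dle_SucI[where f'="\<lambda>_. L"])
       (use assms bounded_linear.has_derivative[OF assms(2) has_derivative_ident] in \<open>auto intro: Dle_const\<close>)
qed

lemma Dle_add:
  assumes "open S" "Dle r S f" "Dle r S g"
  shows "Dle r S (\<lambda>x. f x + g x)"
  using assms(2,3)
proof (induction r arbitrary: f g)
  case 0
  then show ?case by (simp add: Dle_0 continuous_on_add)
next
  case (Suc r)
  show ?case
  proof (rule Dle_SucI[OF assms(1)])
    show "((\<lambda>x. f x + g x) has_derivative (\<lambda>v. frechet_derivative f (at x) v + frechet_derivative g (at x) v)) (at x)"
      if "x \<in> S" for x
      using that Suc.prems by (intro has_derivative_add Dle_has_derivative)
    show "Dle r S (\<lambda>x. frechet_derivative f (at x) v + frechet_derivative g (at x) v)" for v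
      using Suc.prems by (intro Suc.IH) (auto simp: Dle_Suc)
  qed
qed

lemma Dle_sum:
  assumes "open S" "\<And>i. i \<in> I \<Longrightarrow> Dle r S (f i)"
  shows "Dle r S (\<lambda>x. \<Sum>i\<in>I. f i x)"
  using assms(2)
proof (induction I rule: infinite_finite_induct)
  case (insert i F)
  then show ?case using Dle_add[OF assms(1), of r "f i" "\<lambda>x. \<Sum>i\<in>F. f i x"] by simp
qed (simp_all add: Dle_const[OF assms(1)])

lemma Dle_scaleR:
  assumes "open S" "Dle r S f" "Dle r S g"
  shows "Dle r S (\<lambda>x. f x *\<^sub>R g x)"
  using assms(2,3)
proof (induction r arbitrary: f g)
  case 0
  then show ?case by (simp add: Dle_0 continuous_on_scaleR)
next
  case (Suc r)
  show ?case
  proof (rule Dle_SucI[OF assms(1)])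
    show "((\<lambda>x. f x *\<^sub>R g x) has_derivative
        (\<lambda>v. f x *\<^sub>R frechet_derivative g (at x) v + frechet_derivative f (at x) v *\<^sub>R g x)) (at x)"
      if "x \<in> S" for x
      using that Suc.prems by (intro has_derivative_scaleR Dle_has_derivative)
    show "Dle r S (\<lambda>x. f x *\<^sub>R frechet_derivative g (at x) v + frechet_derivative f (at x) v *\<^sub>R g x)" for v
      using Suc.prems Dle_antimono[OF Suc.prems(1), of r] Dle_antimono[OF Suc.prems(2), of r]
      by (intro Dle_add[OF assms(1)] Suc.IH) (auto simp: Dle_Suc)
  qed
qed

lemma Dle_linear_comp:
  assumes "open S" "bounded_linear L" "Dle r S f"
  shows "Dle r S (\<lambda>x. L (f x))"
  using assms(3)
proof (induction r arbitrary: f)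
  case 0
  then show ?case using bounded_linear.continuous_on[OF assms(2)] by (simp add: Dle_0)
next
  case (Suc r)
  show ?case
  proof (rule Dle_SucI[OF assms(1)])
    show "((\<lambda>x. L (f x)) has_derivative (\<lambda>v. L (frechet_derivative f (at x) v))) (at x)" if "x \<in> S" for x
      by (rule bounded_linear.has_derivative[OF assms(2) Dle_has_derivative[OF Suc.prems that]])
    show "Dle r S (\<lambda>x. L (frechet_derivative f (at x) v))" for v
      using Suc.prems by (intro Suc.IH) (auto simp: Dle_Suc)
  qed
qed

lemma Dle_comp:
  fixes f :: "'e::euclidean_space \<Rightarrow> 'f::euclidean_space" and g :: "'f \<Rightarrow> 'g::euclidean_space"
  assumes S: "open S" and f: "Dle r S f" and g: "smooth_on W g" and into: "f ` S \<subseteq> W"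
  shows "Dle r S (\<lambda>x. g (f x))"
  using f g
proof (induction r arbitrary: g)
  case 0
  have "continuous_on W g" using 0(2) Dle_continuous_on smooth_on_Dle by blast
  then show ?case using 0 into by (auto simp: Dle_0 intro: continuous_on_compose2)
next
  case (Suc r)
  have gW: "Dle q W g" for q using Suc.prems(2) by (simp add: smooth_on_Dle)
  show ?case
  proof (rule Dle_SucI[OF S])
    fix x assume x: "x \<in> S"
    have D: "(g has_derivative frechet_derivative g (at (f x))) (at (f x))"
      using Dle_has_derivative[OF gW[of "Suc 0"]] into x by auto
    have der: "((\<lambda>x. g (f x)) has_derivative (\<lambda>v. frechet_derivative g (at (f x)) (frechet_derivative f (at x) v))) (at x)"
      by (rule has_derivative_compose[OF Dle_has_derivative[OF Suc.prems(1) x] D])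
    \<comment> \<open>The direction \<open>frechet_derivative f (at x) v\<close> varies with
      \<open>x\<close>. Expanding it in the basis leaves derivatives of \<open>g\<close> in fixed
      directions, to which the induction hypothesis applies.\<close>
    have expand: "frechet_derivative g (at (f x)) w =
        (\<Sum>b\<in>Basis. (w \<bullet> b) *\<^sub>R frechet_derivative g (at (f x)) b)" for w
    proof -
      interpret bounded_linear "frechet_derivative g (at (f x))" using has_derivative_bounded_linear[OF D] .
      have "frechet_derivative g (at (f x)) (\<Sum>b\<in>Basis. (w \<bullet> b) *\<^sub>R b) =
          (\<Sum>b\<in>Basis. (w \<bullet> b) *\<^sub>R frechet_derivative g (at (f x)) b)" by (simp add: sum scaleR)
      then show ?thesis by (simp add: euclidean_representation)
    qed
    show "((\<lambda>x. g (f x)) has_derivative (\<lambda>v. \<Sum>b\<in>Basis. (frechet_derivative f (at x) v \<bullet> b) *\<^sub>R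
        frechet_derivative g (at (f x)) b)) (at x)"
      by (rule has_derivative_eq_rhs[OF der]) (rule ext, rule expand)
  next
    fix v
    show "Dle r S (\<lambda>x. \<Sum>b\<in>Basis. (frechet_derivative f (at x) v \<bullet> b) *\<^sub>R frechet_derivative g (at (f x)) b)"
    proof (intro Dle_sum Dle_scaleR S)
      fix b :: 'f assume "b \<in> Basis"
      show "Dle r S (\<lambda>x. frechet_derivative f (at x) v \<bullet> b)"
        by (rule Dle_linear_comp[OF S bounded_linear_inner_left]) (use Suc.prems(1) in \<open>simp add: Dle_Suc\<close>)
      have "smooth_on W (\<lambda>y. frechet_derivative g (at y) b)"
        unfolding smooth_on_Dle
      proof
        fix q show "Dle q W (\<lambda>y. frechet_derivative g (at y) b)" using gW[of "Suc q"] by (simp add: Dle_Suc)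
      qed
      then show "Dle r S (\<lambda>x. frechet_derivative g (at (f x)) b)"
        using Suc.IH[of "\<lambda>y. frechet_derivative g (at y) b"] Dle_antimono[OF Suc.prems(1), of r] by simp
    qed
  qed
qed

section \<open>Taylor maps and their partial derivatives\<close>

lemma Dle_vec_monomial: "Dle r UNIV (\<lambda>t :: real ^ 'n::finite. monomial M (($) t))"
proof -
  have mult: "Dle r UNIV (\<lambda>t. f t * g t)" if "Dle r UNIV f" "Dle r UNIV g" for f g :: "real ^ 'n \<Rightarrow> real"
    using Dle_scaleR[OF open_UNIV that] by simp
  have power: "Dle r UNIV (\<lambda>t. f t ^ k)" if "Dle r UNIV f" for f :: "real ^ 'n \<Rightarrow> real" and k
    by (induction k) (simp_all add: Dle_const mult that)
  have prod: "Dle r UNIV (\<lambda>t. \<Prod>i\<in>I. f i t)" if "\<And>i. Dle r UNIV (f i)" for f :: "'n \<Rightarrow> real ^ 'n \<Rightarrow> real" and I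
  proof (induction I rule: infinite_finite_induct)
    case (insert i F)
    then show ?case using mult[OF that[of i] insert.IH] by simp
  qed (simp_all add: Dle_const)
  show ?thesis unfolding monomial_def divide_inverse
    by (intro prod mult power Dle_const Dle_linear bounded_linear_vec_nth open_UNIV)
qed

definition taylor_map :: "nat \<Rightarrow> ('a::finite, 'n::finite) vcoords \<Rightarrow> real ^ 'n \<Rightarrow> real ^ 'a" where
  "taylor_map N c t = (\<chi> A. taylor N (\<lambda>M. c (A, M)) (($) t))"

lemma smooth_on_taylor_map: "smooth_on UNIV (taylor_map N c)"
proof -
  have "taylor_map N c = (\<lambda>t. \<Sum>A\<in>UNIV. taylor N (\<lambda>M. c (A, M)) (($) t) *\<^sub>R axis A 1)"
    by (auto simp: taylor_map_def fun_eq_iff vec_eq_iff axis_def if_distrib cong: if_cong)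
  moreover have "Dle r UNIV (\<lambda>t. \<Sum>A\<in>UNIV. taylor N (\<lambda>M. c (A, M)) (($) t) *\<^sub>R axis A (1::real))" for r
    unfolding taylor_def real_scaleR_def[symmetric]
    by (intro Dle_sum Dle_scaleR Dle_const Dle_vec_monomial open_UNIV)
  ultimately show ?thesis by (simp add: smooth_on_Dle)
qed

lemma deriv_shift: "deriv (\<lambda>h. f (a + h)) 0 = deriv f (a :: real)"
  unfolding deriv_def using DERIV_shift[of f _ 0 a] by (simp add: add.commute)

lemma partial_vec_nth: "partial j (\<lambda>t. f (($) t)) t = pd j f (($) t)"
proof -
  have "($) (t + h *\<^sub>R axis j 1) = (($) t)(j := t $ j + h)" for h
    by (auto simp: fun_eq_iff axis_def)
  then show ?thesis
    unfolding partial_def pd_def using deriv_shift[of "\<lambda>u. f ((($) t)(j := u))" "t $ j"] by simp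
qed

lemma partials_vec_nth: "partials J (\<lambda>t. f (($) t)) = (\<lambda>t. pds J f (($) t))"
proof (induction J)
  case (Cons j J)
  have "partials (j # J) (\<lambda>t. f (($) t)) = partial j (partials J (\<lambda>t. f (($) t)))" by (simp add: partials_def)
  then show ?case unfolding Cons by (simp add: fun_eq_iff partial_vec_nth pds_def)
qed (simp add: partials_def pds_def)

lemma partial_cong:
  fixes f g :: "real ^ 'n::finite \<Rightarrow> real"
  assumes "open U" "t \<in> U" "\<And>t. t \<in> U \<Longrightarrow> f t = g t"
  shows "partial j f t = partial j g t"
proof -
  have cont: "continuous_on UNIV (\<lambda>h::real. t + h *\<^sub>R axis j (1::real))" by (intro continuous_intros)
  have "open ((\<lambda>h::real. t + h *\<^sub>R axis j (1::real)) -` U)" by (rule open_vimage[OF assms(1) cont])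
  moreover have "0 \<in> (\<lambda>h::real. t + h *\<^sub>R axis j (1::real)) -` U" using assms(2) by simp
  ultimately have "\<forall>\<^sub>F h in nhds 0. h \<in> (\<lambda>h::real. t + h *\<^sub>R axis j (1::real)) -` U"
    by (rule eventually_nhds_in_open)
  then have "\<forall>\<^sub>F h in nhds 0. f (t + h *\<^sub>R axis j 1) = g (t + h *\<^sub>R axis j 1)"
    by eventually_elim (simp add: assms(3))
  then show ?thesis unfolding partial_def by (rule deriv_cong_ev) simp
qed

lemma partials_cong:
  fixes f g :: "real ^ 'n::finite \<Rightarrow> real"
  assumes "open U" "\<And>t. t \<in> U \<Longrightarrow> f t = g t"
  shows "t \<in> U \<Longrightarrow> partials J f t = partials J g t"
proof (induction J arbitrary: t)
  case (Cons j J)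
  have "partial j (partials J f) t = partial j (partials J g) t"
    by (rule partial_cong[OF assms(1) Cons.prems Cons.IH])
  then show ?case by (simp add: partials_def)
qed (simp add: partials_def assms(2))

lemma has_derivative_taylor_map:
  "(taylor_map N c has_derivative frechet_derivative (taylor_map N c) (at t)) (at t)"
  by (rule Dle_has_derivative[of 0 UNIV]) (use smooth_on_taylor_map in \<open>auto simp: smooth_on_Dle\<close>)

lemma taylor_map_derivative_component:
  "frechet_derivative (taylor_map N c) (at t) v $ A =
    (\<Sum>j\<in>UNIV. pd j (taylor N (\<lambda>M. c (A, M))) (($) t) * v $ j)"
proof -
  let ?D = "frechet_derivative (taylor_map N c) (at t)"
  interpret D: bounded_linear ?D by (rule has_derivative_bounded_linear[OF has_derivative_taylor_map])
  have comp: "((\<lambda>t. taylor_map N c t $ A) has_derivative (\<lambda>v. ?D v $ A)) (at t)"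
    by (rule bounded_linear.has_derivative[OF bounded_linear_vec_nth has_derivative_taylor_map])
  have axis: "?D (axis j 1) $ A = pd j (taylor N (\<lambda>M. c (A, M))) (($) t)" for j
  proof -
    have "((\<lambda>h. t + h *\<^sub>R axis j 1) has_derivative (\<lambda>h. h *\<^sub>R axis j (1::real))) (at 0)"
      by (auto intro!: derivative_eq_intros)
    moreover have "((\<lambda>t. taylor_map N c t $ A) has_derivative (\<lambda>v. ?D v $ A)) (at (t + 0 *\<^sub>R axis j 1))"
      using comp by simp
    ultimately have "((\<lambda>h. taylor_map N c (t + h *\<^sub>R axis j 1) $ A) has_derivative (\<lambda>h. ?D (h *\<^sub>R axis j 1) $ A)) (at 0)"
      by (rule has_derivative_compose)
    then have "((\<lambda>h. taylor_map N c (t + h *\<^sub>R axis j 1) $ A) has_real_derivative ?D (axis j 1) $ A) (at 0)"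
      unfolding has_field_derivative_def
      by (rule has_derivative_eq_rhs) (simp add: fun_eq_iff D.scaleR mult.commute)
    then have "partial j (\<lambda>t. taylor_map N c t $ A) t = ?D (axis j 1) $ A"
      by (simp add: partial_def DERIV_imp_deriv)
    moreover have "(\<lambda>t. taylor_map N c t $ A) = (\<lambda>t. taylor N (\<lambda>M. c (A, M)) (($) t))"
      by (simp add: taylor_map_def)
    ultimately show ?thesis by (simp add: partial_vec_nth)
  qed
  have "v = (\<Sum>j\<in>UNIV. v $ j *\<^sub>R axis j 1)"
    by (simp add: vec_eq_iff axis_def if_distrib cong: if_cong)
  then have "?D v = ?D (\<Sum>j\<in>UNIV. v $ j *\<^sub>R axis j 1)" by (rule arg_cong)
  also have "\<dots> = (\<Sum>j\<in>UNIV. v $ j *\<^sub>R ?D (axis j 1))" by (simp add: D.sum D.scaleR)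
  finally show ?thesis by (simp add: axis mult.commute)
qed

lemma vec_nth_0: "(($) 0) = (\<lambda>_. 0)"
  by (rule ext) simp

text \<open>The equation is given on velocities, the calculus works with coordinate families; this
  connects the two. The inverse chart after a Taylor polynomial has the prescribed jet, and it is an
  immersion near 0 because one minor of its Jacobian does not vanish there.\<close>

theorem realization:
  fixes \<A> :: "('x::{t2_space, second_countable_topology}, 'a::finite) chart set"
    and c :: "('a, 'n::finite) vcoords"
  assumes \<A>: "smooth_structure \<A>" and chart: "(V, x) \<in> \<A>" and s: "s \<ge> 1"
    and base: "(\<chi> A. c (A, {#})) \<in> x ` V" and det: "det (xmat \<iota> c) \<noteq> 0"
  obtains v where "v \<in> Wset \<A> s V x \<iota>" "agree s (coords x v) c"
proof -
  define P where "P = (taylor_map s c :: real ^ 'n \<Rightarrow> real ^ 'a)"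
  \<comment> \<open>The minor formed by the rows \<iota> i. Where it is nonzero the whole Jacobian
    is injective, and this is an open condition.\<close>
  define minor where "minor t = det (\<chi> i j. pd j (taylor s (\<lambda>M. c (\<iota> i, M))) (($) t))" for t :: "real ^ 'n"
  define \<gamma> where "\<gamma> = inv_into V x \<circ> P"
  define U where "U = {t. P t \<in> x ` V \<and> minor t \<noteq> 0}"
  have V: "open V" "open (x ` V)" "homeomorphism V (x ` V) x (inv_into V x)"
    using \<A> chart by (auto simp: smooth_structure_def is_chart_def)
  have P0: "P 0 = (\<chi> A. c (A, {#}))" by (simp add: P_def taylor_map_def vec_nth_0 taylor_0)
  have smP: "smooth_on UNIV P" unfolding P_def by (rule smooth_on_taylor_map)
  have contP: "continuous_on UNIV P" using smP Dle_continuous_on smooth_on_Dle by blast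
  have derP: "(P has_derivative frechet_derivative P (at t)) (at t)" for t
    unfolding P_def by (rule has_derivative_taylor_map)
  have "continuous_on UNIV (\<lambda>t :: real ^ 'n. pd j (taylor s (\<lambda>M. c (A, M))) (($) t))" for j A
  proof (rule continuous_on_compose2[of UNIV "pd j (taylor s (\<lambda>M. c (A, M)))"])
    show "continuous_on UNIV (pd j (taylor s (\<lambda>M. c (A, M))))"
      by (rule Cle_imp_continuous_on[OF smooth_coords_Cle_D[OF smooth_coords_pd[OF smooth_coords_taylor]]])
    show "continuous_on UNIV (($) :: real ^ 'n \<Rightarrow> 'n \<Rightarrow> real)"
      by (rule continuous_on_coordinatewise_then_product) (intro continuous_intros)
  qed simp
  then have "continuous_on UNIV minor"
    unfolding minor_def det_def by (auto intro!: continuous_intros)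
  then have "open {t. minor t \<noteq> 0}" by (rule open_Collect_neq) simp
  moreover have "open (P -` (x ` V))" by (rule open_vimage[OF V(2) contP])
  moreover have "U = P -` (x ` V) \<inter> {t. minor t \<noteq> 0}" by (auto simp: U_def)
  ultimately have openU: "open U" by (simp only: open_Int)
  have "pd j (taylor s (\<lambda>M. c (A, M))) (\<lambda>_. 0) = c (A, {#j#})" for j A
    using pds_taylor_0[of "[j]" s] s by (simp add: pds_def)
  then have "minor 0 = det (xmat \<iota> c)" by (simp add: minor_def xmat_def vec_nth_0)
  then have U0: "0 \<in> U" using det base by (simp add: U_def P0)
  have \<gamma>V: "\<gamma> t \<in> V" "x (\<gamma> t) = P t" if "t \<in> U" for t
    using that by (auto simp: U_def \<gamma>_def inv_into_into f_inv_into_f)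
  have cont\<gamma>: "continuous_on U \<gamma>"
    unfolding \<gamma>_def
  proof (rule continuous_on_compose)
    show "continuous_on U P" using contP by (rule continuous_on_subset) simp
    have "continuous_on (x ` V) (inv_into V x)" using V(3) by (simp add: homeomorphism_def)
    then show "continuous_on (P ` U) (inv_into V x)" by (rule continuous_on_subset) (auto simp: U_def)
  qed
  have trans: "smooth_on (U \<inter> \<gamma> -` V') (x' \<circ> \<gamma>)" "open (U \<inter> \<gamma> -` V')"
    "smooth_on (x' ` (V \<inter> V')) (x \<circ> inv_into V' x')" "inj_on x' V'" "open (x' ` (V \<inter> V'))"
    if V': "(V', x') \<in> \<A>" for V' x'
  proof -
    have comp: "compatible (V, x) (V', x')" and ch: "is_chart (V', x')"
      using \<A> chart V' unfolding smooth_structure_def by blast+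
    then show "smooth_on (x' ` (V \<inter> V')) (x \<circ> inv_into V' x')" by (simp add: compatible_def)
    have hom: "homeomorphism V' (x' ` V') x' (inv_into V' x')" "open V'" "open (x' ` V')"
      using ch by (auto simp: is_chart_def)
    then show inj: "inj_on x' V'" unfolding homeomorphism_def by (metis inj_on_inverseI)
    show op: "open (U \<inter> \<gamma> -` V')" by (rule continuous_open_preimage[OF cont\<gamma> openU hom(2)])
    have "openin (top_of_set (x' ` V')) (x' ` (V \<inter> V'))"
      by (rule homeomorphism_imp_open_map[OF hom(1)]) (use V(1) in \<open>auto simp: openin_open Int_commute\<close>)
    then show "open (x' ` (V \<inter> V'))" using hom(3) openin_open_trans by blast
    have "Dle r (U \<inter> \<gamma> -` V') (\<lambda>t. (x' \<circ> inv_into V x) (P t))" for r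
    proof (rule Dle_comp[where f=P and g="x' \<circ> inv_into V x" and W="x ` (V \<inter> V')", OF op])
      show "Dle r (U \<inter> \<gamma> -` V') P" using smP Dle_subset unfolding smooth_on_Dle by blast
      show "smooth_on (x ` (V \<inter> V')) (x' \<circ> inv_into V x)" using comp by (simp add: compatible_def)
      show "P ` (U \<inter> \<gamma> -` V') \<subseteq> x ` (V \<inter> V')" using \<gamma>V by (force simp: image_iff)
    qed
    then show "smooth_on (U \<inter> \<gamma> -` V') (x' \<circ> \<gamma>)" by (simp add: smooth_on_Dle \<gamma>_def comp_def)
  qed
  have smap: "smooth_map \<A> U \<gamma>"
    unfolding smooth_map_def using openU cont\<gamma> trans(1) by auto
  have imm: "immersion_on \<A> U \<gamma>"
    unfolding immersion_on_def
  proof (intro conjI smap ballI)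
    have "inj (frechet_derivative (x' \<circ> \<gamma>) (at t))"
      if t: "t \<in> U" and V': "(V', x') \<in> \<A>" and tV': "\<gamma> t \<in> V'" for t V' x'
    proof -
    note tr = trans[OF V']
    let ?D = "frechet_derivative (x' \<circ> \<gamma>) (at t)"
    have tU': "t \<in> U \<inter> \<gamma> -` V'" using t tV' by simp
    have D: "((x' \<circ> \<gamma>) has_derivative ?D) (at t)"
      by (rule Dle_has_derivative[of 0, OF _ tU']) (use tr(1) in \<open>auto simp: smooth_on_Dle\<close>)
    have mem: "x' (\<gamma> t) \<in> x' ` (V \<inter> V')" using \<gamma>V[OF t] tV' by auto
    let ?E = "frechet_derivative (x \<circ> inv_into V' x') (at (x' (\<gamma> t)))"
    have E: "((x \<circ> inv_into V' x') has_derivative ?E) (at ((x' \<circ> \<gamma>) t))"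
      using Dle_has_derivative[of 0 _ "x \<circ> inv_into V' x'", OF _ mem] tr(3) by (auto simp: smooth_on_Dle)
    \<comment> \<open>The Taylor map factors through every other chart, so a vector killed by the
      derivative of x' o \<gamma> is killed by that of \<open>P\<close>, and then it is 0 because
      the minor is nonzero.\<close>
    have "((\<lambda>u. (x \<circ> inv_into V' x') ((x' \<circ> \<gamma>) u)) has_derivative (\<lambda>v. ?E (?D v))) (at t)"
      by (rule has_derivative_compose[OF D E])
    then have "(P has_derivative (\<lambda>v. ?E (?D v))) (at t)"
      by (rule has_derivative_transform_within_open[OF _ tr(2) tU']) (use \<gamma>V tr(4) in auto)
    then have DP: "frechet_derivative P (at t) = (\<lambda>v. ?E (?D v))" by (rule frechet_derivative_at[symmetric])
    interpret E: bounded_linear ?E by (rule has_derivative_bounded_linear[OF E])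
    have "v = 0" if "?D v = 0" for v
    proof -
      have "frechet_derivative P (at t) v = 0" by (simp add: DP that)
      then have z: "frechet_derivative P (at t) v $ A = 0" for A by simp
      let ?M = "\<chi> i j. pd j (taylor s (\<lambda>M. c (\<iota> i, M))) (($) t)"
      have "?M *v v = 0"
        using z[unfolded P_def taylor_map_derivative_component] by (simp add: vec_eq_iff matrix_vector_mult_def)
      moreover have "invertible ?M" using t by (simp add: invertible_det_nz U_def minor_def)
      ultimately show "v = 0"
        by (metis invertible_def matrix_vector_mul_assoc matrix_vector_mul_lid matrix_vector_mult_0_right)
    qed
    then show "inj ?D"
      using linear_injective_0[OF bounded_linear.linear[OF has_derivative_bounded_linear[OF D]]] by blast
    qed
    then show "case C of (V', x') \<Rightarrow> \<gamma> t \<in> V' \<longrightarrow> inj (frechet_derivative (x' \<circ> \<gamma>) (at t))"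
      if "t \<in> U" "C \<in> \<A>" for t C
      using that by (cases C) simp
  qed
  define v where "v = jet0 \<A> s \<gamma>"
  have "\<gamma> \<in> v" unfolding v_def jet0_def using smap U0 by auto
  then have "rep v \<in> v" unfolding rep_def by (rule someI[of "\<lambda>\<gamma>. \<gamma> \<in> v"])
  then have rep: "rep v 0 = \<gamma> 0"
    "\<And>A J. length J \<le> s \<Longrightarrow> partials J (\<lambda>u. x (rep v u) $ A) 0 = partials J (\<lambda>u. x (\<gamma> u) $ A) 0"
    using chart \<gamma>V(1)[OF U0] unfolding v_def jet0_def by auto
  have agree: "agree s (coords x v) c"
    unfolding agree_def
  proof (intro allI impI)
    fix A :: 'a and M :: "'n multiset" assume M: "size M \<le> s"
    have "mset (mlist M) = M" unfolding mlist_def by (rule someI_ex) (rule ex_mset)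
    then have len: "length (mlist M) \<le> s" "mset (mlist M) = M" using M by (metis size_mset)+
    have "coords x v (A, M) = partials (mlist M) (\<lambda>u. x (\<gamma> u) $ A) 0" by (simp add: coords_def rep(2) len)
    also have "\<dots> = partials (mlist M) (\<lambda>u. taylor s (\<lambda>M. c (A, M)) (($) u)) 0"
      by (rule partials_cong[OF openU _ U0]) (simp add: \<gamma>V P_def taylor_map_def)
    also have "\<dots> = c (A, M)" by (simp add: partials_vec_nth vec_nth_0 pds_taylor_0 len)
    finally show "coords x v (A, M) = c (A, M)" .
  qed
  have "xmat \<iota> (coords x v) = xmat \<iota> c"
    using agree s by (simp add: xmat_def agree_def)
  moreover have "v \<in> Imm \<A> s" unfolding Imm_def v_def using imm U0 by blast
  moreover have "base v \<in> V" using rep(1) \<gamma>V(1)[OF U0] by (simp add: base_def)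
  ultimately have "v \<in> Wset \<A> s V x \<iota>" using det by (simp add: Wset_def)
  then show thesis using that agree by blast
qed

section \<open>Commuting derivations\<close>

lemma finite_lists_le [simp]: "finite {J :: 'n::finite list. length J \<le> n}"
  using finite_lists_length_le[of "UNIV :: 'n set" n] by simp

lemma finite_lists_eq [simp]: "finite {J :: 'n::finite list. length J = n}"
  using finite_lists_length_eq[of "UNIV :: 'n set" n] by simp

section \<open>Sums over multi-indices\<close>

lemma sum_lists_Suc:
  "(\<Sum>J\<in>{J :: 'n::finite list. length J = Suc n}. F J) = (\<Sum>i\<in>UNIV. \<Sum>J\<in>{J. length J = n}. F (i # J))"
proof -
  have eq: "{J :: 'n list. length J = Suc n} = (\<lambda>(i, J). i # J) ` (UNIV \<times> {J. length J = n})"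
    by (force simp: length_Suc_conv)
  have "inj_on (\<lambda>(i, J). i # J) (UNIV \<times> {J :: 'n list. length J = n})" by (auto simp: inj_on_def)
  then show ?thesis
    unfolding eq by (subst sum.reindex) (auto simp: sum.cartesian_product case_prod_unfold)
qed

lemma sum_lists_le:
  "(\<Sum>J\<in>{J :: 'n::finite list. length J \<le> n}. F J) = (\<Sum>k\<le>n. \<Sum>J\<in>{J. length J = k}. F J)"
proof -
  have eq: "{J :: 'n list. length J \<le> n} = (\<Union>k\<in>{..n}. {J. length J = k})" by auto
  show ?thesis unfolding eq by (subst sum.UNION_disjoint) auto
qed

lemma triangle_sum:
  "(\<Sum>l\<le>s. \<Sum>k\<le>l. f k (l - k)) = (\<Sum>k\<le>s. \<Sum>m\<le>s - k. (f k m :: 'r::comm_monoid_add))" for s :: nat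
  using sum.triangle_reindex_eq[of "\<lambda>k m. f k m" s]
  by (simp add: sum.Sigma) (intro sum.reindex_bij_witness[of _ "\<lambda>(k, m). (k + m, k)" "\<lambda>(l, k). (k, l - k)"]; auto)

text \<open>Pascal's rule in summed form: in the inductive step of a Leibniz formula the new
  derivation falls on the first or on the second factor, which are the two summands on the
  left.\<close>

lemma pascal_sum:
  fixes f :: "nat \<Rightarrow> nat \<Rightarrow> 'r::comm_ring_1"
  shows "(\<Sum>k\<le>l. of_nat (l choose k) * (f k (Suc (l - k)) + f (Suc k) (l - k))) =
    (\<Sum>k\<le>Suc l. of_nat (Suc l choose k) * f k (Suc l - k))"
proof -
  have "(\<Sum>k\<le>Suc l. of_nat (Suc l choose k) * f k (Suc l - k)) =
      f 0 (Suc l) + (\<Sum>k\<le>l. of_nat (Suc l choose Suc k) * f (Suc k) (l - k))"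
    by (subst sum.atMost_Suc_shift) simp
  also have "\<dots> = f 0 (Suc l) + (\<Sum>k\<le>l. of_nat (l choose Suc k) * f (Suc k) (l - k)) +
      (\<Sum>k\<le>l. of_nat (l choose k) * f (Suc k) (l - k))"
    by (simp add: sum.distrib distrib_right add.commute)
  also have "f 0 (Suc l) + (\<Sum>k\<le>l. of_nat (l choose Suc k) * f (Suc k) (l - k)) =
      (\<Sum>k\<le>Suc l. of_nat (l choose k) * f k (Suc l - k))"
    using sum.atMost_Suc_shift[of "\<lambda>k. of_nat (l choose k) * f k (Suc l - k)" l] by simp
  also have "\<dots> = (\<Sum>k\<le>l. of_nat (l choose k) * f k (Suc (l - k)))"
    by (simp add: Suc_diff_le binomial_eq_0)
  finally show ?thesis by (simp add: sum.distrib distrib_left)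
qed

definition symmetric :: "('n list \<Rightarrow> 'r) \<Rightarrow> bool" where
  "symmetric P \<longleftrightarrow> (\<forall>I J. mset I = mset J \<longrightarrow> P I = P J)"

lemma symmetricD: "symmetric P \<Longrightarrow> mset I = mset J \<Longrightarrow> P I = P J"
  unfolding symmetric_def by blast

lemma symmetric_Cons: "symmetric P \<Longrightarrow> symmetric (\<lambda>J. P (i # J))"
  unfolding symmetric_def by (metis mset.simps(2))

section \<open>Derivations and the derivative of a determinant\<close>

locale derivation =
  fixes E :: "'r \<Rightarrow> 'r :: {comm_ring_1, real_algebra_1}"
  assumes d_add: "E (a + b) = E a + E b"
    and d_mult: "E (a * b) = E a * b + a * E b"
    and d_scaleR: "E (r *\<^sub>R a) = r *\<^sub>R E a"
begin

lemma d_0 [simp]: "E 0 = 0"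
  using d_add[of 0 0] by simp

lemma d_1 [simp]: "E 1 = 0"
  using d_mult[of 1 1] by simp

lemma d_minus: "E (- a) = - E a"
  using d_add[of a "- a"] by (simp add: eq_neg_iff_add_eq_0 add.commute)

lemma d_diff: "E (a - b) = E a - E b"
  using d_add[of a "- b"] by (simp add: d_minus)

lemma d_sum: "E (\<Sum>i\<in>I. f i) = (\<Sum>i\<in>I. E (f i))"
  by (induction I rule: infinite_finite_induct) (simp_all add: d_add)

lemma d_of_nat [simp]: "E (of_nat n) = 0"
  by (induction n) (simp_all add: d_add)

lemma d_of_int [simp]: "E (of_int n) = 0"
  by (cases n) (simp_all add: d_minus d_diff del: of_nat_Suc)

lemma d_prod: "finite S \<Longrightarrow> E (\<Prod>i\<in>S. f i) = (\<Sum>k\<in>S. E (f k) * (\<Prod>i\<in>S - {k}. f i))"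
proof (induction S rule: finite_induct)
  case (insert x S)
  have "(\<Sum>k\<in>S. E (f k) * (\<Prod>i\<in>insert x S - {k}. f i)) = (\<Sum>k\<in>S. f x * (E (f k) * (\<Prod>i\<in>S - {k}. f i)))"
  proof (rule sum.cong[OF refl])
    fix k assume "k \<in> S"
    then have "insert x S - {k} = insert x (S - {k})" "x \<notin> S - {k}" using insert.hyps by auto
    then show "E (f k) * (\<Prod>i\<in>insert x S - {k}. f i) = f x * (E (f k) * (\<Prod>i\<in>S - {k}. f i))"
      using insert.hyps by (simp add: algebra_simps)
  qed
  then show ?case using insert by (simp add: d_mult sum_distrib_left)
qed simp

end

text \<open>Expand the determinant in row \<open>k\<close>: the terms with
  \<open>m \<noteq> k\<close> contain a repeated row.\<close>

lemma det_row_lincomb: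
  fixes A :: "'r::comm_ring_1 ^ 'n ^ 'n"
  shows "det (\<chi> i. if i = k then (\<Sum>m\<in>UNIV. c m *s A $ m) else A $ i) = c k * det A"
proof -
  have "det (\<chi> i. if i = k then (\<Sum>m\<in>UNIV. c m *s A $ m) else A $ i) =
      (\<Sum>m\<in>UNIV. det (\<chi> i. if i = k then c m *s A $ m else A $ i))"
    by (rule det_linear_row_sum[of UNIV k "\<lambda>i m. c m *s A $ m" "\<lambda>i. A $ i"]) simp
  also have "\<dots> = (\<Sum>m\<in>UNIV. c m * det (\<chi> i. if i = k then A $ m else A $ i))"
    by (simp add: det_row_mul[of k _ "\<lambda>i. A $ _" "\<lambda>i. A $ i"])
  also have "\<dots> = (\<Sum>m\<in>UNIV. if m = k then c k * det A else 0)"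
  proof (rule sum.cong[OF refl])
    fix m
    show "c m * det (\<chi> i. if i = k then A $ m else A $ i) = (if m = k then c k * det A else 0)"
    proof (cases "m = k")
      case True
      have "(\<chi> i. if i = k then A $ k else A $ i) = A" by (simp add: vec_eq_iff)
      then show ?thesis unfolding True by simp
    next
      case False
      have "det (\<chi> i. if i = k then A $ m else A $ i) = 0"
        using False by (intro det_identical_rows[of m k]) (auto simp: row_def vec_eq_iff)
      then show ?thesis using False by simp
    qed
  qed
  finally show ?thesis by simp
qed

text \<open>Jacobi's formula. The product rule differentiates one row at a time, and each
  differentiated row is a combination of the rows of \<open>A\<close> because \<open>A\<close> has
  the left inverse \<open>B\<close>.\<close>

lemma (in derivation) derivation_det:
  fixes A B :: "'r ^ 'n::finite ^ 'n"
  assumes BA: "\<And>i l. (\<Sum>m\<in>UNIV. B $ i $ m * A $ m $ l) = (if i = l then 1 else 0)"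
  shows "E (det A) = det A * (\<Sum>i\<in>UNIV. \<Sum>j\<in>UNIV. E (A $ i $ j) * B $ j $ i)"
proof -
  have "E (det A) = (\<Sum>p | p permutes (UNIV :: 'n set).
      of_int (sign p) * (\<Sum>k\<in>UNIV. E (A $ k $ p k) * (\<Prod>i\<in>UNIV - {k}. A $ i $ p i)))"
    by (simp add: det_def d_sum d_mult d_prod)
  also have "\<dots> = (\<Sum>k\<in>UNIV. \<Sum>p | p permutes (UNIV :: 'n set).
      of_int (sign p) * (E (A $ k $ p k) * (\<Prod>i\<in>UNIV - {k}. A $ i $ p i)))"
    by (simp add: sum_distrib_left sum.swap[of _ UNIV])
  also have "\<dots> = (\<Sum>k\<in>UNIV. det (\<chi> i. if i = k then (\<chi> j. E (A $ k $ j)) else A $ i))"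
  proof (rule sum.cong[OF refl])
    fix k
    have "E (A $ k $ p k) * (\<Prod>i\<in>UNIV - {k}. A $ i $ p i) =
        (\<Prod>i\<in>UNIV. (if i = k then (\<chi> j. E (A $ k $ j)) else A $ i) $ p i)" for p
      by (subst prod.remove[of UNIV k]) (auto intro!: prod.cong)
    then show "(\<Sum>p | p permutes (UNIV :: 'n set).
        of_int (sign p) * (E (A $ k $ p k) * (\<Prod>i\<in>UNIV - {k}. A $ i $ p i))) =
        det (\<chi> i. if i = k then (\<chi> j. E (A $ k $ j)) else A $ i)"
      by (simp add: det_def)
  qed
  also have "\<dots> = (\<Sum>k\<in>UNIV. (\<Sum>j\<in>UNIV. E (A $ k $ j) * B $ j $ k) * det A)"
  proof (rule sum.cong[OF refl])
    fix k
    \<comment> \<open>The coefficients are the entries of the differentiated row times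
      \<open>B\<close>; only the coefficient of row \<open>k\<close> survives in the
      determinant.\<close>
    have eq: "(\<chi> l. E (A $ k $ l)) = (\<Sum>m\<in>UNIV. (\<Sum>j\<in>UNIV. E (A $ k $ j) * B $ j $ m) *s A $ m)"
    proof (subst vec_eq_iff, intro allI)
      fix l
      have "(\<Sum>m\<in>UNIV. (\<Sum>j\<in>UNIV. E (A $ k $ j) * B $ j $ m) * A $ m $ l) =
          (\<Sum>j\<in>UNIV. E (A $ k $ j) * (\<Sum>m\<in>UNIV. B $ j $ m * A $ m $ l))"
        unfolding sum_distrib_right sum_distrib_left by (subst sum.swap) (simp add: mult.assoc)
      then show "(\<chi> l. E (A $ k $ l)) $ l = (\<Sum>m\<in>UNIV. (\<Sum>j\<in>UNIV. E (A $ k $ j) * B $ j $ m) *s A $ m) $ l"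
        by (simp add: BA if_distrib cong: if_cong)
    qed
    show "det (\<chi> i. if i = k then (\<chi> j. E (A $ k $ j)) else A $ i) = (\<Sum>j\<in>UNIV. E (A $ k $ j) * B $ j $ k) * det A"
      unfolding eq by (rule det_row_lincomb)
  qed
  finally show ?thesis by (simp add: sum_distrib_right sum_distrib_left mult.commute)
qed

section \<open>Leibniz formulas for iterated commuting derivations\<close>

locale derivations =
  fixes d :: "'n::finite \<Rightarrow> 'r \<Rightarrow> 'r :: {comm_ring_1, real_algebra_1}"
  assumes derivation: "derivation (d i)" and d_commute: "d i (d k a) = d k (d i a)"
begin

sublocale D: derivation "d i" for i by (rule derivation)

definition dl :: "'n list \<Rightarrow> 'r \<Rightarrow> 'r" where
  "dl J a = foldr d J a"

lemma dl_Nil [simp]: "dl [] a = a" and dl_Cons: "dl (i # J) a = d i (dl J a)"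
  by (simp_all add: dl_def)

lemma dl_append: "dl (I @ J) a = dl I (dl J a)"
  by (simp add: dl_def)

lemma d_dl: "d i (dl J a) = dl J (d i a)"
  by (induction J) (simp_all add: dl_Cons d_commute[of i])

lemma dl_mset: "mset I = mset J \<Longrightarrow> dl I a = dl J a"
proof -
  assume "mset I = mset J"
  then have "fold d (rev I) = fold d (rev J)"
    by (intro fold_multiset_equiv) (auto simp: fun_eq_iff d_commute)
  then show ?thesis by (simp add: dl_def foldr_conv_fold)
qed

lemma dl_add: "dl J (a + b) = dl J a + dl J b"
  by (induction J) (simp_all add: dl_Cons D.d_add)

lemma dl_0 [simp]: "dl J 0 = 0"
  by (induction J) (simp_all add: dl_Cons)

lemma dl_minus: "dl J (- a) = - dl J a"
  by (induction J) (simp_all add: dl_Cons D.d_minus)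

text \<open>Distributing the letters of \<open>L\<close> between the two factors selects a set of
  positions. As \<open>P\<close> is symmetric and all \<open>L\<close> of one length are summed,
  only the number \<open>k\<close> of letters that reach \<open>a\<close> matters, which accounts
  for the binomial coefficient.\<close>

lemma leibniz_inside:
  assumes "symmetric P"
  shows "(\<Sum>L\<in>{L. length L = l}. dl L (P L * a)) =
    (\<Sum>k\<le>l. of_nat (l choose k) *
      (\<Sum>J\<in>{J. length J = k}. \<Sum>K\<in>{K. length K = l - k}. dl K (P (J @ K)) * dl J a))"
  using assms
proof (induction l arbitrary: P)
  case (Suc l)
  define G where "G J K = dl K (P (J @ K)) * dl J a" for J K
  define S where "S k m = (\<Sum>J\<in>{J. length J = k}. \<Sum>K\<in>{K. length K = m}. G J K)" for k m
  have "(\<Sum>L\<in>{L. length L = Suc l}. dl L (P L * a)) =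
      (\<Sum>i\<in>UNIV. d i (\<Sum>L\<in>{L. length L = l}. dl L (P (i # L) * a)))"
    by (simp add: sum_lists_Suc dl_Cons D.d_sum)
  also have "\<dots> = (\<Sum>i\<in>UNIV. d i (\<Sum>k\<le>l. of_nat (l choose k) *
      (\<Sum>J\<in>{J. length J = k}. \<Sum>K\<in>{K. length K = l - k}. dl K (P (i # J @ K)) * dl J a)))"
    by (simp add: Suc.IH[OF symmetric_Cons[OF Suc.prems]])
  also have "\<dots> = (\<Sum>i\<in>UNIV. \<Sum>k\<le>l. of_nat (l choose k) *
      (\<Sum>J\<in>{J. length J = k}. \<Sum>K\<in>{K. length K = l - k}. G J (i # K) + G (i # J) K))"
  proof -
    have "P (i # J @ K) = P (J @ i # K)" for i J K
      by (rule symmetricD[OF Suc.prems]) simp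
    then have "d i (dl K (P (i # J @ K)) * dl J a) = G J (i # K) + G (i # J) K" for i J K
      by (simp add: G_def D.d_mult dl_Cons)
    then show ?thesis by (simp add: D.d_sum D.d_mult)
  qed
  also have "\<dots> = (\<Sum>k\<le>l. of_nat (l choose k) * (\<Sum>i\<in>UNIV.
      (\<Sum>J\<in>{J. length J = k}. \<Sum>K\<in>{K. length K = l - k}. G J (i # K) + G (i # J) K)))"
    by (subst sum.swap) (simp add: sum_distrib_left)
  also have "\<dots> = (\<Sum>k\<le>l. of_nat (l choose k) * (S k (Suc (l - k)) + S (Suc k) (l - k)))"
  proof -
    have "(\<Sum>i\<in>UNIV. (\<Sum>J\<in>{J. length J = k}. \<Sum>K\<in>{K. length K = m}. G J (i # K) + G (i # J) K)) =
        S k (Suc m) + S (Suc k) m" for k m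
      unfolding S_def sum_lists_Suc by (simp add: sum.distrib) (rule sum.swap)
    then show ?thesis by simp
  qed
  also have "\<dots> = (\<Sum>k\<le>Suc l. of_nat (Suc l choose k) * S k (Suc l - k))"
    by (rule pascal_sum)
  finally show ?case by (simp only: S_def G_def)
qed simp

text \<open>The same count with the coefficients standing in front: the letters in \<open>J\<close>
  differentiate \<open>a\<close>, those in \<open>K\<close> differentiate \<open>y\<close>.\<close>

lemma leibniz_outside:
  assumes "symmetric H"
  shows "(\<Sum>L\<in>{L. length L = l}. H L * dl L (y * a)) =
    (\<Sum>k\<le>l. of_nat (l choose k) *
      (\<Sum>J\<in>{J. length J = k}. \<Sum>K\<in>{K. length K = l - k}. H (J @ K) * dl K y * dl J a))"
  using assms
proof (induction l arbitrary: H y a)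
  case (Suc l)
  define G where "G J K = H (J @ K) * dl K y * dl J a" for J K
  define S where "S k m = (\<Sum>J\<in>{J. length J = k}. \<Sum>K\<in>{K. length K = m}. G J K)" for k m
  have "(\<Sum>L\<in>{L. length L = Suc l}. H L * dl L (y * a)) =
      (\<Sum>i\<in>UNIV. (\<Sum>L\<in>{L. length L = l}. H (i # L) * dl L (d i y * a)) +
        (\<Sum>L\<in>{L. length L = l}. H (i # L) * dl L (y * d i a)))"
    by (simp add: sum_lists_Suc dl_Cons d_dl D.d_mult dl_add distrib_left sum.distrib)
  also have "\<dots> = (\<Sum>i\<in>UNIV. \<Sum>k\<le>l. of_nat (l choose k) *
      (\<Sum>J\<in>{J. length J = k}. \<Sum>K\<in>{K. length K = l - k}. G J (i # K) + G (i # J) K))"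
  proof -
    have "H (i # J @ K) = H (J @ i # K)" for i J K
      by (rule symmetricD[OF Suc.prems]) simp
    then show ?thesis
      by (simp add: Suc.IH[OF symmetric_Cons[OF Suc.prems]] G_def dl_Cons d_dl sum.distrib distrib_left)
  qed
  also have "\<dots> = (\<Sum>k\<le>l. of_nat (l choose k) * (\<Sum>i\<in>UNIV.
      (\<Sum>J\<in>{J. length J = k}. \<Sum>K\<in>{K. length K = l - k}. G J (i # K) + G (i # J) K)))"
    by (subst sum.swap) (simp add: sum_distrib_left)
  also have "\<dots> = (\<Sum>k\<le>l. of_nat (l choose k) * (S k (Suc (l - k)) + S (Suc k) (l - k)))"
  proof -
    have "(\<Sum>i\<in>UNIV. (\<Sum>J\<in>{J. length J = k}. \<Sum>K\<in>{K. length K = m}. G J (i # K) + G (i # J) K)) =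
        S k (Suc m) + S (Suc k) m" for k m
      unfolding S_def sum_lists_Suc by (simp add: sum.distrib) (rule sum.swap)
    then show ?thesis by simp
  qed
  also have "\<dots> = (\<Sum>k\<le>Suc l. of_nat (Suc l choose k) * S k (Suc l - k))"
    by (rule pascal_sum)
  finally show ?case by (simp only: S_def G_def)
qed simp

text \<open>Normal form of the formal adjoint. Its coefficient at \<open>dl J a\<close> is, up to
  the sign (-1)^|J|, the Lie-Euler expression of the coefficients; this is why the Helmholtz-Sonin
  expressions are coefficients of an operator minus an adjoint.\<close>

lemma formal_adjoint_expand:
  assumes "symmetric P"
  shows "(\<Sum>L\<in>{L. length L \<le> s}. (-1) ^ length L * dl L (P L * a)) =
    (\<Sum>J\<in>{J. length J \<le> s}. (-1) ^ length J *
      (\<Sum>K\<in>{K. length K \<le> s - length J}. (-1) ^ length K *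
        of_nat ((length J + length K) choose length J) * dl K (P (J @ K))) * dl J a)"
proof -
  have "(\<Sum>L\<in>{L. length L \<le> s}. (-1) ^ length L * dl L (P L * a)) =
      (\<Sum>l\<le>s. (-1) ^ l * (\<Sum>L\<in>{L. length L = l}. dl L (P L * a)))"
    by (simp add: sum_lists_le sum_distrib_left)
  also have "\<dots> = (\<Sum>l\<le>s. \<Sum>k\<le>l. (-1) ^ (k + (l - k)) * (of_nat ((k + (l - k)) choose k) *
      (\<Sum>J\<in>{J. length J = k}. \<Sum>K\<in>{K. length K = l - k}. dl K (P (J @ K)) * dl J a)))"
    by (simp add: leibniz_inside[OF assms] sum_distrib_left)
  also have "\<dots> = (\<Sum>k\<le>s. \<Sum>m\<le>s - k. (-1) ^ (k + m) * (of_nat ((k + m) choose k) *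
      (\<Sum>J\<in>{J. length J = k}. \<Sum>K\<in>{K. length K = m}. dl K (P (J @ K)) * dl J a)))"
    by (rule triangle_sum)
  also have "\<dots> = (\<Sum>k\<le>s. \<Sum>J\<in>{J. length J = k}. \<Sum>m\<le>s - k. \<Sum>K\<in>{K. length K = m}.
      (-1) ^ (k + m) * (of_nat ((k + m) choose k) * (dl K (P (J @ K)) * dl J a)))"
    by (simp add: sum_distrib_left) (intro sum.cong refl, rule sum.swap)
  also have "\<dots> = (\<Sum>J\<in>{J. length J \<le> s}. (-1) ^ length J *
      (\<Sum>K\<in>{K. length K \<le> s - length J}. (-1) ^ length K *
        of_nat ((length J + length K) choose length J) * dl K (P (J @ K))) * dl J a)"
    by (simp add: sum_lists_le sum_distrib_left sum_distrib_right power_add mult.assoc)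
  finally show ?thesis .
qed

text \<open>Normal form of an operator preceded by multiplication with \<open>y\<close>. With
  \<open>y\<close> equal to a frame derivative of the immersion, this is the origin of the binomial
  coefficients and of the extra multi-index in the relations whose second lower index is one of the
  split coordinates.\<close>

lemma operator_product_expand:
  assumes "symmetric H"
  shows "(\<Sum>L\<in>{L. length L \<le> s}. H L * dl L (y * a)) =
    (\<Sum>K\<in>{K. length K \<le> s}. \<Sum>J\<in>{J. length J \<le> s - length K}.
      of_nat ((length J + length K) choose length J) * (H (J @ K) * dl K y * dl J a))"
proof -
  have "(\<Sum>L\<in>{L. length L \<le> s}. H L * dl L (y * a)) =
      (\<Sum>l\<le>s. \<Sum>k\<le>l. of_nat ((k + (l - k)) choose k) *
      (\<Sum>J\<in>{J. length J = k}. \<Sum>K\<in>{K. length K = l - k}. H (J @ K) * dl K y * dl J a))"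
    by (simp add: sum_lists_le leibniz_outside[OF assms])
  also have "\<dots> = (\<Sum>k\<le>s. \<Sum>m\<le>s - k. of_nat ((k + m) choose k) *
      (\<Sum>J\<in>{J. length J = k}. \<Sum>K\<in>{K. length K = m}. H (J @ K) * dl K y * dl J a))"
    by (rule triangle_sum)
  also have "\<dots> = (\<Sum>m\<le>s. \<Sum>k\<le>s - m. of_nat ((k + m) choose k) *
      (\<Sum>J\<in>{J. length J = k}. \<Sum>K\<in>{K. length K = m}. H (J @ K) * dl K y * dl J a))"
    by (simp add: sum.Sigma) (intro sum.reindex_bij_witness[of _ "\<lambda>(k, m). (m, k)" "\<lambda>(l, k). (k, l)"]; auto)
  also have "\<dots> = (\<Sum>m\<le>s. \<Sum>K\<in>{K. length K = m}. \<Sum>k\<le>s - m. \<Sum>J\<in>{J. length J = k}.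
      of_nat ((k + m) choose k) * (H (J @ K) * dl K y * dl J a))"
    unfolding sum_distrib_left
  proof (rule sum.cong[OF refl])
    fix m
    let ?f = "\<lambda>k J K. of_nat ((k + m) choose k) * (H (J @ K) * dl K y * dl J a)"
    have "(\<Sum>K\<in>{K. length K = m}. \<Sum>k\<le>s - m. \<Sum>J\<in>{J. length J = k}. ?f k J K) =
        (\<Sum>k\<le>s - m. \<Sum>K\<in>{K. length K = m}. \<Sum>J\<in>{J. length J = k}. ?f k J K)"
      by (rule sum.swap)
    also have "\<dots> = (\<Sum>k\<le>s - m. \<Sum>J\<in>{J. length J = k}. \<Sum>K\<in>{K. length K = m}. ?f k J K)"
      by (intro sum.cong refl sum.swap)
    finally show "(\<Sum>k\<le>s - m. \<Sum>J\<in>{J. length J = k}. \<Sum>K\<in>{K. length K = m}. ?f k J K) =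
        (\<Sum>K\<in>{K. length K = m}. \<Sum>k\<le>s - m. \<Sum>J\<in>{J. length J = k}. ?f k J K)" by (rule sym)
  qed
  finally show ?thesis by (simp add: sum_lists_le)
qed

end

subsection \<open>Formal adjoints\<close>

text \<open>The adjoint of a differential operator is recovered from the operator as a map, through its
  iterated commutators with the coordinate functions.  Hence it does not depend on the way in which
  the operator is written.\<close>

locale coordinates = derivations d
  for d :: "'n::finite \<Rightarrow> 'r \<Rightarrow> 'r :: {comm_ring_1, real_algebra_1}" +
  fixes x :: "'n \<Rightarrow> 'r"
  assumes d_x: "d i (x k) = (if i = k then 1 else 0)"
begin

definition ad :: "'n \<Rightarrow> ('r \<Rightarrow> 'r) \<Rightarrow> 'r \<Rightarrow> 'r" where
  "ad k P a = P (x k * a) - x k * P a"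

text \<open>In terms of symbols, \<open>ad k\<close> differentiates in the k-th covector component
  and \<open>P 1\<close> is the value at covector 0. Hence n commutators applied to 1 give n! times
  the symmetric coefficients of order n, and the outer derivations place these under the
  derivatives, as in the adjoint; sign and factorial are supplied in
  \<open>is_adjoint\<close>.\<close>

primrec adj_part :: "nat \<Rightarrow> ('r \<Rightarrow> 'r) \<Rightarrow> 'r \<Rightarrow> 'r" where
  "adj_part 0 P a = P 1 * a"
| "adj_part (Suc n) P a = (\<Sum>k\<in>UNIV. d k (adj_part n (ad k P) a))"

lemma adj_part_add: "adj_part n (\<lambda>a. P a + Q a) a = adj_part n P a + adj_part n Q a"
proof (induction n arbitrary: P Q)
  case (Suc n)
  have "ad k (\<lambda>a. P a + Q a) = (\<lambda>a. ad k P a + ad k Q a)" for k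
    by (simp add: ad_def fun_eq_iff algebra_simps)
  then show ?case by (simp add: Suc D.d_add sum.distrib)
qed (simp add: distrib_right)

lemma adj_part_lmult: "adj_part n (\<lambda>a. b * P a) a = adj_part n P (b * a)"
proof (induction n arbitrary: P)
  case (Suc n)
  have "ad k (\<lambda>a. b * P a) = (\<lambda>a. b * ad k P a)" for k
    by (simp add: ad_def fun_eq_iff algebra_simps)
  then show ?case by (simp add: Suc)
qed (simp add: mult_ac)

lemma adj_part_zero: "adj_part n (\<lambda>a. 0) a = 0"
  using adj_part_lmult[of n 0 "\<lambda>a. 0" a] adj_part_add[of n "\<lambda>a. 0" "\<lambda>a. 0" a] by simp

lemma adj_part_arg_add: "adj_part n P (a + b) = adj_part n P a + adj_part n P b"
  by (induction n arbitrary: P) (simp_all add: distrib_left D.d_add sum.distrib)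

lemma adj_part_mult: "adj_part n (\<lambda>a. b * a) a = (if n = 0 then b * a else 0)"
proof (cases n)
  case (Suc m)
  have "ad k (\<lambda>a. b * a) = (\<lambda>a. 0)" for k by (simp add: ad_def fun_eq_iff mult_ac)
  then show ?thesis by (simp add: Suc adj_part_zero)
qed simp

text \<open>The commutator of \<open>d i\<close> with multiplication by \<open>x k\<close> is 1 or
  0, so each of the n commutators may also consume the leading derivation; this gives the factor n.
  For n = 0 the last term has coefficient 0, and the truncated index there is harmless.\<close>

lemma adj_part_d:
  "adj_part n (\<lambda>a. d i (P a)) a =
    d i (adj_part n P a) - adj_part n P (d i a) + of_nat n * d i (adj_part (n - 1) P a)"
proof (induction n arbitrary: P)
  case 0
  then show ?case by (simp add: D.d_mult)
next
  case (Suc n)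
  have ad: "ad k (\<lambda>a. d i (P a)) = (\<lambda>a. d i (ad k P a) + (if k = i then P a else 0))" for k
    by (auto simp: ad_def fun_eq_iff D.d_mult D.d_diff d_x)
  have one: "adj_part n (\<lambda>a. if k = i then P a else 0) a = (if k = i then adj_part n P a else 0)" for k
    by (simp add: adj_part_zero)
  have step: "of_nat n * d k (d i (adj_part (n - 1) (ad k P) a)) = of_nat n * d i (d k (adj_part (n - 1) (ad k P) a))" for k
    by (simp add: d_commute)
  have "adj_part (Suc n) (\<lambda>a. d i (P a)) a =
      (\<Sum>k\<in>UNIV. d k (d i (adj_part n (ad k P) a) - adj_part n (ad k P) (d i a) +
        of_nat n * d i (adj_part (n - 1) (ad k P) a) + (if k = i then adj_part n P a else 0)))"
    by (simp add: ad adj_part_add Suc one)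
  also have "\<dots> = (\<Sum>k\<in>UNIV. d i (d k (adj_part n (ad k P) a)) - d k (adj_part n (ad k P) (d i a)) +
        of_nat n * d i (d k (adj_part (n - 1) (ad k P) a)) + (if k = i then d i (adj_part n P a) else 0))"
    by (intro sum.cong refl) (simp add: D.d_add D.d_diff D.d_mult d_commute[of i])
  also have "\<dots> = d i (adj_part (Suc n) P a) - adj_part (Suc n) P (d i a) +
      of_nat n * d i (\<Sum>k\<in>UNIV. d k (adj_part (n - 1) (ad k P) a)) + d i (adj_part n P a)"
    by (simp add: sum.distrib sum_subtractf D.d_sum sum_distrib_left)
  also have "of_nat n * d i (\<Sum>k\<in>UNIV. d k (adj_part (n - 1) (ad k P) a)) = of_nat n * d i (adj_part n P a)"
    by (cases n) simp_all
  finally show ?case by (simp add: algebra_simps)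
qed

text \<open>The alternating exponential series in the commutators, demanded to be stationary from
  some order on, uniformly in the argument. No convergence is involved, and uniqueness follows by
  comparing two partial sums.\<close>

definition is_adjoint :: "('r \<Rightarrow> 'r) \<Rightarrow> ('r \<Rightarrow> 'r) \<Rightarrow> bool" where
  "is_adjoint P Q \<longleftrightarrow> (\<exists>N. \<forall>n\<ge>N. \<forall>a. Q a = (\<Sum>m\<le>n. ((-1) ^ m / fact m) *\<^sub>R adj_part m P a))"

lemma is_adjoint_unique:
  assumes "is_adjoint P Q" "is_adjoint P Q'"
  shows "Q a = Q' a"
proof -
  obtain N where "\<forall>n\<ge>N. \<forall>a. Q a = (\<Sum>m\<le>n. ((-1) ^ m / fact m) *\<^sub>R adj_part m P a)"
    using assms(1) is_adjoint_def by blast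
  moreover obtain N' where "\<forall>n\<ge>N'. \<forall>a. Q' a = (\<Sum>m\<le>n. ((-1) ^ m / fact m) *\<^sub>R adj_part m P a)"
    using assms(2) is_adjoint_def by blast
  ultimately show ?thesis by (metis max.cobounded1 max.cobounded2)
qed

lemma is_adjoint_add:
  assumes "is_adjoint P Q" "is_adjoint P' Q'"
  shows "is_adjoint (\<lambda>a. P a + P' a) (\<lambda>a. Q a + Q' a)"
proof -
  obtain N where N: "\<forall>n\<ge>N. \<forall>a. Q a = (\<Sum>m\<le>n. ((-1) ^ m / fact m) *\<^sub>R adj_part m P a)"
    using assms(1) is_adjoint_def by blast
  obtain N' where N': "\<forall>n\<ge>N'. \<forall>a. Q' a = (\<Sum>m\<le>n. ((-1) ^ m / fact m) *\<^sub>R adj_part m P' a)"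
    using assms(2) is_adjoint_def by blast
  show ?thesis unfolding is_adjoint_def
  proof (intro exI[of _ "max N N'"] allI impI)
    fix n a assume n: "n \<ge> max N N'"
    have "Q a = (\<Sum>m\<le>n. ((-1) ^ m / fact m) *\<^sub>R adj_part m P a)" using N n by simp
    moreover have "Q' a = (\<Sum>m\<le>n. ((-1) ^ m / fact m) *\<^sub>R adj_part m P' a)" using N' n by simp
    ultimately show "Q a + Q' a = (\<Sum>m\<le>n. ((-1) ^ m / fact m) *\<^sub>R adj_part m (\<lambda>a. P a + P' a) a)"
      by (simp add: adj_part_add sum.distrib scaleR_add_right)
  qed
qed

lemma is_adjoint_mult: "is_adjoint (\<lambda>a. b * a) (\<lambda>a. b * a)"
  unfolding is_adjoint_def
proof (intro exI[of _ 0] allI impI)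
  fix n a
  have "(\<Sum>m\<le>n. ((-1) ^ m / fact m) *\<^sub>R adj_part m (\<lambda>a. b * a) a) = (\<Sum>m\<le>n. if m = 0 then b * a else 0)"
    by (intro sum.cong refl) (simp add: adj_part_mult)
  then show "b * a = (\<Sum>m\<le>n. ((-1) ^ m / fact m) *\<^sub>R adj_part m (\<lambda>a. b * a) a)" by simp
qed

lemma is_adjoint_lmult:
  assumes "is_adjoint P Q"
  shows "is_adjoint (\<lambda>a. b * P a) (\<lambda>a. Q (b * a))"
proof -
  obtain N where N: "\<forall>n\<ge>N. \<forall>a. Q a = (\<Sum>m\<le>n. ((-1) ^ m / fact m) *\<^sub>R adj_part m P a)"
    using assms(1) is_adjoint_def by blast
  then show ?thesis unfolding is_adjoint_def by (intro exI[of _ N]) (simp add: adj_part_lmult)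
qed

lemma is_adjoint_zero: "is_adjoint (\<lambda>a. 0) (\<lambda>a. 0)"
  using is_adjoint_mult[of 0] by simp

lemma is_adjoint_sum:
  "(\<And>i. i \<in> I \<Longrightarrow> is_adjoint (P i) (Q i)) \<Longrightarrow> is_adjoint (\<lambda>a. \<Sum>i\<in>I. P i a) (\<lambda>a. \<Sum>i\<in>I. Q i a)"
proof (induction I rule: infinite_finite_induct)
  case (insert i I)
  then show ?case using is_adjoint_add[of "P i" "Q i" "\<lambda>a. \<Sum>i\<in>I. P i a" "\<lambda>a. \<Sum>i\<in>I. Q i a"] by simp
qed (simp_all add: is_adjoint_zero)

text \<open>Weighted by (-1)^m / m!, the last term of \<open>adj_part_d\<close> becomes, after a
  shift of the index, the negative of the first one; the middle term alone survives.\<close>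

lemma is_adjoint_d:
  assumes "is_adjoint P Q"
  shows "is_adjoint (\<lambda>a. d i (P a)) (\<lambda>a. - Q (d i a))"
proof -
  obtain N where N: "\<forall>n\<ge>N. \<forall>a. Q a = (\<Sum>m\<le>n. ((-1) ^ m / fact m) *\<^sub>R adj_part m P a)"
    using assms(1) is_adjoint_def by blast
  show ?thesis unfolding is_adjoint_def
  \<comment> \<open>The shifted sum ends at \<open>n - 1\<close>, which must still be at least
    \<open>N\<close>.\<close>
  proof (intro exI[of _ "Suc N"] allI impI)
    fix n a assume n: "n \<ge> Suc N"
    then obtain k where k: "n = Suc k" "k \<ge> N" by (cases n) auto
    have scale: "((-1) ^ Suc m / fact (Suc m)) *\<^sub>R (of_nat (Suc m) * b) = - ((-1) ^ m / fact m) *\<^sub>R (b :: 'r)" for m b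
    proof -
      have "of_nat (Suc m) * b = real (Suc m) *\<^sub>R b"
        by (metis of_real_of_nat_eq scaleR_conv_of_real)
      then show ?thesis by (simp add: field_simps del: of_nat_Suc)
    qed
    have "(\<Sum>m\<le>n. ((-1) ^ m / fact m) *\<^sub>R (of_nat m * d i (adj_part (m - 1) P a))) =
        (\<Sum>m\<le>k. ((-1) ^ Suc m / fact (Suc m)) *\<^sub>R (of_nat (Suc m) * d i (adj_part m P a)))"
      unfolding k(1) by (subst sum.atMost_Suc_shift) simp
    also have "\<dots> = - d i (\<Sum>m\<le>k. ((-1) ^ m / fact m) *\<^sub>R adj_part m P a)"
      by (simp only: scale D.d_sum D.d_scaleR) (simp add: sum_negf)
    also have "\<dots> = - d i (Q a)" using N k by simp
    finally have 1: "(\<Sum>m\<le>n. ((-1) ^ m / fact m) *\<^sub>R (of_nat m * d i (adj_part (m - 1) P a))) = - d i (Q a)" .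
    have 2: "(\<Sum>m\<le>n. ((-1) ^ m / fact m) *\<^sub>R d i (adj_part m P a)) = d i (Q a)"
    proof -
      have "Q a = (\<Sum>m\<le>n. ((-1) ^ m / fact m) *\<^sub>R adj_part m P a)" using N n by simp
      then show ?thesis by (simp add: D.d_sum D.d_scaleR)
    qed
    have 3: "(\<Sum>m\<le>n. ((-1) ^ m / fact m) *\<^sub>R adj_part m P (d i a)) = Q (d i a)"
      using N[rule_format, of n "d i a"] n by simp
    show "- Q (d i a) = (\<Sum>m\<le>n. ((-1) ^ m / fact m) *\<^sub>R adj_part m (\<lambda>a. d i (P a)) a)"
      by (simp add: adj_part_d scaleR_add_right scaleR_diff_right sum.distrib sum_subtractf 1[simplified] 2 3)
  qed
qed

lemma is_adjoint_additive:
  assumes "is_adjoint P Q"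
  shows "Q (a + b) = Q a + Q b"
proof -
  obtain N where N: "\<forall>n\<ge>N. \<forall>a. Q a = (\<Sum>m\<le>n. ((-1) ^ m / fact m) *\<^sub>R adj_part m P a)"
    using assms(1) is_adjoint_def by blast
  then have "\<forall>a. Q a = (\<Sum>m\<le>N. ((-1) ^ m / fact m) *\<^sub>R adj_part m P a)" by blast
  then show ?thesis by (simp add: adj_part_arg_add scaleR_add_right sum.distrib)
qed

lemma is_adjoint_dl: "is_adjoint (dl J) (\<lambda>a. (-1) ^ length J * dl J a)"
proof (induction J)
  case Nil
  then show ?case using is_adjoint_mult[of 1] by simp
next
  case (Cons i J)
  show ?case using is_adjoint_d[OF Cons, of i] by (simp add: dl_Cons d_dl)
qed

lemma is_adjoint_operator:
  "is_adjoint (\<lambda>a. \<Sum>J\<in>S. P J * dl J a) (\<lambda>a. \<Sum>J\<in>S. (-1) ^ length J * dl J (P J * a))"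
  by (intro is_adjoint_sum is_adjoint_lmult is_adjoint_dl)

end

section \<open>Moving frames\<close>

text \<open>The \<open>g k\<close> are new independent variables: \<open>z\<close> is the inverse of
  their Jacobian matrix and \<open>Di\<close> witnesses that its determinant \<open>Dt\<close> is a
  unit. Along an immersion they are the components with index in the range of \<iota>.\<close>

locale frame = derivations d
  for d :: "'n::finite \<Rightarrow> 'r \<Rightarrow> 'r :: {comm_ring_1, real_algebra_1}" +
  fixes g :: "'n \<Rightarrow> 'r" and z :: "'n \<Rightarrow> 'n \<Rightarrow> 'r" and Dt Di :: 'r
  assumes zr: "(\<Sum>j\<in>UNIV. z j i * d j (g k)) = (if i = k then 1 else 0)"
    and zl: "(\<Sum>i\<in>UNIV. d j (g i) * z k i) = (if j = k then 1 else 0)"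
    and Dt: "Dt = det (\<chi> i j. d j (g i))" and Dt_inv: "Dt * Di = 1"
begin

text \<open>Differentiation with respect to \<open>g i\<close>; along an immersion it is the total
  derivative D_i of the quotient.\<close>

definition fd :: "'n \<Rightarrow> 'r \<Rightarrow> 'r" where
  "fd i a = (\<Sum>j\<in>UNIV. z j i * d j a)"

lemma derivation_fd: "derivation (fd i)"
proof
  fix a b r
  show "fd i (a + b) = fd i a + fd i b" by (simp add: fd_def D.d_add distrib_left sum.distrib)
  show "fd i (a * b) = fd i a * b + a * fd i b"
    by (simp add: fd_def D.d_mult distrib_left sum.distrib sum_distrib_left sum_distrib_right mult_ac)
  show "fd i (r *\<^sub>R a) = r *\<^sub>R fd i a" by (simp add: fd_def D.d_scaleR scaleR_sum_right)
qed

lemma fd_g: "fd i (g k) = (if i = k then 1 else 0)"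
  by (simp add: fd_def zr)

lemma d_eq_fd: "d j a = (\<Sum>p\<in>UNIV. d j (g p) * fd p a)"
proof -
  have "(\<Sum>p\<in>UNIV. d j (g p) * fd p a) = (\<Sum>l\<in>UNIV. (\<Sum>p\<in>UNIV. d j (g p) * z l p) * d l a)"
    unfolding fd_def sum_distrib_left sum_distrib_right by (subst sum.swap) (simp add: mult.assoc)
  then show ?thesis by (simp add: zl if_distrib[of "\<lambda>x. x * _"] cong: if_cong)
qed

lemma coefficients_0:
  assumes "\<And>m. (\<Sum>l\<in>UNIV. C l * d l (g m)) = 0"
  shows "C k = 0"
proof -
  have "C k = (\<Sum>l\<in>UNIV. C l * (\<Sum>m\<in>UNIV. d l (g m) * z k m))"
    by (simp add: zl if_distrib[of "\<lambda>x. _ * x"] cong: if_cong)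
  also have "\<dots> = (\<Sum>m\<in>UNIV. (\<Sum>l\<in>UNIV. C l * d l (g m)) * z k m)"
    unfolding sum_distrib_left sum_distrib_right by (subst sum.swap) (simp add: mult.assoc)
  finally show ?thesis by (simp add: assms)
qed

text \<open>The second-order parts cancel, so the bracket is a combination of the
  \<open>d l\<close>. It annihilates every \<open>g m\<close>, because the \<open>fd k (g m)\<close>
  are constants, and the Jacobian of \<open>g\<close> is invertible.\<close>

lemma fd_bracket_0: "fd i (fd k a) - fd k (fd i a) = 0"
proof -
  interpret fi: derivation "fd i" for i by (rule derivation_fd)
  define C where "C l = fd i (z l k) - fd k (z l i)" for l
  have exp: "fd i (fd k a) = (\<Sum>l\<in>UNIV. fd i (z l k) * d l a) + (\<Sum>l\<in>UNIV. \<Sum>j\<in>UNIV. z l k * (z j i * d j (d l a)))" for i k a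
  proof -
    have "fd i (fd k a) = (\<Sum>l\<in>UNIV. fd i (z l k) * d l a + z l k * fd i (d l a))"
      unfolding fd_def[of k a] by (simp add: fi.d_sum fi.d_mult)
    then show ?thesis by (simp add: sum.distrib fd_def[of i "d _ a"] sum_distrib_left)
  qed
  have diff: "fd i (fd k a) - fd k (fd i a) = (\<Sum>l\<in>UNIV. C l * d l a)" for a
  proof -
    have "(\<Sum>l\<in>UNIV. \<Sum>j\<in>UNIV. z l k * (z j i * d j (d l a))) = (\<Sum>j\<in>UNIV. \<Sum>l\<in>UNIV. z l k * (z j i * d j (d l a)))"
      by (rule sum.swap)
    also have "\<dots> = (\<Sum>l\<in>UNIV. \<Sum>j\<in>UNIV. z l i * (z j k * d j (d l a)))"
    proof (intro sum.cong refl)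
      fix j l show "z l k * (z j i * d j (d l a)) = z j i * (z l k * d l (d j a))"
        by (simp add: d_commute[of j l] mult_ac)
    qed
    finally have "(\<Sum>l\<in>UNIV. \<Sum>j\<in>UNIV. z l k * (z j i * d j (d l a))) = (\<Sum>l\<in>UNIV. \<Sum>j\<in>UNIV. z l i * (z j k * d j (d l a)))" .
    then show ?thesis by (simp add: exp C_def left_diff_distrib sum_subtractf)
  qed
  have "C l = 0" for l
    by (rule coefficients_0) (simp add: diff[symmetric] fd_g if_distrib[of "fd _"] cong: if_cong)
  then have "fd i (fd k a) - fd k (fd i a) = 0" unfolding diff by simp
  then show "fd i (fd k a) - fd k (fd i a) = 0" by this
qed

lemma fd_commute: "fd i (fd k a) = fd k (fd i a)"
  using fd_bracket_0[of i k a] by (rule right_minus_eq[THEN iffD1])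

sublocale F: derivations fd
  by (intro derivations.intro derivation_fd fd_commute)

text \<open>Jacobi's formula with inverse matrix \<open>z\<close>: the variation of the volume is
  the divergence, in the frame, of the variation of the independent variables.\<close>

lemma derivation_Dt:
  assumes E: "derivation E" "\<And>j a. E (d j a) = d j (E a)"
  shows "E Dt = Dt * (\<Sum>p\<in>UNIV. fd p (E (g p)))"
proof -
  interpret E: derivation E by (rule E(1))
  have "E (det (\<chi> i j. d j (g i))) = det (\<chi> i j. d j (g i)) *
      (\<Sum>i\<in>UNIV. \<Sum>j\<in>UNIV. E ((\<chi> i j. d j (g i)) $ i $ j) * (\<chi> j i. z j i) $ j $ i)"
  proof (rule E.derivation_det)
    fix i l
    have "(\<Sum>m\<in>UNIV. z i m * d l (g m)) = (if i = l then 1 else 0)"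
      using zl[of l i] by (auto simp: mult.commute)
    then show "(\<Sum>m\<in>UNIV. (\<chi> j i. z j i) $ i $ m * (\<chi> i j. d j (g i)) $ m $ l) = (if i = l then 1 else 0)"
      by simp
  qed
  then show ?thesis by (simp add: Dt E(2) fd_def mult.commute)
qed

text \<open>Written with frame derivatives, the derivatives of \<open>Dt\<close> and of
  \<open>z\<close> combine into frame derivatives of the product of \<open>z\<close> with the
  Jacobian, a constant matrix. Hence \<open>fd i\<close> is skew with respect to the weight
  \<open>Dt\<close>.\<close>

lemma piola: "(\<Sum>j\<in>UNIV. d j (Dt * z j i * a)) = Dt * fd i a"
proof -
  have "(\<Sum>j\<in>UNIV. d j Dt * z j i) = Dt * (\<Sum>j\<in>UNIV. \<Sum>p\<in>UNIV. fd p (d j (g p)) * z j i)"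
    by (simp add: derivation_Dt[OF derivation d_commute] sum_distrib_left sum_distrib_right mult_ac)
  moreover have "(\<Sum>j\<in>UNIV. d j (z j i)) = (\<Sum>j\<in>UNIV. \<Sum>p\<in>UNIV. d j (g p) * fd p (z j i))"
    by (rule sum.cong[OF refl]) (rule d_eq_fd)
  ultimately have "(\<Sum>j\<in>UNIV. d j Dt * z j i) + Dt * (\<Sum>j\<in>UNIV. d j (z j i)) =
      Dt * (\<Sum>j\<in>UNIV. \<Sum>p\<in>UNIV. fd p (z j i * d j (g p)))"
    by (simp add: F.D.d_mult sum.distrib distrib_left mult_ac)
  also have "(\<Sum>j\<in>UNIV. \<Sum>p\<in>UNIV. fd p (z j i * d j (g p))) = (\<Sum>p\<in>UNIV. fd p (\<Sum>j\<in>UNIV. z j i * d j (g p)))"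
    by (subst sum.swap) (simp add: F.D.d_sum)
  also have "\<dots> = 0" by (simp add: zr if_distrib[of "fd _"] cong: if_cong)
  finally have 0: "(\<Sum>j\<in>UNIV. d j Dt * z j i) + Dt * (\<Sum>j\<in>UNIV. d j (z j i)) = 0" by simp
  have "(\<Sum>j\<in>UNIV. d j (Dt * z j i * a)) =
      ((\<Sum>j\<in>UNIV. d j Dt * z j i) + Dt * (\<Sum>j\<in>UNIV. d j (z j i))) * a + Dt * fd i a"
    by (simp add: D.d_mult fd_def sum.distrib sum_distrib_left sum_distrib_right algebra_simps)
  then show ?thesis by (simp add: 0)
qed

text \<open>For a variation \<open>E\<close> of the immersion, subtracting the part tangent to the orbits of the
  reparametrisations leaves a derivation that commutes with the frame.\<close>

definition char_der :: "('r \<Rightarrow> 'r) \<Rightarrow> 'r \<Rightarrow> 'r" where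
  "char_der E a = E a - (\<Sum>p\<in>UNIV. E (g p) * fd p a)"

text \<open>\<open>E\<close> commutes with the \<open>d j\<close> but not with the coefficients
  \<open>z\<close> of the frame. Differentiating the relation between \<open>z\<close> and the
  Jacobian determines \<open>E z\<close>, and its contribution is exactly absorbed by the subtracted
  tangential part.\<close>

lemma char_der_fd:
  assumes E: "derivation E" "\<And>j a. E (d j a) = d j (E a)"
  shows "char_der E (fd i a) = fd i (char_der E a)"
proof -
  interpret E: derivation E by (rule E(1))
  have dz: "(\<Sum>j\<in>UNIV. E (z j i) * d j (g p)) = - fd i (E (g p))" for p
  proof -
    have "E (\<Sum>j\<in>UNIV. z j i * d j (g p)) = 0" by (simp add: zr)
    then have "(\<Sum>j\<in>UNIV. E (z j i) * d j (g p)) + fd i (E (g p)) = 0"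
      by (simp add: E.d_sum E.d_mult E(2) fd_def sum.distrib)
    then show ?thesis by (simp add: eq_neg_iff_add_eq_0)
  qed
  have "E (fd i a) = fd i (E a) + (\<Sum>j\<in>UNIV. E (z j i) * d j a)"
    by (simp add: fd_def E.d_sum E.d_mult E(2) sum.distrib)
  also have "(\<Sum>j\<in>UNIV. E (z j i) * d j a) = (\<Sum>j\<in>UNIV. \<Sum>p\<in>UNIV. E (z j i) * d j (g p) * fd p a)"
    by (subst d_eq_fd) (simp add: sum_distrib_left mult.assoc)
  also have "\<dots> = (\<Sum>p\<in>UNIV. - fd i (E (g p)) * fd p a)"
    by (subst sum.swap) (simp add: dz sum_distrib_right[symmetric])
  finally show ?thesis
    by (simp add: char_der_def F.D.d_diff F.D.d_sum F.D.d_mult sum.distrib sum_negf fd_commute)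
qed

lemma char_der_fdl:
  assumes E: "derivation E" "\<And>j a. E (d j a) = d j (E a)"
  shows "char_der E (F.dl J a) = F.dl J (char_der E a)"
  by (induction J) (simp_all add: F.dl_Cons char_der_fd[OF E])

lemma char_der_g: "char_der E (g k) = 0"
  by (simp add: char_der_def fd_g if_distrib[of "\<lambda>x. _ * x"] cong: if_cong)

end

locale frame_coordinates = frame d g z Dt Di + coordinates d x
  for d :: "'n::finite \<Rightarrow> 'r \<Rightarrow> 'r :: {comm_ring_1, real_algebra_1}" and g z Dt Di x
begin

text \<open>The adjoint with respect to the density \<open>Dt\<close>: the ordinary adjoint
  conjugated by multiplication with \<open>Dt\<close>.\<close>

definition frame_adjoint :: "('r \<Rightarrow> 'r) \<Rightarrow> ('r \<Rightarrow> 'r) \<Rightarrow> bool" where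
  "frame_adjoint P Q \<longleftrightarrow> is_adjoint (\<lambda>a. Dt * P a) (\<lambda>a. Dt * Q a)"

lemma Di_Dt: "Di * (Dt * a) = a"
  by (metis Dt_inv mult.assoc mult.commute mult_1)

lemma frame_adjoint_mult: "frame_adjoint (\<lambda>a. b * a) (\<lambda>a. b * a)"
  unfolding frame_adjoint_def using is_adjoint_mult[of "Dt * b"] by (simp add: mult.assoc)

lemma frame_adjoint_lmult: "frame_adjoint P Q \<Longrightarrow> frame_adjoint (\<lambda>a. b * P a) (\<lambda>a. Q (b * a))"
  unfolding frame_adjoint_def using is_adjoint_lmult[of "\<lambda>a. Dt * P a" "\<lambda>a. Dt * Q a" b]
  by (simp add: mult.left_commute)

lemma frame_adjoint_add:
  "frame_adjoint P Q \<Longrightarrow> frame_adjoint P' Q' \<Longrightarrow> frame_adjoint (\<lambda>a. P a + P' a) (\<lambda>a. Q a + Q' a)"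
  unfolding frame_adjoint_def
  using is_adjoint_add[of "\<lambda>a. Dt * P a" "\<lambda>a. Dt * Q a" "\<lambda>a. Dt * P' a" "\<lambda>a. Dt * Q' a"]
  by (simp add: distrib_left)

lemma frame_adjoint_sum:
  "(\<And>i. i \<in> I \<Longrightarrow> frame_adjoint (P i) (Q i)) \<Longrightarrow> frame_adjoint (\<lambda>a. \<Sum>i\<in>I. P i a) (\<lambda>a. \<Sum>i\<in>I. Q i a)"
  unfolding frame_adjoint_def
  using is_adjoint_sum[of I "\<lambda>i a. Dt * P i a" "\<lambda>i a. Dt * Q i a"] by (simp add: sum_distrib_left)

lemma frame_adjoint_additive:
  assumes "frame_adjoint P Q"
  shows "Q (a + b) = Q a + Q b"
proof -
  have "Dt * Q (a + b) = Dt * (Q a + Q b)"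
    using is_adjoint_additive[OF assms[unfolded frame_adjoint_def]] by (simp add: distrib_left)
  then show ?thesis by (metis Di_Dt)
qed

lemma frame_adjoint_arg_0: "frame_adjoint P Q \<Longrightarrow> Q 0 = 0"
  using frame_adjoint_additive[of P Q 0 0] by simp

lemma frame_adjoint_arg_sum:
  assumes "frame_adjoint P Q"
  shows "Q (\<Sum>i\<in>I. f i) = (\<Sum>i\<in>I. Q (f i))"
  by (induction I rule: infinite_finite_induct)
     (simp_all add: frame_adjoint_additive[OF assms] frame_adjoint_arg_0[OF assms])

lemma frame_adjoint_minus:
  assumes "frame_adjoint P Q"
  shows "frame_adjoint (\<lambda>a. - P a) (\<lambda>a. - Q a)"
proof -
  have "Q (- a) = - Q a" for a
    using frame_adjoint_additive[OF assms, of a "- a"] frame_adjoint_arg_0[OF assms]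
    by (simp add: eq_neg_iff_add_eq_0 add.commute)
  then show ?thesis using frame_adjoint_lmult[OF assms, of "- 1"] by simp
qed

text \<open>Since \<open>Dt\<close> is a unit, the ordinary adjoint of \<open>P\<close> can be
  recovered from the weighted one. Composing with each \<open>Dt * z j i * d j\<close> and summing
  over \<open>j\<close> brings in exactly the divergence of Piola's identity.\<close>

lemma frame_adjoint_fd:
  assumes "frame_adjoint P Q"
  shows "frame_adjoint (\<lambda>a. fd i (P a)) (\<lambda>a. - Q (fd i a))"
proof -
  have "is_adjoint P (\<lambda>a. Dt * Q (Di * a))"
    using is_adjoint_lmult[OF assms[unfolded frame_adjoint_def], of Di] by (simp add: Di_Dt)
  then have "is_adjoint (\<lambda>a. \<Sum>j\<in>UNIV. Dt * z j i * d j (P a))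
      (\<lambda>a. \<Sum>j\<in>UNIV. - (Dt * Q (Di * d j (Dt * z j i * a))))"
    by (intro is_adjoint_sum is_adjoint_lmult is_adjoint_d)
  moreover have "(\<Sum>j\<in>UNIV. Dt * z j i * d j (P a)) = Dt * fd i (P a)" for a
    by (simp add: fd_def sum_distrib_left mult.assoc)
  moreover have "(\<Sum>j\<in>UNIV. - (Dt * Q (Di * d j (Dt * z j i * a)))) = Dt * - Q (fd i a)" for a
  proof -
    have "(\<Sum>j\<in>UNIV. - (Dt * Q (Di * d j (Dt * z j i * a)))) =
        - (Dt * Q (Di * (\<Sum>j\<in>UNIV. d j (Dt * z j i * a))))"
      by (simp add: sum_negf sum_distrib_left frame_adjoint_arg_sum[OF assms])
    then show ?thesis by (simp add: piola Di_Dt)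
  qed
  ultimately show ?thesis unfolding frame_adjoint_def by simp
qed

lemma frame_adjoint_fdl_mult: "frame_adjoint (\<lambda>a. F.dl J (b * a)) (\<lambda>a. (-1) ^ length J * (b * F.dl J a))"
proof (induction J)
  case Nil
  then show ?case using frame_adjoint_mult[of b] by simp
next
  case (Cons i J)
  show ?case using frame_adjoint_fd[OF Cons, of i] by (simp add: F.dl_Cons F.d_dl)
qed

lemma frame_adjoint_operator:
  "frame_adjoint (\<lambda>a. \<Sum>J\<in>S. P J * F.dl J (b * a)) (\<lambda>a. b * (\<Sum>J\<in>S. (-1) ^ length J * F.dl J (P J * a)))"
  using frame_adjoint_sum[of S "\<lambda>J a. P J * F.dl J (b * a)" "\<lambda>J a. (-1) ^ length J * (b * F.dl J (P J * a))",
      OF frame_adjoint_lmult[OF frame_adjoint_fdl_mult]]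
  by (simp add: sum_distrib_left mult.left_commute)

end

subsection \<open>Helmholtz operators\<close>

text \<open>\<open>P A B\<close> stands for the derivatives of component A of \<T> with respect to
  the jet variables of B, \<open>R A B\<close> for those of T with respect to the quotient
  variables, both along the immersion \<open>h\<close>. Accordingly \<open>lin\<close>,
  \<open>Lam\<close> are linearisations, \<open>lint\<close>, \<open>Lamt\<close> their formal
  adjoints, and \<open>hv\<close>, \<open>hq\<close> the two kinds of Helmholtz-Sonin
  expressions.\<close>

locale helmholtz_frame = frame_coordinates d g z Dt Di x
  for d :: "'n::finite \<Rightarrow> 'r \<Rightarrow> 'r :: {comm_ring_1, real_algebra_1}" and g z Dt Di x +
  fixes \<iota> :: "'n \<Rightarrow> 'a::finite" and h T :: "'a \<Rightarrow> 'r"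
    and R P :: "'a \<Rightarrow> 'a \<Rightarrow> 'n list \<Rightarrow> 'r" and s :: nat
  assumes inj: "inj \<iota>" and R_sym: "symmetric (R A B)" and P_sym: "symmetric (P A B)"
begin

definition lin :: "'a \<Rightarrow> 'a \<Rightarrow> 'r \<Rightarrow> 'r" where
  "lin A B a = (\<Sum>J\<in>{J. length J \<le> s}. P A B J * dl J a)"

definition lint :: "'a \<Rightarrow> 'a \<Rightarrow> 'r \<Rightarrow> 'r" where
  "lint A B a = (\<Sum>J\<in>{J. length J \<le> s}. (-1) ^ length J * dl J (P A B J * a))"

definition Lam :: "'a \<Rightarrow> 'a \<Rightarrow> 'r \<Rightarrow> 'r" where
  "Lam A B a = (\<Sum>J\<in>{J. length J \<le> s}. R A B J * F.dl J a)"

definition Lamt :: "'a \<Rightarrow> 'a \<Rightarrow> 'r \<Rightarrow> 'r" where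
  "Lamt A B a = (\<Sum>J\<in>{J. length J \<le> s}. (-1) ^ length J * F.dl J (R A B J * a))"

definition Theta :: "'a \<Rightarrow> 'a \<Rightarrow> 'r \<Rightarrow> 'r" where
  "Theta A B a = Lam A B a - Lamt B A a"

definition hv :: "'a \<Rightarrow> 'a \<Rightarrow> 'n list \<Rightarrow> 'r" where
  "hv A B J = P A B J - (-1) ^ length J * (\<Sum>K\<in>{K. length K \<le> s - length J}. (-1) ^ length K *
     of_nat ((length J + length K) choose length J) * dl K (P B A (J @ K)))"

definition hq :: "'a \<Rightarrow> 'a \<Rightarrow> 'n list \<Rightarrow> 'r" where
  "hq A B J = R A B J - (-1) ^ length J * (\<Sum>K\<in>{K. length K \<le> s - length J}. (-1) ^ length K *
     of_nat ((length J + length K) choose length J) * F.dl K (R B A (J @ K)))"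

lemma lin_lint_expand: "lin A B a - lint B A a = (\<Sum>J\<in>{J. length J \<le> s}. hv A B J * dl J a)"
  unfolding lin_def lint_def formal_adjoint_expand[OF P_sym] sum_subtractf[symmetric]
  by (intro sum.cong refl) (simp add: hv_def left_diff_distrib)

lemma Theta_expand: "Theta A B a = (\<Sum>J\<in>{J. length J \<le> s}. hq A B J * F.dl J a)"
  unfolding Theta_def Lam_def Lamt_def F.formal_adjoint_expand[OF R_sym] sum_subtractf[symmetric]
  by (intro sum.cong refl) (simp add: hq_def left_diff_distrib)

lemma symmetric_hv: "symmetric (hv A B)"
  unfolding symmetric_def
proof (intro allI impI)
  fix I J :: "'n list" assume eq: "mset I = mset J"
  have len: "length I = length J" by (rule mset_eq_length[OF eq])
  have "P A B I = P A B J" by (rule symmetricD[OF P_sym eq])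
  moreover have "P B A (I @ K) = P B A (J @ K)" for K
    by (rule symmetricD[OF P_sym]) (simp add: eq)
  ultimately show "hv A B I = hv A B J" by (simp add: hv_def len)
qed

lemma symmetric_hq: "symmetric (hq A B)"
  unfolding symmetric_def
proof (intro allI impI)
  fix I J :: "'n list" assume eq: "mset I = mset J"
  have len: "length I = length J" by (rule mset_eq_length[OF eq])
  have "R A B I = R A B J" by (rule symmetricD[OF R_sym eq])
  moreover have "R B A (I @ K) = R B A (J @ K)" for K
    by (rule symmetricD[OF R_sym]) (simp add: eq)
  ultimately show "hq A B I = hq A B J" by (simp add: hq_def len)
qed

lemma Lam_0 [simp]: "Lam A B 0 = 0" and lin_0 [simp]: "lin A B 0 = 0"
  by (simp_all add: Lam_def lin_def)

lemma Lam_minus: "Lam A B (- a) = - Lam A B a"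
  by (simp add: Lam_def F.dl_minus sum_negf)

lemma is_adjoint_lin: "is_adjoint (lin A B) (lint A B)"
  unfolding lin_def[abs_def] lint_def[abs_def] by (rule is_adjoint_operator)

lemma frame_adjoint_Lam: "frame_adjoint (\<lambda>a. Lam A B (b * a)) (\<lambda>a. b * Lamt A B a)"
  unfolding Lam_def Lamt_def by (rule frame_adjoint_operator)

text \<open>\<open>lint\<close> is written in the derivations \<open>d\<close>, \<open>Q\<close> in
  the frame. Both are adjoint to the same map, so uniqueness identifies them without any conversion
  of coefficients.\<close>

lemma lintI:
  assumes "\<And>a. lin A B a = Dt * P' a" "frame_adjoint P' Q"
  shows "lint A B a = Dt * Q a"
proof -
  have "is_adjoint (lin A B) (\<lambda>a. Dt * Q a)"
    using assms(2) by (simp add: frame_adjoint_def assms(1)[abs_def])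
  then show ?thesis using is_adjoint_unique[OF is_adjoint_lin] by blast
qed

end

text \<open>The linearised equations for an arbitrary variation \<open>v\<close>. The difference
  under \<open>Lam\<close> is the transversal part of \<open>v\<close>; the divergence collects the
  variation of the determinant and the transport of T along the tangential part. The second equation
  is the first variation of \<T>_p = - y^\<sigma>_p \<T>_\<sigma>.\<close>

locale helmholtz_reduction = helmholtz_frame +
  assumes lin_sigma: "\<And>v \<sigma>. \<sigma> \<notin> range \<iota> \<Longrightarrow> (\<Sum>B\<in>UNIV. lin \<sigma> B (v B)) =
      Dt * ((\<Sum>p\<in>UNIV. fd p (v (\<iota> p) * T \<sigma>)) +
        (\<Sum>\<nu>\<in>- range \<iota>. Lam \<sigma> \<nu> (v \<nu> - (\<Sum>p\<in>UNIV. v (\<iota> p) * fd p (h \<nu>)))))"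
    and lin_iota: "\<And>v p. (\<Sum>B\<in>UNIV. lin (\<iota> p) B (v B)) =
      - (\<Sum>\<sigma>\<in>- range \<iota>. fd p (h \<sigma>) * (\<Sum>B\<in>UNIV. lin \<sigma> B (v B))) -
      Dt * (\<Sum>\<sigma>\<in>- range \<iota>. (fd p (v \<sigma> - (\<Sum>q\<in>UNIV. v (\<iota> q) * fd q (h \<sigma>))) +
        (\<Sum>q\<in>UNIV. v (\<iota> q) * fd q (fd p (h \<sigma>)))) * T \<sigma>)"
begin

lemma sum_lin_single: "(\<Sum>B\<in>UNIV. lin A B (if B = C then a else 0)) = lin A C a"
proof -
  have "(\<Sum>B\<in>UNIV. lin A B (if B = C then a else 0)) = (\<Sum>B\<in>UNIV. if B = C then lin A C a else 0)"
    by (intro sum.cong) auto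
  then show ?thesis by simp
qed

lemma iota_neq: "\<nu> \<notin> range \<iota> \<Longrightarrow> \<iota> p \<noteq> \<nu>"
  by auto

lemma sum_iota_single: "(\<Sum>q\<in>UNIV. (if \<iota> q = \<iota> p then a else 0) * f q) = a * (f p :: 'b)"
proof -
  have "(\<Sum>q\<in>UNIV. (if \<iota> q = \<iota> p then a else 0) * f q) = (\<Sum>q\<in>UNIV. if q = p then a * f p else 0)"
    by (intro sum.cong) (auto simp: inj_eq[OF inj])
  then show ?thesis by simp
qed

lemma lin_sn:
  assumes "\<sigma> \<notin> range \<iota>" "\<nu> \<notin> range \<iota>"
  shows "lin \<sigma> \<nu> a = Dt * Lam \<sigma> \<nu> a"
proof -
  have "(\<Sum>\<mu>\<in>- range \<iota>. Lam \<sigma> \<mu> (if \<mu> = \<nu> then a else 0)) = (\<Sum>\<mu>\<in>- range \<iota>. if \<mu> = \<nu> then Lam \<sigma> \<nu> a else 0)"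
    by (intro sum.cong) auto
  then show ?thesis
    using lin_sigma[OF assms(1), of "\<lambda>B. if B = \<nu> then a else 0"] assms(2)
    by (simp add: sum_lin_single iota_neq)
qed

lemma lin_sp:
  assumes "\<sigma> \<notin> range \<iota>"
  shows "lin \<sigma> (\<iota> p) a = Dt * (fd p (a * T \<sigma>) - (\<Sum>\<nu>\<in>- range \<iota>. Lam \<sigma> \<nu> (fd p (h \<nu>) * a)))"
proof -
  have "(\<Sum>q\<in>UNIV. fd q ((if \<iota> q = \<iota> p then a else 0) * T \<sigma>)) = (\<Sum>q\<in>UNIV. if q = p then fd p (a * T \<sigma>) else 0)"
    by (intro sum.cong) (auto simp: inj_eq[OF inj])
  moreover have "(\<Sum>\<mu>\<in>- range \<iota>. Lam \<sigma> \<mu> ((if \<mu> = \<iota> p then a else 0) - (\<Sum>q\<in>UNIV. (if \<iota> q = \<iota> p then a else 0) * fd q (h \<mu>)))) =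
      (\<Sum>\<mu>\<in>- range \<iota>. - Lam \<sigma> \<mu> (fd p (h \<mu>) * a))"
    by (intro sum.cong) (auto simp: sum_iota_single Lam_minus mult.commute[of a])
  ultimately show ?thesis
    using lin_sigma[OF assms(1), of "\<lambda>B. if B = \<iota> p then a else 0"]
    by (simp add: sum_lin_single sum_negf)
qed

lemma lin_pn:
  assumes "\<nu> \<notin> range \<iota>"
  shows "lin (\<iota> p) \<nu> a = Dt * (- (\<Sum>\<sigma>\<in>- range \<iota>. fd p (h \<sigma>) * Lam \<sigma> \<nu> a) - T \<nu> * fd p a)"
proof -
  have "(\<Sum>\<sigma>\<in>- range \<iota>. fd p (if \<sigma> = \<nu> then a else 0) * T \<sigma>) = (\<Sum>\<sigma>\<in>- range \<iota>. if \<sigma> = \<nu> then fd p a * T \<nu> else 0)"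
    by (intro sum.cong) auto
  moreover have "(\<Sum>\<sigma>\<in>- range \<iota>. fd p (h \<sigma>) * lin \<sigma> \<nu> a) = Dt * (\<Sum>\<sigma>\<in>- range \<iota>. fd p (h \<sigma>) * Lam \<sigma> \<nu> a)"
    by (simp add: sum_distrib_left lin_sn assms mult.left_commute)
  ultimately show ?thesis
    using lin_iota[of p "\<lambda>B. if B = \<nu> then a else 0"] assms
    by (simp add: sum_lin_single iota_neq right_diff_distrib mult.commute)
qed

lemma lin_pq:
  "lin (\<iota> p) (\<iota> q) a = Dt * ((\<Sum>\<sigma>\<in>- range \<iota>. T \<sigma> * (fd q (h \<sigma>) * fd p a) - fd p (h \<sigma>) * fd q (a * T \<sigma>)) +
    (\<Sum>\<sigma>\<in>- range \<iota>. fd p (h \<sigma>) * (\<Sum>\<nu>\<in>- range \<iota>. Lam \<sigma> \<nu> (fd q (h \<nu>) * a))))"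
proof -
  have 1: "(\<Sum>\<sigma>\<in>- range \<iota>. (fd p ((if \<sigma> = \<iota> q then a else 0) - (\<Sum>r\<in>UNIV. (if \<iota> r = \<iota> q then a else 0) * fd r (h \<sigma>))) +
        (\<Sum>r\<in>UNIV. (if \<iota> r = \<iota> q then a else 0) * fd r (fd p (h \<sigma>)))) * T \<sigma>) =
      (\<Sum>\<sigma>\<in>- range \<iota>. - (T \<sigma> * (fd q (h \<sigma>) * fd p a)))"
  proof (intro sum.cong refl)
    fix \<sigma> assume "\<sigma> \<in> - range \<iota>"
    then have "\<sigma> \<noteq> \<iota> q" by auto
    then show "(fd p ((if \<sigma> = \<iota> q then a else 0) - (\<Sum>r\<in>UNIV. (if \<iota> r = \<iota> q then a else 0) * fd r (h \<sigma>))) +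
        (\<Sum>r\<in>UNIV. (if \<iota> r = \<iota> q then a else 0) * fd r (fd p (h \<sigma>)))) * T \<sigma> = - (T \<sigma> * (fd q (h \<sigma>) * fd p a))"
      by (simp only: sum_iota_single if_False)
         (simp add: F.D.d_minus F.D.d_mult fd_commute[of q p] algebra_simps)
  qed
  have 2: "(\<Sum>\<sigma>\<in>- range \<iota>. fd p (h \<sigma>) * lin \<sigma> (\<iota> q) a) =
      Dt * (\<Sum>\<sigma>\<in>- range \<iota>. fd p (h \<sigma>) * (fd q (a * T \<sigma>) - (\<Sum>\<nu>\<in>- range \<iota>. Lam \<sigma> \<nu> (fd q (h \<nu>) * a))))"
    unfolding sum_distrib_left by (intro sum.cong refl) (simp add: lin_sp mult.left_commute)
  show ?thesis
    using lin_iota[of p "\<lambda>B. if B = \<iota> q then a else 0"]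
    unfolding sum_lin_single 1 2
    by (simp add: right_diff_distrib sum_subtractf sum_negf distrib_left)
qed

lemma H_sn:
  assumes "\<sigma> \<notin> range \<iota>" "\<nu> \<notin> range \<iota>"
  shows "lin \<sigma> \<nu> a - lint \<nu> \<sigma> a = Dt * Theta \<sigma> \<nu> a"
proof -
  have "lint \<nu> \<sigma> a = Dt * Lamt \<nu> \<sigma> a"
    by (rule lintI[OF lin_sn[OF assms(2,1)]]) (use frame_adjoint_Lam[of \<nu> \<sigma> 1] in simp)
  then show ?thesis by (simp add: lin_sn[OF assms] Theta_def right_diff_distrib)
qed

text \<open>The operator and the adjoint each contribute \<open>Dt * fd p (T \<sigma> * a)\<close>.
  These are the only terms in which \<open>T\<close> itself occurs, and they cancel; each remaining
  \<open>Lam\<close> meets its \<open>Lamt\<close>.\<close>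

lemma H_sp:
  assumes "\<sigma> \<notin> range \<iota>"
  shows "lin \<sigma> (\<iota> p) a - lint (\<iota> p) \<sigma> a = - (Dt * (\<Sum>\<nu>\<in>- range \<iota>. Theta \<sigma> \<nu> (fd p (h \<nu>) * a)))"
proof -
  have "lint (\<iota> p) \<sigma> a = Dt * ((\<Sum>\<nu>\<in>- range \<iota>. - Lamt \<nu> \<sigma> (fd p (h \<nu>) * a)) + fd p (T \<sigma> * a))"
  proof (rule lintI)
    show "lin (\<iota> p) \<sigma> a = Dt * ((\<Sum>\<nu>\<in>- range \<iota>. - (fd p (h \<nu>) * Lam \<nu> \<sigma> a)) + - (T \<sigma> * fd p a))" for a
      by (simp add: lin_pn[OF assms] sum_negf)
    have 1: "frame_adjoint (Lam \<nu> \<sigma>) (Lamt \<nu> \<sigma>)" for \<nu>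
      using frame_adjoint_Lam[of \<nu> \<sigma> 1] by simp
    have "frame_adjoint (\<lambda>a. - (T \<sigma> * fd p (1 * a))) (\<lambda>a. - (- (1 * fd p (T \<sigma> * a))))"
      by (intro frame_adjoint_minus frame_adjoint_lmult[of "\<lambda>a. fd p (1 * a)" "\<lambda>a. - (1 * fd p a)"]
          frame_adjoint_fd frame_adjoint_mult)
    then have 2: "frame_adjoint (\<lambda>a. - (T \<sigma> * fd p a)) (\<lambda>a. fd p (T \<sigma> * a))" by simp
    show "frame_adjoint (\<lambda>a. (\<Sum>\<nu>\<in>- range \<iota>. - (fd p (h \<nu>) * Lam \<nu> \<sigma> a)) + - (T \<sigma> * fd p a))
        (\<lambda>a. (\<Sum>\<nu>\<in>- range \<iota>. - Lamt \<nu> \<sigma> (fd p (h \<nu>) * a)) + fd p (T \<sigma> * a))"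
      by (intro frame_adjoint_add frame_adjoint_sum frame_adjoint_minus frame_adjoint_lmult 1 2)
  qed
  then show ?thesis
    by (simp add: lin_sp[OF assms] Theta_def sum_subtractf sum_negf algebra_simps)
qed

lemma frame_adjoint_fd_mult: "frame_adjoint (\<lambda>a. fd p (a * b)) (\<lambda>a. - (b * fd p a))"
  using frame_adjoint_fd[OF frame_adjoint_mult[of b], of p] by (simp add: mult.commute)

lemma frame_adjoint_fd_id: "frame_adjoint (\<lambda>a. fd p a) (\<lambda>a. - fd p a)"
  using frame_adjoint_fd_mult[of p 1] by simp

text \<open>Here the terms with \<open>T\<close> itself are \<open>- (T \<nu> * fd p a)\<close> on
  both sides, the second one because \<open>fd p\<close> is skew for the weight
  \<open>Dt\<close>.\<close>

lemma H_pn: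
  assumes "\<nu> \<notin> range \<iota>"
  shows "lin (\<iota> p) \<nu> a - lint \<nu> (\<iota> p) a = - (Dt * (\<Sum>\<sigma>\<in>- range \<iota>. fd p (h \<sigma>) * Theta \<sigma> \<nu> a))"
proof -
  have "lint \<nu> (\<iota> p) a = Dt * (- (T \<nu> * fd p a) + (\<Sum>\<sigma>\<in>- range \<iota>. - (fd p (h \<sigma>) * Lamt \<nu> \<sigma> a)))"
  proof (rule lintI)
    show "lin \<nu> (\<iota> p) a = Dt * (fd p (a * T \<nu>) + (\<Sum>\<sigma>\<in>- range \<iota>. - Lam \<nu> \<sigma> (fd p (h \<sigma>) * a)))" for a
      by (simp add: lin_sp[OF assms] sum_negf)
    show "frame_adjoint (\<lambda>a. fd p (a * T \<nu>) + (\<Sum>\<sigma>\<in>- range \<iota>. - Lam \<nu> \<sigma> (fd p (h \<sigma>) * a)))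
        (\<lambda>a. - (T \<nu> * fd p a) + (\<Sum>\<sigma>\<in>- range \<iota>. - (fd p (h \<sigma>) * Lamt \<nu> \<sigma> a)))"
      by (intro frame_adjoint_add frame_adjoint_sum frame_adjoint_minus frame_adjoint_Lam frame_adjoint_fd_mult)
  qed
  note lint = this
  show ?thesis unfolding lint lin_pn[OF assms]
    by (simp add: Theta_def sum_subtractf sum_negf algebra_simps)
qed

lemma H_pq:
  "lin (\<iota> p) (\<iota> q) a - lint (\<iota> q) (\<iota> p) a =
    Dt * (\<Sum>\<sigma>\<in>- range \<iota>. fd p (h \<sigma>) * (\<Sum>\<nu>\<in>- range \<iota>. Theta \<sigma> \<nu> (fd q (h \<nu>) * a)))"
proof -
  have lint: "lint (\<iota> q) (\<iota> p) a =
      Dt * ((\<Sum>\<nu>\<in>- range \<iota>. - fd q (T \<nu> * fd p (h \<nu>) * a) + T \<nu> * fd p (fd q (h \<nu>) * a)) +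
        (\<Sum>\<nu>\<in>- range \<iota>. \<Sum>\<sigma>\<in>- range \<iota>. fd p (h \<sigma>) * Lamt \<nu> \<sigma> (fd q (h \<nu>) * a)))"
  proof (rule lintI)
    show "lin (\<iota> q) (\<iota> p) a =
      Dt * ((\<Sum>\<nu>\<in>- range \<iota>. T \<nu> * fd p (h \<nu>) * fd q a + - (fd q (h \<nu>) * fd p (a * T \<nu>))) +
        (\<Sum>\<nu>\<in>- range \<iota>. \<Sum>\<sigma>\<in>- range \<iota>. fd q (h \<nu>) * Lam \<nu> \<sigma> (fd p (h \<sigma>) * a)))" for a
      unfolding lin_pq by (simp add: sum_distrib_left mult.assoc)
    have 1: "frame_adjoint (\<lambda>a. T \<nu> * fd p (h \<nu>) * fd q a) (\<lambda>a. - fd q (T \<nu> * fd p (h \<nu>) * a))" for \<nu>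
      by (rule frame_adjoint_lmult[OF frame_adjoint_fd_id])
    have 2: "frame_adjoint (\<lambda>a. - (fd q (h \<nu>) * fd p (a * T \<nu>))) (\<lambda>a. T \<nu> * fd p (fd q (h \<nu>) * a))" for \<nu>
      using frame_adjoint_minus[OF frame_adjoint_lmult[OF frame_adjoint_fd_mult[of p "T \<nu>"], of "fd q (h \<nu>)"]] by simp
    show "frame_adjoint (\<lambda>a. (\<Sum>\<nu>\<in>- range \<iota>. T \<nu> * fd p (h \<nu>) * fd q a + - (fd q (h \<nu>) * fd p (a * T \<nu>))) +
        (\<Sum>\<nu>\<in>- range \<iota>. \<Sum>\<sigma>\<in>- range \<iota>. fd q (h \<nu>) * Lam \<nu> \<sigma> (fd p (h \<sigma>) * a)))
      (\<lambda>a. (\<Sum>\<nu>\<in>- range \<iota>. - fd q (T \<nu> * fd p (h \<nu>) * a) + T \<nu> * fd p (fd q (h \<nu>) * a)) +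
        (\<Sum>\<nu>\<in>- range \<iota>. \<Sum>\<sigma>\<in>- range \<iota>. fd p (h \<sigma>) * Lamt \<nu> \<sigma> (fd q (h \<nu>) * a)))"
      by (intro frame_adjoint_add frame_adjoint_sum 1 2 frame_adjoint_lmult[OF frame_adjoint_Lam])
  qed
  \<comment> \<open>The terms with \<open>T\<close> itself agree summand by summand. After expansion
    the difference consists of second frame derivatives of \<open>h \<sigma>\<close>, which cancel
    because the frame commutes.\<close>
  have T: "T \<sigma> * (fd q (h \<sigma>) * fd p a) - fd p (h \<sigma>) * fd q (a * T \<sigma>) =
      - fd q (T \<sigma> * fd p (h \<sigma>) * a) + T \<sigma> * fd p (fd q (h \<sigma>) * a)" for \<sigma>
    by (simp add: F.D.d_mult fd_commute[of q p] algebra_simps)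
  have swap: "(\<Sum>\<nu>\<in>- range \<iota>. \<Sum>\<sigma>\<in>- range \<iota>. fd p (h \<sigma>) * Lamt \<nu> \<sigma> (fd q (h \<nu>) * a)) =
      (\<Sum>\<sigma>\<in>- range \<iota>. \<Sum>\<nu>\<in>- range \<iota>. fd p (h \<sigma>) * Lamt \<nu> \<sigma> (fd q (h \<nu>) * a))"
    by (rule sum.swap)
  show ?thesis unfolding lint lin_pq T swap
    by (simp add: Theta_def sum_distrib_left right_diff_distrib sum_subtractf distrib_left)
qed

end

section \<open>Iterated frame derivatives\<close>

lemma nths_insert_less:
  assumes "b < length I" "\<And>a. a \<in> A \<Longrightarrow> b < a"
  shows "nths I (insert b A) = I ! b # nths I A"
  using assms
proof (induction I arbitrary: b A)
  case (Cons x xs)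
  show ?case
  proof (cases b)
    case 0
    then have "0 \<notin> A" using Cons.prems(2)[of 0] by auto
    then show ?thesis by (simp add: nths_Cons 0)
  next
    case (Suc b')
    have "0 \<notin> A" using Cons.prems(2)[of 0] by auto
    moreover have "{j. Suc j \<in> insert (Suc b') A} = insert b' {j. Suc j \<in> A}" by auto
    moreover have "nths xs (insert b' {j. Suc j \<in> A}) = xs ! b' # nths xs {j. Suc j \<in> A}"
    proof (rule Cons.IH)
      show "b' < length xs" using Cons.prems(1) Suc by simp
      show "b' < a" if "a \<in> {j. Suc j \<in> A}" for a using Cons.prems(2)[of "Suc a"] that Suc by simp
    qed
    ultimately show ?thesis by (simp add: nths_Cons Suc)
  qed
qed simp

lemma nths_nonempty:
  assumes "B \<subseteq> {..<length I}" "B \<noteq> {}"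
  shows "nths I B \<noteq> []"
proof -
  have "set (nths I B) \<noteq> {}" using assms by (auto simp: set_nths)
  then show ?thesis by auto
qed

section \<open>Set partitions and their recursion\<close>

abbreviation partitions :: "'b set \<Rightarrow> 'b set set set" where
  "partitions A \<equiv> {P. partition_on A P}"

lemma partition_block_subset: "partition_on A P \<Longrightarrow> B \<in> P \<Longrightarrow> B \<subseteq> A"
  by (auto simp: partition_on_def)

lemma partition_block_nonempty: "partition_on A P \<Longrightarrow> B \<in> P \<Longrightarrow> B \<noteq> {}"
  by (auto simp: partition_on_def)

lemma partition_blocks_eq: "partition_on A P \<Longrightarrow> B \<in> P \<Longrightarrow> C \<in> P \<Longrightarrow> b \<in> B \<Longrightarrow> b \<in> C \<Longrightarrow> B = C"
  by (auto simp: partition_on_def disjoint_def)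

lemma partition_on_alt_def:
  "partition_on A P \<longleftrightarrow> \<Union>P = A \<and> {} \<notin> P \<and> (\<forall>B\<in>P. \<forall>C\<in>P. B \<noteq> C \<longrightarrow> B \<inter> C = {})"
  by (auto simp: partition_on_def disjoint_def)

lemma partition_add_singleton:
  "partition_on A P \<Longrightarrow> b \<notin> A \<Longrightarrow> partition_on (insert b A) (insert {b} P)"
  unfolding partition_on_alt_def by auto

lemma partition_remove_singleton:
  assumes "partition_on (insert b A) P" "b \<notin> A" "{b} \<in> P"
  shows "partition_on A (P - {{b}})"
  unfolding partition_on_alt_def
proof (intro conjI)
  have "\<Union>P = insert b A" using assms(1) by (simp add: partition_on_alt_def)
  moreover have "\<Union>P = insert b (\<Union>(P - {{b}}))" using assms(3) by auto
  moreover have "b \<notin> \<Union>(P - {{b}})"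
    using partition_blocks_eq[OF assms(1), of _ "{b}" b] assms(3) by blast
  ultimately show "\<Union>(P - {{b}}) = A" using assms(2) by (metis insert_ident)
qed (use assms(1) in \<open>auto simp: partition_on_alt_def\<close>)

lemma partition_enlarge_block:
  assumes "partition_on A P" "b \<notin> A" "B \<in> P"
  shows "partition_on (insert b A) (insert (insert b B) (P - {B}))"
  unfolding partition_on_alt_def
proof (intro conjI ballI impI)
  have U: "\<Union>P = A" using assms(1) by (simp add: partition_on_alt_def)
  show "\<Union>(insert (insert b B) (P - {B})) = insert b A" using U assms(3) by auto
  show "{} \<notin> insert (insert b B) (P - {B})" using assms(1) by (auto simp: partition_on_alt_def)
  fix C C' assume C: "C \<in> insert (insert b B) (P - {B})" "C' \<in> insert (insert b B) (P - {B})" "C \<noteq> C'"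
  have b: "b \<notin> D" if "D \<in> P" for D using partition_block_subset[OF assms(1) that] assms(2) by auto
  have dis: "D \<inter> D' = {}" if "D \<in> P" "D' \<in> P" "D \<noteq> D'" for D D'
    using assms(1) that by (simp add: partition_on_alt_def)
  consider "C = insert b B" "C' \<in> P" "C' \<noteq> B" | "C' = insert b B" "C \<in> P" "C \<noteq> B" | "C \<in> P" "C' \<in> P"
    using C by auto
  then show "C \<inter> C' = {}"
  proof cases
    case 1
    then show ?thesis using dis[OF assms(3) 1(2)] b[OF 1(2)] by auto
  next
    case 2
    then show ?thesis using dis[OF assms(3) 2(2)] b[OF 2(2)] by auto
  qed (use dis C(3) in auto)
qed

lemma partition_shrink_block:
  assumes "partition_on (insert b A) P" "b \<notin> A" "C \<in> P" "b \<in> C" "C \<noteq> {b}"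
  shows "partition_on A (insert (C - {b}) (P - {C}))" "C - {b} \<notin> P - {C}"
proof -
  have U: "\<Union>P = insert b A" using assms(1) by (simp add: partition_on_alt_def)
  have dis: "D \<inter> D' = {}" if "D \<in> P" "D' \<in> P" "D \<noteq> D'" for D D'
    using assms(1) that by (simp add: partition_on_alt_def)
  have b: "b \<notin> D" if "D \<in> P" "D \<noteq> C" for D using dis[OF that(1) assms(3) that(2)] assms(4) by auto
  show "partition_on A (insert (C - {b}) (P - {C}))"
    unfolding partition_on_alt_def
  proof (intro conjI ballI impI)
    have "\<Union>P = C \<union> \<Union>(P - {C})" using assms(3) by auto
    then have "\<Union>P = insert b (\<Union>(insert (C - {b}) (P - {C})))" using assms(4) by auto
    moreover have "b \<notin> \<Union>(insert (C - {b}) (P - {C}))" using b by blast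
    ultimately show "\<Union>(insert (C - {b}) (P - {C})) = A" using assms(2) U by (metis insert_ident)
    show "{} \<notin> insert (C - {b}) (P - {C})"
      using assms(1,4,5) by (auto simp: partition_on_alt_def)
    fix D D' assume "D \<in> insert (C - {b}) (P - {C})" "D' \<in> insert (C - {b}) (P - {C})" "D \<noteq> D'"
    then consider "D = C - {b}" "D' \<in> P" "D' \<noteq> C" | "D' = C - {b}" "D \<in> P" "D \<noteq> C" | "D \<in> P" "D' \<in> P"
      by auto
    then show "D \<inter> D' = {}"
    proof cases
      case 1
      then show ?thesis using dis[OF 1(2) assms(3) 1(3)] by auto
    next
      case 2
      then show ?thesis using dis[OF 2(2) assms(3) 2(3)] by auto
    qed (use dis \<open>D \<noteq> D'\<close> in auto)
  qed
  show "C - {b} \<notin> P - {C}"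
  proof
    assume "C - {b} \<in> P - {C}"
    then have "(C - {b}) \<inter> C = {}" using dis[of "C - {b}" C] assms(3) by auto
    then show False using assms(4,5) by auto
  qed
qed

text \<open>The new point either forms a block of its own or joins exactly one block of a partition
  of \<open>A\<close>.\<close>

lemma sum_partitions_insert:
  fixes F :: "'b set set \<Rightarrow> 'r::comm_monoid_add"
  assumes A: "finite A" and b: "b \<notin> A"
  shows "(\<Sum>P\<in>partitions (insert b A). F P) =
    (\<Sum>P\<in>partitions A. F (insert {b} P) + (\<Sum>B\<in>P. F (insert (insert b B) (P - {B}))))"
proof -
  have fin: "finite (partitions (insert b A))" "finite (partitions A)"
    using finitely_many_partition_on A by auto
  have finP: "finite P" if "partition_on A P" for P using finite_elements[OF A that] .
  have "(\<Sum>P\<in>partitions (insert b A). F P) =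
      (\<Sum>P\<in>{P. partition_on (insert b A) P \<and> {b} \<in> P}. F P) + (\<Sum>P\<in>{P. partition_on (insert b A) P \<and> {b} \<notin> P}. F P)"
    by (subst sum.union_disjoint[symmetric]) (use fin in \<open>auto intro!: sum.cong elim: finite_subset[rotated]\<close>)
  also have "(\<Sum>P\<in>{P. partition_on (insert b A) P \<and> {b} \<in> P}. F P) = (\<Sum>P\<in>partitions A. F (insert {b} P))"
  proof (rule sum.reindex_bij_witness[of _ "insert {b}" "\<lambda>P. P - {{b}}"])
    fix P assume P: "P \<in> partitions A"
    then have "{b} \<notin> P" using partition_block_subset[of A P "{b}"] b by auto
    then show "insert {b} P - {{b}} = P" by simp
    show "insert {b} P \<in> {P. partition_on (insert b A) P \<and> {b} \<in> P}"
      using P b partition_add_singleton by auto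
  qed (use partition_remove_singleton b in \<open>auto simp: insert_absorb\<close>)
  also have "(\<Sum>P\<in>{P. partition_on (insert b A) P \<and> {b} \<notin> P}. F P) =
      (\<Sum>(P, B)\<in>Sigma (partitions A) (\<lambda>P. P). F (insert (insert b B) (P - {B})))"
  \<comment> \<open>The inverse has to recover the block that contains \<open>b\<close>; being the
    only such block, it is the union of all blocks that contain \<open>b\<close>.\<close>
  proof (rule sum.reindex_bij_witness[of _ "\<lambda>(P, B). insert (insert b B) (P - {B})"
        "\<lambda>P. (insert (\<Union>{C\<in>P. b \<in> C} - {b}) (P - {\<Union>{C\<in>P. b \<in> C}}), \<Union>{C\<in>P. b \<in> C} - {b})"])
    fix P assume P: "P \<in> {P. partition_on (insert b A) P \<and> {b} \<notin> P}"
    then have part: "partition_on (insert b A) P" by simp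
    have "b \<in> \<Union>P" using part by (simp add: partition_on_alt_def)
    then obtain C where C: "C \<in> P" "b \<in> C" by blast
    have "{C\<in>P. b \<in> C} = {C}" using C partition_blocks_eq[OF part] by blast
    then have U: "\<Union>{C\<in>P. b \<in> C} = C" by simp
    have nb: "C \<noteq> {b}" using P C by auto
    note sh = partition_shrink_block[OF part b C nb]
    show "(case (insert (\<Union>{C\<in>P. b \<in> C} - {b}) (P - {\<Union>{C\<in>P. b \<in> C}}), \<Union>{C\<in>P. b \<in> C} - {b}) of
        (P, B) \<Rightarrow> insert (insert b B) (P - {B})) = P"
      unfolding U using C sh(2) by (simp add: insert_absorb)
    show "(insert (\<Union>{C\<in>P. b \<in> C} - {b}) (P - {\<Union>{C\<in>P. b \<in> C}}), \<Union>{C\<in>P. b \<in> C} - {b}) \<in> Sigma (partitions A) (\<lambda>P. P)"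
      unfolding U using sh(1) by simp
    show "(case (insert (\<Union>{C\<in>P. b \<in> C} - {b}) (P - {\<Union>{C\<in>P. b \<in> C}}), \<Union>{C\<in>P. b \<in> C} - {b}) of
        (P, B) \<Rightarrow> F (insert (insert b B) (P - {B}))) = F P"
      unfolding U using C sh(2) by (simp add: insert_absorb)
  next
    fix PB assume "PB \<in> Sigma (partitions A) (\<lambda>P. P)"
    then obtain P B where PB: "PB = (P, B)" "partition_on A P" "B \<in> P" by auto
    have nb: "b \<notin> D" if "D \<in> P" for D using partition_block_subset[OF PB(2) that] b by auto
    have "{C\<in>insert (insert b B) (P - {B}). b \<in> C} = {insert b B}" using nb by auto
    then have U: "\<Union>{C\<in>insert (insert b B) (P - {B}). b \<in> C} = insert b B" by simp
    have "insert b B \<notin> P" using nb by auto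
    then show "(insert (\<Union>{C\<in>(case PB of (P, B) \<Rightarrow> insert (insert b B) (P - {B})). b \<in> C} - {b})
          ((case PB of (P, B) \<Rightarrow> insert (insert b B) (P - {B})) - {\<Union>{C\<in>(case PB of (P, B) \<Rightarrow> insert (insert b B) (P - {B})). b \<in> C}}),
        \<Union>{C\<in>(case PB of (P, B) \<Rightarrow> insert (insert b B) (P - {B})). b \<in> C} - {b}) = PB"
      unfolding PB(1) prod.case U using nb[OF PB(3)] PB(3) by (auto simp: insert_absorb)
    have "{b} \<notin> insert (insert b B) (P - {B})"
      using nb partition_block_nonempty[OF PB(2,3)] nb[OF PB(3)] by auto
    then show "(case PB of (P, B) \<Rightarrow> insert (insert b B) (P - {B})) \<in> {P. partition_on (insert b A) P \<and> {b} \<notin> P}"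
      unfolding PB(1) prod.case using partition_enlarge_block[OF PB(2) b PB(3)] by simp
  qed
  also have "\<dots> = (\<Sum>P\<in>partitions A. \<Sum>B\<in>P. F (insert (insert b B) (P - {B})))"
    by (rule sum.Sigma[symmetric]) (use fin finP in auto)
  finally show ?thesis by (simp add: sum.distrib)
qed

lemma sum_PiE_insert:
  assumes "x \<notin> S"
  shows "(\<Sum>f\<in>insert x S \<rightarrow>\<^sub>E (UNIV :: 'n::finite set). G f) =
    (\<Sum>q\<in>UNIV. \<Sum>f\<in>S \<rightarrow>\<^sub>E UNIV. (G (f(x := q)) :: 'r::comm_monoid_add))"
proof -
  have "inj_on (\<lambda>(y, g). g(x := y)) ((UNIV :: 'n set) \<times> (S \<rightarrow>\<^sub>E UNIV))"
    by (rule inj_combinator[OF assms])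
  then show ?thesis
    unfolding PiE_insert_eq sum.cartesian_product by (subst sum.reindex) (auto simp: case_prod_unfold)
qed

lemma mset_mlist [simp]: "mset (mlist M) = M"
  unfolding mlist_def by (rule someI_ex) (rule ex_mset)

lemma mlist_empty [simp]: "mlist {#} = []"
  using mset_mlist[of "{#}"] by (simp only: mset_zero_iff)

lemma length_mlist [simp]: "length (mlist M) = size M"
  using size_mset[of "mlist M"] by simp

section \<open>Frame derivatives expanded over set partitions\<close>

context derivations
begin

definition dm :: "'n multiset \<Rightarrow> 'r \<Rightarrow> 'r" where
  "dm M a = dl (mlist M) a"

lemma dm_mset: "dm (mset J) a = dl J a"
  unfolding dm_def by (rule dl_mset) simp

lemma dm_add_mset: "dm (add_mset i M) a = d i (dm M a)"
proof -
  have "dm (mset (i # mlist M)) a = d i (dm M a)" by (simp only: dm_mset dl_Cons) (simp add: dm_def)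
  then show ?thesis by simp
qed

end

context frame
begin

text \<open>The germ of z^j_K along the immersion: the last index is a matrix index, all earlier
  ones are frame derivatives. The empty list has no meaning here, and blocks of a partition never
  produce it.\<close>

definition zz :: "'n \<Rightarrow> 'n list \<Rightarrow> 'r" where
  "zz j K = F.dl (butlast K) (z j (last K))"

lemma zz_single: "zz j [i] = z j i"
  by (simp add: zz_def)

lemma zz_Cons: "K \<noteq> [] \<Longrightarrow> zz j (i # K) = fd i (zz j K)"
  by (simp add: zz_def F.dl_Cons)

text \<open>The contribution of one partition to D_I a: every block carries a factor z and sends out
  one derivation, whose direction is the label that \<open>f\<close> gives to the block.\<close>

definition zterm :: "'n list \<Rightarrow> 'r \<Rightarrow> nat set set \<Rightarrow> 'r" where
  "zterm I a P = (\<Sum>f\<in>P \<rightarrow>\<^sub>E UNIV. (\<Prod>B\<in>P. zz (f B) (nths I B)) * dm (image_mset f (mset_set P)) a)"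

lemma zterm_insert:
  assumes "finite P" "B \<notin> P"
  shows "zterm I a (insert B P) = (\<Sum>q\<in>UNIV. \<Sum>f\<in>P \<rightarrow>\<^sub>E UNIV.
    zz q (nths I B) * (\<Prod>C\<in>P. zz (f C) (nths I C)) * d q (dm (image_mset f (mset_set P)) a))"
  unfolding zterm_def sum_PiE_insert[OF assms(2)]
proof (intro sum.cong refl)
  fix q f
  have "(\<Prod>C\<in>P. zz ((f(B := q)) C) (nths I C)) = (\<Prod>C\<in>P. zz (f C) (nths I C))"
    using assms(2) by (intro prod.cong) auto
  moreover have "image_mset (f(B := q)) (mset_set P) = image_mset f (mset_set P)"
    using assms by (intro image_mset_cong) auto
  ultimately show "(\<Prod>C\<in>insert B P. zz ((f(B := q)) C) (nths I C)) * dm (image_mset (f(B := q)) (mset_set (insert B P))) a =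
      zz q (nths I B) * (\<Prod>C\<in>P. zz (f C) (nths I C)) * d q (dm (image_mset f (mset_set P)) a)"
    using assms by (simp add: dm_add_mset)
qed

text \<open>By the product rule the new derivation either hits the factor of a block, which thereby
  gains the position \<open>b\<close>, or it hits \<open>a\<close> and opens the block {b}. As
  \<open>b\<close> precedes all of \<open>A\<close>, it is prepended to the index of the block, in
  agreement with the recursion of \<open>zz\<close>.\<close>

lemma fd_zterm:
  assumes P: "partition_on A P" "finite A" "A \<subseteq> {..<length I}" and b: "b < length I" "\<And>a. a \<in> A \<Longrightarrow> b < a"
  shows "fd (I ! b) (zterm I a P) = zterm I a (insert {b} P) + (\<Sum>B\<in>P. zterm I a (insert (insert b B) (P - {B})))"
proof -
  have finP: "finite P" using finite_elements[OF P(2,1)] .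
  have nb: "b \<notin> B" if "B \<in> P" for B using partition_block_subset[OF P(1) that] b(2) by auto
  have bs: "{b} \<notin> P" using nb by auto
  have nths_b: "nths I {b} = [I ! b]" using nths_insert_less[of b I "{}"] b(1) by simp
  have fdz: "fd (I ! b) (zz q (nths I B)) = zz q (nths I (insert b B))" if B: "B \<in> P" for q B
  proof -
    have sub: "B \<subseteq> A" by (rule partition_block_subset[OF P(1) B])
    have "nths I (insert b B) = I ! b # nths I B"
      by (rule nths_insert_less[OF b(1)]) (use b(2) sub in auto)
    moreover have "nths I B \<noteq> []"
      by (rule nths_nonempty) (use sub P(3) partition_block_nonempty[OF P(1) B] in auto)
    ultimately show ?thesis by (simp add: zz_Cons)
  qed
  have "fd (I ! b) (zterm I a P) = (\<Sum>f\<in>P \<rightarrow>\<^sub>E UNIV.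
      (\<Sum>B\<in>P. zz (f B) (nths I (insert b B)) * (\<Prod>C\<in>P - {B}. zz (f C) (nths I C)) * dm (image_mset f (mset_set P)) a) +
      (\<Prod>B\<in>P. zz (f B) (nths I B)) * fd (I ! b) (dm (image_mset f (mset_set P)) a))"
    unfolding zterm_def F.D.d_sum
  proof (rule sum.cong[OF refl])
    fix f
    have "fd (I ! b) (\<Prod>B\<in>P. zz (f B) (nths I B)) =
        (\<Sum>B\<in>P. zz (f B) (nths I (insert b B)) * (\<Prod>C\<in>P - {B}. zz (f C) (nths I C)))"
      unfolding F.D.d_prod[OF finP] by (intro sum.cong refl) (simp add: fdz)
    then show "fd (I ! b) ((\<Prod>B\<in>P. zz (f B) (nths I B)) * dm (image_mset f (mset_set P)) a) =
        (\<Sum>B\<in>P. zz (f B) (nths I (insert b B)) * (\<Prod>C\<in>P - {B}. zz (f C) (nths I C)) * dm (image_mset f (mset_set P)) a) +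
        (\<Prod>B\<in>P. zz (f B) (nths I B)) * fd (I ! b) (dm (image_mset f (mset_set P)) a)"
      by (simp add: F.D.d_mult sum_distrib_right)
  qed
  also have "\<dots> = (\<Sum>B\<in>P. \<Sum>f\<in>P \<rightarrow>\<^sub>E UNIV. zz (f B) (nths I (insert b B)) *
        (\<Prod>C\<in>P - {B}. zz (f C) (nths I C)) * dm (image_mset f (mset_set P)) a) +
      (\<Sum>f\<in>P \<rightarrow>\<^sub>E UNIV. \<Sum>q\<in>UNIV. (\<Prod>B\<in>P. zz (f B) (nths I B)) * (z q (I ! b) * d q (dm (image_mset f (mset_set P)) a)))"
    unfolding sum.distrib by (subst sum.swap) (simp add: fd_def sum_distrib_left)
  also have "(\<Sum>f\<in>P \<rightarrow>\<^sub>E UNIV. \<Sum>q\<in>UNIV. (\<Prod>B\<in>P. zz (f B) (nths I B)) * (z q (I ! b) * d q (dm (image_mset f (mset_set P)) a))) =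
      zterm I a (insert {b} P)"
    unfolding zterm_insert[OF finP bs] nths_b zz_single by (subst sum.swap) (simp add: mult_ac)
  also have "(\<Sum>B\<in>P. \<Sum>f\<in>P \<rightarrow>\<^sub>E UNIV. zz (f B) (nths I (insert b B)) *
        (\<Prod>C\<in>P - {B}. zz (f C) (nths I C)) * dm (image_mset f (mset_set P)) a) =
      (\<Sum>B\<in>P. zterm I a (insert (insert b B) (P - {B})))"
  proof (rule sum.cong[OF refl])
    fix B assume B: "B \<in> P"
    define Q where "Q = P - {B}"
    have P_eq: "P = insert B Q" and Q: "B \<notin> Q" "finite Q" using B finP by (auto simp: Q_def)
    have bQ: "insert b B \<notin> Q" using nb by (auto simp: Q_def)
    have "(\<Sum>f\<in>P \<rightarrow>\<^sub>E UNIV. zz (f B) (nths I (insert b B)) *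
        (\<Prod>C\<in>Q. zz (f C) (nths I C)) * dm (image_mset f (mset_set P)) a) = zterm I a (insert (insert b B) Q)"
      unfolding zterm_insert[OF Q(2) bQ] P_eq sum_PiE_insert[OF Q(1)]
    proof (intro sum.cong refl)
      fix q f
      have "(\<Prod>C\<in>Q. zz ((f(B := q)) C) (nths I C)) = (\<Prod>C\<in>Q. zz (f C) (nths I C))"
        using Q by (intro prod.cong) auto
      moreover have "image_mset (f(B := q)) (mset_set Q) = image_mset f (mset_set Q)"
        using Q by (intro image_mset_cong) auto
      ultimately show "zz ((f(B := q)) B) (nths I (insert b B)) * (\<Prod>C\<in>Q. zz ((f(B := q)) C) (nths I C)) *
          dm (image_mset (f(B := q)) (mset_set (insert B Q))) a =
        zz q (nths I (insert b B)) * (\<Prod>C\<in>Q. zz (f C) (nths I C)) * d q (dm (image_mset f (mset_set Q)) a)"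
        using Q by (simp add: dm_add_mset)
    qed
    then show "(\<Sum>f\<in>P \<rightarrow>\<^sub>E UNIV. zz (f B) (nths I (insert b B)) *
        (\<Prod>C\<in>P - {B}. zz (f C) (nths I C)) * dm (image_mset f (mset_set P)) a) = zterm I a (insert (insert b B) (P - {B}))"
      by (simp add: Q_def)
  qed
  finally show ?thesis by (simp add: add.commute)
qed

text \<open>The formula of Faa di Bruno. The induction adds the smallest position, since the
  leftmost letter is the derivation applied last.\<close>

lemma fdl_nths:
  assumes "finite A" "A \<subseteq> {..<length I}"
  shows "F.dl (nths I A) a = (\<Sum>P\<in>partitions A. zterm I a P)"
  using assms
proof (induction A rule: finite_linorder_min_induct)
  case empty
  have "partitions {} = {{} :: nat set set}" by (auto simp: partition_on_empty)
  then show ?case by (simp add: zterm_def dm_def)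
next
  case (insert b A)
  have b: "b \<notin> A" using insert.hyps by auto
  have "F.dl (nths I (insert b A)) a = fd (I ! b) (F.dl (nths I A) a)"
    using insert by (simp add: nths_insert_less F.dl_Cons)
  also have "\<dots> = (\<Sum>P\<in>partitions A. fd (I ! b) (zterm I a P))"
    using insert by (simp add: F.D.d_sum)
  also have "\<dots> = (\<Sum>P\<in>partitions A. zterm I a (insert {b} P) + (\<Sum>B\<in>P. zterm I a (insert (insert b B) (P - {B}))))"
    using insert by (intro sum.cong refl fd_zterm) auto
  also have "\<dots> = (\<Sum>P\<in>partitions (insert b A). zterm I a P)"
    by (rule sum_partitions_insert[symmetric]) (use insert.hyps b in auto)
  finally show ?case .
qed

definition bijections :: "nat set set \<Rightarrow> nat \<Rightarrow> (nat set \<Rightarrow> nat) set" where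
  "bijections P k = {f \<in> P \<rightarrow>\<^sub>E {..<k}. bij_betw f P {..<k}}"

text \<open>The sum over partitions with averaged upper indices, along the immersion. An unordered
  partition gives no order to its blocks, so the average runs over all numberings of the
  blocks.\<close>

definition Zs :: "'n list \<Rightarrow> 'n list \<Rightarrow> 'r" where
  "Zs J I = (\<Sum>P\<in>{P. partition_on {..<length I} P \<and> card P = length J}.
     (1 / fact (length J)) *\<^sub>R (\<Sum>f\<in>bijections P (length J). \<Prod>B\<in>P. zz (J ! f B) (nths I B)))"

lemma card_bijections:
  assumes "finite P" "card P = k"
  shows "card (bijections P k) = fact k"
proof -
  have "bijections P k = {f \<in> P \<rightarrow>\<^sub>E {..<k}. inj_on f P}"
  proof -
    have "bij_betw f P {..<k}" if "f \<in> P \<rightarrow>\<^sub>E {..<k}" "inj_on f P" for f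
    proof -
      have "f ` P = {..<k}"
        by (rule card_subset_eq) (use that assms in \<open>auto simp: card_image PiE_iff\<close>)
      then show ?thesis using that by (simp add: bij_betw_def)
    qed
    then show ?thesis unfolding bijections_def by (auto simp: bij_betw_def)
  qed
  then show ?thesis
    using card_inj_on_subset_funcset[of P "{..<k}" P] assms by (simp add: fact_prod_rev)
qed

text \<open>Once the blocks are numbered, labelling them is the same as choosing a list. The result
  does not involve the numbering, so every numbering gives the same value.\<close>

lemma sum_lists_via_bijection:
  assumes f: "f \<in> bijections P k" and P: "finite P"
  shows "(\<Sum>J\<in>{J. length J = k}. (\<Prod>B\<in>P. zz (J ! f B) (nths I B)) * dl J a) = zterm I a P"
  unfolding zterm_def
\<comment> \<open>A labelling \<open>j\<close> becomes the list whose entry at \<open>i\<close> is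
  the label of block number \<open>i\<close>; in the other direction block \<open>B\<close> reads
  the entry \<open>f B\<close>.\<close>
proof (rule sum.reindex_bij_witness[of _ "\<lambda>j. map (\<lambda>i. j (inv_into P f i)) [0..<k]" "\<lambda>J. restrict (\<lambda>B. J ! f B) P"])
  have bij: "bij_betw f P {..<k}" using f by (simp add: bijections_def)
  have inv: "inv_into P f (f B) = B" if "B \<in> P" for B
    using bij that by (auto simp: bij_betw_def)
  have fk: "f B < k" if "B \<in> P" for B using bij that by (auto simp: bij_betw_def)
  have inv_in: "inv_into P f i \<in> P" "f (inv_into P f i) = i" if "i < k" for i
    using bij that by (auto simp: bij_betw_def inv_into_into f_inv_into_f)
  fix J :: "'n list" assume J: "J \<in> {J. length J = k}"
  show "map (\<lambda>i. restrict (\<lambda>B. J ! f B) P (inv_into P f i)) [0..<k] = J"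
    by (rule nth_equalityI) (use J inv_in in auto)
  show "restrict (\<lambda>B. J ! f B) P \<in> P \<rightarrow>\<^sub>E UNIV" by auto
  have "image_mset (restrict (\<lambda>B. J ! f B) P) (mset_set P) = image_mset (\<lambda>B. J ! f B) (mset_set P)"
    using P by (intro image_mset_cong) auto
  also have "\<dots> = image_mset ((!) J) (image_mset f (mset_set P))"
    by (simp add: multiset.map_comp comp_def)
  also have "image_mset f (mset_set P) = mset [0..<k]"
    using bij image_mset_mset_set[of f P] by (simp add: bij_betw_def atLeast0LessThan)
  also have "image_mset ((!) J) (mset [0..<k]) = mset J"
    using J map_nth[of J] by (metis (mono_tags) mem_Collect_eq mset_map)
  finally have "image_mset (restrict (\<lambda>B. J ! f B) P) (mset_set P) = mset J" .
  then have "dm (image_mset (restrict (\<lambda>B. J ! f B) P) (mset_set P)) a = dl J a" by (simp only: dm_mset)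
  then show "(\<Prod>B\<in>P. zz (restrict (\<lambda>B. J ! f B) P B) (nths I B)) * dm (image_mset (restrict (\<lambda>B. J ! f B) P) (mset_set P)) a =
      (\<Prod>B\<in>P. zz (J ! f B) (nths I B)) * dl J a" by simp
next
  have bij: "bij_betw f P {..<k}" using f by (simp add: bijections_def)
  fix j :: "nat set \<Rightarrow> 'n" assume j: "j \<in> P \<rightarrow>\<^sub>E UNIV"
  show "restrict (\<lambda>B. map (\<lambda>i. j (inv_into P f i)) [0..<k] ! f B) P = j"
  proof
    fix B
    show "restrict (\<lambda>B. map (\<lambda>i. j (inv_into P f i)) [0..<k] ! f B) P B = j B"
    proof (cases "B \<in> P")
      case True
      then have "f B < k" "inv_into P f (f B) = B" using bij by (auto simp: bij_betw_def)
      then show ?thesis using True by simp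
    next
      case False
      then show ?thesis using j by auto
    qed
  qed
qed simp

text \<open>The k! numberings of a partition with k blocks all contribute the same
  \<open>zterm\<close>, so their average is that term, and summing over k restores the sum over all
  partitions.\<close>

lemma fdl_expand:
  assumes "length I \<le> s"
  shows "F.dl I a = (\<Sum>J\<in>{J. length J \<le> s}. Zs J I * dl J a)"
proof -
  have fin: "finite (partitions {..<length I})" by (rule finitely_many_partition_on) simp
  have finP: "finite P" if "partition_on {..<length I} P" for P using finite_elements[OF _ that] by simp
  \<comment> \<open>A partition has no more blocks than points, as each block is hit by the map from
    a point to its block; hence the bound \<open>s\<close> loses no partition.\<close>
  have cardP: "card P \<le> s" if P: "partition_on {..<length I} P" for P
  proof -
    have "card P \<le> card {..<length I}"
    proof (rule surj_card_le)
      have "\<exists>x\<in>{..<length I}. B = (THE C. C \<in> P \<and> x \<in> C)" if B: "B \<in> P" for B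
      proof -
        obtain x where x: "x \<in> B" using partition_block_nonempty[OF P B] by blast
        then have "(THE C. C \<in> P \<and> x \<in> C) = B"
          using B partition_blocks_eq[OF P] by (intro the_equality) auto
        then show ?thesis using x partition_block_subset[OF P B] by blast
      qed
      then show "P \<subseteq> (\<lambda>x. THE C. C \<in> P \<and> x \<in> C) ` {..<length I}" by auto
    qed simp
    then show ?thesis using assms by simp
  qed
  have "(\<Sum>J\<in>{J. length J \<le> s}. Zs J I * dl J a) =
      (\<Sum>k\<le>s. \<Sum>J\<in>{J. length J = k}. \<Sum>P\<in>{P. partition_on {..<length I} P \<and> card P = k}.
        (1 / fact k) *\<^sub>R (\<Sum>f\<in>bijections P k. (\<Prod>B\<in>P. zz (J ! f B) (nths I B)) * dl J a))"
    unfolding sum_lists_le by (intro sum.cong refl) (simp add: Zs_def sum_distrib_right)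
  also have "\<dots> = (\<Sum>k\<le>s. \<Sum>P\<in>{P. partition_on {..<length I} P \<and> card P = k}. zterm I a P)"
  proof (rule sum.cong[OF refl])
    fix k
    have "(\<Sum>J\<in>{J. length J = k}. \<Sum>P\<in>{P. partition_on {..<length I} P \<and> card P = k}.
        (1 / fact k) *\<^sub>R (\<Sum>f\<in>bijections P k. (\<Prod>B\<in>P. zz (J ! f B) (nths I B)) * dl J a)) =
      (\<Sum>P\<in>{P. partition_on {..<length I} P \<and> card P = k}.
        (1 / fact k) *\<^sub>R (\<Sum>f\<in>bijections P k. \<Sum>J\<in>{J. length J = k}. (\<Prod>B\<in>P. zz (J ! f B) (nths I B)) * dl J a))"
      by (subst sum.swap) (simp add: scaleR_sum_right[symmetric] sum.swap[of _ "{J. length J = k}"])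
    also have "\<dots> = (\<Sum>P\<in>{P. partition_on {..<length I} P \<and> card P = k}. zterm I a P)"
    proof (rule sum.cong[OF refl])
      fix P assume "P \<in> {P. partition_on {..<length I} P \<and> card P = k}"
      then have P: "finite P" "card P = k" using finP by auto
      have "(\<Sum>f\<in>bijections P k. \<Sum>J\<in>{J. length J = k}. (\<Prod>B\<in>P. zz (J ! f B) (nths I B)) * dl J a) =
          (\<Sum>f\<in>bijections P k. zterm I a P)"
        by (intro sum.cong refl sum_lists_via_bijection P)
      also have "\<dots> = of_nat (fact k) * zterm I a P" by (simp add: card_bijections[OF P])
      also have "\<dots> = (fact k :: real) *\<^sub>R zterm I a P"
        by (metis of_nat_fact of_real_of_nat_eq scaleR_conv_of_real)
      finally show "(1 / fact k) *\<^sub>R (\<Sum>f\<in>bijections P k. \<Sum>J\<in>{J. length J = k}.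
          (\<Prod>B\<in>P. zz (J ! f B) (nths I B)) * dl J a) = zterm I a P" by simp
    qed
    finally show "(\<Sum>J\<in>{J. length J = k}. \<Sum>P\<in>{P. partition_on {..<length I} P \<and> card P = k}.
        (1 / fact k) *\<^sub>R (\<Sum>f\<in>bijections P k. (\<Prod>B\<in>P. zz (J ! f B) (nths I B)) * dl J a)) =
      (\<Sum>P\<in>{P. partition_on {..<length I} P \<and> card P = k}. zterm I a P)" .
  qed
  also have "\<dots> = (\<Sum>P\<in>partitions {..<length I}. zterm I a P)"
  proof -
    have eq: "partitions {..<length I} = (\<Union>k\<in>{..s}. {P. partition_on {..<length I} P \<and> card P = k})"
      using cardP by auto
    show ?thesis unfolding eq
      by (rule sum.UNION_disjoint[symmetric]) (use fin in \<open>auto elim: finite_subset[rotated]\<close>)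
  qed
  also have "\<dots> = F.dl (nths I {..<length I}) a" by (rule fdl_nths[symmetric]) auto
  also have "nths I {..<length I} = I" by (rule nths_all) simp
  finally show ?thesis by simp
qed

lemma Zs_Nil: "Zs [] I = (if I = [] then 1 else 0)"
proof (cases "I = []")
  case True
  have "{P. partition_on {..<length I} P \<and> card P = length ([] :: 'n list)} = {{}}"
    using True by (auto simp: partition_on_empty)
  moreover have "bijections {} 0 = {\<lambda>_. undefined}" by (auto simp: bijections_def bij_betw_def)
  ultimately show ?thesis using True by (simp add: Zs_def)
next
  case False
  have "{P. partition_on {..<length I} P \<and> card P = length ([] :: 'n list)} = {}"
  proof -
    have "finite P" if "partition_on {..<length I} P" for P using finite_elements[OF _ that] by simp
    moreover have "\<not> partition_on {..<length I} {}" using False by (auto simp: partition_on_alt_def)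
    ultimately show ?thesis by (auto simp: card_eq_0_iff)
  qed
  then have "Zs [] I = 0" unfolding Zs_def by (simp only: sum.empty)
  then show ?thesis using False by simp
qed

lemma Zs_eq_0:
  assumes "length I < length J"
  shows "Zs J I = 0"
proof -
  have "{P. partition_on {..<length I} P \<and> card P = length J} = {}"
  proof -
    have "card P \<le> length I" if P: "partition_on {..<length I} P" for P
    proof -
      have "card P \<le> card {..<length I}"
      proof (rule surj_card_le)
        have "\<exists>x\<in>{..<length I}. B = (THE C. C \<in> P \<and> x \<in> C)" if B: "B \<in> P" for B
        proof -
          obtain x where x: "x \<in> B" using partition_block_nonempty[OF P B] by blast
          then have "(THE C. C \<in> P \<and> x \<in> C) = B"
            using B partition_blocks_eq[OF P] by (intro the_equality) auto
          then show ?thesis using x partition_block_subset[OF P B] by blast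
        qed
        then show "P \<subseteq> (\<lambda>x. THE C. C \<in> P \<and> x \<in> C) ` {..<length I}" by auto
      qed simp
      then show ?thesis by simp
    qed
    then show ?thesis using assms by force
  qed
  then show ?thesis unfolding Zs_def by (simp only: sum.empty)
qed

text \<open>A permutation of the entries of \<open>J\<close> is absorbed by renumbering the blocks.
  Symmetry is needed because an operator determines its coefficients only up to the order of their
  indices.\<close>

lemma symmetric_Zs: "symmetric (\<lambda>J. Zs J I)"
  unfolding symmetric_def
proof (intro allI impI)
  fix J J' :: "'n list" assume eq: "mset J = mset J'"
  have len: "length J = length J'" by (rule mset_eq_length[OF eq])
  obtain p where p: "p permutes {..<length J'}" "permute_list p J' = J"
    using mset_eq_permutation[OF eq] by blast
  have "(\<Sum>f\<in>bijections P (length J'). \<Prod>B\<in>P. zz (J ! f B) (nths I B)) =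
      (\<Sum>f\<in>bijections P (length J'). \<Prod>B\<in>P. zz (J' ! f B) (nths I B))" for P
  proof (rule sum.reindex_bij_witness[of _ "\<lambda>f. restrict (inv p \<circ> f) P" "\<lambda>f. restrict (p \<circ> f) P"])
    have mem: "restrict (q \<circ> f) P \<in> bijections P (length J')"
      if q: "q permutes {..<length J'}" and f: "f \<in> bijections P (length J')" for q f
    proof -
      have "bij_betw (q \<circ> f) P {..<length J'}"
        using f permutes_imp_bij[OF q] by (auto simp: bijections_def intro: bij_betw_trans)
      then have "bij_betw (restrict (q \<circ> f) P) P {..<length J'}" by (simp add: bij_betw_restrict_eq)
      then show ?thesis by (auto simp: bijections_def bij_betw_def)
    qed
    fix f assume f: "f \<in> bijections P (length J')"
    have ext: "restrict f P = f"
      using f by (simp add: bijections_def PiE_iff extensional_restrict)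
    have "restrict (inv p \<circ> restrict (p \<circ> f) P) P = restrict f P"
      by (simp add: fun_eq_iff permutes_inverses(2)[OF p(1)])
    then show "restrict (inv p \<circ> restrict (p \<circ> f) P) P = f" by (simp only: ext)
    have "restrict (p \<circ> restrict (inv p \<circ> f) P) P = restrict f P"
      by (simp add: fun_eq_iff permutes_inverses(1)[OF p(1)])
    then show "restrict (p \<circ> restrict (inv p \<circ> f) P) P = f" by (simp only: ext)
    show "restrict (p \<circ> f) P \<in> bijections P (length J')" by (rule mem[OF p(1) f])
    show "restrict (inv p \<circ> f) P \<in> bijections P (length J')" by (rule mem[OF permutes_inv[OF p(1)] f])
    have "J ! f B = J' ! p (f B)" if "B \<in> P" for B
    proof -
      have "f B < length J'" using f that by (auto simp: bijections_def)
      then show ?thesis using permute_list_nth[OF p(1), of "f B"] p(2) by simp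
    qed
    then show "(\<Prod>B\<in>P. zz (J' ! restrict (p \<circ> f) P B) (nths I B)) = (\<Prod>B\<in>P. zz (J ! f B) (nths I B))"
      by (intro prod.cong) auto
  qed
  then show "Zs J I = Zs J' I" by (simp add: Zs_def len)
qed

end

subsection \<open>Comparison of coefficients\<close>

lemma sum_triple_swap:
  "(\<Sum>i\<in>A. \<Sum>j\<in>B i. \<Sum>k\<in>C. f i j k) = (\<Sum>k\<in>C. \<Sum>i\<in>A. \<Sum>j\<in>B i. (f i j k :: 'r::comm_monoid_add))"
proof -
  have "(\<Sum>i\<in>A. \<Sum>j\<in>B i. \<Sum>k\<in>C. f i j k) = (\<Sum>i\<in>A. \<Sum>k\<in>C. \<Sum>j\<in>B i. f i j k)"
    by (intro sum.cong refl sum.swap)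
  then show ?thesis by (simp add: sum.swap[of _ C A])
qed

text \<open>\<open>val\<close> is evaluation at the point. The test element for \<open>M\<close>
  has, among the derivatives up to order \<open>s\<close> there, only the one indexed by
  \<open>M\<close> different from 0, so it isolates a single coefficient.\<close>

locale helmholtz_coefficients = helmholtz_reduction d g z Dt Di x \<iota> h T R P s
  for d :: "'n::finite \<Rightarrow> 'r \<Rightarrow> 'r :: {comm_ring_1, real_algebra_1}" and g z Dt Di x
    and \<iota> :: "'n \<Rightarrow> 'a::finite" and h T R P s +
  fixes val :: "'r \<Rightarrow> real" and \<phi> :: "'n multiset \<Rightarrow> 'r"
  assumes val_add: "val (a + b) = val a + val b" and val_mult: "val (a * b) = val a * val b"
    and val_1: "val 1 = 1"
    and test: "length J \<le> s \<Longrightarrow> size M \<le> s \<Longrightarrow> val (dl J (\<phi> M)) = (if mset J = M then 1 else 0)"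
begin

lemma val_0 [simp]: "val 0 = 0"
  using val_add[of 0 0] by simp

lemma val_minus: "val (- a) = - val a"
  using val_add[of a "- a"] by simp

lemma val_sum: "val (\<Sum>i\<in>I. f i) = (\<Sum>i\<in>I. val (f i))"
  by (induction I rule: infinite_finite_induct) (simp_all add: val_add)

lemma val_of_nat: "val (of_nat n) = of_nat n"
  by (induction n) (simp_all add: val_add val_1)

text \<open>The test element selects all orderings of \<open>J\<close> at once; by symmetry each
  side is then the number of orderings times one coefficient.\<close>

lemma compare_coefficients:
  assumes H: "symmetric H" and K: "symmetric K"
    and eq: "\<And>a. val (\<Sum>J\<in>{J. length J \<le> s}. H J * dl J a) = (\<Sum>J\<in>{J. length J \<le> s}. K J * val (dl J a))"
    and J: "length J \<le> s"
  shows "val (H J) = K J"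
proof -
  let ?S = "{I. mset I = mset J}"
  have sub: "?S \<subseteq> {I. length I \<le> s}" using J by (auto dest: mset_eq_length)
  then have fin: "finite ?S" by (rule finite_subset) simp
  have test': "val (dl I (\<phi> (mset J))) = (if I \<in> ?S then 1 else 0)" if "length I \<le> s" for I
    using test[OF that, of "mset J"] J by simp
  have sum: "(\<Sum>I\<in>{I. length I \<le> s}. f I * (if I \<in> ?S then 1 else 0)) = (\<Sum>I\<in>?S. (f I :: real))" for f
    using sub by (simp add: if_distrib[of "\<lambda>x. _ * x"] sum.If_cases Int_absorb1 cong: if_cong)
  have "(\<Sum>I\<in>?S. val (H I)) = (\<Sum>I\<in>{I. length I \<le> s}. val (H I) * val (dl I (\<phi> (mset J))))"
    unfolding sum[symmetric] by (intro sum.cong refl) (simp add: test')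
  also have "\<dots> = (\<Sum>I\<in>{I. length I \<le> s}. K I * val (dl I (\<phi> (mset J))))"
    using eq[of "\<phi> (mset J)"] by (simp add: val_sum val_mult)
  also have "\<dots> = (\<Sum>I\<in>?S. K I)"
    unfolding sum[symmetric] by (intro sum.cong refl) (simp add: test')
  finally have "(\<Sum>I\<in>?S. val (H I)) = (\<Sum>I\<in>?S. K I)" .
  moreover have "(\<Sum>I\<in>?S. val (H I)) = (\<Sum>I\<in>?S. val (H J))"
    by (intro sum.cong refl arg_cong[of _ _ val] symmetricD[OF H]) simp
  moreover have "(\<Sum>I\<in>?S. K I) = (\<Sum>I\<in>?S. K J)"
    by (intro sum.cong refl symmetricD[OF K]) simp
  moreover have "card ?S \<noteq> 0" using fin by auto
  ultimately show ?thesis by simp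
qed

text \<open>The coefficient of \<open>dl J a\<close> in \<open>Theta A B (y * a)\<close>, at the
  point: the product rule in the frame splits off \<open>K\<close>, and the remaining
  \<open>F.dl I\<close> is expanded in the derivations \<open>d\<close>.\<close>

definition coef :: "'r \<Rightarrow> 'a \<Rightarrow> 'a \<Rightarrow> 'n list \<Rightarrow> real" where
  "coef y A B J = (\<Sum>K\<in>{K. length K \<le> s}. \<Sum>I\<in>{I. length I \<le> s - length K}.
     real ((length I + length K) choose length I) * val (Zs J I) * val (F.dl K y) * val (hq A B (I @ K)))"

lemma symmetric_coef: "symmetric (coef y A B)"
  unfolding symmetric_def
proof (intro allI impI)
  fix I J :: "'n list" assume "mset I = mset J"
  then have "Zs I K = Zs J K" for K by (rule symmetricD[OF symmetric_Zs])
  then show "coef y A B I = coef y A B J" unfolding coef_def by (simp only:)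
qed

lemma val_Theta_mult: "val (Theta A B (y * a)) = (\<Sum>J\<in>{J. length J \<le> s}. coef y A B J * val (dl J a))"
proof -
  have "val (Theta A B (y * a)) = (\<Sum>K\<in>{K. length K \<le> s}. \<Sum>I\<in>{I. length I \<le> s - length K}.
      real ((length I + length K) choose length I) * (val (hq A B (I @ K)) * val (F.dl K y) * val (F.dl I a)))"
    unfolding Theta_expand F.operator_product_expand[OF symmetric_hq]
    by (simp add: val_sum val_mult val_of_nat)
  also have "\<dots> = (\<Sum>K\<in>{K. length K \<le> s}. \<Sum>I\<in>{I. length I \<le> s - length K}. \<Sum>J\<in>{J. length J \<le> s}.
      real ((length I + length K) choose length I) * val (Zs J I) * val (F.dl K y) * val (hq A B (I @ K)) * val (dl J a))"
  proof (intro sum.cong refl)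
    fix K I :: "'n list" assume "K \<in> {K. length K \<le> s}" "I \<in> {I. length I \<le> s - length K}"
    then have "length I \<le> s" by auto
    then show "real ((length I + length K) choose length I) * (val (hq A B (I @ K)) * val (F.dl K y) * val (F.dl I a)) =
        (\<Sum>J\<in>{J. length J \<le> s}. real ((length I + length K) choose length I) * val (Zs J I) * val (F.dl K y) *
          val (hq A B (I @ K)) * val (dl J a))"
      by (simp add: fdl_expand val_sum val_mult sum_distrib_left mult_ac)
  qed
  also have "\<dots> = (\<Sum>J\<in>{J. length J \<le> s}. coef y A B J * val (dl J a))"
    by (subst sum_triple_swap) (simp add: coef_def sum_distrib_right)
  finally show ?thesis .
qed

lemma coef_1:
  "coef 1 A B J = (\<Sum>I\<in>{I. length I \<le> s}. val (Zs J I) * val (hq A B I))"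
proof -
  have F1: "val (F.dl K 1) = (if K = [] then 1 else 0)" for K
  proof (cases K rule: rev_cases)
    case (snoc L i)
    then show ?thesis by (simp add: F.dl_append F.dl_Cons)
  qed (simp add: val_1)
  have "coef 1 A B J = (\<Sum>K\<in>{K :: 'n list. length K \<le> s}. if K = [] then (\<Sum>I\<in>{I. length I \<le> s}. val (Zs J I) * val (hq A B I)) else 0)"
    unfolding coef_def by (rule sum.cong[OF refl]) (simp add: F1)
  then show ?thesis by simp
qed

lemma val_Zs_Nil: "val (Zs [] I) = (if I = [] then 1 else 0)"
  by (simp add: Zs_Nil val_1)

lemma coef_Nil: "coef y A B [] = (\<Sum>K\<in>{K. length K \<le> s}. val (F.dl K y) * val (hq A B K))"
  unfolding coef_def
proof (rule sum.cong[OF refl])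
  fix K :: "'n list"
  have "(\<Sum>I\<in>{I. length I \<le> s - length K}. real ((length I + length K) choose length I) * val (Zs [] I) *
      val (F.dl K y) * val (hq A B (I @ K))) =
    (\<Sum>I\<in>{I :: 'n list. length I \<le> s - length K}. if I = [] then val (F.dl K y) * val (hq A B K) else 0)"
    by (rule sum.cong[OF refl]) (simp add: val_Zs_Nil)
  then show "(\<Sum>I\<in>{I. length I \<le> s - length K}. real ((length I + length K) choose length I) * val (Zs [] I) *
      val (F.dl K y) * val (hq A B (I @ K))) = val (F.dl K y) * val (hq A B K)" by simp
qed

lemma val_Zs_length: "val (Zs J I) \<noteq> 0 \<Longrightarrow> length J \<le> length I"
  using Zs_eq_0[of I J] by (cases "length I < length J") auto

lemma coef_restrict:
  "coef y A B J = (\<Sum>K\<in>{K. length K \<le> s}. \<Sum>I\<in>{I. length J \<le> length I \<and> length I \<le> s - length K}.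
     real ((length I + length K) choose length I) * val (Zs J I) * val (F.dl K y) * val (hq A B (I @ K)))"
  unfolding coef_def
proof (rule sum.cong[OF refl])
  fix K :: "'n list"
  show "(\<Sum>I\<in>{I. length I \<le> s - length K}. real ((length I + length K) choose length I) * val (Zs J I) *
      val (F.dl K y) * val (hq A B (I @ K))) =
    (\<Sum>I\<in>{I. length J \<le> length I \<and> length I \<le> s - length K}.
      real ((length I + length K) choose length I) * val (Zs J I) * val (F.dl K y) * val (hq A B (I @ K)))"
    by (rule sum.mono_neutral_right) (auto dest: val_Zs_length)
qed

lemma coef_1_Nil: "coef 1 A B [] = val (hq A B [])"
  by (simp add: coef_1 val_Zs_Nil if_distrib[of "\<lambda>x. x * _"] cong: if_cong)

lemma coef_1_restrict:
  "coef 1 A B J = (\<Sum>I\<in>{I. length J \<le> length I \<and> length I \<le> s}. val (Zs J I) * val (hq A B I))"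
  unfolding coef_1 by (rule sum.mono_neutral_right) (auto dest: val_Zs_length)

lemma symmetric_combination:
  assumes "\<And>i. i \<in> S \<Longrightarrow> symmetric (f i)"
  shows "symmetric (\<lambda>J. b * (\<Sum>i\<in>S. (w i :: real) * f i J))"
  unfolding symmetric_def
proof (intro allI impI)
  fix I J :: "'c list" assume eq: "mset I = mset J"
  have "(\<Sum>i\<in>S. w i * f i I) = (\<Sum>i\<in>S. w i * f i J)"
    by (intro sum.cong refl) (simp add: symmetricD[OF assms eq])
  then show "b * (\<Sum>i\<in>S. w i * f i I) = b * (\<Sum>i\<in>S. w i * f i J)" by simp
qed

text \<open>The common shape of the four types of relations: \<open>w\<close> is multiplied on the
  left of the Helmholtz operator of T, \<open>y\<close> on its argument. Each of them is either
  trivial or a frame derivative of the immersion, up to sign.\<close>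

lemma compare_Theta:
  assumes "\<And>a. lin A B a - lint B A a = Dt * (\<Sum>(\<sigma>, \<nu>)\<in>S. w \<sigma> \<nu> * Theta \<sigma> \<nu> (y \<sigma> \<nu> * a))"
    and J: "length J \<le> s"
  shows "val (hv A B J) = val Dt * (\<Sum>(\<sigma>, \<nu>)\<in>S. val (w \<sigma> \<nu>) * coef (y \<sigma> \<nu>) \<sigma> \<nu> J)"
proof (rule compare_coefficients[OF symmetric_hv _ _ J])
  show "symmetric (\<lambda>J. val Dt * (\<Sum>(\<sigma>, \<nu>)\<in>S. val (w \<sigma> \<nu>) * coef (y \<sigma> \<nu>) \<sigma> \<nu> J))"
    using symmetric_combination[of S "\<lambda>i. coef (y (fst i) (snd i)) (fst i) (snd i)" "val Dt" "\<lambda>i. val (w (fst i) (snd i))"]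
    by (simp add: symmetric_coef case_prod_unfold)
  fix a
  have "val (\<Sum>J\<in>{J. length J \<le> s}. hv A B J * dl J a) =
      val Dt * (\<Sum>(\<sigma>, \<nu>)\<in>S. val (w \<sigma> \<nu>) * (\<Sum>J\<in>{J. length J \<le> s}. coef (y \<sigma> \<nu>) \<sigma> \<nu> J * val (dl J a)))"
    unfolding lin_lint_expand[symmetric] assms(1)
    by (simp add: val_mult val_sum val_Theta_mult case_prod_unfold)
  also have "\<dots> = (\<Sum>J\<in>{J. length J \<le> s}. (val Dt * (\<Sum>(\<sigma>, \<nu>)\<in>S. val (w \<sigma> \<nu>) * coef (y \<sigma> \<nu>) \<sigma> \<nu> J)) * val (dl J a))"
    unfolding case_prod_unfold sum_distrib_left sum_distrib_right
    by (subst sum.swap) (simp add: mult.assoc)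
  finally show "val (\<Sum>J\<in>{J. length J \<le> s}. hv A B J * dl J a) =
      (\<Sum>J\<in>{J. length J \<le> s}. (val Dt * (\<Sum>(\<sigma>, \<nu>)\<in>S. val (w \<sigma> \<nu>) * coef (y \<sigma> \<nu>) \<sigma> \<nu> J)) * val (dl J a))" .
qed

lemma val_hv_sn:
  assumes "\<sigma> \<notin> range \<iota>" "\<nu> \<notin> range \<iota>" "length J \<le> s"
  shows "val (hv \<sigma> \<nu> J) = val Dt * coef 1 \<sigma> \<nu> J"
  using compare_Theta[where S="{(\<sigma>, \<nu>)}" and w="\<lambda>_ _. 1" and y="\<lambda>_ _. 1" and A=\<sigma> and B=\<nu> and J=J] assms
  by (simp add: H_sn val_1)

lemma val_hv_sp:
  assumes "\<sigma> \<notin> range \<iota>" "length J \<le> s"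
  shows "val (hv \<sigma> (\<iota> p) J) = - val Dt * (\<Sum>\<nu>\<in>- range \<iota>. coef (fd p (h \<nu>)) \<sigma> \<nu> J)"
proof -
  have "val (hv \<sigma> (\<iota> p) J) = val Dt * (\<Sum>(\<sigma>, \<nu>)\<in>{\<sigma>} \<times> (- range \<iota>). val (- 1) * coef (fd p (h \<nu>)) \<sigma> \<nu> J)"
    by (rule compare_Theta[where w="\<lambda>_ _. - 1" and y="\<lambda>_ \<nu>. fd p (h \<nu>)"])
       (simp_all add: H_sp assms sum.cartesian_product[symmetric] sum_negf)
  then show ?thesis by (simp add: sum.cartesian_product[symmetric] val_minus val_1 sum_negf)
qed

lemma val_hv_pn:
  assumes "\<nu> \<notin> range \<iota>" "length J \<le> s"
  shows "val (hv (\<iota> p) \<nu> J) = - val Dt * (\<Sum>\<sigma>\<in>- range \<iota>. val (fd p (h \<sigma>)) * coef 1 \<sigma> \<nu> J)"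
proof -
  have "val (hv (\<iota> p) \<nu> J) = val Dt * (\<Sum>(\<sigma>, \<nu>)\<in>(- range \<iota>) \<times> {\<nu>}. val (- fd p (h \<sigma>)) * coef 1 \<sigma> \<nu> J)"
    by (rule compare_Theta[where w="\<lambda>\<sigma> _. - fd p (h \<sigma>)" and y="\<lambda>_ _. 1"])
       (simp_all add: H_pn assms sum.cartesian_product[symmetric] sum_negf)
  then show ?thesis by (simp add: sum.cartesian_product[symmetric] val_minus sum_negf)
qed

lemma val_hv_pq:
  assumes "length J \<le> s"
  shows "val (hv (\<iota> p) (\<iota> q) J) = val Dt * (\<Sum>\<sigma>\<in>- range \<iota>. val (fd p (h \<sigma>)) *
    (\<Sum>\<nu>\<in>- range \<iota>. coef (fd q (h \<nu>)) \<sigma> \<nu> J))"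
proof -
  have "val (hv (\<iota> p) (\<iota> q) J) = val Dt * (\<Sum>(\<sigma>, \<nu>)\<in>(- range \<iota>) \<times> (- range \<iota>). val (fd p (h \<sigma>)) * coef (fd q (h \<nu>)) \<sigma> \<nu> J)"
    by (rule compare_Theta[where w="\<lambda>\<sigma> _. fd p (h \<sigma>)" and y="\<lambda>_ \<nu>. fd q (h \<nu>)"])
       (simp_all add: H_pq assms sum.cartesian_product[symmetric] sum_distrib_left)
  then show ?thesis by (simp add: sum.cartesian_product[symmetric] sum_distrib_left)
qed

end

section \<open>Functions on jets\<close>

lemma count_list_mset: "count_list J l = count (mset J) l"
  by (induction J) auto

text \<open>The number of orderings of \<open>M\<close> is the inverse of the common weight of these
  orderings, so the weights add up to 1. Sums over all sequences thereby become sums over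
  independent coordinates.\<close>

lemma sum_sym_weight:
  fixes w :: "'n::finite multiset \<Rightarrow> 'r::real_vector"
  shows "(\<Sum>J\<in>{J. length J \<le> N}. sym_weight J *\<^sub>R w (mset J)) = (\<Sum>M\<in>{M. size M \<le> N}. w M)"
proof -
  have fin: "finite {M :: 'n multiset. size M \<le> N}"
  proof -
    have "{M :: 'n multiset. size M \<le> N} = mset ` {J. length J \<le> N}"
      by (auto simp: image_iff) (metis ex_mset size_mset)
    then show ?thesis by simp
  qed
  have one: "(\<Sum>J\<in>permutations_of_multiset M. sym_weight J *\<^sub>R w (mset J)) = w M" for M :: "'n multiset"
  proof -
    define p where "p = (\<Prod>l\<in>UNIV. fact (count M l) :: nat)"
    have "(\<Prod>l\<in>set_mset M. fact (count M l) :: nat) = p"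
      unfolding p_def by (rule prod.mono_neutral_left) (auto simp: not_in_iff)
    then have card: "card (permutations_of_multiset M) * p = fact (size M)"
      using card_permutations_of_multiset_aux[of M] by simp
    have "sym_weight J = real p / fact (size M)" if "J \<in> permutations_of_multiset M" for J
    proof -
      have J: "mset J = M" using that by (simp add: permutations_of_multiset_def)
      then have "length J = size M" by (metis size_mset)
      then show ?thesis by (simp add: sym_weight_def count_list_mset J p_def)
    qed
    then have "(\<Sum>J\<in>permutations_of_multiset M. sym_weight J *\<^sub>R w (mset J)) =
        (\<Sum>J\<in>permutations_of_multiset M. (real p / fact (size M)) *\<^sub>R w M)"
      by (intro sum.cong refl) (auto simp: permutations_of_multiset_def)
    also have "\<dots> = (real (card (permutations_of_multiset M)) * (real p / fact (size M))) *\<^sub>R w M"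
      by (simp only: sum_constant_scaleR scaleR_scaleR)
    also have "real (card (permutations_of_multiset M)) * (real p / fact (size M)) = 1"
    proof -
      have "real (card (permutations_of_multiset M)) * real p = fact (size M)"
        by (metis card of_nat_fact of_nat_mult)
      then show ?thesis by simp
    qed
    finally show ?thesis by simp
  qed
  have eq: "{J :: 'n list. length J \<le> N} = (\<Union>M\<in>{M. size M \<le> N}. permutations_of_multiset M)"
    by (auto simp: permutations_of_multiset_def)
  have "(\<Sum>J\<in>{J. length J \<le> N}. sym_weight J *\<^sub>R w (mset J)) =
      (\<Sum>M\<in>{M. size M \<le> N}. \<Sum>J\<in>permutations_of_multiset M. sym_weight J *\<^sub>R w (mset J))"
    unfolding eq
  proof (rule sum.UNION_disjoint[OF fin])
    show "\<forall>M\<in>{M. size M \<le> N}. finite (permutations_of_multiset M)" by simp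
  qed (auto simp: permutations_of_multiset_def)
  then show ?thesis by (simp add: one)
qed

section \<open>Closure properties of smooth functions of finitely many coordinates\<close>

lemma smooth_fn_const: "open S \<Longrightarrow> smooth_fn K S (\<lambda>c. a)"
  by (simp add: smooth_fn_def depends_on_def smooth_coords_const)

lemma smooth_fn_proj: "open S \<Longrightarrow> k \<in> K \<Longrightarrow> smooth_fn K S (\<lambda>c. c k)"
  by (simp add: smooth_fn_def depends_on_def smooth_coords_proj)

lemma depends_on_op2:
  "depends_on K S f \<Longrightarrow> depends_on K S g \<Longrightarrow> depends_on K S (\<lambda>c. h (f c) (g c))"
  unfolding depends_on_def by metis

lemma smooth_fn_add: "open S \<Longrightarrow> smooth_fn K S f \<Longrightarrow> smooth_fn K S g \<Longrightarrow> smooth_fn K S (\<lambda>c. f c + g c)"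
  by (simp add: smooth_fn_def smooth_coords_add depends_on_op2[of K S f g "(+)"])

lemma smooth_fn_mult: "open S \<Longrightarrow> smooth_fn K S f \<Longrightarrow> smooth_fn K S g \<Longrightarrow> smooth_fn K S (\<lambda>c. f c * g c)"
  by (simp add: smooth_fn_def smooth_coords_mult depends_on_op2[of K S f g "(*)"])

lemma smooth_fn_sum:
  assumes "open S" "\<And>i. i \<in> I \<Longrightarrow> smooth_fn K S (f i)"
  shows "smooth_fn K S (\<lambda>c. \<Sum>i\<in>I. f i c)"
  using assms(2)
proof (induction I rule: infinite_finite_induct)
  case (insert i F)
  then show ?case using smooth_fn_add[OF assms(1), of K "f i" "\<lambda>c. \<Sum>i\<in>F. f i c"] by simp
qed (simp_all add: smooth_fn_const[OF assms(1)])

lemma smooth_fn_prod: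
  assumes "open S" "\<And>i. i \<in> I \<Longrightarrow> smooth_fn K S (f i)"
  shows "smooth_fn K S (\<lambda>c. \<Prod>i\<in>I. f i c)"
  using assms(2)
proof (induction I rule: infinite_finite_induct)
  case (insert i F)
  then show ?case using smooth_fn_mult[OF assms(1), of K "f i" "\<lambda>c. \<Prod>i\<in>F. f i c"] by simp
qed (simp_all add: smooth_fn_const[OF assms(1)])

lemma smooth_fn_inverse:
  assumes "open S" "smooth_fn K S f" "\<And>c. c \<in> S \<Longrightarrow> f c \<noteq> 0"
  shows "smooth_fn K S (\<lambda>c. inverse (f c))"
  using assms depends_on_op2[of K S f f "\<lambda>x y. inverse x"]
  by (simp add: smooth_fn_def smooth_coords_inverse)

lemma smooth_fn_cong:
  assumes "open S" "smooth_fn K S f" "\<And>c. c \<in> S \<Longrightarrow> f c = g c"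
  shows "smooth_fn K S g"
  unfolding smooth_fn_def
proof
  show "depends_on K S g"
    unfolding depends_on_def
  proof (intro ballI impI)
    fix c c' assume c: "c \<in> S" "c' \<in> S" "\<forall>k\<in>K. c k = c' k"
    have "f c = f c'" by (rule depends_onD[of K S f]) (use assms(2) c in \<open>auto simp: smooth_fn_def\<close>)
    then show "g c = g c'" using assms(3) c by simp
  qed
  show "smooth_coords S g"
    by (rule smooth_coords_cong[OF assms(1) _ assms(3)]) (use assms(2) in \<open>simp_all add: smooth_fn_def\<close>)
qed

lemma smooth_fn_eq:
  "smooth_fn K S f \<Longrightarrow> c \<in> S \<Longrightarrow> c' \<in> S \<Longrightarrow> (\<And>k. k \<in> K \<Longrightarrow> c k = c' k) \<Longrightarrow> f c = f c'"
  by (rule depends_onD[of K S f]) (auto simp: smooth_fn_def)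

context
  fixes K :: "'k set" and \<Omega> and j :: "'k \<Rightarrow> 'l germ"
  assumes \<Omega>: "region K \<Omega>" and j: "(\<lambda>k. ev (j k)) \<in> \<Omega>"
begin

lemma open_region: "open \<Omega>"
  using \<Omega> by (simp add: region_def)

lemma gcomp_sum:
  "(\<And>i. i \<in> I \<Longrightarrow> smooth_fn K \<Omega> (f i)) \<Longrightarrow> gcomp (\<lambda>c. \<Sum>i\<in>I. f i c) j = (\<Sum>i\<in>I. gcomp (f i) j)"
proof (induction I rule: infinite_finite_induct)
  case (insert i F)
  then show ?case
    using gcomp_add[OF \<Omega> j, of "f i" "\<lambda>c. \<Sum>i\<in>F. f i c"] smooth_fn_sum[OF open_region, of F K f] by simp
qed (simp_all add: gcomp_const)

lemma gcomp_prod: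
  "(\<And>i. i \<in> I \<Longrightarrow> smooth_fn K \<Omega> (f i)) \<Longrightarrow> gcomp (\<lambda>c. \<Prod>i\<in>I. f i c) j = (\<Prod>i\<in>I. gcomp (f i) j)"
proof (induction I rule: infinite_finite_induct)
  case (insert i F)
  then show ?case
    using gcomp_mult[OF \<Omega> j, of "f i" "\<lambda>c. \<Prod>i\<in>F. f i c"] smooth_fn_prod[OF open_region, of F K f] by simp
qed (simp_all add: gcomp_const)

lemma smooth_fn_det:
  assumes "\<And>a b. smooth_fn K \<Omega> (\<lambda>c. F c $ a $ b)"
  shows "smooth_fn K \<Omega> (\<lambda>c. det (F c :: real ^ 'n ^ 'n))"
  unfolding det_def
  by (intro smooth_fn_sum smooth_fn_mult smooth_fn_prod smooth_fn_const open_region assms)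

lemma gcomp_det:
  assumes "\<And>a b. smooth_fn K \<Omega> (\<lambda>c. F c $ a $ b)"
  shows "gcomp (\<lambda>c. det (F c :: real ^ 'n ^ 'n)) j = det (\<chi> a b. gcomp (\<lambda>c. F c $ a $ b) j)"
proof -
  have of_int: "of_int n = real_of_int n *\<^sub>R (1 :: 'l germ)" for n
    by (metis of_real_def of_real_of_int_eq)
  have sm: "smooth_fn K \<Omega> (\<lambda>c. \<Prod>i\<in>UNIV. F c $ i $ p i)" for p
    by (intro smooth_fn_prod open_region assms)
  have "gcomp (\<lambda>c. real_of_int (sign p) * (\<Prod>i\<in>UNIV. F c $ i $ p i)) j =
      of_int (sign p) * (\<Prod>i\<in>UNIV. gcomp (\<lambda>c. F c $ i $ p i) j)" for p
    using gcomp_mult[OF \<Omega> j smooth_fn_const[OF open_region, of K "real_of_int (sign p)"] sm[of p]]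
    by (simp add: gcomp_const gcomp_prod assms of_int)
  then show ?thesis unfolding det_def
    by (subst gcomp_sum) (auto intro!: smooth_fn_mult smooth_fn_const open_region sm)
qed

end

section \<open>Total derivatives along the jet of an immersion\<close>

definition upto_order :: "nat \<Rightarrow> ('a \<times> 'n multiset) set" where
  "upto_order r = {k. size (snd k) \<le> r}"

lemma upto_order_Sigma: "upto_order r = UNIV \<times> {M. size M \<le> r}"
  by (auto simp: upto_order_def)

lemma finite_upto_order [simp]: "finite (upto_order r :: ('a::finite \<times> 'n::finite multiset) set)"
  by (simp add: upto_order_Sigma finite_cartesian_product)

lemma upto_order_mono: "r \<le> r' \<Longrightarrow> upto_order r \<subseteq> upto_order r'"
  by (auto simp: upto_order_def)

lemma dtot_multisets:
  "dtot t i f c = (\<Sum>k\<in>upto_order (t - 1). pd k f c * c (fst k, add_mset i (snd k)))"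
proof -
  have "(\<Sum>J\<in>{J. length J \<le> t - 1}. c (A, mset (i # J)) * dpart A J f c) =
      (\<Sum>M\<in>{M. size M \<le> t - 1}. pd (A, M) f c * c (A, add_mset i M))" for A
    unfolding sum_sym_weight[symmetric] by (intro sum.cong refl) (simp add: dpart_def mult_ac)
  then show ?thesis
    by (simp add: dtot_def upto_order_Sigma sum.cartesian_product case_prod_unfold)
qed

definition jet_region :: "(real ^ 'a) set \<Rightarrow> ('n::finite \<Rightarrow> 'a::finite) \<Rightarrow> ('a, 'n) vcoords set" where
  "jet_region B \<iota> = {c. (\<chi> A. c (A, {#})) \<in> B \<and> det (xmat \<iota> c) \<noteq> 0}"

lemma xmat_component: "xmat \<iota> c $ i $ j = c (\<iota> i, {#j#})"
  by (simp add: xmat_def)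

lemma continuous_on_det_xmat: "continuous_on S (\<lambda>c. det (xmat \<iota> c))"
  unfolding det_def xmat_component by (intro continuous_intros continuous_on_proj)

text \<open>The determinant involves first-order coordinates, whence \<open>r \<ge> 1\<close>; from
  then on the region is a cylinder over finitely many coordinates.\<close>

lemma region_jet_region:
  assumes "open B" "r \<ge> 1"
  shows "region (upto_order r) (jet_region B \<iota>)"
  unfolding region_def
proof (intro conjI)
  have "continuous_on UNIV (\<lambda>c :: ('a, 'b) vcoords. \<chi> A. c (A, {#}))"
    by (intro continuous_on_vec_lambda continuous_on_proj)
  then have "open ((\<lambda>c :: ('a, 'b) vcoords. \<chi> A. c (A, {#})) -` B)" by (rule open_vimage[OF assms(1)])
  moreover have "open {c :: ('a, 'b) vcoords. det (xmat \<iota> c) \<noteq> 0}"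
    by (rule open_Collect_neq[OF continuous_on_det_xmat continuous_on_const])
  ultimately have "open ((\<lambda>c :: ('a, 'b) vcoords. \<chi> A. c (A, {#})) -` B \<inter> {c. det (xmat \<iota> c) \<noteq> 0})" by (rule open_Int)
  then show "open (jet_region B \<iota>)" by (simp add: jet_region_def vimage_def Collect_conj_eq)
  show "saturated (upto_order r) (jet_region B \<iota>)"
    unfolding saturated_def
  proof (intro ballI allI impI)
    fix c c' assume c: "c \<in> jet_region B \<iota>" "\<forall>k\<in>upto_order r. c k = c' k"
    have "c (A, {#}) = c' (A, {#})" "c (A, {#j#}) = c' (A, {#j#})" for A j
      using c(2) assms(2) by (auto simp: upto_order_def)
    then have "(\<chi> A. c (A, {#})) = (\<chi> A. c' (A, {#}))" "xmat \<iota> c = xmat \<iota> c'"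
      by (simp_all add: xmat_def)
    then show "c' \<in> jet_region B \<iota>" using c(1) by (simp add: jet_region_def)
  qed
qed simp

lemma derivations_pder: "derivations (\<lambda>i. pder (e i))"
  by (intro derivations.intro derivation.intro pder_add pder_mult pder_scaleR pder_commute)

text \<open>\<open>e\<close> names the variables in which the immersion is differentiated. It is the
  identity for the immersion itself and \<open>Some\<close> for a deformation, whose additional
  variable takes no part in the jet.\<close>

locale jets =
  fixes e :: "'n::finite \<Rightarrow> 'k" and \<gamma> :: "'a::finite \<Rightarrow> 'k germ" and B :: "(real ^ 'a) set" and \<iota> :: "'n \<Rightarrow> 'a"
    and jet :: "'a \<times> 'n multiset \<Rightarrow> 'k germ"
  assumes open_B: "open B"
    and jet_def: "jet = (\<lambda>(A, M). derivations.dm (\<lambda>i. pder (e i)) M (\<gamma> A))"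
    and jet_mem: "(\<lambda>k. ev (jet k)) \<in> jet_region B \<iota>"
begin

interpretation d: derivations "\<lambda>i. pder (e i)" by (rule derivations_pder)

abbreviation "Reg \<equiv> jet_region B \<iota>"

lemma region_Reg: "r \<ge> 1 \<Longrightarrow> region (upto_order r) Reg"
  by (rule region_jet_region[OF open_B])

lemma open_Reg: "open Reg"
  using region_Reg[of 1] by (simp add: region_def)

lemma jet_empty: "jet (A, {#}) = \<gamma> A"
  by (simp add: jet_def d.dm_def)

lemma jet_add_mset: "jet (A, add_mset i M) = pder (e i) (jet (A, M))"
  by (simp add: jet_def d.dm_add_mset)

text \<open>The region is not determined by the coordinates of order \<open>0\<close>; the second condition makes
  the notion precise for \<open>r = 0\<close>.\<close>

definition of_order :: "nat \<Rightarrow> (('a, 'n) vcoords \<Rightarrow> real) \<Rightarrow> bool" where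
  "of_order r f \<longleftrightarrow> smooth_fn (upto_order (max 1 r)) Reg f \<and> (\<forall>k. \<forall>c\<in>Reg. r < size (snd k) \<longrightarrow> pd k f c = 0)"

lemma of_orderI:
  assumes "r \<ge> 1" "smooth_fn (upto_order r) Reg f"
  shows "of_order r f"
  unfolding of_order_def
proof (intro conjI allI ballI impI)
  show "smooth_fn (upto_order (max 1 r)) Reg f" using assms by (simp add: max_def)
  fix k :: "'a \<times> 'n multiset" and c assume "c \<in> Reg" "r < size (snd k)"
  then show "pd k f c = 0"
    using region_Reg[OF assms(1)] assms(2)
    by (intro pd_eq_0[of Reg "upto_order r"]) (auto simp: region_def smooth_fn_def upto_order_def)
qed

lemma of_order_smooth_fn: "of_order r f \<Longrightarrow> max 1 r \<le> r' \<Longrightarrow> smooth_fn (upto_order r') Reg f"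
  unfolding of_order_def by (elim conjE) (rule smooth_fn_mono[OF _ upto_order_mono])

lemma of_order_proj: "of_order (size M) (\<lambda>c. c (A, M))"
  unfolding of_order_def
proof (intro conjI allI ballI impI)
  show "smooth_fn (upto_order (max 1 (size M))) Reg (\<lambda>c. c (A, M))"
    by (intro smooth_fn_proj open_Reg) (auto simp: upto_order_def)
  fix k :: "'a \<times> 'n multiset" and c :: "('a, 'n) vcoords" assume "size M < size (snd k)"
  then show "pd k (\<lambda>c. c (A, M)) c = 0" using pdI[OF has_pd_proj[of c k "(A, M)"]] by auto
qed

text \<open>Derivatives beyond order \<open>r\<close> vanish, so the order \<open>t\<close> of the
  surrounding manifold is immaterial once it exceeds \<open>r\<close>.\<close>

lemma dtot_eq:
  assumes f: "of_order r f" and t: "r + 1 \<le> t" and c: "c \<in> Reg"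
  shows "dtot t i f c = (\<Sum>k\<in>upto_order r. pd k f c * c (fst k, add_mset i (snd k)))"
  unfolding dtot_multisets
proof (rule sum.mono_neutral_right)
  show "upto_order r \<subseteq> (upto_order (t - 1) :: ('a \<times> 'n multiset) set)"
    using t by (intro upto_order_mono) simp
  show "\<forall>k\<in>upto_order (t - 1) - upto_order r. pd k f c * c (fst k, add_mset i (snd k)) = 0"
    using f c by (auto simp: of_order_def upto_order_def)
qed simp

lemma smooth_fn_dtot_sum:
  assumes f: "of_order r f"
  shows "smooth_fn (upto_order (r + 1)) Reg (\<lambda>c. \<Sum>k\<in>upto_order r. pd k f c * c (fst k, add_mset i (snd k)))"
proof (intro smooth_fn_sum smooth_fn_mult open_Reg smooth_fn_pd region_Reg)
  show "smooth_fn (upto_order (r + 1)) Reg f" by (rule of_order_smooth_fn[OF f]) simp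
qed (auto intro!: smooth_fn_proj open_Reg simp: upto_order_def)

lemma of_order_dtot:
  assumes f: "of_order r f" and t: "r + 1 \<le> t"
  shows "of_order (r + 1) (dtot t i f)"
  by (rule of_orderI, simp, rule smooth_fn_cong[OF open_Reg smooth_fn_dtot_sum[OF f]])
     (simp add: dtot_eq[OF f t])

lemma gcomp_eq:
  "r \<ge> 1 \<Longrightarrow> smooth_fn (upto_order r) Reg f \<Longrightarrow> smooth_fn (upto_order r) Reg g \<Longrightarrow> (\<And>c. c \<in> Reg \<Longrightarrow> f c = g c) \<Longrightarrow>
    gcomp f jet = gcomp g jet"
  by (rule gcomp_cong[OF region_Reg jet_mem])

text \<open>The chain rule: along a jet, raising the order of a coordinate by \<open>i\<close> is
  differentiation in the variable \<open>e i\<close>, so the total derivative turns into an honest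
  derivation.\<close>

lemma gcomp_dtot:
  assumes f: "of_order r f" and t: "r + 1 \<le> t"
  shows "gcomp (dtot t i f) jet = pder (e i) (gcomp f jet)"
proof -
  let ?K = "upto_order (max 1 r)"
  have reg: "region ?K Reg" "region (upto_order (r + 1)) Reg" by (simp_all add: region_Reg)
  have smf: "smooth_fn ?K Reg f" "smooth_fn (upto_order (r + 1)) Reg f" using of_order_smooth_fn[OF f] by simp_all
  have "gcomp (dtot t i f) jet = gcomp (\<lambda>c. \<Sum>k\<in>upto_order r. pd k f c * c (fst k, add_mset i (snd k))) jet"
    by (rule gcomp_eq[of "r + 1"])
       (use of_order_dtot[OF f t, of i] smooth_fn_dtot_sum[OF f] dtot_eq[OF f t] in \<open>auto simp: of_order_def max_def\<close>)
  also have "\<dots> = (\<Sum>k\<in>upto_order r. gcomp (\<lambda>c. pd k f c * c (fst k, add_mset i (snd k))) jet)"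
  proof (rule gcomp_sum[OF reg(2) jet_mem])
    fix k :: "'a \<times> 'n multiset" assume "k \<in> upto_order r"
    then show "smooth_fn (upto_order (r + 1)) Reg (\<lambda>c. pd k f c * c (fst k, add_mset i (snd k)))"
      by (intro smooth_fn_mult open_Reg smooth_fn_pd[OF reg(2) smf(2)] smooth_fn_proj) (simp add: upto_order_def)
  qed
  also have "\<dots> = (\<Sum>k\<in>upto_order r. gcomp (pd k f) jet * pder (e i) (jet k))"
  proof (rule sum.cong[OF refl])
    fix k :: "'a \<times> 'n multiset" assume k: "k \<in> upto_order r"
    have "gcomp (\<lambda>c. pd k f c * c (fst k, add_mset i (snd k))) jet = gcomp (pd k f) jet * jet (fst k, add_mset i (snd k))"
      using gcomp_mult[OF reg(2) jet_mem smooth_fn_pd[OF reg(2) smf(2), of k] smooth_fn_proj[OF open_Reg, of "(fst k, add_mset i (snd k))"]] k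
      by (simp add: gcomp_proj upto_order_def)
    then show "gcomp (\<lambda>c. pd k f c * c (fst k, add_mset i (snd k))) jet = gcomp (pd k f) jet * pder (e i) (jet k)"
      by (cases k) (simp add: jet_add_mset)
  qed
  \<comment> \<open>This matters for r = 0 only: the region needs first-order coordinates, so the
    chain rule runs over these too, although \<open>f\<close> has vanishing derivatives
    there.\<close>
  also have "\<dots> = (\<Sum>k\<in>?K. gcomp (pd k f) jet * pder (e i) (jet k))"
  proof (rule sum.mono_neutral_left)
    show "\<forall>k\<in>?K - upto_order r. gcomp (pd k f) jet * pder (e i) (jet k) = 0"
    proof
      fix k :: "'a \<times> 'n multiset" assume k: "k \<in> ?K - upto_order r"
      then have "r < size (snd k)" unfolding upto_order_def by (simp only: Diff_iff mem_Collect_eq not_le)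
      then have "pd k f c = 0" if "c \<in> Reg" for c
        using f[unfolded of_order_def, THEN conjunct2] that by metis
      then have "gcomp (pd k f) jet = gcomp (\<lambda>c. 0) jet"
        by (intro gcomp_cong[OF reg(1) jet_mem smooth_fn_pd[OF reg(1) smf(1)] smooth_fn_const[OF open_Reg]])
      then show "gcomp (pd k f) jet * pder (e i) (jet k) = 0" by (simp add: gcomp_const)
    qed
  qed (simp_all add: upto_order_mono del: One_nat_def)
  also have "\<dots> = pder (e i) (gcomp f jet)"
    by (rule pder_gcomp[OF reg(1) jet_mem smf(1), symmetric])
  finally show ?thesis .
qed

lemma dtots_jet:
  assumes f: "of_order r f" and t: "r + length J \<le> t"
  shows "of_order (r + length J) (dtots t J f) \<and> gcomp (dtots t J f) jet = d.dl J (gcomp f jet)"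
  using t
proof (induction J)
  case (Cons i J)
  then have IH: "of_order (r + length J) (dtots t J f)" "gcomp (dtots t J f) jet = d.dl J (gcomp f jet)" by auto
  have "dtots t (i # J) f = dtot t i (dtots t J f)" by (simp add: dtots_def)
  then show ?case
    using of_order_dtot[OF IH(1), of t i] gcomp_dtot[OF IH(1), of t i] Cons.prems by (simp add: IH(2) d.dl_Cons)
qed (simp add: dtots_def f)

subsection \<open>The frame of an immersion\<close>

lemma smooth_fn_xmat: "r \<ge> 1 \<Longrightarrow> smooth_fn (upto_order r) Reg (\<lambda>c. xmat \<iota> c $ a $ b)"
  unfolding xmat_component by (intro smooth_fn_proj open_Reg) (simp add: upto_order_def)

lemma gcomp_xmat: "gcomp (\<lambda>c. xmat \<iota> c $ a $ b) jet = pder (e b) (\<gamma> (\<iota> a))"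
  unfolding xmat_component gcomp_proj using jet_add_mset[of "\<iota> a" b "{#}"] by (simp add: jet_empty)

lemma smooth_fn_det_xmat: "smooth_fn (upto_order 1) Reg (\<lambda>c. det (xmat \<iota> c))"
  by (rule smooth_fn_det[OF region_Reg jet_mem]) (simp_all add: smooth_fn_xmat)

lemma matrix_inv_xmat:
  assumes "c \<in> Reg"
  shows "xmat \<iota> c ** matrix_inv (xmat \<iota> c) = mat 1" "matrix_inv (xmat \<iota> c) ** xmat \<iota> c = mat 1"
proof -
  have "invertible (xmat \<iota> c)" using assms by (simp add: jet_region_def invertible_det_nz)
  then have "\<exists>A'. xmat \<iota> c ** A' = mat 1 \<and> A' ** xmat \<iota> c = mat 1" by (simp add: invertible_def)
  then have "xmat \<iota> c ** matrix_inv (xmat \<iota> c) = mat 1 \<and> matrix_inv (xmat \<iota> c) ** xmat \<iota> c = mat 1"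
    unfolding matrix_inv_def by (rule someI_ex)
  then show "xmat \<iota> c ** matrix_inv (xmat \<iota> c) = mat 1" "matrix_inv (xmat \<iota> c) ** xmat \<iota> c = mat 1" by auto
qed

text \<open>By Cramer's rule every entry of the inverse is a determinant divided by
  \<open>det (xmat \<iota> c)\<close>, which is nonzero on the region.\<close>

lemma smooth_fn_matrix_inv: "smooth_fn (upto_order 1) Reg (\<lambda>c. matrix_inv (xmat \<iota> c) $ a $ b)"
proof -
  \<comment> \<open>Column \<open>a\<close> is replaced by the unit vector \<open>axis b 1\<close>,
    as Cramer's rule requires for entry (a, b) of the inverse.\<close>
  define F where "F c = (\<chi> i j. if j = a then (axis b 1 :: real ^ 'n) $ i else xmat \<iota> c $ i $ j)" for c
  have sm: "smooth_fn (upto_order 1) Reg (\<lambda>c. det (F c) * inverse (det (xmat \<iota> c)))"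
  proof (intro smooth_fn_mult smooth_fn_inverse open_Reg smooth_fn_det_xmat smooth_fn_det[OF region_Reg jet_mem])
    show "smooth_fn (upto_order 1) Reg (\<lambda>c. F c $ i $ j)" for i j
      by (cases "j = a") (simp_all add: F_def smooth_fn_xmat smooth_fn_const open_Reg)
  qed (simp_all add: jet_region_def)
  show ?thesis
  proof (rule smooth_fn_cong[OF open_Reg sm])
    fix c assume c: "c \<in> Reg"
    let ?A = "xmat \<iota> c" and ?w = "\<chi> k. matrix_inv (xmat \<iota> c) $ k $ b"
    have "?A *v ?w = axis b 1"
    proof (subst vec_eq_iff, intro allI)
      fix i
      have "(?A *v ?w) $ i = (?A ** matrix_inv ?A) $ i $ b"
        by (simp add: matrix_vector_mult_def matrix_matrix_mult_def)
      then show "(?A *v ?w) $ i = axis b 1 $ i" by (simp add: matrix_inv_xmat(1)[OF c] mat_def axis_def)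
    qed
    moreover have "det ?A \<noteq> 0" using c by (simp add: jet_region_def)
    ultimately have "?w = (\<chi> k. det (\<chi> i j. if j = k then axis b 1 $ i else ?A $ i $ j) / det ?A)"
      using cramer by blast
    then have "?w $ a = det (F c) / det ?A" unfolding F_def by simp
    then show "det (F c) * inverse (det (xmat \<iota> c)) = matrix_inv (xmat \<iota> c) $ a $ b" by (simp add: field_simps)
  qed
qed

definition zg :: "'n \<Rightarrow> 'n \<Rightarrow> 'k germ" where
  "zg j i = gcomp (\<lambda>c. matrix_inv (xmat \<iota> c) $ j $ i) jet"

definition det_germ :: "'k germ" where
  "det_germ = gcomp (\<lambda>c. det (xmat \<iota> c)) jet"

definition det_germ_inv :: "'k germ" where
  "det_germ_inv = gcomp (\<lambda>c. inverse (det (xmat \<iota> c))) jet"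

lemma frame_jets: "frame (\<lambda>i. pder (e i)) (\<lambda>i. \<gamma> (\<iota> i)) zg det_germ det_germ_inv"
proof (intro frame.intro derivations_pder frame_axioms.intro)
  have reg: "region (upto_order 1) Reg" by (simp add: region_Reg)
  have delta: "gcomp (\<lambda>c. if P then 1 else 0) jet = (if P then 1 else 0)" for P
    by (cases P) (simp_all add: gcomp_const)
  note sm = smooth_fn_mult[OF open_Reg] smooth_fn_matrix_inv smooth_fn_xmat[OF order_refl]
  fix i j k
  have "(\<Sum>j\<in>UNIV. zg j i * pder (e j) (\<gamma> (\<iota> k))) =
      (\<Sum>j\<in>UNIV. gcomp (\<lambda>c. matrix_inv (xmat \<iota> c) $ j $ i * xmat \<iota> c $ k $ j) jet)"
    by (intro sum.cong refl) (simp add: zg_def gcomp_xmat gcomp_mult[OF reg jet_mem] sm del: One_nat_def)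
  also have "\<dots> = gcomp (\<lambda>c. \<Sum>j\<in>UNIV. matrix_inv (xmat \<iota> c) $ j $ i * xmat \<iota> c $ k $ j) jet"
    by (rule gcomp_sum[OF reg jet_mem, symmetric]) (intro sm)
  also have "\<dots> = gcomp (\<lambda>c. if i = k then 1 else 0) jet"
  proof (rule gcomp_eq[of 1])
    fix c assume c: "c \<in> Reg"
    have "(\<Sum>j\<in>UNIV. matrix_inv (xmat \<iota> c) $ j $ i * xmat \<iota> c $ k $ j) = (xmat \<iota> c ** matrix_inv (xmat \<iota> c)) $ k $ i"
      by (simp add: matrix_matrix_mult_def mult.commute)
    then show "(\<Sum>j\<in>UNIV. matrix_inv (xmat \<iota> c) $ j $ i * xmat \<iota> c $ k $ j) = (if i = k then 1 else 0)"
      by (simp add: matrix_inv_xmat(1)[OF c] mat_def)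
  qed (intro smooth_fn_sum sm open_Reg smooth_fn_const order_refl)+
  finally show "(\<Sum>j\<in>UNIV. zg j i * pder (e j) (\<gamma> (\<iota> k))) = (if i = k then 1 else 0)" by (simp only: delta)
  have "(\<Sum>i\<in>UNIV. pder (e j) (\<gamma> (\<iota> i)) * zg k i) =
      (\<Sum>i\<in>UNIV. gcomp (\<lambda>c. xmat \<iota> c $ i $ j * matrix_inv (xmat \<iota> c) $ k $ i) jet)"
    by (intro sum.cong refl) (simp add: zg_def gcomp_xmat gcomp_mult[OF reg jet_mem] sm del: One_nat_def)
  also have "\<dots> = gcomp (\<lambda>c. \<Sum>i\<in>UNIV. xmat \<iota> c $ i $ j * matrix_inv (xmat \<iota> c) $ k $ i) jet"
    by (rule gcomp_sum[OF reg jet_mem, symmetric]) (intro sm)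
  also have "\<dots> = gcomp (\<lambda>c. if j = k then 1 else 0) jet"
  proof (rule gcomp_eq[of 1])
    fix c assume c: "c \<in> Reg"
    have "(\<Sum>i\<in>UNIV. xmat \<iota> c $ i $ j * matrix_inv (xmat \<iota> c) $ k $ i) = (matrix_inv (xmat \<iota> c) ** xmat \<iota> c) $ k $ j"
      by (simp add: matrix_matrix_mult_def mult.commute)
    then show "(\<Sum>i\<in>UNIV. xmat \<iota> c $ i $ j * matrix_inv (xmat \<iota> c) $ k $ i) = (if j = k then 1 else 0)"
      by (auto simp: matrix_inv_xmat(2)[OF c] mat_def)
  qed (intro smooth_fn_sum sm open_Reg smooth_fn_const order_refl)+
  finally show "(\<Sum>i\<in>UNIV. pder (e j) (\<gamma> (\<iota> i)) * zg k i) = (if j = k then 1 else 0)" by (simp only: delta)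
next
  have reg: "region (upto_order 1) Reg" by (simp add: region_Reg)
  show "det_germ = det (\<chi> i j. pder (e j) (\<gamma> (\<iota> i)))"
    unfolding det_germ_def by (subst gcomp_det[OF reg jet_mem]) (simp_all add: smooth_fn_xmat gcomp_xmat)
  have inv: "smooth_fn (upto_order 1) Reg (\<lambda>c. inverse (det (xmat \<iota> c)))"
    by (rule smooth_fn_inverse[OF open_Reg smooth_fn_det_xmat]) (simp add: jet_region_def)
  have "det_germ * det_germ_inv = gcomp (\<lambda>c. det (xmat \<iota> c) * inverse (det (xmat \<iota> c))) jet"
    by (simp only: det_germ_def det_germ_inv_def gcomp_mult[OF reg jet_mem smooth_fn_det_xmat inv])
  also have "\<dots> = gcomp (\<lambda>c. 1) jet"
  proof (rule gcomp_eq[of 1])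
    show "smooth_fn (upto_order 1) Reg (\<lambda>c. det (xmat \<iota> c) * inverse (det (xmat \<iota> c)))"
      by (rule smooth_fn_mult[OF open_Reg smooth_fn_det_xmat inv])
    show "smooth_fn (upto_order 1) Reg (\<lambda>c. 1)" by (rule smooth_fn_const[OF open_Reg])
  qed (simp_all add: jet_region_def)
  finally show "det_germ * det_germ_inv = 1" by (simp add: gcomp_const)
qed

sublocale f: frame "\<lambda>i. pder (e i)" "\<lambda>i. \<gamma> (\<iota> i)" zg det_germ det_germ_inv
  by (rule frame_jets)

lemma gcomp_frame_step:
  assumes f: "of_order r f" and t: "r + 1 \<le> t"
  shows "of_order (r + 1) (\<lambda>c. \<Sum>p\<in>UNIV. matrix_inv (xmat \<iota> c) $ p $ i * dtot t p f c) \<and>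
    gcomp (\<lambda>c. \<Sum>p\<in>UNIV. matrix_inv (xmat \<iota> c) $ p $ i * dtot t p f c) jet = f.fd i (gcomp f jet)"
proof -
  have reg: "region (upto_order (r + 1)) Reg" by (simp add: region_Reg)
  have z: "smooth_fn (upto_order (r + 1)) Reg (\<lambda>c. matrix_inv (xmat \<iota> c) $ p $ i)" for p
    by (rule smooth_fn_mono[OF smooth_fn_matrix_inv upto_order_mono]) simp
  have D: "smooth_fn (upto_order (r + 1)) Reg (dtot t p f)" for p
    by (rule of_order_smooth_fn[OF of_order_dtot[OF f t]]) simp
  have "gcomp (\<lambda>c. \<Sum>p\<in>UNIV. matrix_inv (xmat \<iota> c) $ p $ i * dtot t p f c) jet =
      (\<Sum>p\<in>UNIV. zg p i * pder (e p) (gcomp f jet))"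
    by (subst gcomp_sum[OF reg jet_mem])
       (simp_all add: smooth_fn_mult open_Reg z D gcomp_mult[OF reg jet_mem] zg_def gcomp_dtot[OF f t] del: One_nat_def)
  moreover have "of_order (r + 1) (\<lambda>c. \<Sum>p\<in>UNIV. matrix_inv (xmat \<iota> c) $ p $ i * dtot t p f c)"
    by (rule of_orderI, simp, intro smooth_fn_sum smooth_fn_mult open_Reg z D)
  ultimately show ?thesis by (simp only: f.fd_def simp_thms)
qed

text \<open>Each additional letter costs one total derivative and so raises the order by one;
  \<open>length K \<le> t\<close> ensures that none of these derivatives is truncated.\<close>

lemma zjet_jet:
  "K \<noteq> [] \<Longrightarrow> length K \<le> t \<Longrightarrow> of_order (length K) (zjet \<iota> t i K) \<and> gcomp (zjet \<iota> t i K) jet = f.zz i K"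
proof (induction K)
  case (Cons j K)
  show ?case
  proof (cases K)
    case Nil
    then show ?thesis using of_orderI[OF order_refl smooth_fn_matrix_inv] by (simp add: f.zz_single zg_def[symmetric])
  next
    case (Cons k J)
    then have IH: "of_order (length K) (zjet \<iota> t i K)" "gcomp (zjet \<iota> t i K) jet = f.zz i K"
      using Cons.IH Cons.prems by auto
    have "zjet \<iota> t i (j # K) = (\<lambda>c. \<Sum>p\<in>UNIV. matrix_inv (xmat \<iota> c) $ p $ j * dtot t p (zjet \<iota> t i K) c)"
      by (simp add: Cons)
    moreover have "length K + 1 \<le> t" "length (j # K) = length K + 1" using Cons.prems(2) by simp_all
    moreover have "f.zz i (j # K) = f.fd j (f.zz i K)" using f.zz_Cons[of K i j] Cons by simp
    ultimately show ?thesis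
      using gcomp_frame_step[OF IH(1), of t j] by (simp only: IH(2) simp_thms)
  qed
qed simp

lemma yjet_jet:
  "length K \<le> t \<Longrightarrow> of_order (length K) (yjet \<iota> t \<sigma> K) \<and> gcomp (yjet \<iota> t \<sigma> K) jet = f.F.dl K (\<gamma> \<sigma>)"
proof (induction K)
  case Nil
  then show ?case using of_order_proj[of "{#}" \<sigma>] gcomp_proj[of "(\<sigma>, {#})" jet] by (simp add: jet_empty)
next
  case (Cons j K)
  then have IH: "of_order (length K) (yjet \<iota> t \<sigma> K)" "gcomp (yjet \<iota> t \<sigma> K) jet = f.F.dl K (\<gamma> \<sigma>)"
    by auto
  have "yjet \<iota> t \<sigma> (j # K) = (\<lambda>c. \<Sum>p\<in>UNIV. matrix_inv (xmat \<iota> c) $ p $ j * dtot t p (yjet \<iota> t \<sigma> K) c)"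
    by simp
  then show ?case
    using gcomp_frame_step[OF IH(1), of t j] Cons.prems by (simp add: IH(2) f.F.dl_Cons)
qed

end

section \<open>Functions on the quotient\<close>

definition pord :: "('n::finite \<Rightarrow> 'a::finite) \<Rightarrow> nat \<Rightarrow> ('a, 'n) pindex set" where
  "pord \<iota> r = range PX \<union> (\<lambda>(\<sigma>, M). PY \<sigma> M) ` ((- range \<iota>) \<times> {M. size M \<le> r})"

definition quot_region :: "(real ^ 'a) set \<Rightarrow> ('n::finite \<Rightarrow> 'a::finite) \<Rightarrow> ('a, 'n) pcoords set" where
  "quot_region B \<iota> = {Y. (\<chi> A. if A \<in> range \<iota> then Y (PX (inv \<iota> A)) else Y (PY A {#})) \<in> B}"

lemma PX_pord [simp]: "PX i \<in> pord \<iota> r"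
  by (simp add: pord_def)

lemma PY_pord [simp]: "PY \<sigma> M \<in> pord \<iota> r \<longleftrightarrow> \<sigma> \<notin> range \<iota> \<and> size M \<le> r"
  by (auto simp: pord_def)

lemma finite_pord [simp]: "finite (pord \<iota> r)"
  by (simp add: pord_def)

lemma pord_mono:
  assumes "r \<le> r'"
  shows "pord \<iota> r \<subseteq> pord \<iota> r'"
proof
  fix k assume "k \<in> pord \<iota> r"
  then show "k \<in> pord \<iota> r'" using assms by (cases k) auto
qed

lemma sum_pord: "(\<Sum>k\<in>pord \<iota> r. F k) = (\<Sum>i\<in>UNIV. F (PX i)) + (\<Sum>\<sigma>\<in>- range \<iota>. \<Sum>M\<in>{M. size M \<le> r}. F (PY \<sigma> M))"
proof -
  have "(\<Sum>k\<in>pord \<iota> r. F k) = (\<Sum>k\<in>range PX. F k) +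
      (\<Sum>k\<in>(\<lambda>(\<sigma>, M). PY \<sigma> M) ` ((- range \<iota>) \<times> {M. size M \<le> r}). F k)"
    unfolding pord_def by (rule sum.union_disjoint) auto
  also have "(\<Sum>k\<in>range PX. F k) = (\<Sum>i\<in>UNIV. F (PX i))"
    by (subst sum.reindex) (auto simp: inj_on_def)
  also have "(\<Sum>k\<in>(\<lambda>(\<sigma>, M). PY \<sigma> M) ` ((- range \<iota>) \<times> {M. size M \<le> r}). F k) =
      (\<Sum>k\<in>(- range \<iota>) \<times> {M. size M \<le> r}. F (case k of (\<sigma>, M) \<Rightarrow> PY \<sigma> M))"
    by (subst sum.reindex) (auto simp: inj_on_def)
  finally show ?thesis by (simp add: sum.cartesian_product case_prod_unfold)
qed

lemma region_quot_region:
  assumes "open B"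
  shows "region (pord \<iota> r) (quot_region B \<iota>)"
  unfolding region_def
proof (intro conjI)
  have "continuous_on UNIV (\<lambda>Y :: ('a, 'b) pcoords. \<chi> A. if A \<in> range \<iota> then Y (PX (inv \<iota> A)) else Y (PY A {#}))"
  proof (rule continuous_on_vec_lambda)
    fix A
    show "continuous_on UNIV (\<lambda>Y :: ('a, 'b) pcoords. if A \<in> range \<iota> then Y (PX (inv \<iota> A)) else Y (PY A {#}))"
      by (cases "A \<in> range \<iota>") (simp_all add: continuous_on_proj)
  qed
  then have "open ((\<lambda>Y :: ('a, 'b) pcoords. \<chi> A. if A \<in> range \<iota> then Y (PX (inv \<iota> A)) else Y (PY A {#})) -` B)"
    by (rule open_vimage[OF assms])
  then show "open (quot_region B \<iota>)" by (simp add: quot_region_def vimage_def)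
  show "saturated (pord \<iota> r) (quot_region B \<iota>)"
    unfolding saturated_def
  proof (intro ballI allI impI)
    fix Y Y' assume Y: "Y \<in> quot_region B \<iota>" "\<forall>k\<in>pord \<iota> r. Y k = Y' k"
    have eq: "Y k = Y' k" if "k \<in> pord \<iota> r" for k by (rule bspec[OF Y(2) that])
    have "(if A \<in> range \<iota> then Y (PX (inv \<iota> A)) else Y (PY A {#})) =
        (if A \<in> range \<iota> then Y' (PX (inv \<iota> A)) else Y' (PY A {#}))" for A
      by (cases "A \<in> range \<iota>") (simp_all only: if_True if_False eq PX_pord PY_pord size_empty le0 not_False_eq_True simp_thms)
    then show "Y' \<in> quot_region B \<iota>" using Y(1) by (simp only: quot_region_def mem_Collect_eq)
  qed
qed simp

text \<open>The coefficient of the partial derivative with respect to the given coordinate in \<open>D\<^sub>i\<close>.\<close>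

fun shift :: "'n \<Rightarrow> ('a, 'n) pindex \<Rightarrow> ('a, 'n) pcoords \<Rightarrow> real" where
  "shift i (PX j) Y = (if i = j then 1 else 0)"
| "shift i (PY \<sigma> M) Y = Y (PY \<sigma> (add_mset i M))"

lemma Dtot_pord: "Dtot \<iota> t i f Y = (\<Sum>k\<in>pord \<iota> (t - 1). pd k f Y * shift i k Y)"
proof -
  have "(\<Sum>J\<in>{J. length J \<le> t - 1}. Y (PY \<sigma> (mset (i # J))) * Delta \<sigma> J f Y) =
      (\<Sum>M\<in>{M. size M \<le> t - 1}. pd (PY \<sigma> M) f Y * Y (PY \<sigma> (add_mset i M)))" for \<sigma>
    unfolding sum_sym_weight[symmetric] by (intro sum.cong refl) (simp add: Delta_def mult_ac)
  moreover have "(\<Sum>j\<in>UNIV. pd (PX j) f Y * (if i = j then 1 else 0)) = pd (PX i) f Y"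
    by (simp add: if_distrib[of "\<lambda>x. _ * x"] cong: if_cong)
  ultimately show ?thesis unfolding Dtot_def sum_pord shift.simps by (simp only:)
qed

lemma sym_weight_cong: "mset I = mset J \<Longrightarrow> sym_weight I = sym_weight J"
  by (simp only: sym_weight_def count_list_mset size_mset[symmetric])

section \<open>Operators of the quotient along an immersion\<close>

context jets
begin

abbreviation "Om \<equiv> quot_region B \<iota>"

text \<open>The germs of the quotient coordinates along the immersion: y^\<sigma>_M is the M-th
  frame derivative of \<gamma> \<sigma>.\<close>

definition qjet :: "('a, 'n) pindex \<Rightarrow> 'k germ" where
  "qjet k = (case k of PX i \<Rightarrow> \<gamma> (\<iota> i) | PY \<sigma> M \<Rightarrow> f.F.dm M (\<gamma> \<sigma>))"

lemma qjet_PX [simp]: "qjet (PX i) = \<gamma> (\<iota> i)" and qjet_PY: "qjet (PY \<sigma> M) = f.F.dm M (\<gamma> \<sigma>)"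
  by (simp_all add: qjet_def)

lemma region_Om: "region (pord \<iota> r) Om"
  by (rule region_quot_region[OF open_B])

lemma open_Om: "open Om"
  using region_Om[of 0] by (simp add: region_def)

lemma ev_gamma: "ev (\<gamma> A) = ev (jet (A, {#}))"
  by (simp add: jet_empty)

lemma qjet_mem: "(\<lambda>k. ev (qjet k)) \<in> Om"
proof -
  have "(\<chi> A. if A \<in> range \<iota> then ev (qjet (PX (inv \<iota> A))) else ev (qjet (PY A {#}))) = (\<chi> A. ev (jet (A, {#})))"
    by (auto simp: vec_eq_iff ev_gamma[symmetric] f_inv_into_f qjet_PY f.F.dm_def)
  then show ?thesis using jet_mem by (simp add: quot_region_def jet_region_def)
qed

lemma pder_qjet_chain:
  assumes f: "smooth_fn (pord \<iota> r) Om f"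
  shows "pder l (gcomp f qjet) = (\<Sum>k\<in>pord \<iota> r. gcomp (pd k f) qjet * pder l (qjet k))"
  by (rule pder_gcomp[OF region_Om qjet_mem f])

lemma fd_qjet_chain:
  assumes f: "smooth_fn (pord \<iota> r) Om f"
  shows "f.fd i (gcomp f qjet) = (\<Sum>k\<in>pord \<iota> r. gcomp (pd k f) qjet * f.fd i (qjet k))"
  unfolding f.fd_def pder_qjet_chain[OF f] sum_distrib_left
  by (subst sum.swap) (simp add: mult_ac)

text \<open>\<open>char_der\<close> is a combination of derivations with coefficients in the ring,
  so it obeys the chain rule like each of them.\<close>

lemma char_der_qjet_chain:
  assumes f: "smooth_fn (pord \<iota> r) Om f"
  shows "f.char_der (pder l) (gcomp f qjet) = (\<Sum>k\<in>pord \<iota> r. gcomp (pd k f) qjet * f.char_der (pder l) (qjet k))"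
  unfolding f.char_der_def pder_qjet_chain[OF f] fd_qjet_chain[OF f] sum_distrib_left right_diff_distrib sum_subtractf
  by (subst sum.swap) (simp add: mult_ac)

lemma smooth_fn_shift: "k \<in> pord \<iota> r \<Longrightarrow> smooth_fn (pord \<iota> (r + 1)) Om (shift i k)"
proof (cases k)
  case (PY \<sigma> M)
  assume "k \<in> pord \<iota> r"
  then have "smooth_fn (pord \<iota> (r + 1)) Om (\<lambda>Y. Y (PY \<sigma> (add_mset i M)))"
    by (intro smooth_fn_proj open_Om) (simp add: PY)
  moreover have "shift i k = (\<lambda>Y. Y (PY \<sigma> (add_mset i M)))" by (rule ext) (simp add: PY)
  ultimately show ?thesis by simp
next
  case (PX j)
  have "shift i k = (\<lambda>Y. if i = j then 1 else 0)" by (rule ext) (simp add: PX)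
  then show ?thesis by (simp add: smooth_fn_const open_Om)
qed

lemma gcomp_shift: "gcomp (shift i k) qjet = f.fd i (qjet k)"
proof (cases k)
  case (PX j)
  have "shift i k = (\<lambda>Y. if i = j then 1 else 0)" by (rule ext) (simp add: PX)
  then show ?thesis by (simp add: PX gcomp_const f.fd_g)
next
  case (PY \<sigma> M)
  have "shift i k = (\<lambda>Y. Y (PY \<sigma> (add_mset i M)))" by (rule ext) (simp add: PY)
  then show ?thesis by (simp add: PY gcomp_proj qjet_PY f.F.dm_add_mset)
qed

lemma smooth_fn_Dtot_sum:
  assumes f: "smooth_fn (pord \<iota> r) Om f"
  shows "smooth_fn (pord \<iota> (r + 1)) Om (\<lambda>Y. \<Sum>k\<in>pord \<iota> r. pd k f Y * shift i k Y)"
proof (intro smooth_fn_sum smooth_fn_mult open_Om smooth_fn_shift)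
  fix k
  show "smooth_fn (pord \<iota> (r + 1)) Om (pd k f)"
    by (rule smooth_fn_mono[OF smooth_fn_pd[OF region_Om f] pord_mono]) simp
qed

text \<open>The chain rule for the frame: \<open>fd i\<close> sends each quotient coordinate to
  \<open>shift i\<close> of it, the coefficient with which D_i differentiates in that
  coordinate.\<close>

lemma Dtot_qjet:
  assumes f: "smooth_fn (pord \<iota> r) Om f" and t: "r + 1 \<le> t"
  shows "smooth_fn (pord \<iota> (r + 1)) Om (Dtot \<iota> t i f)" "gcomp (Dtot \<iota> t i f) qjet = f.fd i (gcomp f qjet)"
proof -
  have eq: "(\<Sum>k\<in>pord \<iota> r. pd k f Y * shift i k Y) = Dtot \<iota> t i f Y" if "Y \<in> Om" for Y
    unfolding Dtot_pord
  proof (rule sum.mono_neutral_left)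
    show "pord \<iota> r \<subseteq> pord \<iota> (t - 1)" using t by (intro pord_mono) simp
    show "\<forall>k\<in>pord \<iota> (t - 1) - pord \<iota> r. pd k f Y * shift i k Y = 0"
    proof
      fix k assume "k \<in> pord \<iota> (t - 1) - pord \<iota> r"
      then have "pd k f Y = 0"
        using region_Om[of r] f that by (intro pd_eq_0[of Om "pord \<iota> r"]) (auto simp: region_def smooth_fn_def)
      then show "pd k f Y * shift i k Y = 0" by simp
    qed
  qed simp
  show sm: "smooth_fn (pord \<iota> (r + 1)) Om (Dtot \<iota> t i f)"
    by (rule smooth_fn_cong[OF open_Om smooth_fn_Dtot_sum[OF f] eq])
  have "gcomp (Dtot \<iota> t i f) qjet = gcomp (\<lambda>Y. \<Sum>k\<in>pord \<iota> r. pd k f Y * shift i k Y) qjet"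
    by (rule gcomp_cong[OF region_Om qjet_mem sm smooth_fn_Dtot_sum[OF f] eq[symmetric]])
  also have "\<dots> = (\<Sum>k\<in>pord \<iota> r. gcomp (pd k f) qjet * f.fd i (qjet k))"
  proof (subst gcomp_sum[OF region_Om qjet_mem])
    have pd: "smooth_fn (pord \<iota> (r + 1)) Om (pd k f)" for k
      by (rule smooth_fn_mono[OF smooth_fn_pd[OF region_Om f] pord_mono]) simp
    show "smooth_fn (pord \<iota> (r + 1)) Om (\<lambda>Y. pd k f Y * shift i k Y)" if "k \<in> pord \<iota> r" for k
      by (rule smooth_fn_mult[OF open_Om pd smooth_fn_shift[OF that]])
    show "(\<Sum>k\<in>pord \<iota> r. gcomp (\<lambda>Y. pd k f Y * shift i k Y) qjet) = (\<Sum>k\<in>pord \<iota> r. gcomp (pd k f) qjet * f.fd i (qjet k))"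
      by (rule sum.cong[OF refl], subst gcomp_mult[OF region_Om qjet_mem pd smooth_fn_shift], assumption)
         (simp only: gcomp_shift)
  qed
  also have "\<dots> = f.fd i (gcomp f qjet)" by (rule fd_qjet_chain[OF f, symmetric])
  finally show "gcomp (Dtot \<iota> t i f) qjet = f.fd i (gcomp f qjet)" .
qed

lemma Dtots_qjet:
  assumes f: "smooth_fn (pord \<iota> r) Om f" and t: "r + length J \<le> t"
  shows "smooth_fn (pord \<iota> (r + length J)) Om (Dtots \<iota> t J f) \<and> gcomp (Dtots \<iota> t J f) qjet = f.F.dl J (gcomp f qjet)"
  using t
proof (induction J)
  case (Cons i J)
  then have IH: "smooth_fn (pord \<iota> (r + length J)) Om (Dtots \<iota> t J f)" "gcomp (Dtots \<iota> t J f) qjet = f.F.dl J (gcomp f qjet)"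
    by auto
  have "Dtots \<iota> t (i # J) f = Dtot \<iota> t i (Dtots \<iota> t J f)" by (simp add: Dtots_def)
  then show ?case
    using Dtot_qjet[OF IH(1), of t i] Cons.prems by (simp add: IH(2) f.F.dl_Cons)
qed (simp add: Dtots_def f)

lemma smooth_fn_Delta: "smooth_fn (pord \<iota> r) Om f \<Longrightarrow> smooth_fn (pord \<iota> r) Om (Delta \<sigma> J f)"
  unfolding Delta_def[abs_def] by (intro smooth_fn_mult smooth_fn_const open_Om smooth_fn_pd[OF region_Om])

lemma gcomp_Delta:
  assumes "smooth_fn (pord \<iota> r) Om f"
  shows "gcomp (Delta \<sigma> J f) qjet = sym_weight J *\<^sub>R gcomp (pd (PY \<sigma> (mset J)) f) qjet"
  unfolding Delta_def[abs_def]
  by (subst gcomp_mult[OF region_Om qjet_mem smooth_fn_const[OF open_Om] smooth_fn_pd[OF region_Om assms]])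
     (simp add: gcomp_const)

lemma gcomp_dpart:
  assumes "r \<ge> 1" "smooth_fn (upto_order r) Reg f"
  shows "gcomp (dpart A J f) jet = sym_weight J *\<^sub>R gcomp (pd (A, mset J) f) jet"
  unfolding dpart_def[abs_def]
  by (subst gcomp_mult[OF region_Reg[OF assms(1)] jet_mem smooth_fn_const[OF open_Reg] smooth_fn_pd[OF region_Reg[OF assms(1)] assms(2)]])
     (simp add: gcomp_const)

lemma smooth_fn_dpart: "r \<ge> 1 \<Longrightarrow> smooth_fn (upto_order r) Reg f \<Longrightarrow> smooth_fn (upto_order r) Reg (dpart A J f)"
  unfolding dpart_def[abs_def] by (intro smooth_fn_mult smooth_fn_const open_Reg smooth_fn_pd[OF region_Reg])

lemma smooth_fn_quot_coords:
  assumes "k \<in> pord \<iota> s" "s \<ge> 1" "s \<le> t"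
  shows "smooth_fn (upto_order s) Reg (\<lambda>c. quot_coords \<iota> t c k)"
    "gcomp (\<lambda>c. quot_coords \<iota> t c k) jet = qjet k"
proof -
  have "smooth_fn (upto_order s) Reg (\<lambda>c. quot_coords \<iota> t c k) \<and> gcomp (\<lambda>c. quot_coords \<iota> t c k) jet = qjet k"
  proof (cases k)
    case (PX i)
    have "smooth_fn (upto_order s) Reg (\<lambda>c. c (\<iota> i, {#}))"
      by (intro smooth_fn_proj open_Reg) (simp add: upto_order_def)
    then show ?thesis by (simp add: PX quot_coords_def gcomp_proj jet_empty)
  next
    case (PY \<sigma> M)
    then have "length (mlist M) \<le> t" "max 1 (length (mlist M)) \<le> s" using assms by simp_all
    then show ?thesis
      using yjet_jet[of "mlist M" t \<sigma>] of_order_smooth_fn[of "length (mlist M)" "yjet \<iota> t \<sigma> (mlist M)" s]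
      by (simp add: PY quot_coords_def qjet_PY f.F.dm_def)
  qed
  then show "smooth_fn (upto_order s) Reg (\<lambda>c. quot_coords \<iota> t c k)"
    "gcomp (\<lambda>c. quot_coords \<iota> t c k) jet = qjet k" by auto
qed

lemma quot_coords_mem:
  assumes "c \<in> Reg"
  shows "quot_coords \<iota> t c \<in> Om"
proof -
  have "(\<chi> A. if A \<in> range \<iota> then quot_coords \<iota> t c (PX (inv \<iota> A)) else quot_coords \<iota> t c (PY A {#})) = (\<chi> A. c (A, {#}))"
    by (auto simp: vec_eq_iff f_inv_into_f quot_coords_def)
  then show ?thesis using assms by (simp add: quot_region_def jet_region_def)
qed

text \<open>The projection to the quotient disappears: a function on the quotient, pulled back and
  restricted to the immersion, is that function at the frame derivatives.\<close>

lemma quot_comp: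
  assumes f: "smooth_fn (pord \<iota> s) Om f" and s: "s \<ge> 1" "s \<le> t"
  shows "smooth_fn (upto_order s) Reg (\<lambda>c. f (quot_coords \<iota> t c))"
    "gcomp (\<lambda>c. f (quot_coords \<iota> t c)) jet = gcomp f qjet"
proof -
  show "smooth_fn (upto_order s) Reg (\<lambda>c. f (quot_coords \<iota> t c))"
    by (rule smooth_fn_comp[OF region_Om f open_Reg, where F="\<lambda>k c. quot_coords \<iota> t c k"])
       (rule smooth_fn_quot_coords(1)[OF _ s] quot_coords_mem, assumption)+
  have "gcomp (\<lambda>c. f (quot_coords \<iota> t c)) jet = gcomp f (\<lambda>k. gcomp (\<lambda>c. quot_coords \<iota> t c k) jet)"
    by (rule gcomp_gcomp[OF region_Om f region_Reg[OF s(1)] jet_mem, where F="\<lambda>k c. quot_coords \<iota> t c k"])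
       (rule smooth_fn_quot_coords(1)[OF _ s] quot_coords_mem, assumption)+
  also have "\<dots> = gcomp f qjet"
    by (rule gcomp_cong_germs[OF region_Om qjet_mem f, symmetric]) (rule smooth_fn_quot_coords(2)[OF _ s, symmetric])
  finally show "gcomp (\<lambda>c. f (quot_coords \<iota> t c)) jet = gcomp f qjet" .
qed

end

section \<open>Variation of a homogeneous equation\<close>

text \<open>The relations between \<tau> and T' hold on a whole region of coordinates, so they
  persist for every immersion germ with jet in the region, and in particular for
  deformations.\<close>

locale equation_jets = jets e \<gamma> B \<iota> jet
  for e :: "'n::finite \<Rightarrow> 'k" and \<gamma> :: "'a::finite \<Rightarrow> 'k germ" and B :: "(real ^ 'a) set" and \<iota> :: "'n \<Rightarrow> 'a"
    and jet :: "'a \<times> 'n multiset \<Rightarrow> 'k germ" +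
  fixes s :: nat and \<tau> :: "'a \<Rightarrow> ('a, 'n) vcoords \<Rightarrow> real" and T' :: "'a \<Rightarrow> ('a, 'n) pcoords \<Rightarrow> real"
  assumes s: "s \<ge> 1"
    and smooth_tau: "smooth_fn (upto_order s) (jet_region B \<iota>) (\<tau> A)"
    and smooth_T: "\<sigma> \<notin> range \<iota> \<Longrightarrow> smooth_fn (pord \<iota> s) (quot_region B \<iota>) (T' \<sigma>)"
    and tau_sigma: "c \<in> jet_region B \<iota> \<Longrightarrow> \<sigma> \<notin> range \<iota> \<Longrightarrow> \<tau> \<sigma> c = det (xmat \<iota> c) * T' \<sigma> (quot_coords \<iota> s c)"
    and tau_iota: "c \<in> jet_region B \<iota> \<Longrightarrow> \<tau> (\<iota> p) c = - det (xmat \<iota> c) *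
      (\<Sum>\<sigma>\<in>- range \<iota>. yjet \<iota> s \<sigma> [p] c * T' \<sigma> (quot_coords \<iota> s c))"
begin

abbreviation "TT \<sigma> \<equiv> gcomp (T' \<sigma>) qjet"

lemmas T_comp = quot_comp[OF smooth_T s order_refl]

lemma gcomp_tau_sigma:
  assumes "\<sigma> \<notin> range \<iota>"
  shows "gcomp (\<tau> \<sigma>) jet = det_germ * TT \<sigma>"
proof -
  have sd: "smooth_fn (upto_order s) Reg (\<lambda>c. det (xmat \<iota> c))"
    by (rule smooth_fn_mono[OF smooth_fn_det_xmat upto_order_mono[OF s]])
  have "gcomp (\<tau> \<sigma>) jet = gcomp (\<lambda>c. det (xmat \<iota> c) * T' \<sigma> (quot_coords \<iota> s c)) jet"
    by (rule gcomp_eq[OF s smooth_tau smooth_fn_mult[OF open_Reg sd T_comp(1)[OF assms]]]) (simp add: tau_sigma assms)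
  then show ?thesis
    by (simp only: gcomp_mult[OF region_Reg[OF s] jet_mem sd T_comp(1)[OF assms]] T_comp(2)[OF assms] det_germ_def)
qed

lemma gcomp_tau_iota: "gcomp (\<tau> (\<iota> p)) jet = - (\<Sum>\<sigma>\<in>- range \<iota>. f.fd p (\<gamma> \<sigma>) * gcomp (\<tau> \<sigma>) jet)"
proof -
  have y: "smooth_fn (upto_order s) Reg (yjet \<iota> s \<sigma> [p])" "gcomp (yjet \<iota> s \<sigma> [p]) jet = f.fd p (\<gamma> \<sigma>)" for \<sigma>
  proof -
    have "of_order 1 (yjet \<iota> s \<sigma> [p]) \<and> gcomp (yjet \<iota> s \<sigma> [p]) jet = f.fd p (\<gamma> \<sigma>)"
      using yjet_jet[of "[p]" s \<sigma>] s by (simp add: f.F.dl_Cons)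
    then show "smooth_fn (upto_order s) Reg (yjet \<iota> s \<sigma> [p])" "gcomp (yjet \<iota> s \<sigma> [p]) jet = f.fd p (\<gamma> \<sigma>)"
      using of_order_smooth_fn[of 1 "yjet \<iota> s \<sigma> [p]" s] s by (auto simp del: yjet.simps)
  qed
  note sm = smooth_fn_mult[OF open_Reg smooth_fn_const[OF open_Reg] smooth_fn_sum[OF open_Reg smooth_fn_mult[OF open_Reg y(1) smooth_tau]]]
  have "gcomp (\<tau> (\<iota> p)) jet = gcomp (\<lambda>c. - 1 * (\<Sum>\<sigma>\<in>- range \<iota>. yjet \<iota> s \<sigma> [p] c * \<tau> \<sigma> c)) jet"
  proof (rule gcomp_eq[OF s smooth_tau sm])
    fix c assume "c \<in> Reg"
    then show "\<tau> (\<iota> p) c = - 1 * (\<Sum>\<sigma>\<in>- range \<iota>. yjet \<iota> s \<sigma> [p] c * \<tau> \<sigma> c)"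
      by (simp add: tau_iota tau_sigma sum_distrib_left mult_ac del: yjet.simps)
  qed
  also have "\<dots> = - (\<Sum>\<sigma>\<in>- range \<iota>. gcomp (\<lambda>c. yjet \<iota> s \<sigma> [p] c * \<tau> \<sigma> c) jet)"
    by (subst gcomp_mult[OF region_Reg[OF s] jet_mem smooth_fn_const[OF open_Reg] smooth_fn_sum[OF open_Reg smooth_fn_mult[OF open_Reg y(1) smooth_tau]]],
        subst gcomp_sum[OF region_Reg[OF s] jet_mem smooth_fn_mult[OF open_Reg y(1) smooth_tau]])
       (simp add: gcomp_const del: yjet.simps)
  also have "\<dots> = - (\<Sum>\<sigma>\<in>- range \<iota>. f.fd p (\<gamma> \<sigma>) * gcomp (\<tau> \<sigma>) jet)"
    by (simp only: gcomp_mult[OF region_Reg[OF s] jet_mem y(1) smooth_tau] y(2))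
  finally show ?thesis .
qed

lemma derivation_pder: "derivation (pder l)"
  by (intro derivation.intro pder_add pder_mult pder_scaleR)

lemma pder_fd: "pder l a = f.char_der (pder l) a + (\<Sum>p\<in>UNIV. pder l (\<gamma> (\<iota> p)) * f.fd p a)"
  by (simp add: f.char_der_def)

text \<open>The coordinates x^i drop out because \<open>char_der\<close> annihilates them. On the
  y^\<nu>_M it commutes with the frame, so only the transversal variations of the \<gamma> \<nu>
  enter.\<close>

lemma char_der_T:
  assumes "\<sigma> \<notin> range \<iota>"
  shows "f.char_der (pder l) (TT \<sigma>) =
    (\<Sum>\<nu>\<in>- range \<iota>. \<Sum>J\<in>{J. length J \<le> s}. gcomp (Delta \<nu> J (T' \<sigma>)) qjet * f.F.dl J (f.char_der (pder l) (\<gamma> \<nu>)))"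
proof -
  have "f.char_der (pder l) (TT \<sigma>) = (\<Sum>\<nu>\<in>- range \<iota>. \<Sum>M\<in>{M. size M \<le> s}.
      gcomp (pd (PY \<nu> M) (T' \<sigma>)) qjet * f.F.dm M (f.char_der (pder l) (\<gamma> \<nu>)))"
    unfolding char_der_qjet_chain[OF smooth_T[OF assms]] sum_pord
    by (simp add: f.char_der_g qjet_PY f.F.dm_def f.char_der_fdl[OF derivation_pder pder_commute])
  also have "\<dots> = (\<Sum>\<nu>\<in>- range \<iota>. \<Sum>J\<in>{J. length J \<le> s}. sym_weight J *\<^sub>R
      (gcomp (pd (PY \<nu> (mset J)) (T' \<sigma>)) qjet * f.F.dm (mset J) (f.char_der (pder l) (\<gamma> \<nu>))))"
    by (rule sum.cong[OF refl], rule sum_sym_weight[symmetric])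
  finally show ?thesis by (simp only: gcomp_Delta[OF smooth_T[OF assms]] f.F.dm_mset mult_scaleR_left)
qed

text \<open>The determinant contributes the divergence of the variation of the x^p, and T its
  transport along the tangential part. By the product rule these two form one divergence.\<close>

lemma variation_sigma:
  assumes "\<sigma> \<notin> range \<iota>"
  shows "pder l (gcomp (\<tau> \<sigma>) jet) = det_germ *
    ((\<Sum>p\<in>UNIV. f.fd p (pder l (\<gamma> (\<iota> p)) * TT \<sigma>)) +
     (\<Sum>\<nu>\<in>- range \<iota>. \<Sum>J\<in>{J. length J \<le> s}. gcomp (Delta \<nu> J (T' \<sigma>)) qjet * f.F.dl J (f.char_der (pder l) (\<gamma> \<nu>))))"
  unfolding gcomp_tau_sigma[OF assms] pder_mult f.derivation_Dt[OF derivation_pder pder_commute]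
    pder_fd[of l "TT \<sigma>"] char_der_T[OF assms] f.F.D.d_mult
  by (simp add: sum.distrib sum_distrib_left sum_distrib_right algebra_simps)

text \<open>Vary both factors of y^\<sigma>_p \<T>_\<sigma>. The variation of y^\<sigma>_p splits
  into a transversal part, which commutes with the frame, and a tangential one.\<close>

lemma variation_iota:
  "pder l (gcomp (\<tau> (\<iota> p)) jet) = - (\<Sum>\<sigma>\<in>- range \<iota>. f.fd p (\<gamma> \<sigma>) * pder l (gcomp (\<tau> \<sigma>) jet)) -
    det_germ * (\<Sum>\<sigma>\<in>- range \<iota>. (f.fd p (f.char_der (pder l) (\<gamma> \<sigma>)) +
      (\<Sum>q\<in>UNIV. pder l (\<gamma> (\<iota> q)) * f.fd q (f.fd p (\<gamma> \<sigma>)))) * TT \<sigma>)"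
proof -
  interpret E: derivation "pder l" by (rule derivation_pder)
  have "pder l (f.fd p (\<gamma> \<sigma>)) = f.fd p (f.char_der (pder l) (\<gamma> \<sigma>)) +
      (\<Sum>q\<in>UNIV. pder l (\<gamma> (\<iota> q)) * f.fd q (f.fd p (\<gamma> \<sigma>)))" for \<sigma>
    using pder_fd[of l "f.fd p (\<gamma> \<sigma>)"] by (simp only: f.char_der_fd[OF derivation_pder pder_commute])
  then have "pder l (gcomp (\<tau> (\<iota> p)) jet) = - (\<Sum>\<sigma>\<in>- range \<iota>. (f.fd p (f.char_der (pder l) (\<gamma> \<sigma>)) +
      (\<Sum>q\<in>UNIV. pder l (\<gamma> (\<iota> q)) * f.fd q (f.fd p (\<gamma> \<sigma>)))) * gcomp (\<tau> \<sigma>) jet +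
      f.fd p (\<gamma> \<sigma>) * pder l (gcomp (\<tau> \<sigma>) jet))"
    by (simp only: gcomp_tau_iota E.d_minus E.d_sum pder_mult)
  also have "\<dots> = - (\<Sum>\<sigma>\<in>- range \<iota>. (f.fd p (f.char_der (pder l) (\<gamma> \<sigma>)) +
      (\<Sum>q\<in>UNIV. pder l (\<gamma> (\<iota> q)) * f.fd q (f.fd p (\<gamma> \<sigma>)))) * (det_germ * TT \<sigma>) +
      f.fd p (\<gamma> \<sigma>) * pder l (gcomp (\<tau> \<sigma>) jet))"
    by (intro arg_cong[of _ _ uminus] sum.cong refl) (simp add: gcomp_tau_sigma)
  finally show ?thesis
    by (simp only: sum.distrib sum_distrib_left) (simp only: mult.left_commute minus_add_distrib add.commute diff_conv_add_uminus)
qed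

lemma variation_tau:
  "pder l (gcomp (\<tau> A) jet) = (\<Sum>C\<in>UNIV. \<Sum>J\<in>{J. length J \<le> s}. gcomp (dpart C J (\<tau> A)) jet * f.dl J (pder l (\<gamma> C)))"
proof -
  have E: "pder l (f.dl J a) = f.dl J (pder l a)" for J a
    by (induction J) (simp_all add: f.dl_Cons pder_commute[of l])
  have "pder l (gcomp (\<tau> A) jet) = (\<Sum>C\<in>UNIV. \<Sum>M\<in>{M. size M \<le> s}. gcomp (pd (C, M) (\<tau> A)) jet * f.dm M (pder l (\<gamma> C)))"
    unfolding pder_gcomp[OF region_Reg[OF s] jet_mem smooth_tau] upto_order_Sigma sum.cartesian_product
    by (intro sum.cong refl) (auto simp: jet_def f.dm_def E)
  also have "\<dots> = (\<Sum>C\<in>UNIV. \<Sum>J\<in>{J. length J \<le> s}. sym_weight J *\<^sub>R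
      (gcomp (pd (C, mset J) (\<tau> A)) jet * f.dm (mset J) (pder l (\<gamma> C))))"
    by (rule sum.cong[OF refl], rule sum_sym_weight[symmetric])
  finally show ?thesis by (simp only: gcomp_dpart[OF s smooth_tau] f.dm_mset mult_scaleR_left)
qed

end

section \<open>First variations as derivatives in a parameter\<close>

locale variation = equation_jets "\<lambda>i. i" \<gamma> B \<iota> jet s \<tau> T'
  for \<gamma> :: "'a::finite \<Rightarrow> 'n::finite germ" and B \<iota> jet s \<tau> T' +
  fixes v :: "'a \<Rightarrow> 'n germ"
begin

text \<open>The deformation \<gamma> + r v, where the parameter r is the variable
  \<open>None\<close>. Its derivative in r is \<open>v\<close>, and at r = 0 it is \<gamma>.\<close>

definition lift :: "'a \<Rightarrow> 'n option germ" where
  "lift A = gext (\<gamma> A) + gvar None * gext (v A)"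

definition lift_jet :: "'a \<times> 'n multiset \<Rightarrow> 'n option germ" where
  "lift_jet = (\<lambda>(A, M). derivations.dm (\<lambda>i. pder (Some i)) M (lift A))"

lemma gres_lift: "gres (lift A) = \<gamma> A"
  by (simp add: lift_def gres_add gres_mult gres_gext gres_gvar_None)

lemma pder_None_lift: "pder None (lift A) = gext (v A)"
  by (simp add: lift_def pder_add pder_mult pder_None_gext pder_gvar)

lemma gres_dl: "gres (derivations.dl (\<lambda>i. pder (Some i)) J a) = f.dl J (gres a)"
proof -
  interpret s: derivations "\<lambda>i. pder (Some i)" by (rule derivations_pder)
  show ?thesis by (induction J) (simp_all add: s.dl_Cons f.dl_Cons gres_pder)
qed

lemma gres_lift_jet: "(\<lambda>k. gres (lift_jet k)) = jet"
  by (auto simp: fun_eq_iff lift_jet_def jet_def derivations.dm_def[OF derivations_pder] gres_dl gres_lift)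

text \<open>Evaluation at the origin includes the parameter value 0, so the deformed jet has the
  same value at the point and stays in the region.\<close>

lemma lift_jets: "equation_jets Some lift B \<iota> lift_jet s \<tau> T'"
proof (intro equation_jets.intro jets.intro equation_jets_axioms.intro)
  show "open B" by (rule open_B)
  show "lift_jet = (\<lambda>(A, M). derivations.dm (\<lambda>i. pder (Some i)) M (lift A))" by (rule lift_jet_def)
  show "(\<lambda>k. ev (lift_jet k)) \<in> jet_region B \<iota>"
    using jet_mem unfolding gres_lift_jet[symmetric] ev_gres .
qed (fact s smooth_tau smooth_T tau_sigma tau_iota)+

interpretation L: equation_jets Some lift B \<iota> lift_jet s \<tau> T'
  by (rule lift_jets)

lemma gres_jet: "smooth_fn (upto_order r) Reg f \<Longrightarrow> r \<ge> 1 \<Longrightarrow> gres (gcomp f lift_jet) = gcomp f jet"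
  using gres_gcomp[OF region_Reg _ L.jet_mem] by (simp add: gres_lift_jet)

lemma gres_zg: "gres (L.zg j i) = zg j i"
  unfolding L.zg_def zg_def by (rule gres_jet[OF smooth_fn_matrix_inv order_refl])

lemma gres_det: "gres L.det_germ = det_germ"
  unfolding L.det_germ_def det_germ_def by (rule gres_jet[OF smooth_fn_det_xmat order_refl])

lemma gres_fd: "gres (L.f.fd i a) = f.fd i (gres a)"
  by (simp add: L.f.fd_def f.fd_def gres_sum gres_mult gres_zg gres_pder)

lemma gres_fdl: "gres (L.f.F.dl J a) = f.F.dl J (gres a)"
  by (induction J) (simp_all add: L.f.F.dl_Cons f.F.dl_Cons gres_fd)

lemma gres_qjet: "(\<lambda>k. gres (L.qjet k)) = qjet"
proof
  fix k show "gres (L.qjet k) = qjet k"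
    by (cases k) (simp_all add: gres_lift L.qjet_PY qjet_PY L.f.F.dm_def f.F.dm_def gres_fdl)
qed

lemma gres_quot: "smooth_fn (pord \<iota> r) Om f \<Longrightarrow> gres (gcomp f L.qjet) = gcomp f qjet"
  using gres_gcomp[OF region_Om _ L.qjet_mem] by (simp add: gres_qjet)

lemma gres_char_der:
  "gres (L.f.char_der (pder None) (lift A)) = v A - (\<Sum>p\<in>UNIV. v (\<iota> p) * f.fd p (\<gamma> A))"
  by (simp add: L.f.char_der_def pder_None_lift gres_diff gres_sum gres_mult gres_gext gres_fd gres_lift)

lemma linearization_tau:
  "gres (pder None (gcomp (\<tau> A) lift_jet)) = (\<Sum>C\<in>UNIV. \<Sum>J\<in>{J. length J \<le> s}. gcomp (dpart C J (\<tau> A)) jet * f.dl J (v C))"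
  unfolding L.variation_tau
  by (simp add: gres_sum gres_mult gres_jet[OF smooth_fn_dpart[OF s smooth_tau] s] gres_dl pder_None_lift gres_gext)

lemma linearization_sigma:
  assumes "\<sigma> \<notin> range \<iota>"
  shows "gres (pder None (gcomp (\<tau> \<sigma>) lift_jet)) = det_germ * ((\<Sum>p\<in>UNIV. f.fd p (v (\<iota> p) * TT \<sigma>)) +
    (\<Sum>\<nu>\<in>- range \<iota>. \<Sum>J\<in>{J. length J \<le> s}. gcomp (Delta \<nu> J (T' \<sigma>)) qjet *
      f.F.dl J (v \<nu> - (\<Sum>p\<in>UNIV. v (\<iota> p) * f.fd p (\<gamma> \<nu>)))))"
  unfolding L.variation_sigma[OF assms] gres_mult gres_add gres_sum gres_det gres_fd gres_fdl gres_char_der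
    gres_quot[OF smooth_T[OF assms]] gres_quot[OF smooth_fn_Delta[OF smooth_T[OF assms]]] pder_None_lift gres_gext ..

lemma linearization_iota:
  "gres (pder None (gcomp (\<tau> (\<iota> p)) lift_jet)) =
    - (\<Sum>\<sigma>\<in>- range \<iota>. f.fd p (\<gamma> \<sigma>) * gres (pder None (gcomp (\<tau> \<sigma>) lift_jet))) -
    det_germ * (\<Sum>\<sigma>\<in>- range \<iota>. (f.fd p (v \<sigma> - (\<Sum>q\<in>UNIV. v (\<iota> q) * f.fd q (\<gamma> \<sigma>))) +
      (\<Sum>q\<in>UNIV. v (\<iota> q) * f.fd q (f.fd p (\<gamma> \<sigma>)))) * TT \<sigma>)"
proof -
  have "(\<Sum>\<sigma>\<in>- range \<iota>. X \<sigma> * gres (gcomp (T' \<sigma>) L.qjet)) = (\<Sum>\<sigma>\<in>- range \<iota>. X \<sigma> * TT \<sigma>)" for X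
    by (rule sum.cong[OF refl]) (simp add: gres_quot[OF smooth_T])
  then show ?thesis
    unfolding L.variation_iota gres_diff gres_uminus gres_sum gres_mult gres_add gres_det gres_fd gres_char_der
      pder_None_lift gres_gext gres_lift by (simp only:)
qed

end

section \<open>The abstract Helmholtz calculus applied to germs\<close>

locale equation_germs = equation_jets "\<lambda>i. i" \<gamma> B \<iota> jet s \<tau> T'
  for \<gamma> :: "'a::finite \<Rightarrow> 'n::finite germ" and B \<iota> jet s \<tau> T' +
  assumes inj: "inj \<iota>"
begin

abbreviation "RR A C I \<equiv> gcomp (Delta C I (T' A)) qjet"
abbreviation "PP A C J \<equiv> gcomp (dpart C J (\<tau> A)) jet"

lemma helmholtz_frame_germs:
  "helmholtz_frame (\<lambda>i. pder i) (\<lambda>i. \<gamma> (\<iota> i)) zg det_germ det_germ_inv gvar \<iota> RR PP"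
proof (intro helmholtz_frame.intro frame_coordinates.intro coordinates.intro f.frame_axioms
    coordinates_axioms.intro helmholtz_frame_axioms.intro f.derivations_axioms inj pder_gvar)
  fix A C
  have "Delta C I (T' A) = Delta C J (T' A)" "dpart C I (\<tau> A) = dpart C J (\<tau> A)" if "mset I = mset J" for I J
    by (simp_all only: Delta_def[abs_def] dpart_def[abs_def] that sym_weight_cong[OF that])
  then show "symmetric (RR A C)" "symmetric (PP A C)"
    unfolding symmetric_def by metis+
qed

text \<open>For every \<open>v\<close> the first variation in the direction \<open>v\<close> is
  computed twice: from the coefficients of \<tau>, which gives the sum of the \<open>lin\<close>,
  and from the factorisation through T.\<close>

lemma helmholtz_reduction_germs:
  "helmholtz_reduction (\<lambda>i. pder i) (\<lambda>i. \<gamma> (\<iota> i)) zg det_germ det_germ_inv gvar \<iota> \<gamma> (\<lambda>\<sigma>. TT \<sigma>) RR PP s"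
proof (intro helmholtz_reduction.intro helmholtz_reduction_axioms.intro helmholtz_frame_germs)
  interpret H: helmholtz_frame "\<lambda>i. pder i" "\<lambda>i. \<gamma> (\<iota> i)" zg det_germ det_germ_inv gvar \<iota> \<gamma> "\<lambda>\<sigma>. TT \<sigma>" RR PP s
    by (rule helmholtz_frame_germs)
  fix v
  interpret V: variation \<gamma> B \<iota> jet s \<tau> T' v
    by (intro variation.intro equation_jets_axioms)
  have lin: "(\<Sum>C\<in>UNIV. H.lin A C (v C)) = gres (pder None (gcomp (\<tau> A) V.lift_jet))" for A
    by (simp only: H.lin_def V.linearization_tau)
  fix \<sigma> assume "\<sigma> \<notin> range \<iota>"
  then show "(\<Sum>C\<in>UNIV. H.lin \<sigma> C (v C)) = det_germ * ((\<Sum>p\<in>UNIV. f.fd p (v (\<iota> p) * TT \<sigma>)) +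
        (\<Sum>\<nu>\<in>- range \<iota>. H.Lam \<sigma> \<nu> (v \<nu> - (\<Sum>p\<in>UNIV. v (\<iota> p) * f.fd p (\<gamma> \<nu>)))))"
    unfolding lin H.Lam_def by (rule V.linearization_sigma)
next
  interpret H: helmholtz_frame "\<lambda>i. pder i" "\<lambda>i. \<gamma> (\<iota> i)" zg det_germ det_germ_inv gvar \<iota> \<gamma> "\<lambda>\<sigma>. TT \<sigma>" RR PP s
    by (rule helmholtz_frame_germs)
  fix v p
  interpret V: variation \<gamma> B \<iota> jet s \<tau> T' v
    by (intro variation.intro equation_jets_axioms)
  have lin: "(\<Sum>C\<in>UNIV. H.lin A C (v C)) = gres (pder None (gcomp (\<tau> A) V.lift_jet))" for A
    by (simp only: H.lin_def V.linearization_tau)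
  show "(\<Sum>C\<in>UNIV. H.lin (\<iota> p) C (v C)) =
      - (\<Sum>\<sigma>\<in>- range \<iota>. f.fd p (\<gamma> \<sigma>) * (\<Sum>C\<in>UNIV. H.lin \<sigma> C (v C))) -
      det_germ * (\<Sum>\<sigma>\<in>- range \<iota>. (f.fd p (v \<sigma> - (\<Sum>q\<in>UNIV. v (\<iota> q) * f.fd q (\<gamma> \<sigma>))) +
        (\<Sum>q\<in>UNIV. v (\<iota> q) * f.fd q (f.fd p (\<gamma> \<sigma>)))) * TT \<sigma>)"
    unfolding lin by (rule V.linearization_iota)
qed

end

section \<open>Values at a point\<close>

lemma ev_power: "ev (a ^ n) = ev a ^ n"
  by (induction n) simp_all

lemma ev_of_nat: "ev (of_nat n) = of_nat n"
  by (induction n) simp_all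

lemma ev_dl_abs:
  assumes "smooth_coords UNIV f"
  shows "ev (derivations.dl (\<lambda>i. pder i) J (abs_germ f)) = pds J f (\<lambda>_. 0)"
proof -
  interpret d: derivations "\<lambda>i. pder i" by (rule derivations_pder)
  have "d.dl J (abs_germ f) = abs_germ (pds J f) \<and> smooth_coords UNIV (pds J f)"
  proof (induction J)
    case (Cons i J)
    then have "smooth_near0 (pds J f)" by (intro smooth_near0I[of UNIV]) auto
    then have "pder i (abs_germ (pds J f)) = abs_germ (pd i (pds J f))"
      by (simp add: pder.abs_eq germ_rel_refl)
    moreover have "pds (i # J) f = pd i (pds J f)" by (simp add: pds_def)
    ultimately show ?case using Cons by (simp add: d.dl_Cons smooth_coords_pd)
  qed (simp add: pds_def assms)
  moreover from this have "smooth_near0 (pds J f)" by (intro smooth_near0I[of UNIV]) auto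
  ultimately show ?thesis by (simp add: ev.abs_eq germ_rel_refl)
qed

lemma ev_dl_taylor:
  "length J \<le> N \<Longrightarrow> ev (derivations.dl (\<lambda>i. pder i) J (abs_germ (taylor N c))) = c (mset J)"
  by (simp add: ev_dl_abs smooth_coords_taylor pds_taylor_0)

locale equation_at = equation_germs \<gamma> B \<iota> jet s \<tau> T'
  for \<gamma> :: "'a::finite \<Rightarrow> 'n::finite germ" and B \<iota> jet s \<tau> T' +
  fixes c :: "('a, 'n) vcoords" and t :: nat
  assumes t: "t \<ge> 2 * s" and c: "c \<in> jet_region B \<iota>"
    and ev_jet: "size M \<le> t \<Longrightarrow> ev (jet (A, M)) = c (A, M)"
begin

lemma t1: "t \<ge> 1" and st: "s \<le> t"
  using t s by auto

lemma ev_smooth: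
  assumes "smooth_fn (upto_order t) Reg f"
  shows "ev (gcomp f jet) = f c"
proof -
  have "ev (gcomp f jet) = f (\<lambda>k. ev (jet k))" by (rule ev_gcomp[OF region_Reg[OF t1] jet_mem assms])
  also have "\<dots> = f c"
    by (rule smooth_fn_eq[OF assms jet_mem c]) (auto simp: upto_order_def ev_jet)
  finally show ?thesis .
qed

lemma ev_of_order: "of_order r f \<Longrightarrow> r \<le> t \<Longrightarrow> ev (gcomp f jet) = f c"
  by (rule ev_smooth, erule of_order_smooth_fn) (use t1 in simp)

lemma ev_quot:
  assumes "smooth_fn (pord \<iota> t) Om f"
  shows "ev (gcomp f qjet) = f (quot_coords \<iota> t c)"
  using ev_smooth[OF quot_comp(1)[OF assms t1 order_refl]] by (simp only: quot_comp(2)[OF assms t1 order_refl])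

text \<open>The coordinate functions for the commutators are the variables \<open>gvar\<close>; for
  \<open>size M \<le> s\<close> the test element is the divided-power monomial of
  \<open>M\<close>.\<close>

sublocale H: helmholtz_coefficients "\<lambda>i. pder i" "\<lambda>i. \<gamma> (\<iota> i)" zg det_germ det_germ_inv gvar \<iota> \<gamma> "\<lambda>\<sigma>. TT \<sigma>" RR PP s
    ev "\<lambda>M. abs_germ (taylor s (\<lambda>M'. if M' = M then 1 else 0))"
  by (intro helmholtz_coefficients.intro helmholtz_coefficients_axioms.intro helmholtz_reduction_germs)
     (simp_all add: ev_dl_taylor)

lemma ev_det: "ev det_germ = det (xmat \<iota> c)"
  unfolding det_germ_def by (rule ev_smooth) (rule smooth_fn_mono[OF smooth_fn_det_xmat upto_order_mono[OF t1]])

lemma ev_hv: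
  assumes "length J \<le> s"
  shows "ev (H.hv A C J) = helmholtz t s \<tau> J A C c"
proof -
  have o: "of_order s (dpart C J (\<tau> A))" for A C J
    by (rule of_orderI[OF s smooth_fn_dpart[OF s smooth_tau]])
  have P: "ev (PP A C J) = dpart C J (\<tau> A) c" for A C J
    by (rule ev_of_order[OF o st])
  have "ev (f.dl K (PP C A (J @ K))) = dtots t K (dpart A (J @ K) (\<tau> C)) c" if "length K \<le> s - length J" for K
  proof -
    \<comment> \<open>The coefficient has order \<open>s\<close> and is differentiated at most
      \<open>s\<close> times more; this is where the order 2s enters.\<close>
    have le: "s + length K \<le> t" using that t by simp
    note D = dtots_jet[OF o le, of A "J @ K" C]
    show ?thesis unfolding conjunct2[OF D, symmetric] by (rule ev_of_order[OF conjunct1[OF D] le])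
  qed
  then show ?thesis
    by (simp add: H.hv_def helmholtz_def lie_euler_def P ev_power ev_of_nat sum_negf)
qed

lemma ev_hq:
  assumes "\<sigma> \<notin> range \<iota>" "\<nu> \<notin> range \<iota>" "length J \<le> s"
  shows "ev (H.hq \<sigma> \<nu> J) = quot_helmholtz \<iota> t s T' J \<sigma> \<nu> (quot_coords \<iota> t c)"
proof -
  have sm: "smooth_fn (pord \<iota> s) Om (Delta C I (T' A))" if "A \<notin> range \<iota>" for A C I
    by (rule smooth_fn_Delta[OF smooth_T[OF that]])
  have R: "ev (RR \<sigma> \<nu> J) = Delta \<nu> J (T' \<sigma>) (quot_coords \<iota> t c)"
    by (rule ev_quot) (rule smooth_fn_mono[OF sm[OF assms(1)] pord_mono[OF st]])
  have "ev (f.F.dl K (RR \<nu> \<sigma> (J @ K))) = Dtots \<iota> t K (Delta \<sigma> (J @ K) (T' \<nu>)) (quot_coords \<iota> t c)"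
    if "length K \<le> s - length J" for K
  proof -
    have le: "s + length K \<le> t" using that t by simp
    note D = Dtots_qjet[OF sm[OF assms(2)] le, of \<sigma> "J @ K"]
    show ?thesis unfolding conjunct2[OF D, symmetric]
      by (rule ev_quot) (rule smooth_fn_mono[OF conjunct1[OF D] pord_mono[OF le]])
  qed
  then show ?thesis
    by (simp add: H.hq_def quot_helmholtz_def quot_lie_euler_def R ev_power ev_of_nat sum_negf)
qed

lemma ev_Zs:
  assumes "length I \<le> s"
  shows "ev (f.Zs J I) = Zsum \<iota> t J I c"
proof -
  have z: "ev (f.zz i (nths I b)) = zjet \<iota> t i (nths I b) c"
    if "partition_on {..<length I} P" "b \<in> P" for i b P
  proof -
    have b: "b \<subseteq> {..<length I}" "b \<noteq> {}" using that by (auto simp: partition_on_def)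
    then obtain m where "m \<in> b" "m < length I" by auto
    then have "nths I b \<noteq> []" using in_set_conv_nth[of "I ! m" I] by (auto simp: set_nths simp flip: set_empty2)
    moreover have le: "length (nths I b) \<le> t"
    proof -
      have "length (nths I b) \<le> length I" unfolding length_nths using card_mono[of "{..<length I}" "{i. i < length I \<and> i \<in> b}"] by auto
      then show ?thesis using assms st by simp
    qed
    ultimately show ?thesis using zjet_jet[of "nths I b" t i] ev_of_order[of "length (nths I b)" "zjet \<iota> t i (nths I b)"] by simp
  qed
  have "ev (f.Zs J I) = (\<Sum>P\<in>{P. partition_on {..<length I} P \<and> card P = length J}.
      (1 / fact (length J)) * (\<Sum>f\<in>f.bijections P (length J). \<Prod>b\<in>P. ev (f.zz (J ! f b) (nths I b))))"
    by (simp add: f.Zs_def)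
  also have "\<dots> = (\<Sum>P\<in>{P. partition_on {..<length I} P \<and> card P = length J}.
      (\<Sum>f\<in>f.bijections P (length J). \<Prod>b\<in>P. zjet \<iota> t (J ! f b) (nths I b) c) / fact (length J))"
  proof (rule sum.cong[OF refl])
    fix P assume "P \<in> {P. partition_on {..<length I} P \<and> card P = length J}"
    then have P: "partition_on {..<length I} P" by simp
    have "(\<Sum>f\<in>f.bijections P (length J). \<Prod>b\<in>P. ev (f.zz (J ! f b) (nths I b))) =
        (\<Sum>f\<in>f.bijections P (length J). \<Prod>b\<in>P. zjet \<iota> t (J ! f b) (nths I b) c)"
      by (intro sum.cong prod.cong refl z[OF P])
    then show "(1 / fact (length J)) * (\<Sum>f\<in>f.bijections P (length J). \<Prod>b\<in>P. ev (f.zz (J ! f b) (nths I b))) =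
        (\<Sum>f\<in>f.bijections P (length J). \<Prod>b\<in>P. zjet \<iota> t (J ! f b) (nths I b) c) / fact (length J)" by simp
  qed
  finally show ?thesis by (simp only: Zsum_def f.bijections_def)
qed

lemma ev_y:
  assumes "length K \<le> s"
  shows "ev (f.F.dl K (f.fd p (\<gamma> \<nu>))) = yjet \<iota> t \<nu> (p # K) c"
proof -
  \<comment> \<open>The frame derivative in \<open>p\<close> is applied first, whereas the recursion
    of \<open>yjet\<close> applies its head last; the frame commutes, so \<open>p\<close> may be
    moved to the front.\<close>
  have "f.F.dl (p # K) (\<gamma> \<nu>) = f.F.dl (K @ [p]) (\<gamma> \<nu>)" by (rule f.F.dl_mset) simp
  then have eq: "f.F.dl K (f.fd p (\<gamma> \<nu>)) = f.F.dl (p # K) (\<gamma> \<nu>)" by (simp add: f.F.dl_append f.F.dl_Cons)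
  \<comment> \<open>The order is at most s + 1, and s + 1 is at most 2s because s is at least
    1.\<close>
  have le: "length (p # K) \<le> t" using assms t s by simp
  note D = yjet_jet[OF le, of \<nu>]
  show ?thesis
    unfolding eq conjunct2[OF D, symmetric] by (rule ev_of_order[OF conjunct1[OF D] le])
qed

lemma ev_y0: "ev (f.fd p (\<gamma> \<nu>)) = yjet \<iota> t \<nu> [p] c"
  using ev_y[of "[]" p \<nu>] by (simp del: yjet.simps)

lemma coef_1:
  assumes "\<sigma> \<notin> range \<iota>" "\<nu> \<notin> range \<iota>"
  shows "H.coef 1 \<sigma> \<nu> J = (\<Sum>I\<in>{I. length J \<le> length I \<and> length I \<le> s}.
      Zsum \<iota> t J I c * quot_helmholtz \<iota> t s T' I \<sigma> \<nu> (quot_coords \<iota> t c))"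
    "H.coef 1 \<sigma> \<nu> [] = quot_helmholtz \<iota> t s T' [] \<sigma> \<nu> (quot_coords \<iota> t c)"
  unfolding H.coef_1_restrict[of _ _ J] H.coef_1_Nil
  by (intro sum.cong refl, simp add: ev_Zs ev_hq assms) (simp add: ev_hq assms)

lemma sum_coef:
  assumes "\<sigma> \<notin> range \<iota>"
  shows "(\<Sum>\<nu>\<in>- range \<iota>. H.coef (f.fd p (\<gamma> \<nu>)) \<sigma> \<nu> J) = (\<Sum>I\<^sub>0\<in>{I\<^sub>0. length I\<^sub>0 \<le> s}.
      \<Sum>I\<in>{I. length J \<le> length I \<and> length I \<le> s - length I\<^sub>0}. \<Sum>\<nu>\<in>- range \<iota>.
        real ((length I + length I\<^sub>0) choose length I) * Zsum \<iota> t J I c *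
        yjet \<iota> t \<nu> (p # I\<^sub>0) c * quot_helmholtz \<iota> t s T' (I @ I\<^sub>0) \<sigma> \<nu> (quot_coords \<iota> t c))"
    "(\<Sum>\<nu>\<in>- range \<iota>. H.coef (f.fd p (\<gamma> \<nu>)) \<sigma> \<nu> []) = (\<Sum>I\<^sub>0\<in>{I\<^sub>0. length I\<^sub>0 \<le> s}. \<Sum>\<nu>\<in>- range \<iota>.
        yjet \<iota> t \<nu> (p # I\<^sub>0) c * quot_helmholtz \<iota> t s T' I\<^sub>0 \<sigma> \<nu> (quot_coords \<iota> t c))"
proof -
  have "(\<Sum>\<nu>\<in>- range \<iota>. H.coef (f.fd p (\<gamma> \<nu>)) \<sigma> \<nu> J) = (\<Sum>\<nu>\<in>- range \<iota>. \<Sum>I\<^sub>0\<in>{I\<^sub>0. length I\<^sub>0 \<le> s}.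
      \<Sum>I\<in>{I. length J \<le> length I \<and> length I \<le> s - length I\<^sub>0}.
        real ((length I + length I\<^sub>0) choose length I) * Zsum \<iota> t J I c *
        yjet \<iota> t \<nu> (p # I\<^sub>0) c * quot_helmholtz \<iota> t s T' (I @ I\<^sub>0) \<sigma> \<nu> (quot_coords \<iota> t c))"
    unfolding H.coef_restrict[of _ _ _ J]
  proof (intro sum.cong refl)
    fix \<nu> and K I :: "'n list"
    assume \<nu>: "\<nu> \<in> - range \<iota>" and K: "K \<in> {I\<^sub>0. length I\<^sub>0 \<le> s}" and I: "I \<in> {I. length J \<le> length I \<and> length I \<le> s - length K}"
    have le: "length K \<le> s" "length I \<le> s" "length (I @ K) \<le> s" using K I by auto
    have \<nu>': "\<nu> \<notin> range \<iota>" using \<nu> by simp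
    show "real ((length I + length K) choose length I) * ev (f.Zs J I) * ev (f.F.dl K (f.fd p (\<gamma> \<nu>))) * ev (H.hq \<sigma> \<nu> (I @ K)) =
        real ((length I + length K) choose length I) * Zsum \<iota> t J I c *
        yjet \<iota> t \<nu> (p # K) c * quot_helmholtz \<iota> t s T' (I @ K) \<sigma> \<nu> (quot_coords \<iota> t c)"
      by (simp only: ev_Zs[OF le(2)] ev_y[OF le(1)] ev_hq[OF assms \<nu>' le(3)])
  qed
  then show "(\<Sum>\<nu>\<in>- range \<iota>. H.coef (f.fd p (\<gamma> \<nu>)) \<sigma> \<nu> J) = (\<Sum>I\<^sub>0\<in>{I\<^sub>0. length I\<^sub>0 \<le> s}.
      \<Sum>I\<in>{I. length J \<le> length I \<and> length I \<le> s - length I\<^sub>0}. \<Sum>\<nu>\<in>- range \<iota>.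
        real ((length I + length I\<^sub>0) choose length I) * Zsum \<iota> t J I c *
        yjet \<iota> t \<nu> (p # I\<^sub>0) c * quot_helmholtz \<iota> t s T' (I @ I\<^sub>0) \<sigma> \<nu> (quot_coords \<iota> t c))"
    by (simp only: sum_triple_swap)
  have "(\<Sum>\<nu>\<in>- range \<iota>. H.coef (f.fd p (\<gamma> \<nu>)) \<sigma> \<nu> []) = (\<Sum>\<nu>\<in>- range \<iota>. \<Sum>I\<^sub>0\<in>{I\<^sub>0. length I\<^sub>0 \<le> s}.
        yjet \<iota> t \<nu> (p # I\<^sub>0) c * quot_helmholtz \<iota> t s T' I\<^sub>0 \<sigma> \<nu> (quot_coords \<iota> t c))"
    unfolding H.coef_Nil
    by (intro sum.cong refl) (simp add: ev_hq ev_y assms del: yjet.simps)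
  then show "(\<Sum>\<nu>\<in>- range \<iota>. H.coef (f.fd p (\<gamma> \<nu>)) \<sigma> \<nu> []) = (\<Sum>I\<^sub>0\<in>{I\<^sub>0. length I\<^sub>0 \<le> s}. \<Sum>\<nu>\<in>- range \<iota>.
        yjet \<iota> t \<nu> (p # I\<^sub>0) c * quot_helmholtz \<iota> t s T' I\<^sub>0 \<sigma> \<nu> (quot_coords \<iota> t c))"
    using sum.swap by simp
qed

lemma helmholtz_relations:
  shows "(\<forall>\<sigma>\<in>- range \<iota>. \<forall>\<nu>\<in>- range \<iota>.
             helmholtz t s \<tau> [] \<sigma> \<nu> c = det (xmat \<iota> c) * quot_helmholtz \<iota> t s T' [] \<sigma> \<nu> (quot_coords \<iota> t c)) \<and>
         (\<forall>J. 1 \<le> length J \<and> length J \<le> s \<longrightarrow> (\<forall>\<sigma>\<in>- range \<iota>. \<forall>\<nu>\<in>- range \<iota>.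
             helmholtz t s \<tau> J \<sigma> \<nu> c =
               det (xmat \<iota> c) * (\<Sum>I\<in>{I. length J \<le> length I \<and> length I \<le> s}.
                 Zsum \<iota> t J I c * quot_helmholtz \<iota> t s T' I \<sigma> \<nu> (quot_coords \<iota> t c)))) \<and>
         (\<forall>\<sigma>\<in>- range \<iota>. \<forall>p.
             helmholtz t s \<tau> [] \<sigma> (\<iota> p) c =
               - det (xmat \<iota> c) * (\<Sum>I\<^sub>0\<in>{I\<^sub>0. length I\<^sub>0 \<le> s}. \<Sum>\<nu>\<in>- range \<iota>.
                 yjet \<iota> t \<nu> (p # I\<^sub>0) c * quot_helmholtz \<iota> t s T' I\<^sub>0 \<sigma> \<nu> (quot_coords \<iota> t c))) \<and>
         (\<forall>J. 1 \<le> length J \<and> length J \<le> s \<longrightarrow> (\<forall>\<sigma>\<in>- range \<iota>. \<forall>p.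
             helmholtz t s \<tau> J \<sigma> (\<iota> p) c =
               - det (xmat \<iota> c) * (\<Sum>I\<^sub>0\<in>{I\<^sub>0. length I\<^sub>0 \<le> s}.
                 \<Sum>I\<in>{I. length J \<le> length I \<and> length I \<le> s - length I\<^sub>0}. \<Sum>\<nu>\<in>- range \<iota>.
                   real ((length I + length I\<^sub>0) choose length I) * Zsum \<iota> t J I c *
                   yjet \<iota> t \<nu> (p # I\<^sub>0) c * quot_helmholtz \<iota> t s T' (I @ I\<^sub>0) \<sigma> \<nu> (quot_coords \<iota> t c)))) \<and>
         (\<forall>p. \<forall>\<nu>\<in>- range \<iota>.
             helmholtz t s \<tau> [] (\<iota> p) \<nu> c =
               - det (xmat \<iota> c) * (\<Sum>\<sigma>\<in>- range \<iota>.
                 yjet \<iota> t \<sigma> [p] c * quot_helmholtz \<iota> t s T' [] \<sigma> \<nu> (quot_coords \<iota> t c))) \<and>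
         (\<forall>J. 1 \<le> length J \<and> length J \<le> s \<longrightarrow> (\<forall>p. \<forall>\<nu>\<in>- range \<iota>.
             helmholtz t s \<tau> J (\<iota> p) \<nu> c =
               - det (xmat \<iota> c) * (\<Sum>\<sigma>\<in>- range \<iota>. yjet \<iota> t \<sigma> [p] c *
                 (\<Sum>I\<in>{I. length J \<le> length I \<and> length I \<le> s}.
                   Zsum \<iota> t J I c * quot_helmholtz \<iota> t s T' I \<sigma> \<nu> (quot_coords \<iota> t c))))) \<and>
         (\<forall>p q.
             helmholtz t s \<tau> [] (\<iota> p) (\<iota> q) c =
               det (xmat \<iota> c) * (\<Sum>\<sigma>\<in>- range \<iota>. yjet \<iota> t \<sigma> [p] c *
                 (\<Sum>I\<^sub>0\<in>{I\<^sub>0. length I\<^sub>0 \<le> s}. \<Sum>\<nu>\<in>- range \<iota>.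
                   yjet \<iota> t \<nu> (q # I\<^sub>0) c * quot_helmholtz \<iota> t s T' I\<^sub>0 \<sigma> \<nu> (quot_coords \<iota> t c)))) \<and>
         (\<forall>J. 1 \<le> length J \<and> length J \<le> s \<longrightarrow> (\<forall>p q.
             helmholtz t s \<tau> J (\<iota> p) (\<iota> q) c =
               det (xmat \<iota> c) * (\<Sum>\<sigma>\<in>- range \<iota>. yjet \<iota> t \<sigma> [p] c *
                 (\<Sum>I\<^sub>0\<in>{I\<^sub>0. length I\<^sub>0 \<le> s}.
                   \<Sum>I\<in>{I. length J \<le> length I \<and> length I \<le> s - length I\<^sub>0}. \<Sum>\<nu>\<in>- range \<iota>.
                     real ((length I + length I\<^sub>0) choose length I) * Zsum \<iota> t J I c *
                     yjet \<iota> t \<nu> (q # I\<^sub>0) c * quot_helmholtz \<iota> t s T' (I @ I\<^sub>0) \<sigma> \<nu> (quot_coords \<iota> t c)))))"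
  unfolding ev_det[symmetric]
proof (intro conjI allI ballI impI)
  fix \<sigma> \<nu> assume \<sigma>: "\<sigma> \<in> - range \<iota>" and \<nu>: "\<nu> \<in> - range \<iota>"
  note n = ComplD[OF \<sigma>] ComplD[OF \<nu>]
  show "helmholtz t s \<tau> [] \<sigma> \<nu> c = ev det_germ * quot_helmholtz \<iota> t s T' [] \<sigma> \<nu> (quot_coords \<iota> t c)"
    using H.val_hv_sn[OF n, of "[]"] by (simp add: ev_hv coef_1(2)[OF n])
  fix J :: "'n list" assume J: "1 \<le> length J \<and> length J \<le> s"
  then have Js: "length J \<le> s" by simp
  show "helmholtz t s \<tau> J \<sigma> \<nu> c = ev det_germ * (\<Sum>I\<in>{I. length J \<le> length I \<and> length I \<le> s}.
      Zsum \<iota> t J I c * quot_helmholtz \<iota> t s T' I \<sigma> \<nu> (quot_coords \<iota> t c))"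
    using H.val_hv_sn[OF n Js] by (simp only: ev_hv[OF Js] coef_1(1)[OF n])
next
  fix \<sigma> p assume \<sigma>: "\<sigma> \<in> - range \<iota>"
  note n = ComplD[OF \<sigma>]
  show "helmholtz t s \<tau> [] \<sigma> (\<iota> p) c = - ev det_germ * (\<Sum>I\<^sub>0\<in>{I\<^sub>0. length I\<^sub>0 \<le> s}. \<Sum>\<nu>\<in>- range \<iota>.
      yjet \<iota> t \<nu> (p # I\<^sub>0) c * quot_helmholtz \<iota> t s T' I\<^sub>0 \<sigma> \<nu> (quot_coords \<iota> t c))"
    using H.val_hv_sp[OF n, of "[]" p] unfolding sum_coef(2)[OF n] by (simp add: ev_hv del: yjet.simps)
  fix J :: "'n list" assume J: "1 \<le> length J \<and> length J \<le> s"
  then have Js: "length J \<le> s" by simp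
  show "helmholtz t s \<tau> J \<sigma> (\<iota> p) c = - ev det_germ * (\<Sum>I\<^sub>0\<in>{I\<^sub>0. length I\<^sub>0 \<le> s}.
      \<Sum>I\<in>{I. length J \<le> length I \<and> length I \<le> s - length I\<^sub>0}. \<Sum>\<nu>\<in>- range \<iota>.
        real ((length I + length I\<^sub>0) choose length I) * Zsum \<iota> t J I c *
        yjet \<iota> t \<nu> (p # I\<^sub>0) c * quot_helmholtz \<iota> t s T' (I @ I\<^sub>0) \<sigma> \<nu> (quot_coords \<iota> t c))"
    using H.val_hv_sp[OF n Js] by (simp only: ev_hv[OF Js] sum_coef(1)[OF n])
next
  fix p \<nu> assume \<nu>: "\<nu> \<in> - range \<iota>"
  note n = ComplD[OF \<nu>]
  have 1: "(\<Sum>\<sigma>\<in>- range \<iota>. ev (f.fd p (\<gamma> \<sigma>)) * H.coef 1 \<sigma> \<nu> []) = (\<Sum>\<sigma>\<in>- range \<iota>.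
      yjet \<iota> t \<sigma> [p] c * quot_helmholtz \<iota> t s T' [] \<sigma> \<nu> (quot_coords \<iota> t c))"
    by (intro sum.cong refl) (simp only: ev_y0 coef_1(2)[OF ComplD n])
  show "helmholtz t s \<tau> [] (\<iota> p) \<nu> c = - ev det_germ * (\<Sum>\<sigma>\<in>- range \<iota>.
      yjet \<iota> t \<sigma> [p] c * quot_helmholtz \<iota> t s T' [] \<sigma> \<nu> (quot_coords \<iota> t c))"
    using H.val_hv_pn[OF n, of "[]" p] unfolding 1 by (simp add: ev_hv del: yjet.simps)
  fix J :: "'n list" assume J: "1 \<le> length J \<and> length J \<le> s"
  then have Js: "length J \<le> s" by simp
  have 2: "(\<Sum>\<sigma>\<in>- range \<iota>. ev (f.fd p (\<gamma> \<sigma>)) * H.coef 1 \<sigma> \<nu> J) = (\<Sum>\<sigma>\<in>- range \<iota>. yjet \<iota> t \<sigma> [p] c *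
      (\<Sum>I\<in>{I. length J \<le> length I \<and> length I \<le> s}. Zsum \<iota> t J I c * quot_helmholtz \<iota> t s T' I \<sigma> \<nu> (quot_coords \<iota> t c)))"
    by (intro sum.cong refl) (simp only: ev_y0 coef_1(1)[OF ComplD n])
  show "helmholtz t s \<tau> J (\<iota> p) \<nu> c = - ev det_germ * (\<Sum>\<sigma>\<in>- range \<iota>. yjet \<iota> t \<sigma> [p] c *
      (\<Sum>I\<in>{I. length J \<le> length I \<and> length I \<le> s}. Zsum \<iota> t J I c * quot_helmholtz \<iota> t s T' I \<sigma> \<nu> (quot_coords \<iota> t c)))"
    using H.val_hv_pn[OF n Js] by (simp only: ev_hv[OF Js] 2)
next
  fix p q
  have 1: "(\<Sum>\<sigma>\<in>- range \<iota>. ev (f.fd p (\<gamma> \<sigma>)) * (\<Sum>\<nu>\<in>- range \<iota>. H.coef (f.fd q (\<gamma> \<nu>)) \<sigma> \<nu> [])) =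
      (\<Sum>\<sigma>\<in>- range \<iota>. yjet \<iota> t \<sigma> [p] c * (\<Sum>I\<^sub>0\<in>{I\<^sub>0. length I\<^sub>0 \<le> s}. \<Sum>\<nu>\<in>- range \<iota>.
        yjet \<iota> t \<nu> (q # I\<^sub>0) c * quot_helmholtz \<iota> t s T' I\<^sub>0 \<sigma> \<nu> (quot_coords \<iota> t c)))"
    by (intro sum.cong refl) (simp only: ev_y0 sum_coef(2)[OF ComplD])
  show "helmholtz t s \<tau> [] (\<iota> p) (\<iota> q) c = ev det_germ * (\<Sum>\<sigma>\<in>- range \<iota>. yjet \<iota> t \<sigma> [p] c *
      (\<Sum>I\<^sub>0\<in>{I\<^sub>0. length I\<^sub>0 \<le> s}. \<Sum>\<nu>\<in>- range \<iota>.
        yjet \<iota> t \<nu> (q # I\<^sub>0) c * quot_helmholtz \<iota> t s T' I\<^sub>0 \<sigma> \<nu> (quot_coords \<iota> t c)))"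
    using H.val_hv_pq[of "[]" p q] unfolding 1 by (simp add: ev_hv del: yjet.simps)
  fix J :: "'n list" assume J: "1 \<le> length J \<and> length J \<le> s"
  then have Js: "length J \<le> s" by simp
  have 2: "(\<Sum>\<sigma>\<in>- range \<iota>. ev (f.fd p (\<gamma> \<sigma>)) * (\<Sum>\<nu>\<in>- range \<iota>. H.coef (f.fd q (\<gamma> \<nu>)) \<sigma> \<nu> J)) =
      (\<Sum>\<sigma>\<in>- range \<iota>. yjet \<iota> t \<sigma> [p] c * (\<Sum>I\<^sub>0\<in>{I\<^sub>0. length I\<^sub>0 \<le> s}.
        \<Sum>I\<in>{I. length J \<le> length I \<and> length I \<le> s - length I\<^sub>0}. \<Sum>\<nu>\<in>- range \<iota>.
          real ((length I + length I\<^sub>0) choose length I) * Zsum \<iota> t J I c *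
          yjet \<iota> t \<nu> (q # I\<^sub>0) c * quot_helmholtz \<iota> t s T' (I @ I\<^sub>0) \<sigma> \<nu> (quot_coords \<iota> t c)))"
    by (intro sum.cong refl) (simp only: ev_y0 sum_coef(1)[OF ComplD])
  show "helmholtz t s \<tau> J (\<iota> p) (\<iota> q) c = ev det_germ * (\<Sum>\<sigma>\<in>- range \<iota>. yjet \<iota> t \<sigma> [p] c *
      (\<Sum>I\<^sub>0\<in>{I\<^sub>0. length I\<^sub>0 \<le> s}. \<Sum>I\<in>{I. length J \<le> length I \<and> length I \<le> s - length I\<^sub>0}. \<Sum>\<nu>\<in>- range \<iota>.
          real ((length I + length I\<^sub>0) choose length I) * Zsum \<iota> t J I c *
          yjet \<iota> t \<nu> (q # I\<^sub>0) c * quot_helmholtz \<iota> t s T' (I @ I\<^sub>0) \<sigma> \<nu> (quot_coords \<iota> t c)))"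
    using H.val_hv_pq[OF Js] by (simp only: ev_hv[OF Js] 2)
qed

end

section \<open>The theorem on the quotient bundle\<close>

lemma jet_region_agree:
  assumes "open B" "s \<ge> 1" "c \<in> jet_region B \<iota>" "agree s c c'"
  shows "c' \<in> jet_region B \<iota>"
  by (rule saturatedD[of "upto_order s" "jet_region B \<iota>" c])
     (use assms region_jet_region[OF assms(1,2), of \<iota>] in \<open>auto simp: region_def upto_order_def agree_def\<close>)

lemma coords_jet_region:
  assumes "w \<in> Wset \<A> t V x \<iota>"
  shows "coords x w \<in> jet_region (x ` V) \<iota>"
proof -
  have "(\<chi> A. coords x w (A, {#})) = x (base w)"
    by (simp add: coords_def partials_def base_def vec_eq_iff)
  then show ?thesis using assms by (simp add: jet_region_def Wset_def)
qed

definition taylor_germs :: "nat \<Rightarrow> ('a, 'n::finite) vcoords \<Rightarrow> 'a \<Rightarrow> 'n germ" where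
  "taylor_germs N c A = abs_germ (taylor N (\<lambda>M. c (A, M)))"

definition taylor_jet :: "nat \<Rightarrow> ('a, 'n::finite) vcoords \<Rightarrow> 'a \<times> 'n multiset \<Rightarrow> 'n germ" where
  "taylor_jet N c = (\<lambda>(A, M). derivations.dm (\<lambda>i. pder i) M (taylor_germs N c A))"

lemma ev_taylor_jet: "size M \<le> N \<Longrightarrow> ev (taylor_jet N c (A, M)) = c (A, M)"
  by (simp add: taylor_jet_def taylor_germs_def derivations.dm_def[OF derivations_pder] ev_dl_taylor)

lemma jets_taylor:
  assumes "open B" "N \<ge> 1" "c \<in> jet_region B \<iota>"
  shows "jets (\<lambda>i. i) (taylor_germs N c) B \<iota> (taylor_jet N c)"
proof
  show "(\<lambda>k. ev (taylor_jet N c k)) \<in> jet_region B \<iota>"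
    by (rule jet_region_agree[OF assms]) (simp add: agree_def ev_taylor_jet)
qed (simp_all add: assms(1) taylor_jet_def)

text \<open>Dependence on the coordinates of order at most \<open>s\<close> is part of the
  smoothness proved in \<open>jets\<close>. That locale asks for an immersion germ with jet in the
  region; the Taylor germs of \<open>c\<close> supply one.\<close>

lemma quot_coords_agree:
  assumes B: "open B" "s \<ge> 1" and c: "c \<in> jet_region B \<iota>" "agree s c c'" and k: "k \<in> pord \<iota> s"
  shows "quot_coords \<iota> s c k = quot_coords \<iota> s c' k"
proof -
  interpret jets "\<lambda>i. i" "taylor_germs s c" B \<iota> "taylor_jet s c" by (rule jets_taylor[OF B c(1)])
  show ?thesis
    by (rule smooth_fn_eq[OF smooth_fn_quot_coords(1)[OF k B(2) order_refl] c(1) jet_region_agree[OF B c]])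
       (use c(2) in \<open>auto simp: agree_def upto_order_def\<close>)
qed

text \<open>A local section of the quotient map: the velocity with coordinates \<open>sec \<iota> Y\<close> is that of a
  graph over the coordinates \<open>x\<^sup>i\<close>.\<close>

definition sec :: "('n::finite \<Rightarrow> 'a::finite) \<Rightarrow> ('a, 'n) pcoords \<Rightarrow> ('a, 'n) vcoords" where
  "sec \<iota> Y = (\<lambda>(A, M). if A \<in> range \<iota> then if M = {#} then Y (PX (inv \<iota> A)) else if M = {#inv \<iota> A#} then 1 else 0
     else Y (PY A M))"

lemma sec_iota: "inj \<iota> \<Longrightarrow> sec \<iota> Y (\<iota> i, M) = (if M = {#} then Y (PX i) else if M = {#i#} then 1 else 0)"
  by (simp add: sec_def)

lemma xmat_sec: "inj \<iota> \<Longrightarrow> xmat \<iota> (sec \<iota> Y) = mat 1"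
  by (auto simp: xmat_def sec_iota mat_def vec_eq_iff)

lemma sec_mem:
  assumes "inj \<iota>" "Y \<in> quot_region B \<iota>"
  shows "sec \<iota> Y \<in> jet_region B \<iota>"
proof -
  have "(\<chi> A. sec \<iota> Y (A, {#})) = (\<chi> A. if A \<in> range \<iota> then Y (PX (inv \<iota> A)) else Y (PY A {#}))"
    by (simp add: sec_def vec_eq_iff)
  then show ?thesis using assms(2) by (simp add: jet_region_def quot_region_def xmat_sec[OF assms(1)])
qed

text \<open>For a graph the components x^i are the variables up to constants. The Jacobian matrix is
  then the identity, the frame coincides with the partial derivatives, and the y^\<sigma>_M are the
  Taylor coefficients themselves.\<close>

lemma quot_coords_sec:
  assumes B: "open B" "s \<ge> 1" and \<iota>: "inj \<iota>" and Y: "Y \<in> quot_region B \<iota>" and k: "k \<in> pord \<iota> s"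
  shows "quot_coords \<iota> s (sec \<iota> Y) k = Y k"
proof -
  interpret jets "\<lambda>i. i" "taylor_germs s (sec \<iota> Y)" B \<iota> "taylor_jet s (sec \<iota> Y)"
    by (rule jets_taylor[OF B sec_mem[OF \<iota> Y]])
  have d: "pder j (taylor_germs s (sec \<iota> Y) (\<iota> i)) = (if i = j then 1 else 0)" for i j
  proof -
    obtain N where N: "s = Suc N" using B(2) by (cases s) auto
    have "taylor_germs s (sec \<iota> Y) (\<iota> i) = abs_germ (taylor s (\<lambda>M. sec \<iota> Y (\<iota> i, M)))"
      by (simp add: taylor_germs_def)
    moreover have "smooth_near0 (taylor s (\<lambda>M. sec \<iota> Y (\<iota> i, M)))"
      by (rule smooth_near0I[OF open_UNIV UNIV_I smooth_coords_taylor])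
    ultimately have "pder j (taylor_germs s (sec \<iota> Y) (\<iota> i)) = abs_germ (pd j (taylor s (\<lambda>M. sec \<iota> Y (\<iota> i, M))))"
      by (simp add: pder.abs_eq germ_rel_refl)
    also have "pd j (taylor s (\<lambda>M. sec \<iota> Y (\<iota> i, M))) = (\<lambda>u. if i = j then 1 else 0)"
    proof
      fix u
      \<comment> \<open>Of the derivatives of x^i only the first one in its own variable is nonzero,
        so the differentiated Taylor sum reduces to its constant term.\<close>
      have "sec \<iota> Y (\<iota> i, add_mset j M) * monomial M u = (if M = {#} then (if i = j then 1 else 0) else 0)" for M
        by (auto simp: sec_iota[OF \<iota>] monomial_def)
      then show "pd j (taylor s (\<lambda>M. sec \<iota> Y (\<iota> i, M))) u = (if i = j then 1 else 0)"
        unfolding N pd_taylor by (simp add: taylor_def)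
    qed
    also have "abs_germ (\<lambda>u. if i = j then 1 else 0) = (if i = j then 1 else 0)"
      by (simp add: one_germ_def zero_germ_def)
    finally show ?thesis .
  qed
  have "zg k i = (if i = k then 1 else 0)" for i k
    using f.zr[of i k] by (simp add: d if_distrib[of "\<lambda>x. _ * x"] cong: if_cong)
  then have fd: "f.fd i a = pder i a" for i a
    by (simp add: f.fd_def if_distrib[of "\<lambda>x. x * _"] cong: if_cong)
  have dl: "f.F.dl J a = f.dl J a" for J a
    by (induction J) (simp_all add: f.F.dl_Cons f.dl_Cons fd)
  have jet: "qjet (PY \<sigma> M) = taylor_jet s (sec \<iota> Y) (\<sigma>, M)" for \<sigma> M
    unfolding qjet_PY f.F.dm_def dl by (simp add: taylor_jet_def f.dm_def)
  have "quot_coords \<iota> s (sec \<iota> Y) k = quot_coords \<iota> s (\<lambda>k. ev (taylor_jet s (sec \<iota> Y) k)) k"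
    by (rule quot_coords_agree[OF B sec_mem[OF \<iota> Y] _ k]) (simp add: agree_def ev_taylor_jet)
  also have "\<dots> = ev (qjet k)"
    using ev_gcomp[OF region_Reg[OF B(2)] jet_mem smooth_fn_quot_coords(1)[OF k B(2) order_refl]]
    by (simp only: smooth_fn_quot_coords(2)[OF k B(2) order_refl])
  also have "\<dots> = Y k"
  proof (cases k)
    case (PX i)
    have "ev (qjet k) = sec \<iota> Y (\<iota> i, {#})" using ev_taylor_jet[of "{#}" s "sec \<iota> Y" "\<iota> i"] by (simp add: PX ev_gamma)
    then show ?thesis by (simp add: PX sec_iota[OF \<iota>])
  next
    case (PY \<sigma> M)
    then show ?thesis using k by (simp add: jet ev_taylor_jet) (simp add: sec_def)
  qed
  finally show ?thesis .
qed

text \<open>What remains is to pass from velocities to coordinate families. Every family in the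
  region is realised by a velocity, which transfers the equations between \<tau> and T'; the graph
  section then gives smoothness of T', and the relations are read off along the Taylor germs of the
  point.\<close>

theorem theorem3p18:
  fixes \<A> :: "('x::{t2_space, second_countable_topology}, 'a::finite) chart set"
    and V :: "'x set" and x :: "'x \<Rightarrow> real ^ 'a"
    and \<iota> :: "'n::finite \<Rightarrow> 'a"
    and s t :: nat
    and \<omega> :: "('n, 'x) velocity one_form"
    and \<tau> :: "'a \<Rightarrow> ('a, 'n) vcoords \<Rightarrow> real"
    and T :: "'a \<Rightarrow> ('n, 'x) velocity set \<Rightarrow> real"
    and T' :: "'a \<Rightarrow> ('a, 'n) pcoords \<Rightarrow> real"
    and w :: "('n, 'x) velocity"
    and c :: "('a, 'n) vcoords" and Y :: "('a, 'n) pcoords"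
  assumes manifold: "smooth_structure \<A>"
    and s: "s \<ge> 1" and t: "t \<ge> 2 * s"
    and equation: "differential_equation \<A> s \<omega>"
    and homogeneous: "homogeneous \<A> s \<omega>"
    and chart: "(V, x) \<in> \<A>" and splitting: "inj \<iota>"
    and components: "chart_form \<A> s V x \<omega> \<tau>"
    and associated_sigma: "\<And>v \<sigma>. v \<in> Wset \<A> s V x \<iota> \<Longrightarrow> \<sigma> \<notin> range \<iota> \<Longrightarrow>
          \<tau> \<sigma> (coords x v) = det (xmat \<iota> (coords x v)) * T \<sigma> (orbit \<A> s v)"
    and associated_i: "\<And>v i. v \<in> Wset \<A> s V x \<iota> \<Longrightarrow>
          \<tau> (\<iota> i) (coords x v) = - det (xmat \<iota> (coords x v)) *
            (\<Sum>\<sigma>\<in>- range \<iota>. yjet \<iota> s \<sigma> [i] (coords x v) * T \<sigma> (orbit \<A> s v))"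
    and expression: "\<And>\<sigma>. \<sigma> \<notin> range \<iota> \<Longrightarrow> quot_expression \<A> s V x \<iota> (T \<sigma>) (T' \<sigma>)"
    and point: "w \<in> Wset \<A> t V x \<iota>"
    and c: "c = coords x w" and Y: "Y = quot_coords \<iota> t c"
  shows "(\<forall>\<sigma>\<in>- range \<iota>. \<forall>\<nu>\<in>- range \<iota>.
             helmholtz t s \<tau> [] \<sigma> \<nu> c = det (xmat \<iota> c) * quot_helmholtz \<iota> t s T' [] \<sigma> \<nu> Y) \<and>
         (\<forall>J. 1 \<le> length J \<and> length J \<le> s \<longrightarrow> (\<forall>\<sigma>\<in>- range \<iota>. \<forall>\<nu>\<in>- range \<iota>.
             helmholtz t s \<tau> J \<sigma> \<nu> c =
               det (xmat \<iota> c) * (\<Sum>I\<in>{I. length J \<le> length I \<and> length I \<le> s}.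
                 Zsum \<iota> t J I c * quot_helmholtz \<iota> t s T' I \<sigma> \<nu> Y))) \<and>
         (\<forall>\<sigma>\<in>- range \<iota>. \<forall>p.
             helmholtz t s \<tau> [] \<sigma> (\<iota> p) c =
               - det (xmat \<iota> c) * (\<Sum>I\<^sub>0\<in>{I\<^sub>0. length I\<^sub>0 \<le> s}. \<Sum>\<nu>\<in>- range \<iota>.
                 yjet \<iota> t \<nu> (p # I\<^sub>0) c * quot_helmholtz \<iota> t s T' I\<^sub>0 \<sigma> \<nu> Y)) \<and>
         (\<forall>J. 1 \<le> length J \<and> length J \<le> s \<longrightarrow> (\<forall>\<sigma>\<in>- range \<iota>. \<forall>p.
             helmholtz t s \<tau> J \<sigma> (\<iota> p) c =
               - det (xmat \<iota> c) * (\<Sum>I\<^sub>0\<in>{I\<^sub>0. length I\<^sub>0 \<le> s}.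
                 \<Sum>I\<in>{I. length J \<le> length I \<and> length I \<le> s - length I\<^sub>0}. \<Sum>\<nu>\<in>- range \<iota>.
                   real ((length I + length I\<^sub>0) choose length I) * Zsum \<iota> t J I c *
                   yjet \<iota> t \<nu> (p # I\<^sub>0) c * quot_helmholtz \<iota> t s T' (I @ I\<^sub>0) \<sigma> \<nu> Y))) \<and>
         (\<forall>p. \<forall>\<nu>\<in>- range \<iota>.
             helmholtz t s \<tau> [] (\<iota> p) \<nu> c =
               - det (xmat \<iota> c) * (\<Sum>\<sigma>\<in>- range \<iota>.
                 yjet \<iota> t \<sigma> [p] c * quot_helmholtz \<iota> t s T' [] \<sigma> \<nu> Y)) \<and>
         (\<forall>J. 1 \<le> length J \<and> length J \<le> s \<longrightarrow> (\<forall>p. \<forall>\<nu>\<in>- range \<iota>.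
             helmholtz t s \<tau> J (\<iota> p) \<nu> c =
               - det (xmat \<iota> c) * (\<Sum>\<sigma>\<in>- range \<iota>. yjet \<iota> t \<sigma> [p] c *
                 (\<Sum>I\<in>{I. length J \<le> length I \<and> length I \<le> s}.
                   Zsum \<iota> t J I c * quot_helmholtz \<iota> t s T' I \<sigma> \<nu> Y)))) \<and>
         (\<forall>p q.
             helmholtz t s \<tau> [] (\<iota> p) (\<iota> q) c =
               det (xmat \<iota> c) * (\<Sum>\<sigma>\<in>- range \<iota>. yjet \<iota> t \<sigma> [p] c *
                 (\<Sum>I\<^sub>0\<in>{I\<^sub>0. length I\<^sub>0 \<le> s}. \<Sum>\<nu>\<in>- range \<iota>.
                   yjet \<iota> t \<nu> (q # I\<^sub>0) c * quot_helmholtz \<iota> t s T' I\<^sub>0 \<sigma> \<nu> Y))) \<and>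
         (\<forall>J. 1 \<le> length J \<and> length J \<le> s \<longrightarrow> (\<forall>p q.
             helmholtz t s \<tau> J (\<iota> p) (\<iota> q) c =
               det (xmat \<iota> c) * (\<Sum>\<sigma>\<in>- range \<iota>. yjet \<iota> t \<sigma> [p] c *
                 (\<Sum>I\<^sub>0\<in>{I\<^sub>0. length I\<^sub>0 \<le> s}.
                   \<Sum>I\<in>{I. length J \<le> length I \<and> length I \<le> s - length I\<^sub>0}. \<Sum>\<nu>\<in>- range \<iota>.
                     real ((length I + length I\<^sub>0) choose length I) * Zsum \<iota> t J I c *
                     yjet \<iota> t \<nu> (q # I\<^sub>0) c * quot_helmholtz \<iota> t s T' (I @ I\<^sub>0) \<sigma> \<nu> Y))))"
proof -
  let ?B = "x ` V"
  have B: "open ?B" using manifold chart by (auto simp: smooth_structure_def is_chart_def)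
  have real: "\<exists>v\<in>Wset \<A> s V x \<iota>. agree s (coords x v) c" if "c \<in> jet_region ?B \<iota>" for c
    using realization[OF manifold chart s, of c \<iota>] that unfolding jet_region_def by blast
  have sub: "jet_region ?B \<iota> \<subseteq> chart_image \<A> s V x"
  proof
    fix c assume "c \<in> jet_region ?B \<iota>"
    then obtain v where "v \<in> Wset \<A> s V x \<iota>" "agree s (coords x v) c" using real by blast
    then show "c \<in> chart_image \<A> s V x"
      unfolding chart_image_def Wset_def agree_def by (intro CollectI exI[of _ v]) simp
  qed
  have tau: "smooth_fn (upto_order s) (jet_region ?B \<iota>) (\<tau> A)" for A
  proof -
    have sm: "smooth_of_order s (chart_image \<A> s V x) (\<tau> A)" using components by (simp add: chart_form_def)
    have "depends_on (upto_order s) (jet_region ?B \<iota>) (\<tau> A)"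
      unfolding depends_on_def
    proof (intro ballI impI)
      fix c c' assume c: "c \<in> jet_region ?B \<iota>" "c' \<in> jet_region ?B \<iota>" "\<forall>k\<in>upto_order s. c k = c' k"
      have "agree s c c'" unfolding agree_def using c(3) by (auto simp: upto_order_def)
      then show "\<tau> A c = \<tau> A c'" using sm c(1,2) sub unfolding smooth_of_order_def by blast
    qed
    moreover have "smooth_coords (jet_region ?B \<iota>) (\<tau> A)"
      by (rule smooth_coords_subset[OF _ sub]) (use sm in \<open>simp add: smooth_of_order_def smooth_coords_def\<close>)
    ultimately show ?thesis by (simp add: smooth_fn_def)
  qed
  \<comment> \<open>\<open>Y\<close> is left arbitrary outside the coordinates of order at most
    \<open>s\<close>, as the local expression allows. This freedom is needed for the section, whose
    quotient coordinates reproduce a given \<open>Y\<close> only up to that order.\<close>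
  have eqs: "(\<sigma> \<notin> range \<iota> \<longrightarrow> \<tau> \<sigma> c = det (xmat \<iota> c) * T' \<sigma> Y) \<and>
      \<tau> (\<iota> p) c = - det (xmat \<iota> c) * (\<Sum>\<sigma>\<in>- range \<iota>. yjet \<iota> s \<sigma> [p] c * T' \<sigma> Y)"
    if c: "c \<in> jet_region ?B \<iota>" and Y: "\<And>k. k \<in> pord \<iota> s \<Longrightarrow> Y k = quot_coords \<iota> s c k" for c Y \<sigma> p
  proof -
    obtain v where v: "v \<in> Wset \<A> s V x \<iota>" and ag: "agree s (coords x v) c" using real[OF c] by blast
    have cv: "coords x v \<in> jet_region ?B \<iota>" by (rule coords_jet_region[OF v])
    have \<tau>: "\<tau> A (coords x v) = \<tau> A c" for A
      by (rule smooth_fn_eq[OF tau cv c]) (use ag in \<open>auto simp: agree_def upto_order_def\<close>)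
    have x: "xmat \<iota> (coords x v) = xmat \<iota> c" using ag s by (simp add: xmat_def agree_def)
    have q: "Y k = quot_coords \<iota> s (coords x v) k" if "k \<in> pord \<iota> s" for k
      unfolding Y[OF that] by (rule quot_coords_agree[OF B s cv ag that, symmetric])
    have T: "T \<sigma> (orbit \<A> s v) = T' \<sigma> Y" if "\<sigma> \<notin> range \<iota>" for \<sigma>
      using expression[OF that] v q unfolding quot_expression_def by simp
    have y: "yjet \<iota> s \<sigma> [p] (coords x v) = yjet \<iota> s \<sigma> [p] c" if "\<sigma> \<notin> range \<iota>" for \<sigma>
    proof -
      have "mlist {#p#} = [p]" using mset_mlist[of "{#p#}"] by (metis mset_single_iff)
      then show ?thesis
        using quot_coords_agree[OF B s cv ag, of "PY \<sigma> {#p#}"] that s by (simp add: quot_coords_def del: yjet.simps)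
    qed
    have "\<tau> (\<iota> p) c = - det (xmat \<iota> c) * (\<Sum>\<sigma>\<in>- range \<iota>. yjet \<iota> s \<sigma> [p] (coords x v) * T \<sigma> (orbit \<A> s v))"
      using associated_i[OF v, of p] by (simp only: \<tau> x)
    also have "(\<Sum>\<sigma>\<in>- range \<iota>. yjet \<iota> s \<sigma> [p] (coords x v) * T \<sigma> (orbit \<A> s v)) =
        (\<Sum>\<sigma>\<in>- range \<iota>. yjet \<iota> s \<sigma> [p] c * T' \<sigma> Y)"
      by (rule sum.cong[OF refl]) (simp add: y T del: yjet.simps)
    finally have "\<tau> (\<iota> p) c = - det (xmat \<iota> c) * (\<Sum>\<sigma>\<in>- range \<iota>. yjet \<iota> s \<sigma> [p] c * T' \<sigma> Y)" .
    moreover have "\<tau> \<sigma> c = det (xmat \<iota> c) * T' \<sigma> Y" if "\<sigma> \<notin> range \<iota>"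
      using associated_sigma[OF v that] by (simp only: \<tau> x T[OF that])
    ultimately show ?thesis by blast
  qed
  \<comment> \<open>On the section the determinant is 1, so T' is the composition of \<tau> with
    \<open>sec\<close>, whose components are coordinates of \<open>Y\<close> or constants.\<close>
  have smT: "smooth_fn (pord \<iota> s) (quot_region ?B \<iota>) (T' \<sigma>)" if \<sigma>: "\<sigma> \<notin> range \<iota>" for \<sigma>
  proof (rule smooth_fn_cong)
    show op: "open (quot_region ?B \<iota>)" using region_quot_region[OF B, of \<iota> 0] by (simp add: region_def)
    show "smooth_fn (pord \<iota> s) (quot_region ?B \<iota>) (\<lambda>Y. \<tau> \<sigma> (\<lambda>k. sec \<iota> Y k))"
    proof (rule smooth_fn_comp[OF region_jet_region[OF B s] tau op, where F="\<lambda>k Y. sec \<iota> Y k"])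
      fix k :: "'a \<times> 'n multiset" assume k: "k \<in> upto_order s"
      obtain A M where AM: "k = (A, M)" by (cases k)
      show "smooth_fn (pord \<iota> s) (quot_region ?B \<iota>) (\<lambda>Y. sec \<iota> Y k)"
      proof (cases "A \<in> range \<iota>")
        case True
        then obtain i where i: "A = \<iota> i" by auto
        show ?thesis
          by (cases "M = {#}") (simp_all add: AM i sec_iota[OF splitting] smooth_fn_const smooth_fn_proj op)
      next
        case False
        then have "PY A M \<in> pord \<iota> s" using k by (simp add: AM upto_order_def)
        then show ?thesis using False by (simp add: AM sec_def smooth_fn_proj op)
      qed
    qed (simp add: sec_mem[OF splitting])
    fix Y assume Y: "Y \<in> quot_region ?B \<iota>"
    have "\<tau> \<sigma> (sec \<iota> Y) = det (xmat \<iota> (sec \<iota> Y)) * T' \<sigma> Y"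
      using eqs[OF sec_mem[OF splitting Y], of Y \<sigma>] quot_coords_sec[OF B s splitting Y] \<sigma> by simp
    then show "\<tau> \<sigma> (\<lambda>k. sec \<iota> Y k) = T' \<sigma> Y" by (simp add: xmat_sec[OF splitting])
  qed
  have cB: "c \<in> jet_region ?B \<iota>" unfolding c by (rule coords_jet_region[OF point])
  have t1: "t \<ge> 1" using s t by simp
  interpret J: jets "\<lambda>i. i" "taylor_germs t c" ?B \<iota> "taylor_jet t c" by (rule jets_taylor[OF B t1 cB])
  interpret equation_at "taylor_germs t c" ?B \<iota> "taylor_jet t c" s \<tau> T' c t
  proof
    show "\<tau> \<sigma> c = det (xmat \<iota> c) * T' \<sigma> (quot_coords \<iota> s c)" if "c \<in> jet_region ?B \<iota>" "\<sigma> \<notin> range \<iota>" for c \<sigma>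
      using eqs[OF that(1)] that(2) by blast
    show "\<tau> (\<iota> p) c = - det (xmat \<iota> c) * (\<Sum>\<sigma>\<in>- range \<iota>. yjet \<iota> s \<sigma> [p] c * T' \<sigma> (quot_coords \<iota> s c))"
      if "c \<in> jet_region ?B \<iota>" for c p
      using eqs[OF that] by blast
  qed (use s tau smT splitting t cB ev_taylor_jet in auto)
  show ?thesis unfolding Y by (rule helmholtz_relations)
qed

end
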